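(* Let $P$ be a semisimple, totally ordered, nontrivial MV-domain, let $(R,e)$ be the $\ell u$-ring with $P=\Gamma_{(\cdot)}(R,e)$, and let $K$ be the quotient field of $R$. Then the functors $\Gamma_{(K,e)}\colon \mathbf{LinSpArK}\to\mathbf{MVArDomP}$ and $\mathcal{L}\colon\mathbf{MVArDomP}\to\mathbf{LinSpArK}$ form an adjoint pair, with $\mathcal{L}$ left adjoint to $\Gamma_{(K,e)}$ (with unit given by the maps $\iota_M\colon M\to\Gamma_{(K,e)}(\mathcal{L}(M))$): for every object $M\simeq\Gamma(G,v)$ of $\mathbf{MVArDomP}$, every object $(V,u)$ of $\mathbf{LinSpArK}$ and every homomorphism of $P$-MV-modules $h\colon M\to\Gamma_{(K,e)}(V,u)$ there is a unique morphism $h^{\sharp}\colon K\otimes_a G\to V$ in $\mathbf{LinSpArK}$ with $\Gamma_{(K,e)}(h^{\sharp})\circ\iota_M=h$.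
   Context: MV-algebras: $(A,\oplus,{}^*,0)$ with $(A,\oplus,0)$ an abelian monoid, $x^{**}=x$, $(x^*\oplus y)^*\oplus y=(y^*\oplus x)^*\oplus x$, $x\oplus 0^*=0^*$; $1=0^*$; $x\le y$ iff $x^*\oplus y=1$. The partial sum $x+y$ is defined iff $x\le y^*$, and then $x+y=x\oplus y$. $A$ is semisimple if the intersection of its maximal ideals is $\{0\}$. A PMV-algebra is an MV-algebra $P$ with a commutative, associative product $\cdot$ having $1$ as unit, such that if $x+y$ is defined then $z\cdot x+z\cdot y$ is defined and equals $z\cdot(x+y)$. It is an MV-domain if $x\cdot y=0$ implies $x=0$ or $y=0$. A (unital) $P$-MV-module is an MV-algebra $M$ with a map $P\times M\to M$, $(\alpha,x)\mapsto\alpha x$, such that: if $x+y$ is defined then $\alpha x+\alpha y$ is defined and equals $\alpha(x+y)$; if $\alpha+\beta$ is defined then $\alpha x+\beta x$ is defined and equals $(\alpha+\beta)x$; $(\alpha\cdot\beta)x=\alpha(\beta x)$; $1x=x$. Homomorphisms of $P$-MV-modules are MV-algebra homomorphisms $f$ with $f(\alpha x)=\alpha f(x)$. $\mathbf{MVArDomP}$ is the category of semisimple $P$-MV-modules and their homomorphisms. An $\ell u$-group $(G,u)$ is an abelian lattice-ordered group with strong unit $u$; it is Archimedean if $nx\le y$ for all $n\in\mathbb{N}$, with $x\ge 0$, implies $x=0$. $\Gamma(G,u)=[0,u]$ with $x\oplus y=(x+y)\wedge u$, $x^*=u-x$; $\Gamma$ is an equivalence between $\ell u$-groups (with unit-preserving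 $\ell$-group homomorphisms) and MV-algebras, under which Archimedean corresponds to semisimple. $\Gamma_{(\cdot)}(R,e)$ is the PMV-algebra $[0,e]$ with product restricted from the $\ell u$-ring $R$ (lattice-ordered ring with strong unit); for (unital, commutative) PMV-algebras the corresponding $R$ is commutative with identity $e$. For $P$ as in the claim, $R$ is an Archimedean totally ordered integral domain, its quotient field $K$ is ordered by $a/b\ge 0$ iff $ab\ge 0$ and is an Archimedean totally ordered field, $e$ is the identity and a strong unit of $K$, and $P\subseteq\Gamma_{(\cdot)}(K,e)$. $\mathbf{LinSpArK}$ is the category whose objects are pairs $(V,u)$, $V$ an Archimedean lattice-ordered $K$-linear space ($kv\ge 0$ for $k,v\ge 0$) with strong unit $u$, and whose morphisms are $K$-homogeneous homomorphisms of $\ell$-groups preserving the strong units. $\Gamma_{(K,e)}(V,u)$ is the MV-algebra $[0,u]$ with the scalar multiplication by $\Gamma_{(\cdot)}(K,e)$ restricted from $V$, regarded as a $P$-MV-module by restricting scalars along $P\subseteq\Gamma_{(\cdot)}(K,e)$; on morphisms $\Gamma_{(K,e)}$ is restriction to the unit intervals. For Archimedean $\ell u$-groups $(G,u_G),(H,u_H)$, $G\otimes_a H$ is the Archimedean tensor product: the Archimedean $\ell$-group with a universal bimorphism $(g,h)\mapsto g\otimes_a h$ from $G\times H$ into Archimedean $\ell$-groups, where a bimorphism is a biadditive map that is a lattice homomorphism in each variable when the other variable is fixed at a positive element; its strong unit is $u_G\otimes_a u_H$. $K\otimes_a G$ is a lattice-ordered $K$-linear space by $\lambda(\mu\otimes_a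 g)=(\lambda\mu)\otimes_a g$. For $M\simeq\Gamma(G,v)$ in $\mathbf{MVArDomP}$, $\mathcal{L}(M)=(K\otimes_a G,\,e\otimes_a v)$, and $\iota_M\colon M\to\Gamma(K\otimes_a G,e\otimes_a v)$ is $\iota_M(x)=e\otimes_a x$. For a morphism $h\colon M\to N$, $\mathcal{L}(h)$ is the unique morphism $\mathcal{L}(M)\to\mathcal{L}(N)$ in $\mathbf{LinSpArK}$ with $\Gamma_{(K,e)}(\mathcal{L}(h))\circ\iota_M=\iota_N\circ h$. *)

theory Defs
  imports "HOL-Algebra.Lattice" "HOL-Algebra.Module" "HOL-Library.FuncSet"
begin

section \<open>MV-algebras, PMV-algebras and MV-modules\<close>

record 'a mv = "'a partial_object" +
  mv_add :: "'a \<Rightarrow> 'a \<Rightarrow> 'a"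
  mv_neg :: "'a \<Rightarrow> 'a"
  mv_zero :: 'a

record 'a pmv = "'a mv" +
  pmv_mult :: "'a \<Rightarrow> 'a \<Rightarrow> 'a"

record ('p, 'm) pmodule = "'m mv" +
  act :: "'p \<Rightarrow> 'm \<Rightarrow> 'm"

definition mv_one :: "('a, 'b) mv_scheme \<Rightarrow> 'a" where
  "mv_one A = mv_neg A (mv_zero A)"

definition mv_le :: "('a, 'b) mv_scheme \<Rightarrow> 'a \<Rightarrow> 'a \<Rightarrow> bool" where
  "mv_le A x y \<longleftrightarrow> mv_add A (mv_neg A x) y = mv_one A"

text \<open>\<open>mv_summable A x y\<close> says that the partial sum \<open>x + y\<close> is defined; its value is then
  \<open>mv_add A x y\<close>.\<close>

definition mv_summable :: "('a, 'b) mv_scheme \<Rightarrow> 'a \<Rightarrow> 'a \<Rightarrow> bool" where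
  "mv_summable A x y \<longleftrightarrow> mv_le A x (mv_neg A y)"

definition mv_algebra :: "('a, 'b) mv_scheme \<Rightarrow> bool" where
  "mv_algebra A \<longleftrightarrow>
     mv_zero A \<in> carrier A \<and>
     (\<forall>x\<in>carrier A. mv_neg A x \<in> carrier A) \<and>
     (\<forall>x\<in>carrier A. \<forall>y\<in>carrier A. mv_add A x y \<in> carrier A) \<and>
     (\<forall>x\<in>carrier A. \<forall>y\<in>carrier A. \<forall>z\<in>carrier A.
        mv_add A (mv_add A x y) z = mv_add A x (mv_add A y z)) \<and>
     (\<forall>x\<in>carrier A. \<forall>y\<in>carrier A. mv_add A x y = mv_add A y x) \<and>
     (\<forall>x\<in>carrier A. mv_add A x (mv_zero A) = x) \<and>
     (\<forall>x\<in>carrier A. mv_neg A (mv_neg A x) = x) \<and>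
     (\<forall>x\<in>carrier A. \<forall>y\<in>carrier A.
        mv_add A (mv_neg A (mv_add A (mv_neg A x) y)) y =
        mv_add A (mv_neg A (mv_add A (mv_neg A y) x)) x) \<and>
     (\<forall>x\<in>carrier A. mv_add A x (mv_one A) = mv_one A)"

definition mv_ideal :: "('a, 'b) mv_scheme \<Rightarrow> 'a set \<Rightarrow> bool" where
  "mv_ideal A I \<longleftrightarrow>
     I \<subseteq> carrier A \<and> mv_zero A \<in> I \<and>
     (\<forall>x\<in>I. \<forall>y\<in>I. mv_add A x y \<in> I) \<and>
     (\<forall>x\<in>I. \<forall>y\<in>carrier A. mv_le A y x \<longrightarrow> y \<in> I)"

definition mv_maximal_ideal :: "('a, 'b) mv_scheme \<Rightarrow> 'a set \<Rightarrow> bool" where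
  "mv_maximal_ideal A I \<longleftrightarrow>
     mv_ideal A I \<and> I \<noteq> carrier A \<and>
     (\<forall>J. mv_ideal A J \<and> I \<subseteq> J \<and> J \<noteq> carrier A \<longrightarrow> J = I)"

text \<open>The intersection is taken inside the carrier, so the one-element MV-algebra, which has no
  maximal ideals, is semisimple.\<close>

definition semisimple :: "('a, 'b) mv_scheme \<Rightarrow> bool" where
  "semisimple A \<longleftrightarrow>
     {x \<in> carrier A. \<forall>I. mv_maximal_ideal A I \<longrightarrow> x \<in> I} = {mv_zero A}"

definition mv_total :: "('a, 'b) mv_scheme \<Rightarrow> bool" where
  "mv_total A \<longleftrightarrow> (\<forall>x\<in>carrier A. \<forall>y\<in>carrier A. mv_le A x y \<or> mv_le A y x)"

definition mv_nontrivial :: "('a, 'b) mv_scheme \<Rightarrow> bool" where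
  "mv_nontrivial A \<longleftrightarrow> mv_zero A \<noteq> mv_one A"

definition mv_map ::
    "('a, 'c) mv_scheme \<Rightarrow> ('b, 'd) mv_scheme \<Rightarrow> ('a \<Rightarrow> 'b) \<Rightarrow> bool" where
  "mv_map A B f \<longleftrightarrow>
     (\<forall>x\<in>carrier A. f x \<in> carrier B) \<and>
     (\<forall>x\<in>carrier A. \<forall>y\<in>carrier A. f (mv_add A x y) = mv_add B (f x) (f y)) \<and>
     (\<forall>x\<in>carrier A. f (mv_neg A x) = mv_neg B (f x)) \<and>
     f (mv_zero A) = mv_zero B"

definition mv_iso ::
    "('a, 'c) mv_scheme \<Rightarrow> ('b, 'd) mv_scheme \<Rightarrow> ('a \<Rightarrow> 'b) \<Rightarrow> bool" where
  "mv_iso A B f \<longleftrightarrow> mv_map A B f \<and> bij_betw f (carrier A) (carrier B)"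

definition pmv_algebra :: "('p, 'b) pmv_scheme \<Rightarrow> bool" where
  "pmv_algebra P \<longleftrightarrow>
     mv_algebra P \<and>
     (\<forall>x\<in>carrier P. \<forall>y\<in>carrier P. pmv_mult P x y \<in> carrier P) \<and>
     (\<forall>x\<in>carrier P. \<forall>y\<in>carrier P. pmv_mult P x y = pmv_mult P y x) \<and>
     (\<forall>x\<in>carrier P. \<forall>y\<in>carrier P. \<forall>z\<in>carrier P.
        pmv_mult P (pmv_mult P x y) z = pmv_mult P x (pmv_mult P y z)) \<and>
     (\<forall>x\<in>carrier P. pmv_mult P (mv_one P) x = x) \<and>
     (\<forall>x\<in>carrier P. \<forall>y\<in>carrier P. \<forall>z\<in>carrier P. mv_summable P x y \<longrightarrow>
        mv_summable P (pmv_mult P z x) (pmv_mult P z y) \<and>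
        mv_add P (pmv_mult P z x) (pmv_mult P z y) = pmv_mult P z (mv_add P x y))"

definition mv_domain :: "('p, 'b) pmv_scheme \<Rightarrow> bool" where
  "mv_domain P \<longleftrightarrow>
     pmv_algebra P \<and>
     (\<forall>x\<in>carrier P. \<forall>y\<in>carrier P. pmv_mult P x y = mv_zero P \<longrightarrow>
        x = mv_zero P \<or> y = mv_zero P)"

definition pmv_iso ::
    "('p, 'c) pmv_scheme \<Rightarrow> ('q, 'd) pmv_scheme \<Rightarrow> ('p \<Rightarrow> 'q) \<Rightarrow> bool" where
  "pmv_iso P Q f \<longleftrightarrow>
     mv_iso P Q f \<and>
     (\<forall>x\<in>carrier P. \<forall>y\<in>carrier P. f (pmv_mult P x y) = pmv_mult Q (f x) (f y))"

definition mv_module :: "('p, 'b) pmv_scheme \<Rightarrow> ('p, 'm, 'c) pmodule_scheme \<Rightarrow> bool" where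
  "mv_module P M \<longleftrightarrow>
     mv_algebra M \<and>
     (\<forall>\<alpha>\<in>carrier P. \<forall>x\<in>carrier M. act M \<alpha> x \<in> carrier M) \<and>
     (\<forall>\<alpha>\<in>carrier P. \<forall>x\<in>carrier M. \<forall>y\<in>carrier M. mv_summable M x y \<longrightarrow>
        mv_summable M (act M \<alpha> x) (act M \<alpha> y) \<and>
        mv_add M (act M \<alpha> x) (act M \<alpha> y) = act M \<alpha> (mv_add M x y)) \<and>
     (\<forall>\<alpha>\<in>carrier P. \<forall>\<beta>\<in>carrier P. \<forall>x\<in>carrier M. mv_summable P \<alpha> \<beta> \<longrightarrow>
        mv_summable M (act M \<alpha> x) (act M \<beta> x) \<and>
        mv_add M (act M \<alpha> x) (act M \<beta> x) = act M (mv_add P \<alpha> \<beta>) x) \<and>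
     (\<forall>\<alpha>\<in>carrier P. \<forall>\<beta>\<in>carrier P. \<forall>x\<in>carrier M.
        act M (pmv_mult P \<alpha> \<beta>) x = act M \<alpha> (act M \<beta> x)) \<and>
     (\<forall>x\<in>carrier M. act M (mv_one P) x = x)"

definition MVArDom :: "('p, 'b) pmv_scheme \<Rightarrow> ('p, 'm) pmodule set" where
  "MVArDom P = {M. mv_module P M \<and> semisimple M}"

text \<open>Here and for the other categories below, morphisms are functions that are extensional on the
  carrier of their domain, so that equality of morphisms is equality of functions; composition is
  \<^const>\<open>compose\<close>. Hom-sets are heterogeneous: domain and codomain may have carriers in
  different types.\<close>

definition mv_module_hom ::
    "('p, 'b) pmv_scheme \<Rightarrow> ('p, 'm) pmodule \<Rightarrow> ('p, 'n) pmodule \<Rightarrow> ('m \<Rightarrow> 'n) set" where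
  "mv_module_hom P M N =
     {f \<in> carrier M \<rightarrow>\<^sub>E carrier N. mv_map M N f \<and>
        (\<forall>\<alpha>\<in>carrier P. \<forall>x\<in>carrier M. f (act M \<alpha> x) = act N \<alpha> (f x))}"

definition restrict_scalars :: "('p \<Rightarrow> 'k) \<Rightarrow> ('k, 'm) pmodule \<Rightarrow> ('p, 'm) pmodule" where
  "restrict_scalars \<epsilon> M =
     \<lparr>carrier = carrier M, mv_add = mv_add M, mv_neg = mv_neg M, mv_zero = mv_zero M,
      act = (\<lambda>\<alpha>. act M (\<epsilon> \<alpha>))\<rparr>"


section \<open>Lattice-ordered groups, rings and linear spaces\<close>

text \<open>As usual in \<^theory>\<open>HOL-Algebra.Ring\<close>, abelian groups live in ring records, whose
  multiplicative fields are then ignored.\<close>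

record 'a ogroup = "'a ring" +
  leq :: "'a \<Rightarrow> 'a \<Rightarrow> bool"

record ('k, 'v) olspace = "'v ogroup" +
  scale :: "'k \<Rightarrow> 'v \<Rightarrow> 'v"

definition order_of :: "('a, 'b) ogroup_scheme \<Rightarrow> 'a gorder" where
  "order_of G = \<lparr>carrier = carrier G, eq = (=), le = leq G\<rparr>"

abbreviation lsup :: "('a, 'b) ogroup_scheme \<Rightarrow> 'a \<Rightarrow> 'a \<Rightarrow> 'a" where
  "lsup G \<equiv> join (order_of G)"

abbreviation linf :: "('a, 'b) ogroup_scheme \<Rightarrow> 'a \<Rightarrow> 'a \<Rightarrow> 'a" where
  "linf G \<equiv> meet (order_of G)"

definition l_group :: "('a, 'b) ogroup_scheme \<Rightarrow> bool" where
  "l_group G \<longleftrightarrow>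
     abelian_group G \<and> Lattice.lattice (order_of G) \<and>
     (\<forall>x\<in>carrier G. \<forall>y\<in>carrier G. \<forall>z\<in>carrier G.
        leq G x y \<longrightarrow> leq G (x \<oplus>\<^bsub>G\<^esub> z) (y \<oplus>\<^bsub>G\<^esub> z))"

definition archimedean :: "('a, 'b) ogroup_scheme \<Rightarrow> bool" where
  "archimedean G \<longleftrightarrow>
     (\<forall>x\<in>carrier G. \<forall>y\<in>carrier G.
        leq G \<zero>\<^bsub>G\<^esub> x \<and> (\<forall>n::nat. leq G ([n] \<cdot>\<^bsub>G\<^esub> x) y) \<longrightarrow> x = \<zero>\<^bsub>G\<^esub>)"

definition strong_unit :: "('a, 'b) ogroup_scheme \<Rightarrow> 'a \<Rightarrow> bool" where
  "strong_unit G u \<longleftrightarrow>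
     u \<in> carrier G \<and> leq G \<zero>\<^bsub>G\<^esub> u \<and> (\<forall>x\<in>carrier G. \<exists>n::nat. leq G x ([n] \<cdot>\<^bsub>G\<^esub> u))"

definition lu_group :: "('a, 'b) ogroup_scheme \<Rightarrow> 'a \<Rightarrow> bool" where
  "lu_group G u \<longleftrightarrow> l_group G \<and> strong_unit G u"

definition l_hom ::
    "('a, 'c) ogroup_scheme \<Rightarrow> ('b, 'd) ogroup_scheme \<Rightarrow> ('a \<Rightarrow> 'b) set" where
  "l_hom G H =
     {f \<in> carrier G \<rightarrow>\<^sub>E carrier H. \<forall>x\<in>carrier G. \<forall>y\<in>carrier G.
        f (x \<oplus>\<^bsub>G\<^esub> y) = f x \<oplus>\<^bsub>H\<^esub> f y \<and>
        f (lsup G x y) = lsup H (f x) (f y) \<and>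
        f (linf G x y) = linf H (f x) (f y)}"

definition lu_ring :: "('a, 'b) ogroup_scheme \<Rightarrow> 'a \<Rightarrow> bool" where
  "lu_ring R e \<longleftrightarrow>
     ring R \<and> lu_group R e \<and>
     (\<forall>x\<in>carrier R. \<forall>y\<in>carrier R.
        leq R \<zero>\<^bsub>R\<^esub> x \<and> leq R \<zero>\<^bsub>R\<^esub> y \<longrightarrow> leq R \<zero>\<^bsub>R\<^esub> (x \<otimes>\<^bsub>R\<^esub> y))"

text \<open>\<open>quotient_field R K j\<close>: \<open>K\<close> is the quotient field of \<open>R\<close>, with canonical embedding \<open>j\<close>,
  ordered by \<open>0 \<le> a / b \<longleftrightarrow> 0 \<le> a b\<close>.\<close>

definition quotient_field ::
    "('r, 'b) ogroup_scheme \<Rightarrow> ('k, 'c) ogroup_scheme \<Rightarrow> ('r \<Rightarrow> 'k) \<Rightarrow> bool" where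
  "quotient_field R K j \<longleftrightarrow>
     field K \<and> j \<in> ring_hom R K \<and> inj_on j (carrier R) \<and>
     (\<forall>x\<in>carrier K. \<exists>a\<in>carrier R. \<exists>b\<in>carrier R - {\<zero>\<^bsub>R\<^esub>}. x = j a \<otimes>\<^bsub>K\<^esub> inv\<^bsub>K\<^esub> (j b)) \<and>
     (\<forall>x\<in>carrier K. \<forall>y\<in>carrier K. \<forall>a\<in>carrier R. \<forall>b\<in>carrier R - {\<zero>\<^bsub>R\<^esub>}.
        y \<ominus>\<^bsub>K\<^esub> x = j a \<otimes>\<^bsub>K\<^esub> inv\<^bsub>K\<^esub> (j b) \<longrightarrow> (leq K x y \<longleftrightarrow> leq R \<zero>\<^bsub>R\<^esub> (a \<otimes>\<^bsub>R\<^esub> b)))"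

definition module_of :: "('k, 'v, 'b) olspace_scheme \<Rightarrow> ('k, 'v) module" where
  "module_of V =
     \<lparr>carrier = carrier V, mult = mult V, one = one V, zero = zero V, add = add V,
      smult = scale V\<rparr>"

definition lo_linear_space ::
    "('k, 'c) ogroup_scheme \<Rightarrow> ('k, 'v, 'b) olspace_scheme \<Rightarrow> bool" where
  "lo_linear_space K V \<longleftrightarrow>
     field K \<and> module K (module_of V) \<and> l_group V \<and>
     (\<forall>k\<in>carrier K. \<forall>x\<in>carrier V.
        leq K \<zero>\<^bsub>K\<^esub> k \<and> leq V \<zero>\<^bsub>V\<^esub> x \<longrightarrow> leq V \<zero>\<^bsub>V\<^esub> (scale V k x))"

definition LinSpAr :: "('k, 'c) ogroup_scheme \<Rightarrow> (('k, 'v) olspace \<times> 'v) set" where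
  "LinSpAr K = {(V, u). lo_linear_space K V \<and> archimedean V \<and> strong_unit V u}"

definition lin_hom ::
    "('k, 'c) ogroup_scheme \<Rightarrow> ('k, 'v) olspace \<times> 'v \<Rightarrow> ('k, 'w) olspace \<times> 'w \<Rightarrow> ('v \<Rightarrow> 'w) set"
  where
  "lin_hom K = (\<lambda>(V, u) (W, w).
     {f \<in> l_hom V W. f u = w \<and>
        (\<forall>k\<in>carrier K. \<forall>x\<in>carrier V. f (scale V k x) = scale W k (f x))})"


section \<open>The functor \<open>\<Gamma>\<close>\<close>

definition Gamma :: "('a, 'b) ogroup_scheme \<Rightarrow> 'a \<Rightarrow> 'a mv" where
  "Gamma G u =
     \<lparr>carrier = {x \<in> carrier G. leq G \<zero>\<^bsub>G\<^esub> x \<and> leq G x u},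
      mv_add = (\<lambda>x y. linf G (x \<oplus>\<^bsub>G\<^esub> y) u),
      mv_neg = (\<lambda>x. u \<ominus>\<^bsub>G\<^esub> x),
      mv_zero = \<zero>\<^bsub>G\<^esub>\<rparr>"

definition Gamma_ring :: "('a, 'b) ogroup_scheme \<Rightarrow> 'a \<Rightarrow> 'a pmv" where
  "Gamma_ring R e = mv.extend (Gamma R e) (pmv.fields (mult R))"

definition Gamma_space :: "('k, 'v) olspace \<times> 'v \<Rightarrow> ('k, 'v) pmodule" where
  "Gamma_space = (\<lambda>(V, u). mv.extend (Gamma V u) (pmodule.fields (scale V)))"

text \<open>\<open>GammaK \<epsilon>\<close> and \<open>GammaK_map\<close> are the object and the morphism part of the functor
  \<open>\<Gamma>\<close> from \<open>LinSpAr K\<close> to \<open>MVArDom P\<close>, where \<open>\<epsilon>\<close> is the embedding of \<open>P\<close> into the unit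
  interval of \<open>K\<close>.\<close>

definition GammaK :: "('p \<Rightarrow> 'k) \<Rightarrow> ('k, 'v) olspace \<times> 'v \<Rightarrow> ('p, 'v) pmodule" where
  "GammaK \<epsilon> A = restrict_scalars \<epsilon> (Gamma_space A)"

definition GammaK_map :: "('k, 'v) olspace \<times> 'v \<Rightarrow> ('v \<Rightarrow> 'w) \<Rightarrow> 'v \<Rightarrow> 'w" where
  "GammaK_map A f = restrict f (carrier (Gamma_space A))"


section \<open>The Archimedean tensor product\<close>

definition bimorphism ::
    "('g, 'b) ogroup_scheme \<Rightarrow> ('h, 'c) ogroup_scheme \<Rightarrow> ('l, 'd) ogroup_scheme \<Rightarrow>
     ('g \<Rightarrow> 'h \<Rightarrow> 'l) \<Rightarrow> bool" where
  "bimorphism G H L \<beta> \<longleftrightarrow>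
     (\<forall>g\<in>carrier G. \<forall>h\<in>carrier H. \<beta> g h \<in> carrier L) \<and>
     (\<forall>g\<in>carrier G. \<forall>g'\<in>carrier G. \<forall>h\<in>carrier H. \<beta> (g \<oplus>\<^bsub>G\<^esub> g') h = \<beta> g h \<oplus>\<^bsub>L\<^esub> \<beta> g' h) \<and>
     (\<forall>g\<in>carrier G. \<forall>h\<in>carrier H. \<forall>h'\<in>carrier H. \<beta> g (h \<oplus>\<^bsub>H\<^esub> h') = \<beta> g h \<oplus>\<^bsub>L\<^esub> \<beta> g h') \<and>
     (\<forall>g\<in>carrier G. \<forall>g'\<in>carrier G. \<forall>h\<in>carrier H. leq H \<zero>\<^bsub>H\<^esub> h \<longrightarrow>
        \<beta> (lsup G g g') h = lsup L (\<beta> g h) (\<beta> g' h) \<and>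
        \<beta> (linf G g g') h = linf L (\<beta> g h) (\<beta> g' h)) \<and>
     (\<forall>g\<in>carrier G. \<forall>h\<in>carrier H. \<forall>h'\<in>carrier H. leq G \<zero>\<^bsub>G\<^esub> g \<longrightarrow>
        \<beta> g (lsup H h h') = lsup L (\<beta> g h) (\<beta> g h') \<and>
        \<beta> g (linf H h h') = linf L (\<beta> g h) (\<beta> g h'))"

text \<open>The type argument is the type in which the carriers of the test objects \<open>L\<close> live.\<close>

definition universal_bimorphism ::
    "'l itself \<Rightarrow> ('g, 'b) ogroup_scheme \<Rightarrow> ('h, 'c) ogroup_scheme \<Rightarrow> 't ogroup \<Rightarrow>
     ('g \<Rightarrow> 'h \<Rightarrow> 't) \<Rightarrow> bool" where
  "universal_bimorphism (_ :: 'l itself) G H T \<tau> \<longleftrightarrow>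
     l_group T \<and> archimedean T \<and> bimorphism G H T \<tau> \<and>
     (\<forall>(L :: 'l ogroup) \<beta>. l_group L \<and> archimedean L \<and> bimorphism G H L \<beta> \<longrightarrow>
        (\<exists>!f. f \<in> l_hom T L \<and> (\<forall>g\<in>carrier G. \<forall>h\<in>carrier H. f (\<tau> g h) = \<beta> g h)))"

text \<open>Sets of formal \<open>\<ell>\<close>-group terms over pure tensors are a large enough universe for the
  Archimedean tensor product and for its test objects: the elements of an \<open>\<ell>\<close>-group generated by
  the image of a bimorphism can be identified with the sets of terms evaluating to them. Hence such
  a tensor product exists in this type, and universality among test objects in this type implies
  universality among test objects in any type.\<close>

datatype ('g, 'h) lterm =
    Pure 'g 'h
  | LZero
  | LAdd "('g, 'h) lterm" "('g, 'h) lterm"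
  | LNeg "('g, 'h) lterm"
  | LSup "('g, 'h) lterm" "('g, 'h) lterm"

definition arch_tensor ::
    "('g, 'b) ogroup_scheme \<Rightarrow> ('h, 'c) ogroup_scheme \<Rightarrow>
     ('g, 'h) lterm set ogroup \<times> ('g \<Rightarrow> 'h \<Rightarrow> ('g, 'h) lterm set)" where
  "arch_tensor G H =
     (SOME (T, \<tau>). universal_bimorphism TYPE(('g, 'h) lterm set) G H T \<tau>)"

abbreviation tensor_group ::
    "('g, 'b) ogroup_scheme \<Rightarrow> ('h, 'c) ogroup_scheme \<Rightarrow> ('g, 'h) lterm set ogroup" where
  "tensor_group G H \<equiv> fst (arch_tensor G H)"

abbreviation pure_tensor ::
    "('g, 'b) ogroup_scheme \<Rightarrow> ('h, 'c) ogroup_scheme \<Rightarrow> 'g \<Rightarrow> 'h \<Rightarrow> ('g, 'h) lterm set" where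
  "pure_tensor G H \<equiv> snd (arch_tensor G H)"

text \<open>The scalar multiplication is determined on the carrier by its values on pure tensors, because
  multiplication by a nonnegative scalar is an \<open>\<ell>\<close>-homomorphism.\<close>

definition tensor_space ::
    "('k, 'c) ogroup_scheme \<Rightarrow> ('g, 'b) ogroup_scheme \<Rightarrow> ('k, ('k, 'g) lterm set) olspace" where
  "tensor_space K G =
     (SOME V. ogroup.truncate V = tensor_group K G \<and> lo_linear_space K V \<and>
        (\<forall>k\<in>carrier K. \<forall>\<mu>\<in>carrier K. \<forall>g\<in>carrier G.
           scale V k (pure_tensor K G \<mu> g) = pure_tensor K G (k \<otimes>\<^bsub>K\<^esub> \<mu>) g))"


section \<open>The functor \<open>\<L>\<close>\<close>

text \<open>A triple \<open>(G, v, \<phi>)\<close> presents \<open>M\<close> as \<open>\<Gamma>(G, v)\<close>.\<close>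

definition presents ::
    "('m, 'b) mv_scheme \<Rightarrow> 'g ogroup \<times> 'g \<times> ('m \<Rightarrow> 'g) \<Rightarrow> bool" where
  "presents M = (\<lambda>(G, v, \<phi>). lu_group G v \<and> mv_iso M (Gamma G v) \<phi>)"

text \<open>Every MV-algebra has a presentation, unique up to isomorphism, and one is chosen for each. The
  type is large enough: \<open>G\<close> is generated by its unit interval, so that its elements can be
  identified with classes of formal differences of formal sums of elements of \<open>M\<close>.\<close>

definition presentation_of ::
    "('m, 'b) mv_scheme \<Rightarrow>
     ('m list \<times> 'm list) set ogroup \<times> ('m list \<times> 'm list) set \<times> ('m \<Rightarrow> ('m list \<times> 'm list) set)"
  where
  "presentation_of M = (SOME X. presents M X)"

definition tensor_obj ::
    "('k, 'c) ogroup_scheme \<Rightarrow> 'g ogroup \<times> 'g \<times> ('m \<Rightarrow> 'g) \<Rightarrow>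
     ('k, ('k, 'g) lterm set) olspace \<times> ('k, 'g) lterm set" where
  "tensor_obj K = (\<lambda>(G, v, \<phi>). (tensor_space K G, pure_tensor K G \<one>\<^bsub>K\<^esub> v))"

definition tensor_unit ::
    "('k, 'c) ogroup_scheme \<Rightarrow> ('m, 'b) mv_scheme \<Rightarrow> 'g ogroup \<times> 'g \<times> ('m \<Rightarrow> 'g) \<Rightarrow>
     'm \<Rightarrow> ('k, 'g) lterm set" where
  "tensor_unit K M = (\<lambda>(G, v, \<phi>). \<lambda>x\<in>carrier M. pure_tensor K G \<one>\<^bsub>K\<^esub> (\<phi> x))"

definition L_obj ::
    "('k, 'c) ogroup_scheme \<Rightarrow> ('p, 'm) pmodule \<Rightarrow>
     ('k, ('k, ('m list \<times> 'm list) set) lterm set) olspace \<times>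
     ('k, ('m list \<times> 'm list) set) lterm set" where
  "L_obj K M = tensor_obj K (presentation_of M)"

definition iota ::
    "('k, 'c) ogroup_scheme \<Rightarrow> ('p, 'm) pmodule \<Rightarrow>
     'm \<Rightarrow> ('k, ('m list \<times> 'm list) set) lterm set" where
  "iota K M = tensor_unit K M (presentation_of M)"

definition L_map ::
    "('k, 'c) ogroup_scheme \<Rightarrow> ('p, 'm) pmodule \<Rightarrow> ('p, 'n) pmodule \<Rightarrow> ('m \<Rightarrow> 'n) \<Rightarrow>
     ('k, ('m list \<times> 'm list) set) lterm set \<Rightarrow> ('k, ('n list \<times> 'n list) set) lterm set" where
  "L_map K M N h =
     (THE f. f \<in> lin_hom K (L_obj K M) (L_obj K N) \<and>
        compose (carrier M) (GammaK_map (L_obj K M) f) (iota K M) =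
        compose (carrier M) (iota K N) h)"

end

theory Submission
  imports Defs "HOL-Library.Multiset"
begin

text \<open>
  Let \<open>\<epsilon>\<close> be the embedding of \<open>P\<close> into the unit interval of \<open>K\<close>, and let \<open>M = \<Gamma>(G, v)\<close>. Every positive
  element of \<open>G\<close> is a sum of elements of \<open>[0, v]\<close>, and two such decompositions have a common
  refinement by the Riesz property. Hence a homomorphism of MV-algebras \<open>h : M \<rightarrow> \<Gamma>(V, u)\<close> extends
  to exactly one additive map \<open>f0 : G \<rightarrow> V\<close>, and \<open>f0\<close> is an \<open>\<ell>\<close>-homomorphism because \<open>h\<close> preserves
  disjointness (\<open>ext_l_hom\<close>). As \<open>K\<close> is totally ordered, \<open>(k, g) \<mapsto> k f0(g)\<close> is a bimorphism into an
  Archimedean \<open>\<ell>\<close>-group, so it factors through \<open>K \<otimes> G\<close>. The factor \<open>f\<close> is homogeneous: for \<open>k \<ge> 0\<close>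
  both \<open>x \<mapsto> f(k x)\<close> and \<open>x \<mapsto> k f(x)\<close> are \<open>\<ell>\<close>-homomorphisms, and they agree on the pure tensors,
  which generate \<open>K \<otimes> G\<close> (\<open>linear_lift\<close>). Conversely a homogeneous map with prescribed values on the
  elements \<open>1 \<otimes> g\<close> with \<open>g\<close> in \<open>[0, v]\<close> is determined on all pure tensors, hence everywhere. This is
  the universal property of \<open>\<iota>\<close> (\<open>universal_arrow\<close>), from which functoriality of \<open>L\<close> and naturality
  of \<open>\<iota>\<close> follow formally.

  The rest of the proof shows that the objects and maps in this argument are what they should be.

  Every MV-algebra is some \<open>\<Gamma>(G, v)\<close> (\<open>chang_presents\<close>). Formal sums of its elements, modulo common
  refinement, form a cancellative monoid, and \<open>G\<close> is the group of differences of this monoid.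

  The Archimedean tensor product exists, and it has its universal property with respect to test
  objects of any type (\<open>universal_bimorphism_exists\<close>, \<open>lift_exists\<close>). The image of a bimorphism
  generates an \<open>\<ell>\<close>-group that fits into the type of sets of terms, so all test objects may be
  collected in one product, and the tensor product is what the diagonal bimorphism generates there.

  \<open>K \<otimes> G\<close> is a lattice-ordered linear space (\<open>linear_space_exists\<close>). A scalar \<open>k \<ge> 0\<close> acts by the
  lift of the bimorphism \<open>(\<mu>, g) \<mapsto> k \<mu> \<otimes> g\<close>. That this action is additive in \<open>k\<close> cannot be read off
  from the pure tensors, since a sum of \<open>\<ell>\<close>-homomorphisms need not be one. But \<open>k x\<close> is determined
  by the integral multiples of \<open>x\<close>: for \<open>m\<close> the integer part of \<open>n k\<close>, the distance between \<open>n (k x)\<close>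
  and \<open>m x\<close> is bounded independently of \<open>n\<close>, and in an Archimedean group only one element has this
  property. The description is additive in \<open>k\<close> (\<open>smul_add_left\<close>).

  The map \<open>\<iota>\<close> commutes with the scalars from \<open>P\<close> (\<open>pure_act\<close>). The chain \<open>P\<close> has division with
  remainder, \<open>n \<alpha> = m + r\<close>, so both \<open>n (1 \<otimes> \<alpha> x)\<close> and \<open>n (\<epsilon> \<alpha> \<otimes> x)\<close> consist of \<open>m (1 \<otimes> x)\<close> and a
  remainder between \<open>0\<close> and the unit. Again the Archimedean property identifies the two.

  \<open>\<Gamma>(V, u)\<close> is semisimple because \<open>V\<close> is Archimedean (\<open>Gamma_semisimple\<close>).

  Finally, \<open>K\<close> is a totally ordered field with \<open>1\<close> as a strong unit (\<open>K_ordered_field\<close>): \<open>R\<close> inherits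
  from \<open>P\<close> that it is totally ordered and has no infinitesimals, and \<open>e = 1\<close> because \<open>e\<close> is a unit for
  the elements of \<open>[0, e]\<close>, which generate \<open>R\<close>.
\<close>

section \<open>Lattice-ordered groups\<close>

text \<open>The symbols for joins and meets in an order are given to the lattice operations of an
  \<open>\<ell>\<close>-group, so that they take the group as their structure argument.\<close>

no_notation join (infixl "\<squnion>\<index>" 65)
no_notation meet (infixl "\<sqinter>\<index>" 70)
notation lsup (infixl "\<squnion>\<index>" 65)
notation linf (infixl "\<sqinter>\<index>" 70)
notation leq (infix "\<preceq>\<index>" 50)

locale lgroup =
  fixes G :: "('a, 'b) ogroup_scheme" (structure)
  assumes l_group: "l_group G"

sublocale lgroup \<subseteq> abelian_group G
  using l_group by (simp add: l_group_def)

lemma order_of_simps [simp]: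
  "carrier (order_of G) = carrier G" "le (order_of G) = leq G" "eq (order_of G) = (=)"
  by (simp_all add: order_of_def)

context lgroup
begin

\<comment> \<open>only for this block: the order-theoretic rules are restated below in terms of the group\<close>
interpretation ord: Lattice.lattice "order_of G"
  rewrites "carrier (order_of G) = carrier G" and "le (order_of G) = leq G"
    and "eq (order_of G) = (=)"
  using l_group by (simp_all add: l_group_def)

lemma minus_zero [simp]: "\<ominus> \<zero> = \<zero>"
  using r_neg[of \<zero>] by simp

lemmas group_simprules [algebra abelian_group "zero G" "add G" "a_inv G" "a_minus G"] =
  a_closed zero_closed a_inv_closed minus_closed a_assoc l_zero l_neg a_comm minus_eq
  r_zero r_neg r_neg2 r_neg1 minus_add minus_minus minus_zero a_lcomm

lemma leq_refl [simp, intro]: "x \<in> carrier G \<Longrightarrow> x \<preceq> x"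
  by simp

lemma leq_trans: "\<lbrakk>x \<preceq> y; y \<preceq> z; x \<in> carrier G; y \<in> carrier G; z \<in> carrier G\<rbrakk> \<Longrightarrow> x \<preceq> z"
  by (rule ord.le_trans)

lemma leq_antisym: "\<lbrakk>x \<preceq> y; y \<preceq> x; x \<in> carrier G; y \<in> carrier G\<rbrakk> \<Longrightarrow> x = y"
  using ord.weak_le_antisym by simp

lemma add_leq_right:
  "\<lbrakk>x \<preceq> y; x \<in> carrier G; y \<in> carrier G; z \<in> carrier G\<rbrakk> \<Longrightarrow> x \<oplus> z \<preceq> y \<oplus> z"
  using l_group by (simp add: l_group_def)

lemma leq_iff: "\<lbrakk>x \<in> carrier G; y \<in> carrier G\<rbrakk> \<Longrightarrow> x \<preceq> y \<longleftrightarrow> \<zero> \<preceq> y \<ominus> x"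
  using add_leq_right[of x y "\<ominus> x"] add_leq_right[of \<zero> "y \<ominus> x" x]
  by (auto simp: minus_eq r_neg l_neg a_assoc)

lemma leq_minus_iff: "\<lbrakk>x \<in> carrier G; y \<in> carrier G\<rbrakk> \<Longrightarrow> \<ominus> y \<preceq> \<ominus> x \<longleftrightarrow> x \<preceq> y"
  by (subst (1 2) leq_iff) (auto simp: minus_eq a_comm)

lemma add_leq_cancel_right:
  assumes "x \<in> carrier G" "y \<in> carrier G" "z \<in> carrier G"
  shows "x \<oplus> z \<preceq> y \<oplus> z \<longleftrightarrow> x \<preceq> y"
proof -
  have "y \<oplus> z \<ominus> (x \<oplus> z) = y \<ominus> x" using assms by algebra
  then show ?thesis using assms by (simp add: leq_iff[of "x \<oplus> z"] leq_iff[of x])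
qed

lemma add_leq_cancel_left:
  "\<lbrakk>x \<in> carrier G; y \<in> carrier G; z \<in> carrier G\<rbrakk> \<Longrightarrow> z \<oplus> x \<preceq> z \<oplus> y \<longleftrightarrow> x \<preceq> y"
  using add_leq_cancel_right by (simp add: a_comm)

lemma add_mono:
  assumes "a \<preceq> b" "c \<preceq> d" "a \<in> carrier G" "b \<in> carrier G" "c \<in> carrier G" "d \<in> carrier G"
  shows "a \<oplus> c \<preceq> b \<oplus> d"
  using assms leq_trans[of "a \<oplus> c" "b \<oplus> c" "b \<oplus> d"]
  by (simp add: add_leq_cancel_left add_leq_cancel_right)

lemma add_nonneg: "\<lbrakk>\<zero> \<preceq> x; \<zero> \<preceq> y; x \<in> carrier G; y \<in> carrier G\<rbrakk> \<Longrightarrow> \<zero> \<preceq> x \<oplus> y"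
  using add_mono[of \<zero> x \<zero> y] by simp

lemma leq_add_nonneg: "\<lbrakk>\<zero> \<preceq> y; x \<in> carrier G; y \<in> carrier G\<rbrakk> \<Longrightarrow> x \<preceq> x \<oplus> y"
  using add_leq_cancel_left[of \<zero> y x] by simp

lemma leq_diff_iff:
  assumes "x \<in> carrier G" "y \<in> carrier G" "z \<in> carrier G"
  shows "x \<preceq> y \<ominus> z \<longleftrightarrow> x \<oplus> z \<preceq> y"
proof -
  have "y \<ominus> z \<ominus> x = y \<ominus> (x \<oplus> z)" using assms by algebra
  then show ?thesis using assms by (simp add: leq_iff[of x] leq_iff[of "x \<oplus> z"])
qed

lemma diff_leq_iff:
  assumes "x \<in> carrier G" "y \<in> carrier G" "z \<in> carrier G"
  shows "x \<ominus> z \<preceq> y \<longleftrightarrow> x \<preceq> y \<oplus> z"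
proof -
  have "y \<ominus> (x \<ominus> z) = y \<oplus> z \<ominus> x" using assms by algebra
  then show ?thesis using assms by (simp add: leq_iff[of "x \<ominus> z"] leq_iff[of "x"])
qed

lemma sup_closed [simp, intro]: "\<lbrakk>x \<in> carrier G; y \<in> carrier G\<rbrakk> \<Longrightarrow> x \<squnion> y \<in> carrier G"
  by (rule ord.join_closed)
lemma inf_closed [simp, intro]: "\<lbrakk>x \<in> carrier G; y \<in> carrier G\<rbrakk> \<Longrightarrow> x \<sqinter> y \<in> carrier G"
  by (rule ord.meet_closed)
lemma sup_ge1: "\<lbrakk>x \<in> carrier G; y \<in> carrier G\<rbrakk> \<Longrightarrow> x \<preceq> x \<squnion> y"
  by (rule ord.join_left)
lemma sup_ge2: "\<lbrakk>x \<in> carrier G; y \<in> carrier G\<rbrakk> \<Longrightarrow> y \<preceq> x \<squnion> y"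
  by (rule ord.join_right)
lemma inf_le1: "\<lbrakk>x \<in> carrier G; y \<in> carrier G\<rbrakk> \<Longrightarrow> x \<sqinter> y \<preceq> x"
  by (rule ord.meet_left)
lemma inf_le2: "\<lbrakk>x \<in> carrier G; y \<in> carrier G\<rbrakk> \<Longrightarrow> x \<sqinter> y \<preceq> y"
  by (rule ord.meet_right)
lemma sup_least: "\<lbrakk>x \<preceq> z; y \<preceq> z; x \<in> carrier G; y \<in> carrier G; z \<in> carrier G\<rbrakk> \<Longrightarrow> x \<squnion> y \<preceq> z"
  by (rule ord.join_le)
lemma inf_greatest: "\<lbrakk>z \<preceq> x; z \<preceq> y; x \<in> carrier G; y \<in> carrier G; z \<in> carrier G\<rbrakk> \<Longrightarrow> z \<preceq> x \<sqinter> y"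
  by (rule ord.meet_le)
lemma sup_comm: "x \<squnion> y = y \<squnion> x" by (rule join_comm)
lemma inf_comm: "x \<sqinter> y = y \<sqinter> x" by (rule meet_comm)

end

context lgroup
begin

lemma sup_leq_iff: "\<lbrakk>x \<in> carrier G; y \<in> carrier G; z \<in> carrier G\<rbrakk> \<Longrightarrow> x \<squnion> y \<preceq> z \<longleftrightarrow> x \<preceq> z \<and> y \<preceq> z"
  by (meson leq_trans sup_closed sup_ge1 sup_ge2 sup_least)

lemma leq_inf_iff: "\<lbrakk>x \<in> carrier G; y \<in> carrier G; z \<in> carrier G\<rbrakk> \<Longrightarrow> z \<preceq> x \<sqinter> y \<longleftrightarrow> z \<preceq> x \<and> z \<preceq> y"
  by (meson leq_trans inf_closed inf_le1 inf_le2 inf_greatest)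

lemma sup_eqI:
  assumes "x \<in> carrier G" "y \<in> carrier G" "s \<in> carrier G"
    and "\<And>z. z \<in> carrier G \<Longrightarrow> s \<preceq> z \<longleftrightarrow> x \<preceq> z \<and> y \<preceq> z"
  shows "x \<squnion> y = s"
  by (rule leq_antisym) (use assms assms(4)[of s] in \<open>auto simp: sup_leq_iff sup_ge1 sup_ge2\<close>)

lemma inf_eqI:
  assumes "x \<in> carrier G" "y \<in> carrier G" "s \<in> carrier G"
    and "\<And>z. z \<in> carrier G \<Longrightarrow> z \<preceq> s \<longleftrightarrow> z \<preceq> x \<and> z \<preceq> y"
  shows "x \<sqinter> y = s"
  by (rule leq_antisym) (use assms assms(4)[of s] in \<open>auto simp: leq_inf_iff inf_le1 inf_le2\<close>)

lemma sup_absorb2: "\<lbrakk>x \<preceq> y; x \<in> carrier G; y \<in> carrier G\<rbrakk> \<Longrightarrow> x \<squnion> y = y"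
  by (rule sup_eqI) (auto intro: leq_trans)
lemma sup_absorb1: "\<lbrakk>y \<preceq> x; x \<in> carrier G; y \<in> carrier G\<rbrakk> \<Longrightarrow> x \<squnion> y = x"
  using sup_absorb2 sup_comm by metis
lemma inf_absorb1: "\<lbrakk>x \<preceq> y; x \<in> carrier G; y \<in> carrier G\<rbrakk> \<Longrightarrow> x \<sqinter> y = x"
  by (rule inf_eqI) (auto intro: leq_trans)
lemma inf_absorb2: "\<lbrakk>y \<preceq> x; x \<in> carrier G; y \<in> carrier G\<rbrakk> \<Longrightarrow> x \<sqinter> y = y"
  using inf_absorb1 inf_comm by metis

lemma inf_assoc: "\<lbrakk>x \<in> carrier G; y \<in> carrier G; z \<in> carrier G\<rbrakk> \<Longrightarrow> x \<sqinter> y \<sqinter> z = x \<sqinter> (y \<sqinter> z)"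
  by (rule inf_eqI) (auto simp: leq_inf_iff)

text \<open>Translations are order automorphisms, so they preserve suprema and infima.\<close>

lemma add_sup_left:
  assumes "x \<in> carrier G" "y \<in> carrier G" "z \<in> carrier G"
  shows "z \<oplus> (x \<squnion> y) = (z \<oplus> x) \<squnion> (z \<oplus> y)"
proof (rule sym, rule sup_eqI)
  fix w assume w: "w \<in> carrier G"
  have "z \<oplus> v \<preceq> w \<longleftrightarrow> v \<preceq> w \<ominus> z" if "v \<in> carrier G" for v
    using that w assms by (simp add: leq_diff_iff a_comm)
  then show "(z \<oplus> (x \<squnion> y) \<preceq> w) = (z \<oplus> x \<preceq> w \<and> z \<oplus> y \<preceq> w)"
    using assms w by (simp add: sup_leq_iff)
qed (use assms in auto)

lemma add_inf_left:
  assumes "x \<in> carrier G" "y \<in> carrier G" "z \<in> carrier G"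
  shows "z \<oplus> (x \<sqinter> y) = (z \<oplus> x) \<sqinter> (z \<oplus> y)"
proof (rule sym, rule inf_eqI)
  fix w assume w: "w \<in> carrier G"
  have "w \<preceq> z \<oplus> v \<longleftrightarrow> w \<ominus> z \<preceq> v" if "v \<in> carrier G" for v
    using that w assms by (simp add: diff_leq_iff a_comm)
  then show "(w \<preceq> z \<oplus> (x \<sqinter> y)) = (w \<preceq> z \<oplus> x \<and> w \<preceq> z \<oplus> y)"
    using assms w by (simp add: leq_inf_iff)
qed (use assms in auto)

text \<open>Negation is an order anti-automorphism, so it exchanges suprema and infima.\<close>

lemma minus_sup:
  assumes "x \<in> carrier G" "y \<in> carrier G"
  shows "\<ominus> (x \<squnion> y) = \<ominus> x \<sqinter> \<ominus> y"
proof (rule sym, rule inf_eqI)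
  fix w assume w: "w \<in> carrier G"
  have "w \<preceq> \<ominus> v \<longleftrightarrow> v \<preceq> \<ominus> w" if "v \<in> carrier G" for v
    using leq_minus_iff[of v "\<ominus> w"] that w by simp
  then show "(w \<preceq> \<ominus> (x \<squnion> y)) = (w \<preceq> \<ominus> x \<and> w \<preceq> \<ominus> y)"
    using assms w by (simp add: sup_leq_iff)
qed (use assms in auto)

lemma minus_inf:
  assumes "x \<in> carrier G" "y \<in> carrier G"
  shows "\<ominus> (x \<sqinter> y) = \<ominus> x \<squnion> \<ominus> y"
  using minus_sup[of "\<ominus> x" "\<ominus> y"] assms by (metis a_inv_closed minus_minus sup_closed)

lemma inf_eq_minus_sup:
  "\<lbrakk>x \<in> carrier G; y \<in> carrier G\<rbrakk> \<Longrightarrow> x \<sqinter> y = \<ominus> (\<ominus> x \<squnion> \<ominus> y)"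
  by (simp add: minus_sup)

lemma minus_inf_self:
  assumes "a \<in> carrier G" "b \<in> carrier G"
  shows "a \<ominus> (a \<sqinter> b) = \<zero> \<squnion> (a \<ominus> b)"
  using assms by (simp add: minus_eq minus_inf add_sup_left r_neg)

lemma pos_part_minus:
  assumes "x \<in> carrier G"
  shows "\<ominus> x \<squnion> \<zero> = (x \<squnion> \<zero>) \<ominus> x"
proof -
  have "(x \<squnion> \<zero>) \<ominus> x = \<ominus> x \<oplus> (x \<squnion> \<zero>)" using assms by (simp add: minus_eq a_comm)
  then show ?thesis using assms by (simp add: add_sup_left l_neg sup_comm)
qed

lemma pos_parts_disjoint:
  assumes "x \<in> carrier G"
  shows "(x \<squnion> \<zero>) \<sqinter> (\<ominus> x \<squnion> \<zero>) = \<zero>"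
proof -
  have "(x \<squnion> \<zero>) \<sqinter> (\<ominus> x \<squnion> \<zero>) = (x \<squnion> \<zero>) \<oplus> (\<zero> \<sqinter> \<ominus> x)"
    using assms by (subst add_inf_left) (auto simp: pos_part_minus minus_eq)
  also have "\<zero> \<sqinter> \<ominus> x = \<ominus> (x \<squnion> \<zero>)"
    using assms by (simp add: minus_sup inf_comm)
  finally show ?thesis using assms by (simp add: r_neg)
qed

lemma pos_part_diff_disjoint:
  assumes "a \<in> carrier G" "b \<in> carrier G" "a \<sqinter> b = \<zero>"
  shows "(a \<ominus> b) \<squnion> \<zero> = a"
  using minus_inf_self[OF assms(1,2)] assms by (simp add: sup_comm minus_eq)

lemma sup_eq_add_pos_part:
  assumes "x \<in> carrier G" "y \<in> carrier G"
  shows "x \<squnion> y = y \<oplus> ((x \<ominus> y) \<squnion> \<zero>)"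
proof -
  have "y \<oplus> (x \<ominus> y) = x" using assms by algebra
  then show ?thesis using assms by (simp add: add_sup_left)
qed

text \<open>The inductive step of Riesz decomposition: once \<open>a \<sqinter> b\<close> has been taken off \<open>a\<close>, the rest fits
  below \<open>c\<close>.\<close>

lemma minus_inf_leq:
  assumes "a \<preceq> b \<oplus> c" "\<zero> \<preceq> c" "a \<in> carrier G" "b \<in> carrier G" "c \<in> carrier G"
  shows "a \<ominus> (a \<sqinter> b) \<preceq> c"
  using assms by (simp add: minus_inf_self sup_leq_iff diff_leq_iff a_comm)

text \<open>By \<open>minus_inf_leq\<close>, an element below both \<open>a\<close> and \<open>b \<oplus> c\<close> lies below \<open>c\<close> as soon as its part
  below \<open>b\<close> vanishes; and it does, being below both \<open>a\<close> and \<open>b\<close>.\<close>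

lemma disjoint_add:
  assumes "a \<sqinter> b = \<zero>" "a \<sqinter> c = \<zero>" "a \<in> carrier G" "b \<in> carrier G" "c \<in> carrier G"
  shows "a \<sqinter> (b \<oplus> c) = \<zero>"
proof (rule leq_antisym)
  have nn: "\<zero> \<preceq> a" "\<zero> \<preceq> b" "\<zero> \<preceq> c"
    using assms inf_le1 inf_le2 by metis+
  then show "\<zero> \<preceq> a \<sqinter> (b \<oplus> c)"
    using assms by (simp add: leq_inf_iff add_nonneg)
  let ?d = "a \<sqinter> (b \<oplus> c)"
  have d: "?d \<preceq> a" "?d \<preceq> b \<oplus> c" "?d \<in> carrier G"
    using assms inf_le1 inf_le2 by auto
  have "?d \<sqinter> b \<preceq> a \<sqinter> b"
    using d assms by (meson inf_closed inf_greatest inf_le1 inf_le2 leq_trans)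
  moreover have "\<zero> \<preceq> ?d \<sqinter> b"
    using nn assms by (simp add: leq_inf_iff add_nonneg)
  ultimately have "?d \<sqinter> b = \<zero>"
    using assms by (metis d(3) inf_closed leq_antisym zero_closed)
  then have "?d \<preceq> c"
    using minus_inf_leq[OF d(2) nn(3) d(3) assms(4,5)] d(3) by (simp add: minus_eq)
  then show "?d \<preceq> \<zero>" using assms d inf_greatest by metis
qed (use assms in auto)

lemmas nsmul_Suc = add.nat_pow_Suc

lemma nsmul_add: "\<lbrakk>x \<in> carrier G; y \<in> carrier G\<rbrakk> \<Longrightarrow> [(n::nat)] \<cdot> (x \<oplus> y) = [n] \<cdot> x \<oplus> [n] \<cdot> y"
  by (induct n) (simp_all add: nsmul_Suc a_ac)

lemma nsmul_add_left: "x \<in> carrier G \<Longrightarrow> [(m + n::nat)] \<cdot> x = [m] \<cdot> x \<oplus> [n] \<cdot> x"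
  by (induct n) (simp_all add: nsmul_Suc a_ac)

lemma nsmul_mult: "x \<in> carrier G \<Longrightarrow> [(m * n::nat)] \<cdot> x = [m] \<cdot> ([n] \<cdot> x)"
  by (induct m) (simp_all add: nsmul_Suc nsmul_add_left nsmul_add a_ac)

lemma nsmul_minus: "x \<in> carrier G \<Longrightarrow> [(n::nat)] \<cdot> (\<ominus> x) = \<ominus> ([n] \<cdot> x)"
  by (induct n) (simp_all add: nsmul_Suc minus_add a_comm)

lemma nsmul_nonneg: "\<lbrakk>\<zero> \<preceq> x; x \<in> carrier G\<rbrakk> \<Longrightarrow> \<zero> \<preceq> [(n::nat)] \<cdot> x"
  by (induct n) (simp_all add: nsmul_Suc add_nonneg)

lemma nsmul_mono: "\<lbrakk>x \<preceq> y; x \<in> carrier G; y \<in> carrier G\<rbrakk> \<Longrightarrow> [(n::nat)] \<cdot> x \<preceq> [n] \<cdot> y"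
  by (induct n) (simp_all add: nsmul_Suc add_mono)

lemma nsmul_mono_left:
  assumes "m \<le> n" "\<zero> \<preceq> x" "x \<in> carrier G"
  shows "[(m::nat)] \<cdot> x \<preceq> [n] \<cdot> x"
  using nsmul_add_left[of x m "n - m"] assms
  by (simp add: leq_add_nonneg nsmul_nonneg)

end

text \<open>Negation reverses the order and turns suprema into infima, so suprema suffice.\<close>

lemma l_groupI:
  fixes G :: "('a, 'b) ogroup_scheme" (structure)
  assumes grp: "abelian_group G"
    and refl: "\<And>x. x \<in> carrier G \<Longrightarrow> x \<preceq> x"
    and antisym: "\<And>x y. \<lbrakk>x \<in> carrier G; y \<in> carrier G; x \<preceq> y; y \<preceq> x\<rbrakk> \<Longrightarrow> x = y"
    and trans: "\<And>x y z. \<lbrakk>x \<in> carrier G; y \<in> carrier G; z \<in> carrier G; x \<preceq> y; y \<preceq> z\<rbrakk> \<Longrightarrow> x \<preceq> z"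
    and add: "\<And>x y z. \<lbrakk>x \<in> carrier G; y \<in> carrier G; z \<in> carrier G; x \<preceq> y\<rbrakk> \<Longrightarrow> x \<oplus> z \<preceq> y \<oplus> z"
    and sup: "\<And>x y. \<lbrakk>x \<in> carrier G; y \<in> carrier G\<rbrakk> \<Longrightarrow>
      \<exists>s\<in>carrier G. x \<preceq> s \<and> y \<preceq> s \<and> (\<forall>z\<in>carrier G. x \<preceq> z \<and> y \<preceq> z \<longrightarrow> s \<preceq> z)"
  shows "l_group G"
proof -
  interpret abelian_group G by (rule grp)
  have neg: "\<ominus> y \<preceq> \<ominus> x" if "x \<preceq> y" "x \<in> carrier G" "y \<in> carrier G" for x y
  proof -
    have "x \<oplus> (\<ominus> x \<oplus> \<ominus> y) = \<ominus> y" "y \<oplus> (\<ominus> x \<oplus> \<ominus> y) = \<ominus> x"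
      using that a_comm[of "\<ominus> x" "\<ominus> y"] r_neg2[of x "\<ominus> y"] r_neg2[of y "\<ominus> x"] by auto
    then show ?thesis using add[of x y "\<ominus> x \<oplus> \<ominus> y"] that by simp
  qed
  have "partial_order (order_of G)"
    by unfold_locales (auto intro: refl antisym trans)
  then interpret ord: partial_order "order_of G"
    rewrites "carrier (order_of G) = carrier G" and "le (order_of G) = leq G"
      and "eq (order_of G) = (=)"
    by simp_all
  have "Lattice.lattice (order_of G)"
  proof
    fix x y assume xy: "x \<in> carrier (order_of G)" "y \<in> carrier (order_of G)"
    then have xy: "x \<in> carrier G" "y \<in> carrier G" by auto
    obtain s where "s \<in> carrier G" "x \<preceq> s" "y \<preceq> s"
      and "\<And>z. z \<in> carrier G \<Longrightarrow> x \<preceq> z \<Longrightarrow> y \<preceq> z \<Longrightarrow> s \<preceq> z"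
      using sup[OF xy] by blast
    then have "least (order_of G) s (Upper (order_of G) {x, y})"
      using xy by (auto simp: least_def Upper_def)
    then show "\<exists>s. least (order_of G) s (Upper (order_of G) {x, y})" ..
    have m: "\<ominus> x \<in> carrier G" "\<ominus> y \<in> carrier G" using xy by auto
    obtain s where s: "s \<in> carrier G" "\<ominus> x \<preceq> s" "\<ominus> y \<preceq> s"
      and least: "\<And>z. z \<in> carrier G \<Longrightarrow> \<ominus> x \<preceq> z \<Longrightarrow> \<ominus> y \<preceq> z \<Longrightarrow> s \<preceq> z"
      using sup[OF m] by blast
    have "\<ominus> s \<preceq> x" "\<ominus> s \<preceq> y"
      using neg[OF s(2)] neg[OF s(3)] xy s by simp_all
    moreover have "z \<preceq> \<ominus> s" if "z \<preceq> x" "z \<preceq> y" "z \<in> carrier G" for z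
      using neg[OF least[of "\<ominus> z"]] neg[OF that(1)] neg[OF that(2)] that xy s by simp
    ultimately have "greatest (order_of G) (\<ominus> s) (Lower (order_of G) {x, y})"
      using xy s by (auto simp: greatest_def Lower_def)
    then show "\<exists>s. greatest (order_of G) s (Lower (order_of G) {x, y})" ..
  qed
  then show ?thesis using grp add by (simp add: l_group_def)
qed

context lgroup
begin

text \<open>Adding \<open>x \<squnion> \<zero>\<close> is the supremum of adding \<open>x\<close> and of adding nothing. The induction therefore
  needs the statement for mixed sums.\<close>

lemma pos_part_bounded:
  assumes "x \<in> carrier G" "y \<in> carrier G" "\<And>k::nat. [k] \<cdot> x \<preceq> y"
  shows "[(n::nat)] \<cdot> (x \<squnion> \<zero>) \<oplus> [(k::nat)] \<cdot> x \<preceq> y"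
proof (induct n arbitrary: k)
  case 0
  then show ?case using assms by simp
next
  case (Suc n)
  let ?a = "[n] \<cdot> (x \<squnion> \<zero>) \<oplus> [k] \<cdot> x"
  have "[Suc n] \<cdot> (x \<squnion> \<zero>) \<oplus> [k] \<cdot> x = ?a \<oplus> (x \<squnion> \<zero>)"
    using assms(1) by (simp add: nsmul_Suc a_ac)
  also have "\<dots> = (?a \<oplus> x) \<squnion> (?a \<oplus> \<zero>)"
    using assms(1) by (intro add_sup_left) auto
  also have "?a \<oplus> x = [n] \<cdot> (x \<squnion> \<zero>) \<oplus> [Suc k] \<cdot> x"
    using assms(1) by (simp add: nsmul_Suc a_assoc)
  finally show ?case
    using assms(1,2) Suc[of k] Suc[of "Suc k"] by (simp add: sup_leq_iff)
qed

text \<open>The definition of an Archimedean group speaks of nonnegative elements; the passage to the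
  positive part frees it from this restriction.\<close>

lemma archimedean_leq_zero:
  assumes "archimedean G" "x \<in> carrier G" "y \<in> carrier G" "\<And>k::nat. [k] \<cdot> x \<preceq> y"
  shows "x \<preceq> \<zero>"
proof -
  have "[n] \<cdot> (x \<squnion> \<zero>) \<preceq> y" for n :: nat
    using pos_part_bounded[OF assms(2-4), of n 0] assms(2) by simp
  then have "x \<squnion> \<zero> = \<zero>"
    using assms(1-3) sup_ge2[of x \<zero>] sup_closed[of x \<zero>] zero_closed
    unfolding archimedean_def by blast
  then show ?thesis using sup_ge1[of x \<zero>] assms(2) by simp
qed

text \<open>The form in which the Archimedean property is applied below: elements whose multiples stay
  within a constant distance of each other are equal.\<close>

lemma archimedean_eqI:
  assumes "archimedean G" "x \<in> carrier G" "y \<in> carrier G" "z \<in> carrier G"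
    and "\<And>k::nat. [k] \<cdot> x \<preceq> [k] \<cdot> y \<oplus> z" "\<And>k::nat. [k] \<cdot> y \<preceq> [k] \<cdot> x \<oplus> z"
  shows "x = y"
proof -
  have "a \<preceq> b" if "a \<in> carrier G" "b \<in> carrier G" "\<And>k::nat. [k] \<cdot> a \<preceq> [k] \<cdot> b \<oplus> z" for a b
  proof -
    have "[k] \<cdot> (a \<ominus> b) \<preceq> z" for k :: nat
    proof -
      have "[k] \<cdot> (a \<ominus> b) = [k] \<cdot> a \<ominus> [k] \<cdot> b"
        using that by (simp add: minus_eq nsmul_add nsmul_minus)
      then show ?thesis using that assms(4) by (simp add: diff_leq_iff a_comm)
    qed
    then have "a \<ominus> b \<preceq> \<zero>"
      using that assms by (intro archimedean_leq_zero[of _ z]) auto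
    then show ?thesis using that by (simp add: diff_leq_iff)
  qed
  then show ?thesis using assms by (intro leq_antisym) auto
qed

lemma strong_unitE:
  assumes "strong_unit G u"
  shows "u \<in> carrier G" "\<zero> \<preceq> u" "x \<in> carrier G \<Longrightarrow> \<exists>n::nat. x \<preceq> [n] \<cdot> u"
  using assms by (auto simp: strong_unit_def)

end

section \<open>Homomorphisms\<close>

locale lgroup_hom = G: lgroup G + H: lgroup H
  for G :: "('a, 'c) ogroup_scheme" and H :: "('b, 'd) ogroup_scheme" +
  fixes f assumes hom: "f \<in> l_hom G H"
begin

lemma closed [simp]: "x \<in> carrier G \<Longrightarrow> f x \<in> carrier H"
  using hom by (auto simp: l_hom_def)

lemma add: "\<lbrakk>x \<in> carrier G; y \<in> carrier G\<rbrakk> \<Longrightarrow> f (x \<oplus>\<^bsub>G\<^esub> y) = f x \<oplus>\<^bsub>H\<^esub> f y"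
  and sup: "\<lbrakk>x \<in> carrier G; y \<in> carrier G\<rbrakk> \<Longrightarrow> f (x \<squnion>\<^bsub>G\<^esub> y) = f x \<squnion>\<^bsub>H\<^esub> f y"
  and inf: "\<lbrakk>x \<in> carrier G; y \<in> carrier G\<rbrakk> \<Longrightarrow> f (x \<sqinter>\<^bsub>G\<^esub> y) = f x \<sqinter>\<^bsub>H\<^esub> f y"
  using hom by (auto simp: l_hom_def)

lemma mono: "\<lbrakk>x \<preceq>\<^bsub>G\<^esub> y; x \<in> carrier G; y \<in> carrier G\<rbrakk> \<Longrightarrow> f x \<preceq>\<^bsub>H\<^esub> f y"
  using sup[of x y] H.sup_ge1[of "f x" "f y"] by (simp add: G.sup_absorb2)

end

lemma additive_zero:
  assumes "abelian_group G" "abelian_group H" "f \<in> carrier G \<rightarrow> carrier H"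
    and "\<And>x y. \<lbrakk>x \<in> carrier G; y \<in> carrier G\<rbrakk> \<Longrightarrow> f (x \<oplus>\<^bsub>G\<^esub> y) = f x \<oplus>\<^bsub>H\<^esub> f y"
  shows "f \<zero>\<^bsub>G\<^esub> = \<zero>\<^bsub>H\<^esub>"
proof -
  interpret G: abelian_group G by fact
  interpret H: abelian_group H by fact
  have f0: "f \<zero>\<^bsub>G\<^esub> \<in> carrier H" using assms(3) by auto
  have "f \<zero>\<^bsub>G\<^esub> \<oplus>\<^bsub>H\<^esub> f \<zero>\<^bsub>G\<^esub> = f \<zero>\<^bsub>G\<^esub>"
    using assms(4)[of "\<zero>\<^bsub>G\<^esub>" "\<zero>\<^bsub>G\<^esub>"] by simp
  then show ?thesis using f0 H.add.r_cancel_one[OF f0 f0] by simp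
qed

lemma additive_minus:
  assumes "abelian_group G" "abelian_group H" "f \<in> carrier G \<rightarrow> carrier H"
    and "\<And>x y. \<lbrakk>x \<in> carrier G; y \<in> carrier G\<rbrakk> \<Longrightarrow> f (x \<oplus>\<^bsub>G\<^esub> y) = f x \<oplus>\<^bsub>H\<^esub> f y"
    and "x \<in> carrier G"
  shows "f (\<ominus>\<^bsub>G\<^esub> x) = \<ominus>\<^bsub>H\<^esub> f x"
proof -
  interpret G: abelian_group G by fact
  interpret H: abelian_group H by fact
  have f0: "f \<zero>\<^bsub>G\<^esub> = \<zero>\<^bsub>H\<^esub>" by (rule additive_zero[OF assms(1-4)])
  have "f (\<ominus>\<^bsub>G\<^esub> x) \<oplus>\<^bsub>H\<^esub> f x = \<zero>\<^bsub>H\<^esub>"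
    using assms(4)[of "\<ominus>\<^bsub>G\<^esub> x" x] assms(5) f0 by (simp add: G.l_neg)
  then show ?thesis
    using assms(3,5) H.minus_equality[of "f (\<ominus>\<^bsub>G\<^esub> x)" "f x"] G.a_inv_closed[of x] funcset_mem[OF assms(3)] by simp
qed

lemma additive_nsmul:
  assumes "abelian_group G" "abelian_group H" "f \<in> carrier G \<rightarrow> carrier H"
    and "\<And>x y. \<lbrakk>x \<in> carrier G; y \<in> carrier G\<rbrakk> \<Longrightarrow> f (x \<oplus>\<^bsub>G\<^esub> y) = f x \<oplus>\<^bsub>H\<^esub> f y"
    and "x \<in> carrier G"
  shows "f ([(n::nat)] \<cdot>\<^bsub>G\<^esub> x) = [n] \<cdot>\<^bsub>H\<^esub> f x"
proof -
  interpret G: abelian_group G by fact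
  interpret H: abelian_group H by fact
  have f0: "f \<zero>\<^bsub>G\<^esub> = \<zero>\<^bsub>H\<^esub>" by (rule additive_zero[OF assms(1-4)])
  show ?thesis
    by (induct n) (use assms(5) in \<open>simp_all add: f0 assms(4)\<close>)
qed

context lgroup_hom
begin

lemma maps: "f \<in> carrier G \<rightarrow> carrier H"
  by auto

lemma zero: "f \<zero>\<^bsub>G\<^esub> = \<zero>\<^bsub>H\<^esub>"
  by (rule additive_zero[OF G.abelian_group_axioms H.abelian_group_axioms maps]) (rule add)
lemma minus: "x \<in> carrier G \<Longrightarrow> f (\<ominus>\<^bsub>G\<^esub> x) = \<ominus>\<^bsub>H\<^esub> f x"
  by (rule additive_minus[OF G.abelian_group_axioms H.abelian_group_axioms maps]) (rule add)
lemma nsmul: "x \<in> carrier G \<Longrightarrow> f ([(n::nat)] \<cdot>\<^bsub>G\<^esub> x) = [n] \<cdot>\<^bsub>H\<^esub> f x"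
  by (rule additive_nsmul[OF G.abelian_group_axioms H.abelian_group_axioms maps]) (rule add)

end

lemma l_hom_supI:
  assumes "l_group G" "l_group H" and maps: "f \<in> carrier G \<rightarrow>\<^sub>E carrier H"
    and add: "\<And>x y. \<lbrakk>x \<in> carrier G; y \<in> carrier G\<rbrakk> \<Longrightarrow> f (x \<oplus>\<^bsub>G\<^esub> y) = f x \<oplus>\<^bsub>H\<^esub> f y"
    and sup: "\<And>x y. \<lbrakk>x \<in> carrier G; y \<in> carrier G\<rbrakk> \<Longrightarrow> f (x \<squnion>\<^bsub>G\<^esub> y) = f x \<squnion>\<^bsub>H\<^esub> f y"
  shows "f \<in> l_hom G H"
proof -
  interpret G: lgroup G by (simp add: lgroup_def assms)
  interpret H: lgroup H by (simp add: lgroup_def assms)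
  have maps': "f \<in> carrier G \<rightarrow> carrier H" using maps by auto
  have minus: "f (\<ominus>\<^bsub>G\<^esub> x) = \<ominus>\<^bsub>H\<^esub> f x" if "x \<in> carrier G" for x
    by (rule additive_minus[OF G.abelian_group_axioms H.abelian_group_axioms maps' _ that]) (rule add)
  have "f (x \<sqinter>\<^bsub>G\<^esub> y) = f x \<sqinter>\<^bsub>H\<^esub> f y" if "x \<in> carrier G" "y \<in> carrier G" for x y
    using that G.inf_eq_minus_sup[of x y] H.inf_eq_minus_sup[of "f x" "f y"] funcset_mem[OF maps']
    by (simp add: minus sup)
  then show ?thesis using maps add sup by (simp add: l_hom_def)
qed

text \<open>A supremum is \<open>y \<oplus> ((x \<ominus> y) \<squnion> \<zero>)\<close>, so it suffices to preserve positive parts. The positive part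
  of \<open>f x\<close> is the first of two disjoint elements with difference \<open>f x\<close>, and the images of the
  positive and negative part of \<open>x\<close> are such a pair.\<close>

lemma l_hom_disjointI:
  assumes "l_group G" "l_group H" and maps: "f \<in> carrier G \<rightarrow>\<^sub>E carrier H"
    and add: "\<And>x y. \<lbrakk>x \<in> carrier G; y \<in> carrier G\<rbrakk> \<Longrightarrow> f (x \<oplus>\<^bsub>G\<^esub> y) = f x \<oplus>\<^bsub>H\<^esub> f y"
    and disj: "\<And>x y. \<lbrakk>x \<in> carrier G; y \<in> carrier G; x \<sqinter>\<^bsub>G\<^esub> y = \<zero>\<^bsub>G\<^esub>\<rbrakk> \<Longrightarrow> f x \<sqinter>\<^bsub>H\<^esub> f y = \<zero>\<^bsub>H\<^esub>"
  shows "f \<in> l_hom G H"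
proof (rule l_hom_supI[OF assms(1-4)])
  interpret G: lgroup G by (simp add: lgroup_def assms)
  interpret H: lgroup H by (simp add: lgroup_def assms)
  have maps': "f \<in> carrier G \<rightarrow> carrier H" using maps by auto
  note cl [simp] = funcset_mem[OF maps']
  have minus: "f (\<ominus>\<^bsub>G\<^esub> x) = \<ominus>\<^bsub>H\<^esub> f x" if "x \<in> carrier G" for x
    by (rule additive_minus[OF G.abelian_group_axioms H.abelian_group_axioms maps' _ that]) (rule add)
  have pos: "f (x \<squnion>\<^bsub>G\<^esub> \<zero>\<^bsub>G\<^esub>) = f x \<squnion>\<^bsub>H\<^esub> \<zero>\<^bsub>H\<^esub>" if x: "x \<in> carrier G" for x
  proof -
    let ?p = "x \<squnion>\<^bsub>G\<^esub> \<zero>\<^bsub>G\<^esub>" and ?n = "\<ominus>\<^bsub>G\<^esub> x \<squnion>\<^bsub>G\<^esub> \<zero>\<^bsub>G\<^esub>"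
    have "?p \<ominus>\<^bsub>G\<^esub> ?n = ?p \<ominus>\<^bsub>G\<^esub> (?p \<ominus>\<^bsub>G\<^esub> x)"
      using x by (simp add: G.pos_part_minus)
    also have "\<dots> = x"
      using x by (simp add: G.minus_eq G.minus_add G.a_ac G.r_neg G.r_neg1 G.r_neg2)
    finally have "f x = f (?p \<ominus>\<^bsub>G\<^esub> ?n)" by simp
    also have "\<dots> = f ?p \<ominus>\<^bsub>H\<^esub> f ?n"
      using x by (simp add: G.minus_eq H.minus_eq add minus)
    finally have fx: "f x = f ?p \<ominus>\<^bsub>H\<^esub> f ?n" .
    have "f ?p \<sqinter>\<^bsub>H\<^esub> f ?n = \<zero>\<^bsub>H\<^esub>"
      using disj[of ?p ?n] G.pos_parts_disjoint[OF x] x by simp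
    then show ?thesis
      unfolding fx using H.pos_part_diff_disjoint[of "f ?p" "f ?n"] x by simp
  qed
  fix x y assume xy: "x \<in> carrier G" "y \<in> carrier G"
  have "f (x \<squnion>\<^bsub>G\<^esub> y) = f y \<oplus>\<^bsub>H\<^esub> (f (x \<ominus>\<^bsub>G\<^esub> y) \<squnion>\<^bsub>H\<^esub> \<zero>\<^bsub>H\<^esub>)"
    using xy by (subst G.sup_eq_add_pos_part) (simp_all add: add pos)
  also have "f (x \<ominus>\<^bsub>G\<^esub> y) = f x \<ominus>\<^bsub>H\<^esub> f y"
    using xy by (simp add: G.minus_eq H.minus_eq add minus)
  finally show "f (x \<squnion>\<^bsub>G\<^esub> y) = f x \<squnion>\<^bsub>H\<^esub> f y"
    using xy H.sup_eq_add_pos_part[of "f x" "f y"] by simp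
qed

section \<open>Copies of sub-groups, and products\<close>

text \<open>Infima are negatives of suprema of negatives, so closure under suprema is enough.\<close>

definition sub_lgroup :: "'a set \<Rightarrow> ('a, 'b) ogroup_scheme \<Rightarrow> bool" where
  "sub_lgroup S G \<longleftrightarrow> S \<subseteq> carrier G \<and> \<zero>\<^bsub>G\<^esub> \<in> S \<and>
     (\<forall>x\<in>S. \<forall>y\<in>S. x \<oplus>\<^bsub>G\<^esub> y \<in> S \<and> x \<squnion>\<^bsub>G\<^esub> y \<in> S) \<and> (\<forall>x\<in>S. \<ominus>\<^bsub>G\<^esub> x \<in> S)"

text \<open>A copy of the sub-\<open>\<ell>\<close>-group \<open>S\<close> of \<open>G\<close> in another type, along a map that is injective on \<open>S\<close>.\<close>

definition transport :: "('a \<Rightarrow> 't) \<Rightarrow> 'a set \<Rightarrow> ('a, 'b) ogroup_scheme \<Rightarrow> 't ogroup" where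
  "transport \<psi> S G =
     \<lparr>carrier = \<psi> ` S, monoid.mult = undefined, one = undefined, zero = \<psi> \<zero>\<^bsub>G\<^esub>,
      add = (\<lambda>x y. \<psi> (inv_into S \<psi> x \<oplus>\<^bsub>G\<^esub> inv_into S \<psi> y)),
      leq = (\<lambda>x y. inv_into S \<psi> x \<preceq>\<^bsub>G\<^esub> inv_into S \<psi> y)\<rparr>"

locale transported = lgroup G for G :: "('a, 'b) ogroup_scheme" (structure) +
  fixes S :: "'a set" and \<psi> :: "'a \<Rightarrow> 't"
  assumes sub: "sub_lgroup S G" and inj: "inj_on \<psi> S"
begin

abbreviation "T \<equiv> transport \<psi> S G"

lemma in_carrier [simp]: "x \<in> S \<Longrightarrow> x \<in> carrier G"
  and sub_closed [simp]: "\<zero> \<in> S" "x \<in> S \<Longrightarrow> y \<in> S \<Longrightarrow> x \<oplus> y \<in> S"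
    "x \<in> S \<Longrightarrow> y \<in> S \<Longrightarrow> x \<squnion> y \<in> S" "x \<in> S \<Longrightarrow> \<ominus> x \<in> S"
  using sub by (auto simp: sub_lgroup_def)

lemma transport_carrier [simp]: "carrier T = \<psi> ` S"
  and transport_zero: "\<zero>\<^bsub>T\<^esub> = \<psi> \<zero>"
  and transport_add: "\<lbrakk>x \<in> S; y \<in> S\<rbrakk> \<Longrightarrow> \<psi> x \<oplus>\<^bsub>T\<^esub> \<psi> y = \<psi> (x \<oplus> y)"
  and transport_leq: "\<lbrakk>x \<in> S; y \<in> S\<rbrakk> \<Longrightarrow> \<psi> x \<preceq>\<^bsub>T\<^esub> \<psi> y \<longleftrightarrow> x \<preceq> y"
  using inj by (simp_all add: transport_def)

lemma transport_abelian_group: "abelian_group T"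
proof (rule abelian_groupI)
  fix x assume "x \<in> carrier T"
  then obtain a where a: "a \<in> S" "x = \<psi> a" by auto
  then show "\<exists>y\<in>carrier T. y \<oplus>\<^bsub>T\<^esub> x = \<zero>\<^bsub>T\<^esub>"
    by (intro bexI[of _ "\<psi> (\<ominus> a)"]) (simp_all add: transport_add transport_zero l_neg)
qed (auto simp: transport_zero transport_add a_ac)

lemma transport_l_group: "l_group T"
proof (rule l_groupI[OF transport_abelian_group])
  fix x y assume "x \<in> carrier T" "y \<in> carrier T"
  then obtain a b where a: "a \<in> S" "x = \<psi> a" "b \<in> S" "y = \<psi> b" by auto
  then show "\<exists>s\<in>carrier T. x \<preceq>\<^bsub>T\<^esub> s \<and> y \<preceq>\<^bsub>T\<^esub> s \<and>
              (\<forall>z\<in>carrier T. x \<preceq>\<^bsub>T\<^esub> z \<and> y \<preceq>\<^bsub>T\<^esub> z \<longrightarrow> s \<preceq>\<^bsub>T\<^esub> z)"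
  proof (intro bexI[of _ "\<psi> (a \<squnion> b)"] conjI ballI impI)
    fix z assume "z \<in> carrier T" "x \<preceq>\<^bsub>T\<^esub> z \<and> y \<preceq>\<^bsub>T\<^esub> z"
    moreover from this obtain c where "c \<in> S" "z = \<psi> c" by auto
    ultimately show "\<psi> (a \<squnion> b) \<preceq>\<^bsub>T\<^esub> z"
      using a sup_leq_iff[of a b c] by (simp add: transport_leq)
  qed (use a in \<open>simp_all add: transport_leq sup_ge1 sup_ge2\<close>)
next
  fix x y z assume "x \<in> carrier T" "y \<in> carrier T" "z \<in> carrier T" "x \<preceq>\<^bsub>T\<^esub> y" "y \<preceq>\<^bsub>T\<^esub> z"
  moreover from this obtain a b c where "a \<in> S" "x = \<psi> a" "b \<in> S" "y = \<psi> b" "c \<in> S" "z = \<psi> c" by auto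
  ultimately show "x \<preceq>\<^bsub>T\<^esub> z"
    using leq_trans[of a b c] by (simp add: transport_leq)
next
  fix x y assume "x \<in> carrier T" "y \<in> carrier T" "x \<preceq>\<^bsub>T\<^esub> y" "y \<preceq>\<^bsub>T\<^esub> x"
  moreover from this obtain a b where "a \<in> S" "x = \<psi> a" "b \<in> S" "y = \<psi> b" by auto
  ultimately show "x = y"
    using leq_antisym[of a b] by (simp add: transport_leq)
next
  fix x y z assume "x \<in> carrier T" "y \<in> carrier T" "z \<in> carrier T" "x \<preceq>\<^bsub>T\<^esub> y"
  moreover from this obtain a b c where "a \<in> S" "x = \<psi> a" "b \<in> S" "y = \<psi> b" "c \<in> S" "z = \<psi> c" by auto
  ultimately show "x \<oplus>\<^bsub>T\<^esub> z \<preceq>\<^bsub>T\<^esub> y \<oplus>\<^bsub>T\<^esub> z"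
    using add_leq_cancel_right[of a b c] by (simp add: transport_leq transport_add)
next
  fix x assume "x \<in> carrier T"
  then obtain a where "a \<in> S" "x = \<psi> a" by auto
  then show "x \<preceq>\<^bsub>T\<^esub> x" by (simp add: transport_leq)
qed

lemma transport_lgroup: "lgroup T"
  by (rule lgroup.intro) (rule transport_l_group)

interpretation T: lgroup T
  by (rule transport_lgroup)

lemma transport_sup: "\<lbrakk>x \<in> S; y \<in> S\<rbrakk> \<Longrightarrow> \<psi> x \<squnion>\<^bsub>T\<^esub> \<psi> y = \<psi> (x \<squnion> y)"
proof (rule T.sup_eqI)
  fix z assume xy: "x \<in> S" "y \<in> S" and "z \<in> carrier T"
  then obtain c where "c \<in> S" "z = \<psi> c" by auto
  then show "\<psi> (x \<squnion> y) \<preceq>\<^bsub>T\<^esub> z \<longleftrightarrow> \<psi> x \<preceq>\<^bsub>T\<^esub> z \<and> \<psi> y \<preceq>\<^bsub>T\<^esub> z"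
    using sup_leq_iff[of x y c] xy by (simp add: transport_leq)
qed simp_all

lemma transport_minus: "x \<in> S \<Longrightarrow> \<ominus>\<^bsub>T\<^esub> \<psi> x = \<psi> (\<ominus> x)"
  by (rule T.minus_equality) (simp_all add: transport_add l_neg transport_zero)

lemma sub_inf_closed: "\<lbrakk>x \<in> S; y \<in> S\<rbrakk> \<Longrightarrow> x \<sqinter> y \<in> S"
  by (simp add: inf_eq_minus_sup)

lemma transport_inf: "\<lbrakk>x \<in> S; y \<in> S\<rbrakk> \<Longrightarrow> \<psi> x \<sqinter>\<^bsub>T\<^esub> \<psi> y = \<psi> (x \<sqinter> y)"
  by (simp add: T.inf_eq_minus_sup inf_eq_minus_sup transport_minus transport_sup)

lemma nsmul_in_sub: "x \<in> S \<Longrightarrow> [(n::nat)] \<cdot> x \<in> S"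
  by (induct n) (simp_all add: nsmul_Suc)

lemma transport_nsmul: "x \<in> S \<Longrightarrow> [(n::nat)] \<cdot>\<^bsub>T\<^esub> \<psi> x = \<psi> ([n] \<cdot> x)"
  by (induct n) (simp_all add: nsmul_Suc T.nsmul_Suc transport_add nsmul_in_sub transport_zero)

lemma transport_archimedean:
  assumes "archimedean G"
  shows "archimedean T"
  unfolding archimedean_def
proof (intro ballI impI)
  fix x y assume "x \<in> carrier T" "y \<in> carrier T"
    and h: "\<zero>\<^bsub>T\<^esub> \<preceq>\<^bsub>T\<^esub> x \<and> (\<forall>n::nat. [n] \<cdot>\<^bsub>T\<^esub> x \<preceq>\<^bsub>T\<^esub> y)"
  then obtain a b where a: "a \<in> S" "x = \<psi> a" "b \<in> S" "y = \<psi> b" by auto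
  with h have "\<zero> \<preceq> a" "\<forall>n::nat. [n] \<cdot> a \<preceq> b"
    by (simp_all add: transport_leq transport_zero transport_nsmul nsmul_in_sub)
  with assms a have "a = \<zero>" unfolding archimedean_def by (blast intro: in_carrier)
  with a show "x = \<zero>\<^bsub>T\<^esub>" by (simp add: transport_zero)
qed

lemma transport_inv_hom: "(\<lambda>y\<in>carrier T. inv_into S \<psi> y) \<in> l_hom T G"
  using inj by (auto simp: l_hom_def transport_add transport_sup transport_inf sub_inf_closed)

end

definition prod_group :: "'i set \<Rightarrow> ('i \<Rightarrow> ('a, 'b) ogroup_scheme) \<Rightarrow> ('i \<Rightarrow> 'a) ogroup" where
  "prod_group I F =
     \<lparr>carrier = (\<Pi>\<^sub>E i\<in>I. carrier (F i)), monoid.mult = undefined, one = undefined,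
      zero = (\<lambda>i\<in>I. \<zero>\<^bsub>F i\<^esub>), add = (\<lambda>x y. \<lambda>i\<in>I. x i \<oplus>\<^bsub>F i\<^esub> y i),
      leq = (\<lambda>x y. \<forall>i\<in>I. x i \<preceq>\<^bsub>F i\<^esub> y i)\<rparr>"

lemma prod_group_simps:
  "carrier (prod_group I F) = (\<Pi>\<^sub>E i\<in>I. carrier (F i))"
  "\<zero>\<^bsub>prod_group I F\<^esub> = (\<lambda>i\<in>I. \<zero>\<^bsub>F i\<^esub>)"
  "x \<oplus>\<^bsub>prod_group I F\<^esub> y = (\<lambda>i\<in>I. x i \<oplus>\<^bsub>F i\<^esub> y i)"
  "x \<preceq>\<^bsub>prod_group I F\<^esub> y \<longleftrightarrow> (\<forall>i\<in>I. x i \<preceq>\<^bsub>F i\<^esub> y i)"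
  by (simp_all add: prod_group_def)

context
  fixes I :: "'i set" and F :: "'i \<Rightarrow> ('a, 'b) ogroup_scheme"
  assumes lg: "\<And>i. i \<in> I \<Longrightarrow> l_group (F i)"
begin

lemma lgroup_factor: "i \<in> I \<Longrightarrow> lgroup (F i)"
  using lg by (simp add: lgroup_def)

lemma abelian_group_factor: "i \<in> I \<Longrightarrow> abelian_group (F i)"
  using lg by (simp add: l_group_def)

lemma prod_group_abelian_group: "abelian_group (prod_group I F)"
proof (rule abelian_groupI)
  fix x assume x: "x \<in> carrier (prod_group I F)"
  then show "\<exists>y\<in>carrier (prod_group I F). y \<oplus>\<^bsub>prod_group I F\<^esub> x = \<zero>\<^bsub>prod_group I F\<^esub>"
    by (intro bexI[of _ "\<lambda>i\<in>I. \<ominus>\<^bsub>F i\<^esub> x i"])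
       (auto simp: prod_group_simps PiE_iff abelian_group.l_neg[OF abelian_group_factor]
          abelian_group.a_inv_closed[OF abelian_group_factor])
next
  fix x y assume "x \<in> carrier (prod_group I F)" "y \<in> carrier (prod_group I F)"
  then show "x \<oplus>\<^bsub>prod_group I F\<^esub> y = y \<oplus>\<^bsub>prod_group I F\<^esub> x"
    by (auto simp: prod_group_simps PiE_iff intro!: restrict_ext
        abelian_groupE(4)[OF abelian_group_factor])
qed (auto simp: prod_group_simps PiE_iff fun_eq_iff restrict_def extensional_def
      abelian_groupE(1,2,3,5)[OF abelian_group_factor])

lemma prod_group_l_group: "l_group (prod_group I F)"
proof (rule l_groupI[OF prod_group_abelian_group])
  fix x y assume "x \<in> carrier (prod_group I F)" "y \<in> carrier (prod_group I F)"
  then show "\<exists>s\<in>carrier (prod_group I F). x \<preceq>\<^bsub>prod_group I F\<^esub> s \<and> y \<preceq>\<^bsub>prod_group I F\<^esub> s \<and>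
     (\<forall>z\<in>carrier (prod_group I F). x \<preceq>\<^bsub>prod_group I F\<^esub> z \<and> y \<preceq>\<^bsub>prod_group I F\<^esub> z
       \<longrightarrow> s \<preceq>\<^bsub>prod_group I F\<^esub> z)"
    by (intro bexI[of _ "\<lambda>i\<in>I. x i \<squnion>\<^bsub>F i\<^esub> y i"])
       (auto simp: prod_group_simps PiE_iff intro!: lgroup.sup_ge1[OF lgroup_factor]
          lgroup.sup_ge2[OF lgroup_factor] lgroup.sup_least[OF lgroup_factor]
          lgroup.sup_closed[OF lgroup_factor])
next
  fix x y assume x: "x \<in> carrier (prod_group I F)" and y: "y \<in> carrier (prod_group I F)"
    and "x \<preceq>\<^bsub>prod_group I F\<^esub> y" "y \<preceq>\<^bsub>prod_group I F\<^esub> x"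
  then have "x i = y i" if "i \<in> I" for i
    using lgroup.leq_antisym[OF lgroup_factor[OF that], of "x i" "y i"] that
    by (auto simp: prod_group_simps PiE_iff)
  with x y show "x = y"
    by (auto simp: prod_group_simps intro: PiE_ext)
next
  fix x y z assume "x \<in> carrier (prod_group I F)" "y \<in> carrier (prod_group I F)"
    "z \<in> carrier (prod_group I F)" "x \<preceq>\<^bsub>prod_group I F\<^esub> y" "y \<preceq>\<^bsub>prod_group I F\<^esub> z"
  then show "x \<preceq>\<^bsub>prod_group I F\<^esub> z"
    unfolding prod_group_simps PiE_iff by (meson lgroup.leq_trans lgroup_factor)
qed (auto simp: prod_group_simps PiE_iff lgroup.add_leq_cancel_right[OF lgroup_factor]
      lgroup.leq_refl[OF lgroup_factor])

lemma prod_group_sup: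
  assumes "x \<in> carrier (prod_group I F)" "y \<in> carrier (prod_group I F)"
  shows "x \<squnion>\<^bsub>prod_group I F\<^esub> y = (\<lambda>i\<in>I. x i \<squnion>\<^bsub>F i\<^esub> y i)"
proof -
  interpret Q: lgroup "prod_group I F"
    by (simp add: lgroup_def prod_group_l_group)
  show ?thesis
    by (rule Q.sup_eqI)
       (use assms in \<open>auto simp: prod_group_simps PiE_iff lgroup.sup_leq_iff[OF lgroup_factor]
          lgroup.sup_closed[OF lgroup_factor]\<close>)
qed

lemma prod_group_projection: "i \<in> I \<Longrightarrow> (\<lambda>x\<in>carrier (prod_group I F). x i) \<in> l_hom (prod_group I F) (F i)"
proof (rule l_hom_supI[OF prod_group_l_group])
  interpret Q: lgroup "prod_group I F"
    by (simp add: lgroup_def prod_group_l_group)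
  assume i: "i \<in> I"
  show "l_group (F i)" using i by (rule lg)
  fix x y assume "x \<in> carrier (prod_group I F)" "y \<in> carrier (prod_group I F)"
  then show "(\<lambda>x\<in>carrier (prod_group I F). x i) (x \<oplus>\<^bsub>prod_group I F\<^esub> y) =
      (\<lambda>x\<in>carrier (prod_group I F). x i) x \<oplus>\<^bsub>F i\<^esub> (\<lambda>x\<in>carrier (prod_group I F). x i) y"
    "(\<lambda>x\<in>carrier (prod_group I F). x i) (x \<squnion>\<^bsub>prod_group I F\<^esub> y) =
      (\<lambda>x\<in>carrier (prod_group I F). x i) x \<squnion>\<^bsub>F i\<^esub> (\<lambda>x\<in>carrier (prod_group I F). x i) y"
    using i Q.a_closed[of x y] Q.sup_closed[of x y] by (simp_all add: prod_group_simps(3) prod_group_sup)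
qed (auto simp: prod_group_simps)

lemma prod_group_archimedean:
  assumes "\<And>i. i \<in> I \<Longrightarrow> archimedean (F i)"
  shows "archimedean (prod_group I F)"
  unfolding archimedean_def
proof (intro ballI impI)
  interpret Q: lgroup "prod_group I F"
    by (simp add: lgroup_def prod_group_l_group)
  fix x y assume xy: "x \<in> carrier (prod_group I F)" "y \<in> carrier (prod_group I F)"
    and h: "\<zero>\<^bsub>prod_group I F\<^esub> \<preceq>\<^bsub>prod_group I F\<^esub> x \<and>
      (\<forall>n::nat. [n] \<cdot>\<^bsub>prod_group I F\<^esub> x \<preceq>\<^bsub>prod_group I F\<^esub> y)"
  have ns: "([(n::nat)] \<cdot>\<^bsub>prod_group I F\<^esub> x) i = [n] \<cdot>\<^bsub>F i\<^esub> x i" if i: "i \<in> I" for n i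
  proof -
    interpret p: lgroup_hom "prod_group I F" "F i" "\<lambda>x\<in>carrier (prod_group I F). x i"
      using i by (simp add: lgroup_hom_def lgroup_hom_axioms_def lgroup_factor Q.lgroup_axioms
          prod_group_projection)
    show ?thesis using p.nsmul[OF xy(1)] xy(1) by simp
  qed
  have "x i = \<zero>\<^bsub>F i\<^esub>" if i: "i \<in> I" for i
  proof -
    have "\<zero>\<^bsub>F i\<^esub> \<preceq>\<^bsub>F i\<^esub> x i" using h i by (simp add: prod_group_simps)
    moreover have "[n] \<cdot>\<^bsub>F i\<^esub> x i \<preceq>\<^bsub>F i\<^esub> y i" for n :: nat
    proof -
      have "[n] \<cdot>\<^bsub>prod_group I F\<^esub> x \<preceq>\<^bsub>prod_group I F\<^esub> y" using h by blast
      then show ?thesis using i by (simp add: prod_group_simps(4) ns)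
    qed
    moreover have "x i \<in> carrier (F i)" "y i \<in> carrier (F i)"
      using xy i by (auto simp: prod_group_simps)
    ultimately show ?thesis using assms[OF i] by (auto simp: archimedean_def)
  qed
  then show "x = \<zero>\<^bsub>prod_group I F\<^esub>"
    using xy by (auto simp: prod_group_simps PiE_iff fun_eq_iff restrict_def extensional_def)
qed

end

section \<open>Arithmetic of MV-algebras\<close>

locale mv =
  fixes A :: "('a, 'b) mv_scheme"
  assumes mv_algebra: "mv_algebra A"
begin

abbreviation "M \<equiv> carrier A"
abbreviation oplus (infixl "\<boxplus>" 65) where "x \<boxplus> y \<equiv> mv_add A x y"
abbreviation compl ("\<sim>_" [81] 80) where "\<sim>x \<equiv> mv_neg A x"
abbreviation zero ("\<^bold>0") where "\<^bold>0 \<equiv> mv_zero A"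
abbreviation one ("\<^bold>1") where "\<^bold>1 \<equiv> mv_one A"
abbreviation le (infix "\<unlhd>" 50) where "x \<unlhd> y \<equiv> mv_le A x y"
abbreviation summable where "summable x y \<equiv> mv_summable A x y"
text \<open>The truncated difference and the infimum: in \<open>\<Gamma>(G, u)\<close> they are \<open>(x - y) \<squnion> 0\<close> and \<open>x \<sqinter> y\<close>.\<close>

definition minus (infixl "\<boxminus>" 65) where "x \<boxminus> y = \<sim>(\<sim>x \<boxplus> y)"
definition meet (infixl "\<triangle>" 70) where "x \<triangle> y = x \<boxminus> (x \<boxminus> y)"

lemma closed [simp]: "\<^bold>0 \<in> M" "x \<in> M \<Longrightarrow> \<sim>x \<in> M" "x \<in> M \<Longrightarrow> y \<in> M \<Longrightarrow> x \<boxplus> y \<in> M"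
  using mv_algebra by (simp_all add: mv_algebra_def)

lemma derived_closed [simp]: "\<^bold>1 \<in> M" "x \<in> M \<Longrightarrow> y \<in> M \<Longrightarrow> x \<boxminus> y \<in> M"
  "x \<in> M \<Longrightarrow> y \<in> M \<Longrightarrow> x \<triangle> y \<in> M"
  by (simp_all add: minus_def meet_def mv_one_def)

lemma add_comm: "x \<in> M \<Longrightarrow> y \<in> M \<Longrightarrow> x \<boxplus> y = y \<boxplus> x"
  and add_assoc: "x \<in> M \<Longrightarrow> y \<in> M \<Longrightarrow> z \<in> M \<Longrightarrow> (x \<boxplus> y) \<boxplus> z = x \<boxplus> (y \<boxplus> z)"
  and add_zero [simp]: "x \<in> M \<Longrightarrow> x \<boxplus> \<^bold>0 = x"
  and compl_compl [simp]: "x \<in> M \<Longrightarrow> \<sim>(\<sim>x) = x"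
  and add_one [simp]: "x \<in> M \<Longrightarrow> x \<boxplus> \<^bold>1 = \<^bold>1"
  and sup_axiom: "x \<in> M \<Longrightarrow> y \<in> M \<Longrightarrow> \<sim>(\<sim>x \<boxplus> y) \<boxplus> y = \<sim>(\<sim>y \<boxplus> x) \<boxplus> x"
  using mv_algebra unfolding mv_algebra_def by blast+

lemma zero_add [simp]: "x \<in> M \<Longrightarrow> \<^bold>0 \<boxplus> x = x"
  and one_add [simp]: "x \<in> M \<Longrightarrow> \<^bold>1 \<boxplus> x = \<^bold>1"
  using add_comm[of x "\<^bold>0"] add_comm[of x "\<^bold>1"] by simp_all

lemma add_lcomm: "x \<in> M \<Longrightarrow> y \<in> M \<Longrightarrow> z \<in> M \<Longrightarrow> x \<boxplus> (y \<boxplus> z) = y \<boxplus> (x \<boxplus> z)"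
  by (metis add_assoc add_comm)

lemmas add_ac = add_assoc add_comm add_lcomm

lemma compl_zero [simp]: "\<sim>\<^bold>0 = \<^bold>1" and compl_one [simp]: "\<sim>\<^bold>1 = \<^bold>0"
  by (simp_all add: mv_one_def)

lemma compl_add [simp]: "x \<in> M \<Longrightarrow> \<sim>x \<boxplus> x = \<^bold>1" "x \<in> M \<Longrightarrow> x \<boxplus> \<sim>x = \<^bold>1"
  using sup_axiom[of x "\<^bold>1"] add_comm[of x "\<sim>x"] by simp_all

lemma le_iff: "x \<unlhd> y \<longleftrightarrow> \<sim>x \<boxplus> y = \<^bold>1"
  by (simp add: mv_le_def)

lemma summable_iff: "summable x y \<longleftrightarrow> \<sim>x \<boxplus> \<sim>y = \<^bold>1"
  by (simp add: mv_summable_def mv_le_def)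

lemma summable_sym: "x \<in> M \<Longrightarrow> y \<in> M \<Longrightarrow> summable x y \<longleftrightarrow> summable y x"
  using add_comm[of "\<sim>x" "\<sim>y"] by (simp add: summable_iff)

lemma le_refl [simp]: "x \<in> M \<Longrightarrow> x \<unlhd> x"
  by (simp add: le_iff)

lemma le_antisym: "x \<unlhd> y \<Longrightarrow> y \<unlhd> x \<Longrightarrow> x \<in> M \<Longrightarrow> y \<in> M \<Longrightarrow> x = y"
  using sup_axiom[of x y] by (simp add: le_iff)

lemma zero_le [simp]: "x \<in> M \<Longrightarrow> \<^bold>0 \<unlhd> x" and le_one [simp]: "x \<in> M \<Longrightarrow> x \<unlhd> \<^bold>1"
  by (simp_all add: le_iff)

lemma add_minus: "x \<unlhd> y \<Longrightarrow> x \<in> M \<Longrightarrow> y \<in> M \<Longrightarrow> x \<boxplus> (y \<boxminus> x) = y"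
  using sup_axiom[of x y] add_comm[of "y \<boxminus> x" x] by (simp add: le_iff minus_def)

lemma le_add: "x \<in> M \<Longrightarrow> y \<in> M \<Longrightarrow> x \<unlhd> x \<boxplus> y" "x \<in> M \<Longrightarrow> y \<in> M \<Longrightarrow> x \<unlhd> y \<boxplus> x"
  using add_assoc[of "\<sim>x" x y] add_comm[of x y] by (simp_all add: le_iff)

lemma le_trans: "x \<unlhd> y \<Longrightarrow> y \<unlhd> z \<Longrightarrow> x \<in> M \<Longrightarrow> y \<in> M \<Longrightarrow> z \<in> M \<Longrightarrow> x \<unlhd> z"
  using le_add(1)[of x "(y \<boxminus> x) \<boxplus> (z \<boxminus> y)"] add_minus[of x y] add_minus[of y z]
    add_assoc[of x "y \<boxminus> x" "z \<boxminus> y"] by simp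

lemma add_mono_right: "x \<unlhd> y \<Longrightarrow> x \<in> M \<Longrightarrow> y \<in> M \<Longrightarrow> z \<in> M \<Longrightarrow> z \<boxplus> x \<unlhd> z \<boxplus> y"
  using le_add(1)[of "z \<boxplus> x" "y \<boxminus> x"] add_minus[of x y] add_assoc[of z x "y \<boxminus> x"] by simp

lemma compl_le: "x \<in> M \<Longrightarrow> y \<in> M \<Longrightarrow> \<sim>y \<unlhd> \<sim>x \<longleftrightarrow> x \<unlhd> y"
  using add_comm[of y "\<sim>x"] by (simp add: le_iff)

lemma minus_le_iff: "x \<in> M \<Longrightarrow> y \<in> M \<Longrightarrow> z \<in> M \<Longrightarrow> x \<boxminus> y \<unlhd> z \<longleftrightarrow> x \<unlhd> y \<boxplus> z"
  by (simp add: le_iff minus_def add_assoc)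

lemma minus_le: "x \<in> M \<Longrightarrow> y \<in> M \<Longrightarrow> x \<boxminus> y \<unlhd> x"
  by (simp add: minus_le_iff le_add)

lemma minus_mono_left: "x \<unlhd> y \<Longrightarrow> x \<in> M \<Longrightarrow> y \<in> M \<Longrightarrow> z \<in> M \<Longrightarrow> x \<boxminus> z \<unlhd> y \<boxminus> z"
  unfolding minus_def using compl_le[of "\<sim>y \<boxplus> z" "\<sim>x \<boxplus> z"] compl_le[of x y]
    add_mono_right[of "\<sim>y" "\<sim>x" z] add_comm[of z "\<sim>x"] add_comm[of z "\<sim>y"] by simp

lemma minus_mono_right: "x \<unlhd> y \<Longrightarrow> x \<in> M \<Longrightarrow> y \<in> M \<Longrightarrow> z \<in> M \<Longrightarrow> z \<boxminus> y \<unlhd> z \<boxminus> x"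
  unfolding minus_def using compl_le[of "\<sim>z \<boxplus> x" "\<sim>z \<boxplus> y"] add_mono_right[of x y "\<sim>z"] by simp

lemma minus_zero [simp]: "x \<in> M \<Longrightarrow> x \<boxminus> \<^bold>0 = x"
  by (simp add: minus_def)

lemma minus_eq_zero: "x \<unlhd> y \<Longrightarrow> x \<boxminus> y = \<^bold>0"
  by (simp add: le_iff minus_def)

lemma summable_minus: "x \<in> M \<Longrightarrow> y \<in> M \<Longrightarrow> summable x (y \<boxminus> x)"
  using add_lcomm[of "\<sim>x" "\<sim>y" x] by (simp add: summable_iff minus_def)

lemma add_minus_cancel: "summable x y \<Longrightarrow> x \<in> M \<Longrightarrow> y \<in> M \<Longrightarrow> (x \<boxplus> y) \<boxminus> x = y"
proof -
  assume "summable x y" and M: "x \<in> M" "y \<in> M"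
  then have "\<sim>(x \<boxplus> y) \<boxplus> x = \<sim>y"
    using sup_axiom[of x "\<sim>y"] add_comm[of x y] by (simp add: summable_iff)
  then show ?thesis using M by (simp add: minus_def)
qed

lemma add_cancel:
  "x \<boxplus> y = x \<boxplus> z \<Longrightarrow> summable x y \<Longrightarrow> summable x z \<Longrightarrow> x \<in> M \<Longrightarrow> y \<in> M \<Longrightarrow> z \<in> M \<Longrightarrow> y = z"
  by (metis add_minus_cancel)

lemma summable_mono: "summable x y \<Longrightarrow> x' \<unlhd> x \<Longrightarrow> x \<in> M \<Longrightarrow> x' \<in> M \<Longrightarrow> y \<in> M \<Longrightarrow> summable x' y"
  unfolding mv_summable_def using le_trans[of x' x "\<sim>y"] by simp

text \<open>The partial sum is associative: here and in \<open>summable_assoc'\<close>, one bracketing of three summands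
  is defined if the other is.\<close>

lemma summable_assoc:
  assumes "summable x y" "summable (x \<boxplus> y) z" "x \<in> M" "y \<in> M" "z \<in> M"
  shows "summable y z" "summable x (y \<boxplus> z)"
proof -
  show "summable y z" using summable_mono[OF assms(2), of y] assms le_add by simp
  have "(y \<boxplus> x) \<boxminus> y \<unlhd> \<sim>z \<boxminus> y"
    using assms minus_mono_left[of "y \<boxplus> x" "\<sim>z" y] by (simp add: mv_summable_def add_comm)
  then have "x \<unlhd> \<sim>z \<boxminus> y"
    using assms add_minus_cancel[of y x] by (simp add: summable_sym)
  then show "summable x (y \<boxplus> z)"
    using assms by (simp add: mv_summable_def minus_def add_comm)
qed

lemma summable_assoc':
  assumes "summable y z" "summable x (y \<boxplus> z)" "x \<in> M" "y \<in> M" "z \<in> M"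
  shows "summable x y" "summable (x \<boxplus> y) z"
proof -
  have "summable z y" "summable (z \<boxplus> y) x"
    using assms add_comm[of z y] summable_sym[of z y] summable_sym[of "y \<boxplus> z" x] by simp_all
  from summable_assoc[OF this] show "summable x y" "summable (x \<boxplus> y) z"
    using assms add_comm[of x y] summable_sym[of x y] summable_sym[of z "y \<boxplus> x"] by simp_all
qed

lemma meet_comm: "x \<in> M \<Longrightarrow> y \<in> M \<Longrightarrow> x \<triangle> y = y \<triangle> x"
  using sup_axiom[of "\<sim>x" "\<sim>y"]
  by (simp add: meet_def minus_def add_comm)

lemma meet_greatest:
  assumes "z \<unlhd> x" "z \<unlhd> y" "x \<in> M" "y \<in> M" "z \<in> M"
  shows "z \<unlhd> x \<triangle> y"
proof -
  have "z = z \<triangle> x" using assms by (simp add: meet_def minus_eq_zero)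
  also have "\<dots> = x \<boxminus> (x \<boxminus> z)" using assms meet_comm[of z x] by (simp add: meet_def)
  finally have "z = x \<boxminus> (x \<boxminus> z)" .
  moreover have "x \<boxminus> (x \<boxminus> z) \<unlhd> x \<boxminus> (x \<boxminus> y)"
    using assms by (intro minus_mono_right) auto
  ultimately show ?thesis by (simp add: meet_def)
qed

lemma meet_add_minus: "x \<in> M \<Longrightarrow> y \<in> M \<Longrightarrow> x \<triangle> y \<boxplus> (x \<boxminus> y) = x"
  and summable_meet_minus: "x \<in> M \<Longrightarrow> y \<in> M \<Longrightarrow> summable (x \<triangle> y) (x \<boxminus> y)"
  using add_minus[of "x \<boxminus> y" x] add_comm[of "x \<triangle> y" "x \<boxminus> y"] minus_le[of x y]
    summable_minus[of "x \<boxminus> y" x] summable_sym[of "x \<triangle> y" "x \<boxminus> y"]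
  by (simp_all add: meet_def)

text \<open>As \<open>x \<boxminus> y\<close> and \<open>y \<boxminus> x\<close> are the complements of \<open>x \<triangle> y\<close> in \<open>x\<close> and in \<open>y\<close>, the sum of \<open>x \<triangle> y\<close>
  and \<open>d\<close> is still below both \<open>x\<close> and \<open>y\<close>, that is, below \<open>x \<triangle> y\<close>.\<close>

lemma minus_disjoint:
  assumes "d \<unlhd> x \<boxminus> y" "d \<unlhd> y \<boxminus> x" "x \<in> M" "y \<in> M" "d \<in> M"
  shows "d = \<^bold>0"
proof -
  let ?m = "x \<triangle> y"
  have "?m \<boxplus> d \<unlhd> x"
    using add_mono_right[OF assms(1), of ?m] meet_add_minus[of x y] assms by simp
  moreover have "?m \<boxplus> d \<unlhd> y"
    using add_mono_right[OF assms(2), of ?m] meet_add_minus[of y x] meet_comm[of x y] assms by simp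
  ultimately have "?m \<boxplus> d \<unlhd> ?m" using assms by (simp add: meet_greatest)
  then have "?m \<boxplus> d = ?m \<boxplus> \<^bold>0" using assms le_add(1)[of ?m d] le_antisym[of "?m \<boxplus> d" ?m] by simp
  moreover have "summable ?m d"
    using summable_mono[of "x \<boxminus> y" ?m d] summable_meet_minus[of x y] assms
      summable_sym[of ?m "x \<boxminus> y"] summable_sym[of ?m d] by simp
  moreover have "summable ?m \<^bold>0" using assms by (simp add: summable_iff)
  ultimately show ?thesis using add_cancel[of ?m d "\<^bold>0"] assms by simp
qed

section \<open>Refinement of formal sums\<close>

text \<open>A relation, because the partial sum of a multiset need not be defined.\<close>

inductive psum :: "'a multiset \<Rightarrow> 'a \<Rightarrow> bool" where
  empty: "psum {#} \<^bold>0"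
| add: "\<lbrakk>psum D s; a \<in> M; summable s a\<rbrakk> \<Longrightarrow> psum (add_mset a D) (s \<boxplus> a)"

lemma psum_closed: "psum D s \<Longrightarrow> s \<in> M \<and> set_mset D \<subseteq> M"
  by (induct rule: psum.induct) auto

lemma psum_single: "a \<in> M \<Longrightarrow> psum {#a#} a"
  using psum.add[OF psum.empty, of a] by (simp add: summable_iff)

text \<open>Associativity of the partial sum allows any summand to be moved to the last place.\<close>

lemma psum_addD:
  assumes "psum (add_mset a D) s"
  shows "a \<in> M \<and> (\<exists>t. psum D t \<and> summable t a \<and> s = t \<boxplus> a)"
  using assms
proof (induct "add_mset a D" s arbitrary: D rule: psum.induct)
  case (add E s b)
  show ?case
  proof (cases "a = b")
    case True
    then show ?thesis using add by auto
  next
    case False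
    with add(5) obtain F where F: "E = add_mset a F" "D = add_mset b F"
      by (auto simp: add_eq_conv_ex)
    with add(2) obtain t where t: "psum F t" "summable t a" "s = t \<boxplus> a" and a: "a \<in> M" by blast
    have tM: "t \<in> M" using psum_closed[OF t(1)] by simp
    have s: "summable a b" "summable t (a \<boxplus> b)"
      using summable_assoc[of t a b] add(4) t tM a add(3) by simp_all
    then have "summable t b" "summable (t \<boxplus> b) a"
      using summable_assoc'[of b a t] tM a add(3) by (simp_all add: summable_sym[of a b] add_comm)
    moreover have "s \<boxplus> b = (t \<boxplus> b) \<boxplus> a" using t(3) tM a add(3) by (simp add: add_ac)
    ultimately show ?thesis using psum.add[OF t(1) add(3)] F a by auto
  qed
qed simp

lemma psum_emptyD: "psum {#} s \<Longrightarrow> s = \<^bold>0"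
  by (cases rule: psum.cases) auto

lemma psum_unique: "psum D s \<Longrightarrow> psum D t \<Longrightarrow> s = t"
proof (induct D arbitrary: s t)
  case empty
  then show ?case by (auto dest: psum_emptyD)
next
  case (add a D)
  then show ?case by (metis psum_addD)
qed

lemma psum_union:
  "\<lbrakk>psum D d; psum E e; summable d e\<rbrakk> \<Longrightarrow> psum (D + E) (d \<boxplus> e)"
proof (induct E arbitrary: e)
  case empty
  then show ?case using psum_closed[OF empty(1)] by (auto dest: psum_emptyD)
next
  case (add a E)
  from psum_addD[OF add(3)] obtain t where t: "psum E t" "summable t a" "e = t \<boxplus> a" "a \<in> M" by blast
  have M: "d \<in> M" "t \<in> M" using psum_closed[OF add(2)] psum_closed[OF t(1)] by auto
  have "summable d t" "summable (d \<boxplus> t) a"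
    using summable_assoc'[of t a d] add(4) t M by simp_all
  with add(1)[OF add(2) t(1)] t show ?case
    using psum.add[of "D + E" "d \<boxplus> t" a] M by (simp add: add_assoc)
qed

lemma psum_unionD:
  "psum (D + E) s \<Longrightarrow> \<exists>d e. psum D d \<and> psum E e \<and> summable d e \<and> s = d \<boxplus> e"
proof (induct E arbitrary: s)
  case empty
  then show ?case using psum.empty psum_closed[of D s]
    by (intro exI[of _ s] exI[of _ "\<^bold>0"]) (auto simp: summable_iff)
next
  case (add a E)
  from psum_addD[of a "D + E" s] add(2) obtain t where
    t: "psum (D + E) t" "summable t a" "s = t \<boxplus> a" and a: "a \<in> M" by auto
  from add(1)[OF t(1)] obtain d e where de: "psum D d" "psum E e" "summable d e" "t = d \<boxplus> e" by blast
  have M: "d \<in> M" "e \<in> M" using psum_closed[OF de(1)] psum_closed[OF de(2)] by auto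
  have "summable e a" "summable d (e \<boxplus> a)" using summable_assoc[of d e a] de t a M by simp_all
  then show ?case
    using psum.add[OF de(2) a] de(1) t de a M by (auto simp: add_assoc)
qed

text \<open>Every element of the multiset on the left is split into summands, which are collected on the
  right.\<close>

inductive refines (infix "\<Rrightarrow>" 50) where
  empty: "{#} \<Rrightarrow> {#}"
| add: "\<lbrakk>B \<Rrightarrow> C; psum D a\<rbrakk> \<Longrightarrow> add_mset a B \<Rrightarrow> C + D"

lemma refines_closed: "B \<Rrightarrow> C \<Longrightarrow> set_mset B \<subseteq> M \<and> set_mset C \<subseteq> M"
  by (induct rule: refines.induct) (auto dest: psum_closed)

lemma refines_addD:
  assumes "add_mset a B \<Rrightarrow> C"
  shows "\<exists>C' D. C = C' + D \<and> B \<Rrightarrow> C' \<and> psum D a"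
  using assms
proof (induct "add_mset a B" C arbitrary: B rule: refines.induct)
  case (add E C D b)
  show ?case
  proof (cases "a = b")
    case True
    then show ?thesis using add by auto
  next
    case False
    with add(4) obtain F where F: "E = add_mset a F" "B = add_mset b F"
      by (auto simp: add_eq_conv_ex)
    with add(2) obtain C' D' where C: "C = C' + D'" "F \<Rrightarrow> C'" "psum D' a" by blast
    then have "B \<Rrightarrow> C' + D" using refines.add[OF C(2) add(3)] F by simp
    then show ?thesis using C by (intro exI[of _ "C' + D"] exI[of _ D']) (auto simp: ac_simps)
  qed
qed simp

lemma refines_emptyD: "{#} \<Rrightarrow> C \<Longrightarrow> C = {#}"
  by (auto elim: refines.cases)

lemma refines_refl: "set_mset B \<subseteq> M \<Longrightarrow> B \<Rrightarrow> B"
proof (induct B)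
  case (add a B)
  then show ?case using refines.add[of B B "{#a#}" a] psum_single by simp
qed (rule refines.empty)

lemma refines_union: "B \<Rrightarrow> C \<Longrightarrow> B' \<Rrightarrow> C' \<Longrightarrow> B + B' \<Rrightarrow> C + C'"
proof (induct rule: refines.induct)
  case (add B C D a)
  then show ?case using refines.add[of "B + B'" "C + C'" D a] by (simp add: ac_simps)
qed simp

lemma refines_unionD: "B + B' \<Rrightarrow> C \<Longrightarrow> \<exists>D D'. C = D + D' \<and> B \<Rrightarrow> D \<and> B' \<Rrightarrow> D'"
proof (induct B arbitrary: C)
  case empty
  then show ?case using refines.empty by (intro exI[of _ "{#}"] exI[of _ C]) auto
next
  case (add a B)
  then obtain C' E where "C = C' + E" "B + B' \<Rrightarrow> C'" "psum E a"
    using refines_addD[of a "B + B'" C] by auto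
  moreover from add(1)[OF this(2)] obtain D D' where "C' = D + D'" "B \<Rrightarrow> D" "B' \<Rrightarrow> D'" by blast
  ultimately show ?case
    using refines.add[of B D E a] by (intro exI[of _ "D + E"] exI[of _ D']) (auto simp: ac_simps)
qed

lemma refines_singleD: "{#a#} \<Rrightarrow> D \<Longrightarrow> psum D a"
  using refines_addD[of a "{#}" D] by (auto dest: refines_emptyD)

lemma refines_psum: "B \<Rrightarrow> C \<Longrightarrow> psum B s \<longleftrightarrow> psum C s"
proof (induct arbitrary: s rule: refines.induct)
  case (add B C D a)
  show ?case
  proof
    assume "psum (add_mset a B) s"
    then obtain t where "psum B t" "summable t a" "s = t \<boxplus> a" using psum_addD by blast
    then show "psum (C + D) s" using add psum_union by blast
  next
    assume "psum (C + D) s"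
    then obtain t d where "psum C t" "psum D d" "summable t d" "s = t \<boxplus> d" using psum_unionD by blast
    moreover from this have "d = a" using add(3) psum_unique by blast
    ultimately show "psum (add_mset a B) s"
      using add psum.add[of B t a] psum_closed[OF add(3)] by simp
  qed
qed simp

lemma refines_trans: "B \<Rrightarrow> C \<Longrightarrow> C \<Rrightarrow> D \<Longrightarrow> B \<Rrightarrow> D"
proof (induct arbitrary: D rule: refines.induct)
  case (add B C E a)
  from refines_unionD[OF add(4)] obtain D1 D2 where D: "D = D1 + D2" "C \<Rrightarrow> D1" "E \<Rrightarrow> D2" by blast
  then show ?case using refines.add[of B D1 D2 a] add refines_psum by auto
qed

text \<open>Riesz decomposition for partial sums: each summand \<open>b\<close> of \<open>E\<close> in turn is split into the part
  \<open>b \<triangle> a\<close>, which is taken off \<open>a\<close>, and the rest.\<close>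

lemma riesz_split:
  assumes "psum E s" "a \<unlhd> s" "a \<in> M"
  shows "\<exists>E1 E2. E \<Rrightarrow> E1 + E2 \<and> psum E1 a \<and> psum E2 (s \<boxminus> a)"
proof -
  have "\<exists>E1 E2. E \<Rrightarrow> E1 + E2 \<and> psum E1 a"
    using assms
  proof (induct arbitrary: a rule: psum.induct)
    case empty
    then have "a = \<^bold>0" by (simp add: le_antisym)
    then show ?case using refines.empty psum.empty by (intro exI[of _ "{#}"]) auto
  next
    case (add E s b)
    have sM: "s \<in> M" using psum_closed[OF add(1)] by simp
    have "a \<boxminus> b \<unlhd> s" using add sM by (simp add: minus_le_iff add_comm)
    moreover have "a \<boxminus> b \<in> M" using add by simp
    ultimately obtain E1 E2 where E: "E \<Rrightarrow> E1 + E2" "psum E1 (a \<boxminus> b)"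
      using add(2) by blast
    have b: "psum {#b \<triangle> a, b \<boxminus> a#} b"
      using psum_union[OF psum_single psum_single, of "b \<triangle> a" "b \<boxminus> a"] add
        summable_meet_minus[of b a] meet_add_minus[of b a] by (simp add: add_mset_commute)
    have "psum ({#a \<triangle> b#} + E1) (a \<triangle> b \<boxplus> (a \<boxminus> b))"
      using add E(2) by (intro psum_union psum_single summable_meet_minus) auto
    then have "psum (add_mset (b \<triangle> a) E1) a"
      using add meet_add_minus[of a b] meet_comm[of a b] by simp
    moreover have "add_mset b E \<Rrightarrow> add_mset (b \<triangle> a) E1 + add_mset (b \<boxminus> a) E2"
      using refines.add[OF E(1) b] by (simp add: add_mset_commute)
    ultimately show ?case by blast
  qed
  then obtain E1 E2 where E: "E \<Rrightarrow> E1 + E2" "psum E1 a" by blast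
  then have "psum (E1 + E2) s" using refines_psum assms(1) by blast
  then obtain d e where "psum E1 d" "psum E2 e" "summable d e" "s = d \<boxplus> e" using psum_unionD by blast
  then have "psum E2 (s \<boxminus> a)"
    using psum_unique[OF E(2)] add_minus_cancel psum_closed by metis
  then show ?thesis using E by blast
qed

text \<open>Having a common refinement. In the group constructed below this is equality of the sums.\<close>

definition eqv (infix "\<approx>" 50) where "B \<approx> C \<longleftrightarrow> (\<exists>D. B \<Rrightarrow> D \<and> C \<Rrightarrow> D)"

text \<open>Any summand \<open>a\<close> of the first decomposition is cut out of the second one by \<open>riesz_split\<close>; the
  remaining decompositions of the remaining element have a common refinement by induction.\<close>

lemma psum_eqv: "psum D s \<Longrightarrow> psum E s \<Longrightarrow> D \<approx> E"
proof (induct D arbitrary: E s)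
  case empty
  then have "s = \<^bold>0" by (auto dest: psum_emptyD)
  have "E \<Rrightarrow> {#}"
    using empty(2) unfolding \<open>s = \<^bold>0\<close>
  proof (induct E "\<^bold>0" rule: psum.induct)
    case (add D s a)
    then have "s \<in> M" using psum_closed by blast
    with add have "a = \<^bold>0" "s = \<^bold>0"
      using le_add[of s a] le_add[of a s] le_antisym[of a "\<^bold>0"] le_antisym[of s "\<^bold>0"] by (auto simp: add_comm)
    with add show ?case using refines.add[of D "{#}" "{#}" "\<^bold>0"] psum.empty by simp
  qed (rule refines.empty)
  then show ?case using refines.empty by (auto simp: eqv_def)
next
  case (add a D)
  from psum_addD[OF add(2)] obtain t where t: "psum D t" "summable t a" "s = t \<boxplus> a" "a \<in> M" by blast
  have tM: "t \<in> M" using psum_closed[OF t(1)] by simp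
  have "a \<unlhd> s" using le_add(2) t tM by simp
  from riesz_split[OF add(3) this t(4)] obtain E1 E2 where
    E: "E \<Rrightarrow> E1 + E2" "psum E1 a" "psum E2 (s \<boxminus> a)" by blast
  have "s \<boxminus> a = t" using t tM add_minus_cancel[of a t] by (simp add: add_comm summable_sym)
  with add(1)[OF t(1)] E(3) obtain F where F: "D \<Rrightarrow> F" "E2 \<Rrightarrow> F" by (auto simp: eqv_def)
  have "E1 + E2 \<Rrightarrow> E1 + F"
    using refines_union[OF refines_refl F(2), of E1] psum_closed[OF E(2)] by simp
  then have "E \<Rrightarrow> E1 + F" using E(1) refines_trans by blast
  moreover have "add_mset a D \<Rrightarrow> E1 + F" using refines.add[OF F(1) E(2)] by (simp add: ac_simps)
  ultimately show ?case by (auto simp: eqv_def)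
qed

lemma eqv_closed: "B \<approx> C \<Longrightarrow> set_mset B \<subseteq> M \<and> set_mset C \<subseteq> M"
  using refines_closed by (auto simp: eqv_def)

lemma eqv_sym: "B \<approx> C \<Longrightarrow> C \<approx> B"
  by (auto simp: eqv_def)

lemma eqv_refl: "set_mset B \<subseteq> M \<Longrightarrow> B \<approx> B"
  using refines_refl by (auto simp: eqv_def)

lemma eqv_union: "B \<approx> C \<Longrightarrow> B' \<approx> C' \<Longrightarrow> B + B' \<approx> C + C'"
  using refines_union by (fastforce simp: eqv_def)

text \<open>Each element of \<open>B\<close> is split in two ways, which have a common refinement by \<open>psum_eqv\<close>. Hence
  common refinement is a transitive relation.\<close>

lemma refines_diamond: "B \<Rrightarrow> C \<Longrightarrow> B \<Rrightarrow> D \<Longrightarrow> C \<approx> D"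
proof (induct arbitrary: D rule: refines.induct)
  case empty
  then show ?case using eqv_refl[of "{#}"] by (auto dest: refines_emptyD)
next
  case (add B C E a)
  from refines_addD[OF add(4)] obtain D' F where "D = D' + F" "B \<Rrightarrow> D'" "psum F a" by blast
  then show ?case using eqv_union add(2)[of D'] psum_eqv[OF add(3)] by blast
qed

lemma refines_eqv: "B \<Rrightarrow> C \<Longrightarrow> B \<approx> C"
  using refines_refl refines_closed by (auto simp: eqv_def)

lemma eqv_trans: "B \<approx> C \<Longrightarrow> C \<approx> D \<Longrightarrow> B \<approx> D"
proof -
  assume "B \<approx> C" "C \<approx> D"
  then obtain X Y where X: "B \<Rrightarrow> X" "C \<Rrightarrow> X" "C \<Rrightarrow> Y" "D \<Rrightarrow> Y" by (auto simp: eqv_def)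
  then obtain Z where "X \<Rrightarrow> Z" "Y \<Rrightarrow> Z" using refines_diamond[of C X Y] by (auto simp: eqv_def)
  with X show ?thesis using refines_trans by (auto simp: eqv_def)
qed

lemma eqv_psum: "B \<approx> C \<Longrightarrow> psum B s \<Longrightarrow> psum C s"
  using refines_psum by (auto simp: eqv_def)

text \<open>A multiset that is divided in two ways is divided into the four intersections; take \<open>P = B \<inter># D\<close>.\<close>

lemma union_refinement:
  assumes "B + C = D + (E :: 'a multiset)"
  shows "\<exists>P Q R S. B = P + Q \<and> C = R + S \<and> D = P + R \<and> E = Q + S"
proof (intro exI conjI)
  show "B = B \<inter># D + (B - D)" by (auto simp: multiset_eq_iff min_def)
  show "D = B \<inter># D + (D - B)" by (auto simp: multiset_eq_iff min_def)
  have eq: "count B x + count C x = count D x + count E x" for x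
    using arg_cong[OF assms, of "\<lambda>X. count X x"] by simp
  show "C = (D - B) + (C - (D - B))"
    unfolding multiset_eq_iff
  proof
    fix x show "count C x = count (D - B + (C - (D - B))) x" using eq[of x] by simp
  qed
  show "E = (B - D) + (C - (D - B))"
    unfolding multiset_eq_iff
  proof
    fix x show "count E x = count (B - D + (C - (D - B))) x" using eq[of x] by simp
  qed
qed

text \<open>In a common refinement of \<open>add_mset x B\<close> and \<open>add_mset x C\<close> the element \<open>x\<close> is represented twice,
  by \<open>R + S\<close> and by \<open>Q + S\<close>, where \<open>S\<close> is the common part. Cancellation in the MV-algebra makes the
  sums of \<open>R\<close> and \<open>Q\<close> equal, so these have a common refinement.\<close>

lemma eqv_cancel: "B + X \<approx> C + X \<Longrightarrow> B \<approx> C"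
proof (induct X)
  case (add x X)
  then obtain D where "add_mset x (B + X) \<Rrightarrow> D" "add_mset x (C + X) \<Rrightarrow> D" by (auto simp: eqv_def)
  then obtain D1 D2 E1 E2 where D: "D = D1 + D2" "B + X \<Rrightarrow> D1" "psum D2 x"
    and E: "D = E1 + E2" "C + X \<Rrightarrow> E1" "psum E2 x"
    using refines_addD by meson
  then obtain P Q R S where PQ: "D1 = P + Q" "D2 = R + S" "E1 = P + R" "E2 = Q + S"
    using union_refinement[of D1 D2 E1 E2] by auto
  from D(3) PQ obtain r s where r: "psum R r" "psum S s" "summable r s" "x = r \<boxplus> s"
    using psum_unionD by blast
  from E(3) PQ obtain q s' where q: "psum Q q" "psum S s'" "summable q s'" "x = q \<boxplus> s'"
    using psum_unionD by blast
  have M: "r \<in> M" "s \<in> M" "q \<in> M" using psum_closed r q by blast+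
  have "s' = s" using r q psum_unique by blast
  then have "q = r" using add_cancel[of s q r] r q M by (simp add: add_comm summable_sym)
  then have "Q \<approx> R" using psum_eqv r q by blast
  moreover have "P \<approx> P" using refines_closed[OF D(2)] PQ by (intro eqv_refl) auto
  ultimately have "D1 \<approx> E1" using PQ eqv_union by blast
  then have "B + X \<approx> C + X" using D(2) E(2) eqv_trans eqv_sym refines_eqv by blast
  then show ?case using add(1) by simp
qed simp

end

context mv
begin

text \<open>Calculations in the group of differences consist of such steps: add two equivalences, rearrange,
  and cancel \<open>X\<close>.\<close>

lemma eqv_combine:
  assumes "B \<approx> C" "B' \<approx> C'" "B + B' = D + X" "C + C' = E + X"
  shows "D \<approx> E"
  using eqv_cancel[of D X E] eqv_union[OF assms(1,2)] assms(3,4) by simp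

lemma psum_below: "psum D s \<Longrightarrow> d \<in># D \<Longrightarrow> d \<unlhd> s"
proof (induct rule: psum.induct)
  case (add D s a)
  then have "s \<in> M" using psum_closed by blast
  then show ?case
    using add le_add[of s a] le_add[of a s] le_trans[of d s "s \<boxplus> a"] psum_closed[OF add(1)] by auto
qed simp

lemma refines_below: "B \<Rrightarrow> C \<Longrightarrow> c \<in># C \<Longrightarrow> \<exists>b\<in>#B. c \<unlhd> b"
  by (induct rule: refines.induct) (auto dest: psum_below)

definition disjoint where "disjoint x y \<longleftrightarrow> (\<forall>d\<in>M. d \<unlhd> x \<longrightarrow> d \<unlhd> y \<longrightarrow> d = \<^bold>0)"

lemma disjoint_mono: "disjoint x y \<Longrightarrow> x' \<unlhd> x \<Longrightarrow> y' \<unlhd> y \<Longrightarrow>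
    x \<in> M \<Longrightarrow> y \<in> M \<Longrightarrow> x' \<in> M \<Longrightarrow> y' \<in> M \<Longrightarrow> disjoint x' y'"
  unfolding disjoint_def using le_trans by blast

lemma psum_pair: "summable x y \<Longrightarrow> x \<in> M \<Longrightarrow> y \<in> M \<Longrightarrow> psum {#x, y#} (x \<boxplus> y)"
  using psum_union[OF psum_single psum_single, of x y] by (simp add: add_mset_commute)

lemma eqv_meet_minus: "x \<in> M \<Longrightarrow> y \<in> M \<Longrightarrow> {#x#} \<approx> {#x \<triangle> y, x \<boxminus> y#}"
  using psum_eqv[OF psum_single psum_pair, of "x \<triangle> y" "x \<boxminus> y"] summable_meet_minus[of x y]
  by (simp add: meet_add_minus)

text \<open>The meets of \<open>a\<close> with the elements of \<open>B\<close> are moved to \<open>Z\<close> one after the other; what is left of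
  \<open>a\<close> is disjoint from what is left of \<open>B\<close>. The bounds in the conclusion keep remainders disjoint
  when they are cut further.\<close>

lemma cut_element:
  assumes "a \<in> M" "set_mset B \<subseteq> M"
  shows "\<exists>Z a' B'. {#a#} \<approx> add_mset a' Z \<and> B \<approx> Z + B' \<and> a' \<unlhd> a \<and> a' \<in> M \<and>
    (\<forall>b'\<in>#B'. disjoint a' b' \<and> (\<exists>b\<in>#B. b' \<unlhd> b))"
  using assms(2)
proof (induct B)
  case empty
  then show ?case
    using assms eqv_refl[of "{#a#}"] eqv_refl[of "{#}"]
    by (intro exI[of _ "{#}"] exI[of _ a]) auto
next
  case (add b B)
  then obtain Z a' B' where IH: "{#a#} \<approx> add_mset a' Z" "B \<approx> Z + B'" "a' \<unlhd> a" "a' \<in> M"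
    "\<forall>b'\<in>#B'. disjoint a' b' \<and> (\<exists>b\<in>#B. b' \<unlhd> b)" by auto
  have b: "b \<in> M" using add by simp
  have BM: "set_mset B \<subseteq> M" "set_mset B' \<subseteq> M" "set_mset Z \<subseteq> M"
    using eqv_closed[OF IH(2)] by auto
  let ?Z = "add_mset (a' \<triangle> b) Z" and ?a = "a' \<boxminus> b" and ?B = "add_mset (b \<boxminus> a') B'"
  have "{#a#} \<approx> add_mset ?a ?Z"
    using eqv_combine[OF IH(1) eqv_meet_minus[OF IH(4) b], of "{#a#}" "{#a'#}" "add_mset ?a ?Z"]
    by (simp add: add_mset_commute)
  moreover have "add_mset b B \<approx> ?Z + ?B"
    using eqv_union[OF IH(2) eqv_meet_minus[OF b IH(4)]] IH(4) b meet_comm[of a' b]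
    by (simp add: add_mset_commute)
  moreover have "?a \<unlhd> a'" using minus_le IH(4) b by simp
  moreover from this have "?a \<unlhd> a" using IH(3,4) b assms(1) le_trans[of ?a a' a] by simp
  moreover have "disjoint ?a (b \<boxminus> a')"
    unfolding disjoint_def using minus_disjoint IH(4) b by blast
  moreover have "b \<boxminus> a' \<unlhd> b" using minus_le IH(4) b by simp
  moreover have "disjoint ?a b'" if "b' \<in># B'" for b'
    using IH(5) that disjoint_mono[of a' b' ?a b'] \<open>?a \<unlhd> a'\<close> IH(4) b BM by auto
  ultimately show ?case
    using IH(4,5) b by (intro exI[of _ ?Z] exI[of _ ?a] exI[of _ ?B]) auto
qed

text \<open>The classes of \<open>B'\<close> and \<open>C'\<close> will be the positive and the negative part of the difference of \<open>B\<close>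
  and \<open>C\<close>.\<close>

lemma cut:
  assumes "set_mset B \<subseteq> M" "set_mset C \<subseteq> M"
  shows "\<exists>Z B' C'. B \<approx> Z + B' \<and> C \<approx> Z + C' \<and> (\<forall>b\<in>#B'. \<forall>c\<in>#C'. disjoint b c)"
  using assms(1)
proof (induct B)
  case empty
  then show ?case using eqv_refl[of "{#}"] eqv_refl[OF assms(2)]
    by (intro exI[of _ "{#}"] exI[of _ C]) auto
next
  case (add a B)
  then obtain Z B' C' where IH: "B \<approx> Z + B'" "C \<approx> Z + C'" "\<forall>b\<in>#B'. \<forall>c\<in>#C'. disjoint b c" by auto
  have BM: "set_mset C' \<subseteq> M" "set_mset B' \<subseteq> M" "set_mset Z \<subseteq> M"
    using eqv_closed[OF IH(1)] eqv_closed[OF IH(2)] by auto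
  from add have a: "a \<in> M" by simp
  from cut_element[OF a BM(1)] obtain Y a' C'' where
    Y: "{#a#} \<approx> add_mset a' Y" "C' \<approx> Y + C''" "a' \<unlhd> a" "a' \<in> M"
    "\<forall>c'\<in>#C''. disjoint a' c' \<and> (\<exists>c\<in>#C'. c' \<unlhd> c)" by blast
  have CM: "set_mset C'' \<subseteq> M" using eqv_closed[OF Y(2)] by auto
  have "add_mset a B \<approx> (Z + Y) + add_mset a' B'"
    using eqv_union[OF IH(1) Y(1)] by (simp add: ac_simps)
  moreover have "C \<approx> (Z + Y) + C''"
    using eqv_combine[OF IH(2) Y(2), of C C' "Z + Y + C''"] by (simp add: ac_simps)
  moreover have "disjoint b c" if "b \<in># B'" "c \<in># C''" for b c
  proof -
    from Y(5) that obtain c' where "c' \<in># C'" "c \<unlhd> c'" by blast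
    moreover from this that have "c' \<in> M" "b \<in> M" "c \<in> M" using BM CM by blast+
    ultimately show ?thesis
      using IH(3) that disjoint_mono[of b c' b c] by simp
  qed
  ultimately show ?case
    using Y(5) by (intro exI[of _ "Z + Y"] exI[of _ "add_mset a' B'"] exI[of _ C'']) auto
qed

lemma eqv_empty: "psum P \<^bold>0 \<Longrightarrow> P \<approx> {#}"
  using psum_eqv psum.empty by blast

text \<open>In a common refinement of both sides, an element that comes from both \<open>B\<close> and \<open>C\<close> lies below an
  element of each and so is zero. Hence \<open>B\<close> is accounted for by \<open>Y\<close> alone.\<close>

lemma disjoint_absorb:
  assumes "B + X \<approx> C + Y" "\<forall>b\<in>#B. \<forall>c\<in>#C. disjoint b c"
  shows "\<exists>S. Y \<approx> B + S"
proof -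
  from assms(1) obtain D where "B + X \<Rrightarrow> D" "C + Y \<Rrightarrow> D" by (auto simp: eqv_def)
  then obtain D1 D2 E1 E2 where D: "D = D1 + D2" "B \<Rrightarrow> D1" "X \<Rrightarrow> D2"
    and E: "D = E1 + E2" "C \<Rrightarrow> E1" "Y \<Rrightarrow> E2"
    using refines_unionD by meson
  then obtain P Q R S where PQ: "D1 = P + Q" "D2 = R + S" "E1 = P + R" "E2 = Q + S"
    using union_refinement[of D1 D2 E1 E2] by auto
  have PM: "set_mset P \<subseteq> M" "set_mset S \<subseteq> M"
    using refines_closed[OF D(2)] refines_closed[OF D(3)] PQ by auto
  have zero: "p = \<^bold>0" if "p \<in># P" for p
  proof -
    have "p \<in># D1" "p \<in># E1" using that PQ by simp_all
    then obtain b c where "b \<in># B" "p \<unlhd> b" "c \<in># C" "p \<unlhd> c"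
      using refines_below[OF D(2)] refines_below[OF E(2)] by blast
    then show ?thesis using assms(2) PM that unfolding disjoint_def by blast
  qed
  then have "psum P \<^bold>0"
  proof (induct P)
    case (add p P)
    then have "psum P \<^bold>0" "p = \<^bold>0" by simp_all
    then show ?case using psum.add[of P "\<^bold>0" "\<^bold>0"] by (simp add: summable_iff)
  qed (rule psum.empty)
  then have "Q \<approx> D1"
    using eqv_union[OF eqv_empty eqv_refl[of Q]] eqv_sym refines_closed[OF D(2)] PQ by auto
  then have "Q \<approx> B" using D(2) refines_eqv eqv_sym eqv_trans by blast
  then have "Y \<approx> B + S"
    using eqv_union[OF _ eqv_refl[OF PM(2)], of Q B] PQ E(3) refines_eqv eqv_trans by metis
  then show ?thesis ..
qed

section \<open>The lattice-ordered group of an MV-algebra\<close>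

text \<open>The class of the formal difference of \<open>B\<close> and \<open>C\<close>. Its members are pairs of lists,
  because \<^const>\<open>presentation_of\<close> requires a group on sets of such pairs.\<close>

definition cls :: "'a multiset \<Rightarrow> 'a multiset \<Rightarrow> ('a list \<times> 'a list) set" where
  "cls B C = {(bs, cs). mset bs + C \<approx> mset cs + B}"

text \<open>The positive cone consists of the classes of formal sums; in the definition of the order, \<open>F\<close>
  is the difference of the two sides.\<close>

definition chang_group :: "('a list \<times> 'a list) set ogroup" where
  "chang_group =
     \<lparr>carrier = {cls B C |B C. set_mset B \<subseteq> M \<and> set_mset C \<subseteq> M},
      monoid.mult = undefined, one = undefined, ring.zero = cls {#} {#},
      ring.add = (\<lambda>X Y. let (b, c) = (SOME p. p \<in> X); (d, e) = (SOME p. p \<in> Y)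
               in cls (mset b + mset d) (mset c + mset e)),
      leq = (\<lambda>X Y. \<exists>B C D E F. X = cls B C \<and> Y = cls D E \<and> B + E + F \<approx> D + C)\<rparr>"

abbreviation "msets \<equiv> {B. set_mset B \<subseteq> M}"

lemma cls_mem: "B \<in> msets \<Longrightarrow> C \<in> msets \<Longrightarrow> mset bs = B \<Longrightarrow> mset cs = C \<Longrightarrow> (bs, cs) \<in> cls B C"
  using eqv_refl[of "B + C"] by (simp add: cls_def add.commute)

lemma cls_eqI:
  assumes "B + E \<approx> D + C"
  shows "cls B C = cls D E"
proof -
  have "mset bs + E \<approx> mset cs + D" if "mset bs + C \<approx> mset cs + B" for bs cs
    using eqv_combine[OF that assms, of "mset bs + E" "C + B" "mset cs + D"] by (simp add: ac_simps)
  moreover have "mset bs + C \<approx> mset cs + B" if "mset bs + E \<approx> mset cs + D" for bs cs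
    using eqv_combine[OF that eqv_sym[OF assms], of "mset bs + C" "E + D" "mset cs + B"]
    by (simp add: ac_simps)
  ultimately show ?thesis by (auto simp: cls_def)
qed

lemma cls_eqD:
  assumes "cls B C = cls D E" "B \<in> msets" "C \<in> msets"
  shows "B + E \<approx> D + C"
proof -
  obtain bs cs where bc: "mset bs = B" "mset cs = C" using ex_mset by metis
  then have "(bs, cs) \<in> cls D E" using cls_mem[OF assms(2,3)] assms(1) by simp
  then show ?thesis using bc by (simp add: cls_def add.commute[of C D])
qed

lemma cls_carrier [simp]: "B \<in> msets \<Longrightarrow> C \<in> msets \<Longrightarrow> cls B C \<in> carrier chang_group"
  by (auto simp: chang_group_def)

lemma cls_cases:
  assumes "X \<in> carrier chang_group"
  obtains B C where "X = cls B C" "B \<in> msets" "C \<in> msets"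
  using assms by (auto simp: chang_group_def)

lemma cls_some:
  assumes "B \<in> msets" "C \<in> msets" "(SOME p. p \<in> cls B C) = (b, c)"
  shows "mset b + C \<approx> mset c + B"
proof -
  obtain bs cs where "mset bs = B" "mset cs = C" using ex_mset by metis
  then have "(bs, cs) \<in> cls B C" using cls_mem assms by blast
  then have "(SOME p. p \<in> cls B C) \<in> cls B C" by (rule someI)
  then show ?thesis using assms(3) by (simp add: cls_def)
qed

lemma cls_add:
  assumes "B \<in> msets" "C \<in> msets" "D \<in> msets" "E \<in> msets"
  shows "cls B C \<oplus>\<^bsub>chang_group\<^esub> cls D E = cls (B + D) (C + E)"
proof -
  obtain b c where bc: "(SOME p. p \<in> cls B C) = (b, c)" by fastforce
  obtain d e where de: "(SOME p. p \<in> cls D E) = (d, e)" by fastforce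
  have "cls (mset b + mset d) (mset c + mset e) = cls (B + D) (C + E)"
    using eqv_union[OF cls_some[OF assms(1,2) bc] cls_some[OF assms(3,4) de]]
    by (intro cls_eqI) (simp add: ac_simps)
  then show ?thesis by (simp add: chang_group_def bc de)
qed

lemma cls_leq:
  assumes "B \<in> msets" "C \<in> msets" "D \<in> msets" "E \<in> msets"
  shows "cls B C \<preceq>\<^bsub>chang_group\<^esub> cls D E \<longleftrightarrow> (\<exists>F. B + E + F \<approx> D + C)"
proof
  assume "cls B C \<preceq>\<^bsub>chang_group\<^esub> cls D E"
  then obtain B' C' D' E' F where eq: "cls B C = cls B' C'" "cls D E = cls D' E'"
    and le: "B' + E' + F \<approx> D' + C'" by (auto simp: chang_group_def)
  from cls_eqD[OF eq(1) assms(1,2)] eqv_sym[OF cls_eqD[OF eq(2) assms(3,4)]]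
  have "(B + C') + (D' + E) \<approx> (B' + C) + (D + E')" by (rule eqv_union)
  from eqv_combine[OF this le, of "B + E + F" "B' + E' + D' + C'" "D + C"]
  show "\<exists>F. B + E + F \<approx> D + C" by (auto simp: ac_simps)
next
  assume "\<exists>F. B + E + F \<approx> D + C"
  then show "cls B C \<preceq>\<^bsub>chang_group\<^esub> cls D E" unfolding chang_group_def by simp blast
qed

lemma cls_zero: "\<zero>\<^bsub>chang_group\<^esub> = cls {#} {#}"
  by (simp add: chang_group_def)

lemma eqv_union_emptyD:
  assumes "F + F' \<approx> {#}"
  shows "F \<approx> {#}"
proof -
  have "psum (F + F') \<^bold>0" using eqv_psum[OF eqv_sym[OF assms]] psum.empty by blast
  then obtain d e where d: "psum F d" "psum F' e" "\<^bold>0 = d \<boxplus> e" using psum_unionD by blast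
  then have "d \<in> M" "e \<in> M" using psum_closed by blast+
  then have "d = \<^bold>0" using le_add(1)[of d e] d(3)[symmetric] le_antisym[of d "\<^bold>0"] by simp
  then show ?thesis using d eqv_empty by simp
qed

lemma chang_group_abelian_group: "abelian_group chang_group"
proof (rule abelian_groupI)
  fix X assume "X \<in> carrier chang_group"
  then obtain B C where X: "X = cls B C" "B \<in> msets" "C \<in> msets" by (rule cls_cases)
  have "cls (C + B) (B + C) = cls {#} {#}"
    using X eqv_refl[of "C + B"] by (intro cls_eqI) (auto simp: ac_simps)
  then show "\<exists>Y\<in>carrier chang_group. Y \<oplus>\<^bsub>chang_group\<^esub> X = \<zero>\<^bsub>chang_group\<^esub>"
    using X by (intro bexI[of _ "cls C B"]) (auto simp: cls_add cls_zero)
qed (auto elim!: cls_cases simp: cls_add cls_zero ac_simps)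

text \<open>For the supremum of the classes \<open>B - C\<close> and \<open>D - E\<close>, bring them to the common form \<open>B + E\<close> and
  \<open>D + C\<close> and apply \<open>cut\<close>: these are \<open>Z + B'\<close> and \<open>Z + C'\<close> with disjoint \<open>B'\<close> and \<open>C'\<close>, and their
  supremum is \<open>Z + B' + C'\<close>. It is the least upper bound by \<open>disjoint_absorb\<close>.\<close>

lemma chang_group_l_group: "l_group chang_group"
proof (rule l_groupI[OF chang_group_abelian_group])
  fix X assume "X \<in> carrier chang_group"
  then obtain B C where X: "X = cls B C" "B \<in> msets" "C \<in> msets" by (rule cls_cases)
  then show "X \<preceq>\<^bsub>chang_group\<^esub> X"
    using eqv_refl[of "B + C"] by (auto simp: cls_leq intro: exI[of _ "{#}"])
next
  fix X Y assume XY: "X \<in> carrier chang_group" "Y \<in> carrier chang_group"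
  from XY(1) obtain B C where X: "X = cls B C" "B \<in> msets" "C \<in> msets" by (rule cls_cases)
  from XY(2) obtain D E where Y: "Y = cls D E" "D \<in> msets" "E \<in> msets" by (rule cls_cases)
  {
    assume "X \<preceq>\<^bsub>chang_group\<^esub> Y" "Y \<preceq>\<^bsub>chang_group\<^esub> X"
    then obtain F F' where F: "B + E + F \<approx> D + C" "D + C + F' \<approx> B + E" using X Y by (auto simp: cls_leq)
    then have "F + F' \<approx> {#}"
      using eqv_combine[OF F, of "F + F'" "B + C + D + E" "{#}"] by (simp add: ac_simps)
    then have "F \<approx> {#}" by (rule eqv_union_emptyD)
    from eqv_combine[OF F(1) eqv_sym[OF this], of "B + E" F "D + C"]
    show "X = Y" unfolding X Y by (intro cls_eqI) (simp add: ac_simps)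
  }
  have BE: "set_mset (B + E) \<subseteq> M" "set_mset (D + C) \<subseteq> M" using X Y by auto
  from cut[OF BE] obtain Z B' C' where Z: "B + E \<approx> Z + B'" "D + C \<approx> Z + C'"
    and disj: "\<forall>b\<in>#B'. \<forall>c\<in>#C'. disjoint b c" by blast
  have ZM: "Z \<in> msets" "B' \<in> msets" "C' \<in> msets" using eqv_closed[OF Z(1)] eqv_closed[OF Z(2)] by auto
  let ?S = "cls (Z + B' + C') (C + E)"
  have "X \<preceq>\<^bsub>chang_group\<^esub> ?S"
  proof -
    have "B + (C + E) + C' \<approx> Z + B' + C' + C"
      using eqv_union[OF Z(1) eqv_refl[of "C + C'"]] X ZM by (simp add: ac_simps)
    then show ?thesis using X Y ZM by (auto simp: cls_leq)
  qed
  moreover have "Y \<preceq>\<^bsub>chang_group\<^esub> ?S"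
  proof -
    have "D + (C + E) + B' \<approx> Z + B' + C' + E"
      using eqv_union[OF Z(2) eqv_refl[of "E + B'"]] Y ZM by (simp add: ac_simps)
    then show ?thesis using X Y ZM by (auto simp: cls_leq)
  qed
  moreover have "?S \<preceq>\<^bsub>chang_group\<^esub> W"
    if "W \<in> carrier chang_group" "X \<preceq>\<^bsub>chang_group\<^esub> W" "Y \<preceq>\<^bsub>chang_group\<^esub> W" for W
  proof -
    from that(1) obtain U V where W: "W = cls U V" "U \<in> msets" "V \<in> msets" by (rule cls_cases)
    with that X Y obtain F F' where F: "B + V + F \<approx> U + C" "D + V + F' \<approx> U + E"
      by (auto simp: cls_leq)
    have "Z + B' + V + F \<approx> U + C + E"
      using eqv_combine[OF F(1) eqv_sym[OF Z(1)], of "Z + B' + V + F" B "U + C + E"]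
      by (simp add: ac_simps)
    moreover have ZC: "Z + C' + V + F' \<approx> U + C + E"
      using eqv_combine[OF F(2) eqv_sym[OF Z(2)], of "Z + C' + V + F'" D "U + C + E"]
      by (simp add: ac_simps)
    ultimately have "Z + B' + V + F \<approx> Z + C' + V + F'" using eqv_trans eqv_sym by blast
    then have "B' + F \<approx> C' + F'"
      using eqv_cancel[of "B' + F" "Z + V" "C' + F'"] by (simp add: ac_simps)
    from disjoint_absorb[OF this disj] obtain S where "F' \<approx> B' + S" by blast
    from eqv_combine[OF ZC eqv_sym[OF this], of "Z + B' + C' + V + S" F' "U + (C + E)"]
    have "Z + B' + C' + V + S \<approx> U + (C + E)" by (simp add: ac_simps)
    then show ?thesis using W X Y ZM by (auto simp: cls_leq)
  qed
  ultimately show "\<exists>S\<in>carrier chang_group. X \<preceq>\<^bsub>chang_group\<^esub> S \<and> Y \<preceq>\<^bsub>chang_group\<^esub> S \<and>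
      (\<forall>W\<in>carrier chang_group. X \<preceq>\<^bsub>chang_group\<^esub> W \<and> Y \<preceq>\<^bsub>chang_group\<^esub> W \<longrightarrow> S \<preceq>\<^bsub>chang_group\<^esub> W)"
    using X Y ZM by (intro bexI[of _ ?S]) auto
next
  fix X Y W
  assume XYW: "X \<in> carrier chang_group" "Y \<in> carrier chang_group" "W \<in> carrier chang_group"
  from XYW(1) obtain B C where X: "X = cls B C" "B \<in> msets" "C \<in> msets" by (rule cls_cases)
  from XYW(2) obtain D E where Y: "Y = cls D E" "D \<in> msets" "E \<in> msets" by (rule cls_cases)
  from XYW(3) obtain U V where W: "W = cls U V" "U \<in> msets" "V \<in> msets" by (rule cls_cases)
  {
    assume "X \<preceq>\<^bsub>chang_group\<^esub> Y"
    then obtain F where F: "B + E + F \<approx> D + C" using X Y by (auto simp: cls_leq)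
    have "B + U + (E + V) + F \<approx> D + U + (C + V)"
      using eqv_union[OF F eqv_refl[of "U + V"]] W by (simp add: ac_simps)
    then show "X \<oplus>\<^bsub>chang_group\<^esub> W \<preceq>\<^bsub>chang_group\<^esub> Y \<oplus>\<^bsub>chang_group\<^esub> W"
      using X Y W by (auto simp: cls_leq cls_add)
    assume "Y \<preceq>\<^bsub>chang_group\<^esub> W"
    then obtain F' where F': "D + V + F' \<approx> U + E" using W Y by (auto simp: cls_leq)
    have "B + V + (F + F') \<approx> U + C"
      using eqv_combine[OF F F', of "B + V + (F + F')" "D + E" "U + C"] by (simp add: ac_simps)
    then show "X \<preceq>\<^bsub>chang_group\<^esub> W" using X W by (auto simp: cls_leq)
  }
qed

sublocale chang: lgroup chang_group
  by (rule lgroup.intro) (rule chang_group_l_group)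

definition embed :: "'a \<Rightarrow> ('a list \<times> 'a list) set" where "embed x = cls {#x#} {#}"

lemma embed_closed [simp]: "x \<in> M \<Longrightarrow> embed x \<in> carrier chang_group"
  by (simp add: embed_def)

lemma embed_leq:
  assumes "x \<in> M" "y \<in> M"
  shows "embed x \<preceq>\<^bsub>chang_group\<^esub> embed y \<longleftrightarrow> x \<unlhd> y"
proof
  assume "embed x \<preceq>\<^bsub>chang_group\<^esub> embed y"
  then obtain F where "{#x#} + F \<approx> {#y#}" using assms by (auto simp: embed_def cls_leq)
  then have "psum ({#x#} + F) y" using eqv_psum[OF eqv_sym] psum_single assms by blast
  then show "x \<unlhd> y" using psum_below[of "{#x#} + F" y x] by simp
next
  assume "x \<unlhd> y"
  then have "psum ({#x#} + {#y \<boxminus> x#}) y"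
    using psum_pair[OF summable_minus, of x y] assms add_minus by (simp add: add_mset_commute)
  then have "{#x#} + {#y \<boxminus> x#} \<approx> {#y#}" using psum_eqv psum_single assms by blast
  then show "embed x \<preceq>\<^bsub>chang_group\<^esub> embed y"
    using assms unfolding embed_def by (subst cls_leq) (auto intro!: exI[of _ "{#y \<boxminus> x#}"] simp: add_mset_commute)
qed

lemma embed_add:
  assumes "summable x y" "x \<in> M" "y \<in> M"
  shows "embed (x \<boxplus> y) = embed x \<oplus>\<^bsub>chang_group\<^esub> embed y"
proof -
  have "{#x \<boxplus> y#} \<approx> {#x#} + {#y#}"
    using psum_eqv[OF psum_single psum_pair, of x y] assms by (simp add: add_mset_commute)
  then show ?thesis using assms by (simp add: embed_def cls_add) (rule cls_eqI, simp)
qed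

lemma embed_zero: "embed \<^bold>0 = \<zero>\<^bsub>chang_group\<^esub>"
  using eqv_empty[OF psum_single] by (simp add: embed_def cls_zero) (rule cls_eqI, simp)

text \<open>A class between \<open>0\<close> and the unit is given by a formal sum \<open>E\<close> such that \<open>E + F\<close> and the formal sum
  of the single element \<open>\<^bold>1\<close> have a common refinement. So the partial sum of \<open>E + F\<close>, and with it that
  of \<open>E\<close>, is defined in the MV-algebra.\<close>

lemma embed_surj:
  assumes "X \<in> carrier chang_group" "\<zero>\<^bsub>chang_group\<^esub> \<preceq>\<^bsub>chang_group\<^esub> X"
    "X \<preceq>\<^bsub>chang_group\<^esub> embed \<^bold>1"
  shows "\<exists>x\<in>M. X = embed x"
proof -
  from assms(1) obtain B C where X: "X = cls B C" "B \<in> msets" "C \<in> msets" by (rule cls_cases)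
  with assms(2) obtain E where E: "C + E \<approx> B" by (auto simp: cls_leq cls_zero)
  have EM: "E \<in> msets" using eqv_closed[OF E] by auto
  have XE: "X = cls E {#}" unfolding X(1) using eqv_sym[OF E] by (intro cls_eqI) (simp add: ac_simps)
  with assms(3) obtain F where "E + F \<approx> {#\<^bold>1#}" using EM by (auto simp: cls_leq embed_def)
  then have "psum (E + F) \<^bold>1" using eqv_psum[OF eqv_sym] psum_single by simp
  then obtain x where x: "psum E x" using psum_unionD by blast
  then have "x \<in> M" using psum_closed by blast
  moreover have "X = embed x"
    unfolding XE embed_def using psum_eqv[OF x psum_single] \<open>x \<in> M\<close> by (intro cls_eqI) simp
  ultimately show ?thesis by blast
qed

lemma embed_eq_iff: "x \<in> M \<Longrightarrow> y \<in> M \<Longrightarrow> embed x = embed y \<longleftrightarrow> x = y"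
  using embed_leq[of x y] embed_leq[of y x] chang.leq_refl[of "embed x"] le_antisym[of x y] by auto

text \<open>A common refinement writes \<open>z\<close> as \<open>p + q\<close> with \<open>p\<close> below \<open>x\<close> and \<open>q\<close> below \<open>y\<close>.\<close>

lemma embed_add_below:
  assumes "embed z \<preceq>\<^bsub>chang_group\<^esub> embed x \<oplus>\<^bsub>chang_group\<^esub> embed y" "x \<in> M" "y \<in> M" "z \<in> M"
  shows "z \<unlhd> x \<boxplus> y"
proof -
  obtain F where "{#z#} + F \<approx> {#x#} + {#y#}"
    using assms by (auto simp: embed_def cls_add cls_leq)
  then obtain D where "{#z#} + F \<Rrightarrow> D" "{#x#} + {#y#} \<Rrightarrow> D" unfolding eqv_def by blast
  then obtain D1 D2 E1 E2 where D: "D = D1 + D2" "psum D1 z" "D = E1 + E2" "psum E1 x" "psum E2 y"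
    using refines_unionD refines_singleD by metis
  then obtain P Q R S where PQ: "D1 = P + Q" "E1 = P + R" "E2 = Q + S"
    using union_refinement[of D1 D2 E1 E2] by auto
  obtain p q where p: "psum P p" "psum Q q" "z = p \<boxplus> q" using D(2) PQ psum_unionD by blast
  obtain p' r where p': "psum P p'" "psum R r" "x = p' \<boxplus> r" using D(4) PQ psum_unionD by blast
  obtain q' s where q': "psum Q q'" "psum S s" "y = q' \<boxplus> s" using D(5) PQ psum_unionD by blast
  have "p' = p" "q' = q" using psum_unique p p' q' by blast+
  moreover have "p \<in> M" "q \<in> M" "r \<in> M" "s \<in> M" using p p' q' psum_closed by blast+
  moreover from this have "(p \<boxplus> r) \<boxplus> (q \<boxplus> s) = (p \<boxplus> q) \<boxplus> (r \<boxplus> s)" by (simp add: add_ac)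
  ultimately show ?thesis using p(3) p'(3) q'(3) le_add[of z "r \<boxplus> s"] assms by simp
qed

lemma embed_compl:
  assumes "x \<in> M"
  shows "embed (\<sim>x) = embed \<^bold>1 \<ominus>\<^bsub>chang_group\<^esub> embed x"
proof -
  have "embed \<^bold>1 = embed (\<sim>x) \<oplus>\<^bsub>chang_group\<^esub> embed x"
    using embed_add[of "\<sim>x" x] assms by (simp add: summable_iff)
  then show ?thesis
    using assms by (simp add: chang.minus_eq chang.a_assoc chang.r_neg)
qed

text \<open>One inequality is \<open>embed_add_below\<close>; for the other, \<open>x \<boxplus> y\<close> is the partial sum of \<open>x\<close> and
  \<open>(x \<boxplus> y) \<boxminus> x\<close>, which is below \<open>y\<close>.\<close>

lemma embed_oplus:
  assumes "x \<in> M" "y \<in> M"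
  shows "embed (x \<boxplus> y) = (embed x \<oplus>\<^bsub>chang_group\<^esub> embed y) \<sqinter>\<^bsub>chang_group\<^esub> embed \<^bold>1"
proof -
  let ?Z = "(embed x \<oplus>\<^bsub>chang_group\<^esub> embed y) \<sqinter>\<^bsub>chang_group\<^esub> embed \<^bold>1"
  have nn: "\<zero>\<^bsub>chang_group\<^esub> \<preceq>\<^bsub>chang_group\<^esub> embed w" if "w \<in> M" for w
    using embed_leq[of "\<^bold>0" w] that by (simp add: embed_zero)
  have Z: "?Z \<in> carrier chang_group" using assms by simp
  have "\<zero>\<^bsub>chang_group\<^esub> \<preceq>\<^bsub>chang_group\<^esub> ?Z"
    using nn assms by (simp add: chang.leq_inf_iff chang.add_nonneg)
  then obtain z where z: "z \<in> M" "?Z = embed z"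
    using embed_surj[OF Z] chang.inf_le2[of "embed x \<oplus>\<^bsub>chang_group\<^esub> embed y" "embed \<^bold>1"] assms by auto
  have "embed z \<preceq>\<^bsub>chang_group\<^esub> embed x \<oplus>\<^bsub>chang_group\<^esub> embed y"
    unfolding z(2)[symmetric] using assms by (simp add: chang.inf_le1)
  then have "z \<unlhd> x \<boxplus> y" using embed_add_below assms z by blast
  moreover have "embed (x \<boxplus> y) \<preceq>\<^bsub>chang_group\<^esub> ?Z"
  proof -
    have c: "summable x ((x \<boxplus> y) \<boxminus> x)" "x \<boxplus> ((x \<boxplus> y) \<boxminus> x) = x \<boxplus> y"
      using assms summable_minus[of x "x \<boxplus> y"] add_minus[of x "x \<boxplus> y"] le_add by simp_all
    have "(x \<boxplus> y) \<boxminus> x \<unlhd> y" using assms by (simp add: minus_le_iff)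
    then have "embed ((x \<boxplus> y) \<boxminus> x) \<preceq>\<^bsub>chang_group\<^esub> embed y" using embed_leq assms by simp
    then have "embed (x \<boxplus> y) \<preceq>\<^bsub>chang_group\<^esub> embed x \<oplus>\<^bsub>chang_group\<^esub> embed y"
      using embed_add[OF c(1)] c(2) assms by (simp add: chang.add_leq_cancel_left)
    moreover have "embed (x \<boxplus> y) \<preceq>\<^bsub>chang_group\<^esub> embed \<^bold>1" using embed_leq assms by simp
    ultimately show ?thesis using assms by (simp add: chang.leq_inf_iff)
  qed
  ultimately show ?thesis using z embed_leq[of "x \<boxplus> y" z] le_antisym[of z "x \<boxplus> y"] assms by simp
qed

lemma embed_strong_unit: "strong_unit chang_group (embed \<^bold>1)"
  unfolding strong_unit_def
proof (intro conjI ballI)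
  show "embed \<^bold>1 \<in> carrier chang_group" by simp
  show nn: "\<zero>\<^bsub>chang_group\<^esub> \<preceq>\<^bsub>chang_group\<^esub> embed \<^bold>1"
    using embed_leq[of "\<^bold>0" "\<^bold>1"] by (simp add: embed_zero)
  have *: "\<exists>n::nat. cls B {#} \<preceq>\<^bsub>chang_group\<^esub> [n] \<cdot>\<^bsub>chang_group\<^esub> embed \<^bold>1" if "B \<in> msets" for B
    using that
  proof (induct B)
    case empty
    then show ?case using chang.leq_refl[of "cls {#} {#}"] by (auto intro: exI[of _ 0] simp: cls_zero)
  next
    case (add b B)
    then obtain n :: nat where "cls B {#} \<preceq>\<^bsub>chang_group\<^esub> [n] \<cdot>\<^bsub>chang_group\<^esub> embed \<^bold>1" by auto
    moreover have "embed b \<preceq>\<^bsub>chang_group\<^esub> embed \<^bold>1" using embed_leq add by simp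
    ultimately have "cls B {#} \<oplus>\<^bsub>chang_group\<^esub> embed b \<preceq>\<^bsub>chang_group\<^esub> [Suc n] \<cdot>\<^bsub>chang_group\<^esub> embed \<^bold>1"
      using add by (simp add: chang.nsmul_Suc chang.add_mono)
    moreover have "cls B {#} \<oplus>\<^bsub>chang_group\<^esub> embed b = cls (add_mset b B) {#}"
      using add by (simp add: embed_def cls_add)
    ultimately show ?case by (intro exI[of _ "Suc n"]) simp
  qed
  fix X assume "X \<in> carrier chang_group"
  then obtain B C where X: "X = cls B C" "B \<in> msets" "C \<in> msets" by (rule cls_cases)
  then have "X \<preceq>\<^bsub>chang_group\<^esub> cls B {#}"
    using eqv_refl[of "B + C"] by (auto simp: cls_leq)
  moreover from *[of B] X obtain n :: nat where
    "cls B {#} \<preceq>\<^bsub>chang_group\<^esub> [n] \<cdot>\<^bsub>chang_group\<^esub> embed \<^bold>1" by auto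
  ultimately show "\<exists>n::nat. X \<preceq>\<^bsub>chang_group\<^esub> [n] \<cdot>\<^bsub>chang_group\<^esub> embed \<^bold>1"
    using X chang.leq_trans[of X "cls B {#}" "[n] \<cdot>\<^bsub>chang_group\<^esub> embed \<^bold>1"] by auto
qed

text \<open>Mundici's theorem that \<open>\<Gamma>\<close> is essentially surjective.\<close>

lemma chang_presents: "presents A (chang_group, embed \<^bold>1, embed)"
proof -
  have "embed \<^bold>1 \<in> carrier chang_group" by simp
  have nn: "\<zero>\<^bsub>chang_group\<^esub> \<preceq>\<^bsub>chang_group\<^esub> embed w" if "w \<in> M" for w
    using embed_leq[of "\<^bold>0" w] that by (simp add: embed_zero)
  have "mv_map A (Gamma chang_group (embed \<^bold>1)) embed"
    by (auto simp: mv_map_def Gamma_def embed_oplus embed_compl embed_zero nn embed_leq)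
  moreover have "bij_betw embed M (carrier (Gamma chang_group (embed \<^bold>1)))"
    unfolding bij_betw_def inj_on_def using embed_surj
    by (auto simp: Gamma_def embed_eq_iff embed_leq nn)
  ultimately show ?thesis
    using chang_group_l_group embed_strong_unit by (simp add: presents_def lu_group_def mv_iso_def)
qed

end

lemma presents_presentation_of:
  assumes "mv_algebra M"
  shows "presents M (presentation_of M)"
proof -
  interpret mv M using assms by unfold_locales
  show ?thesis unfolding presentation_of_def by (rule someI) (rule chang_presents)
qed

section \<open>Maximal ideals\<close>

context mv
begin

lemma ideal_proper_iff: "mv_ideal A I \<Longrightarrow> I \<noteq> M \<longleftrightarrow> \<^bold>1 \<notin> I"
  unfolding mv_ideal_def using le_one derived_closed(1) by blast

text \<open>Zorn's lemma applies since an ideal is proper iff it omits \<open>\<^bold>1\<close>, a property that passes to unions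
  of chains.\<close>

lemma maximal_ideal_exists:
  assumes "mv_ideal A I" "\<^bold>1 \<notin> I"
  shows "\<exists>J. mv_maximal_ideal A J \<and> I \<subseteq> J"
proof -
  define S where "S = {J. mv_ideal A J \<and> I \<subseteq> J \<and> \<^bold>1 \<notin> J}"
  have "\<Union>C \<in> S" if C: "C \<noteq> {}" "subset.chain S C" for C
  proof -
    have CS: "C \<subseteq> S" and tot: "\<And>X Y. X \<in> C \<Longrightarrow> Y \<in> C \<Longrightarrow> X \<subseteq> Y \<or> Y \<subseteq> X"
      using C(2) by (auto simp: subset.chain_def)
    have "x \<boxplus> y \<in> \<Union>C" if "x \<in> \<Union>C" "y \<in> \<Union>C" for x y
    proof -
      from that obtain X Y where "X \<in> C" "Y \<in> C" "x \<in> X" "y \<in> Y" by blast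
      then obtain Z where "Z \<in> C" "x \<in> Z" "y \<in> Z" using tot by blast
      then show ?thesis using CS unfolding S_def mv_ideal_def by blast
    qed
    moreover have "\<Union>C \<subseteq> M" "I \<subseteq> \<Union>C" "\<^bold>1 \<notin> \<Union>C" "\<^bold>0 \<in> \<Union>C"
      using CS C(1) unfolding S_def mv_ideal_def by blast+
    moreover have "y \<in> \<Union>C" if "x \<in> \<Union>C" "y \<in> M" "y \<unlhd> x" for x y
      using that CS unfolding S_def mv_ideal_def by blast
    ultimately show ?thesis unfolding S_def mv_ideal_def by blast
  qed
  moreover have "I \<in> S" using assms by (simp add: S_def)
  ultimately obtain J where J: "J \<in> S" "\<And>X. X \<in> S \<Longrightarrow> J \<subseteq> X \<Longrightarrow> X = J"
    using subset_Zorn_nonempty[of S] by blast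
  have "mv_maximal_ideal A J"
    unfolding mv_maximal_ideal_def
  proof (intro conjI allI impI)
    show ideal: "mv_ideal A J" using J(1) by (simp add: S_def)
    show "J \<noteq> M" using J(1) ideal_proper_iff[OF ideal] by (simp add: S_def)
    fix X assume X: "mv_ideal A X \<and> J \<subseteq> X \<and> X \<noteq> M"
    then have "X \<in> S" using J(1) ideal_proper_iff[of X] by (auto simp: S_def)
    then show "X = J" using J(2) X by blast
  qed
  then show ?thesis using J(1) by (auto simp: S_def)
qed

abbreviation mult :: "nat \<Rightarrow> 'a \<Rightarrow> 'a" where "mult n x \<equiv> ((\<lambda>y. x \<boxplus> y) ^^ n) \<^bold>0"

lemma mult_closed [simp]: "x \<in> M \<Longrightarrow> mult n x \<in> M"
  by (induct n) auto

lemma mult_add: "x \<in> M \<Longrightarrow> mult (m + n) x = mult m x \<boxplus> mult n x"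
  by (induct m) (auto simp: add_assoc)

text \<open>Otherwise \<open>I\<close> and \<open>x\<close> generate the whole algebra, so that \<open>i \<boxplus> mult n x = \<^bold>1\<close> for some \<open>i\<close> in \<open>I\<close>.
  Then the complement of \<open>mult n x\<close> is below \<open>i\<close>, and so is \<open>mult n x\<close> itself. Both summands of \<open>\<^bold>1\<close>
  would lie in \<open>I\<close>.\<close>

lemma infinitesimal_in_maximal_ideal:
  assumes x: "x \<in> M" and inf: "\<And>n. mult n x \<unlhd> \<sim>(mult n x)" and max: "mv_maximal_ideal A I"
  shows "x \<in> I"
proof (rule ccontr)
  assume xI: "x \<notin> I"
  have ideal: "mv_ideal A I" and proper: "\<^bold>1 \<notin> I"
    using max ideal_proper_iff[of I] by (auto simp: mv_maximal_ideal_def)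
  have I: "I \<subseteq> M" "\<^bold>0 \<in> I" "\<And>a b. a \<in> I \<Longrightarrow> b \<in> I \<Longrightarrow> a \<boxplus> b \<in> I"
    "\<And>a b. a \<in> I \<Longrightarrow> b \<in> M \<Longrightarrow> b \<unlhd> a \<Longrightarrow> b \<in> I"
    using ideal unfolding mv_ideal_def by blast+
  \<comment> \<open>the ideal generated by \<open>I\<close> and \<open>x\<close>\<close>
  define J where "J = {y \<in> M. \<exists>i\<in>I. \<exists>n. y \<unlhd> i \<boxplus> mult n x}"
  have "mv_ideal A J"
    unfolding mv_ideal_def
  proof (intro conjI ballI impI)
    show "J \<subseteq> M" by (auto simp: J_def)
    show "\<^bold>0 \<in> J" using I x by (auto simp: J_def intro!: bexI[of _ "\<^bold>0"])
    fix y assume "y \<in> J"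
    then obtain i m where y: "y \<in> M" "i \<in> I" "y \<unlhd> i \<boxplus> mult m x" by (auto simp: J_def)
    have iM: "i \<in> M" using y I by blast
    {
      fix z assume "z \<in> J"
      then obtain j n where z: "z \<in> M" "j \<in> I" "z \<unlhd> j \<boxplus> mult n x" by (auto simp: J_def)
      have jM: "j \<in> M" using z I by blast
      have "y \<boxplus> z \<unlhd> y \<boxplus> (j \<boxplus> mult n x)"
        using add_mono_right[OF z(3), of y] y(1) z(1) jM x by simp
      also have "y \<boxplus> (j \<boxplus> mult n x) = (j \<boxplus> mult n x) \<boxplus> y"
        using y(1) jM x by (simp add: add_comm)
      finally have 1: "y \<boxplus> z \<unlhd> (j \<boxplus> mult n x) \<boxplus> y" .
      have 2: "(j \<boxplus> mult n x) \<boxplus> y \<unlhd> (j \<boxplus> mult n x) \<boxplus> (i \<boxplus> mult m x)"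
        using add_mono_right[OF y(3), of "j \<boxplus> mult n x"] y(1) jM iM x by simp
      have 3: "(j \<boxplus> mult n x) \<boxplus> (i \<boxplus> mult m x) = (i \<boxplus> j) \<boxplus> mult (m + n) x"
        using iM jM x by (simp add: mult_add add_ac)
      have "y \<boxplus> z \<unlhd> (i \<boxplus> j) \<boxplus> mult (m + n) x"
        using le_trans[OF 1 2] y(1) z(1) iM jM x unfolding 3 by simp
      then show "y \<boxplus> z \<in> J" using y(1) z(1) I(3)[OF y(2) z(2)] by (auto simp: J_def)
    }
    fix z assume "z \<in> M" "z \<unlhd> y"
    then show "z \<in> J" using le_trans[OF _ y(3), of z] y iM x by (auto simp: J_def)
  qed
  moreover have "I \<subseteq> J"
  proof
    fix i assume "i \<in> I"
    then show "i \<in> J" using I(1) by (auto simp: J_def intro!: bexI[of _ i] exI[of _ 0])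
  qed
  moreover have "x \<in> J" using x I(2) by (auto simp: J_def intro!: bexI[of _ "\<^bold>0"] exI[of _ 1])
  ultimately have "J = M" using max xI unfolding mv_maximal_ideal_def by blast
  then have "\<^bold>1 \<in> J" by simp
  then obtain i n where i: "i \<in> I" "\<^bold>1 \<unlhd> i \<boxplus> mult n x" unfolding J_def by blast
  have iM: "i \<in> M" using i I by blast
  have top: "i \<boxplus> mult n x = \<^bold>1"
    using i(2) iM x by (intro le_antisym) simp_all
  then have "\<sim>(mult n x) \<unlhd> i" using iM x by (simp add: le_iff add_comm)
  then have "mult n x \<unlhd> i" using le_trans[OF inf] iM x by simp
  then have "mult n x \<in> I" using I(4)[OF i(1)] x by simp
  then show False using I(3)[OF i(1)] top proper by metis
qed

end

section \<open>Unit intervals\<close>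

lemma Gamma_simps [simp]:
  "carrier (Gamma G u) = {x \<in> carrier G. \<zero>\<^bsub>G\<^esub> \<preceq>\<^bsub>G\<^esub> x \<and> x \<preceq>\<^bsub>G\<^esub> u}"
  "mv_add (Gamma G u) x y = (x \<oplus>\<^bsub>G\<^esub> y) \<sqinter>\<^bsub>G\<^esub> u"
  "mv_neg (Gamma G u) x = u \<ominus>\<^bsub>G\<^esub> x" "mv_zero (Gamma G u) = \<zero>\<^bsub>G\<^esub>"
  by (simp_all add: Gamma_def)

locale lu_grp = lgroup G for G :: "('a, 'b) ogroup_scheme" (structure) +
  fixes u assumes unit: "strong_unit G u"
begin

lemma unit_closed [simp]: "u \<in> carrier G" and unit_nonneg [simp]: "\<zero> \<preceq> u"
  using unit by (auto simp: strong_unit_def)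

abbreviation "U \<equiv> {x \<in> carrier G. \<zero> \<preceq> x \<and> x \<preceq> u}"

lemma Gamma_one [simp]: "mv_one (Gamma G u) = u"
  by (simp add: mv_one_def minus_eq)

text \<open>The MV-term \<open>(x\<^sup>* \<oplus> y)\<^sup>*\<close>, computed in the group. It gives access to disjointness in the
  MV-algebra, and it turns the axiom on \<open>(x\<^sup>* \<oplus> y)\<^sup>* \<oplus> y\<close> into symmetry of the supremum.\<close>

lemma truncated_minus:
  assumes "x \<in> carrier G" "y \<in> carrier G"
  shows "u \<ominus> ((u \<ominus> x \<oplus> y) \<sqinter> u) = (x \<ominus> y) \<squnion> \<zero>"
proof -
  have "u \<ominus> (u \<ominus> x \<oplus> y) = x \<ominus> y"
    using assms r_neg2[of u "x \<oplus> \<ominus> y"] by (simp add: minus_eq minus_add a_assoc)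
  then show ?thesis
    using assms by (simp add: minus_eq minus_inf add_sup_left r_neg)
qed

lemma Gamma_le: "x \<in> carrier G \<Longrightarrow> y \<in> carrier G \<Longrightarrow> mv_le (Gamma G u) x y \<longleftrightarrow> x \<preceq> y"
proof -
  assume xy: "x \<in> carrier G" "y \<in> carrier G"
  have "(u \<ominus> x \<oplus> y) \<sqinter> u = u \<longleftrightarrow> u \<preceq> u \<ominus> x \<oplus> y"
    using xy inf_absorb2[of u "u \<ominus> x \<oplus> y"] inf_le1[of "u \<ominus> x \<oplus> y" u] by auto
  moreover have "u \<ominus> x \<oplus> y = u \<oplus> (y \<ominus> x)" using xy by (simp add: minus_eq a_ac)
  moreover have "u \<preceq> u \<oplus> (y \<ominus> x) \<longleftrightarrow> x \<preceq> y"
    using xy add_leq_cancel_left[of \<zero> "y \<ominus> x" u] leq_iff[of x y] by simp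
  ultimately show ?thesis by (simp add: mv_le_def)
qed

lemma Gamma_summable:
  "x \<in> carrier G \<Longrightarrow> y \<in> carrier G \<Longrightarrow> mv_summable (Gamma G u) x y \<longleftrightarrow> x \<oplus> y \<preceq> u"
  by (simp add: mv_summable_def Gamma_le leq_diff_iff)

lemma Gamma_mv_algebra: "mv_algebra (Gamma G u)"
  unfolding mv_algebra_def Gamma_simps Gamma_one
proof (intro conjI ballI)
  fix x assume "x \<in> U"
  then have x: "x \<in> carrier G" "\<zero> \<preceq> x" "x \<preceq> u" by auto
  show "u \<ominus> x \<in> U" using x leq_iff[of x u] by (auto simp: diff_leq_iff leq_add_nonneg)
  show "(x \<oplus> \<zero>) \<sqinter> u = x" using x by (simp add: inf_absorb1)
  show "u \<ominus> (u \<ominus> x) = x" using x by (simp add: minus_eq minus_add r_neg2)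
  show "(x \<oplus> u) \<sqinter> u = u"
    using x leq_add_nonneg[of x u] by (simp add: inf_absorb2 a_comm)
  fix y assume "y \<in> U"
  then have y: "y \<in> carrier G" "\<zero> \<preceq> y" "y \<preceq> u" by auto
  show "(x \<oplus> y) \<sqinter> u \<in> U" using x y by (simp add: leq_inf_iff add_nonneg inf_le2)
  show "(x \<oplus> y) \<sqinter> u = (y \<oplus> x) \<sqinter> u" using x y by (simp add: a_comm)
  have *: "((u \<ominus> ((u \<ominus> a \<oplus> b) \<sqinter> u)) \<oplus> b) \<sqinter> u = (a \<squnion> b) \<sqinter> u"
    if "a \<in> carrier G" "b \<in> carrier G" for a b
    using sup_eq_add_pos_part[of a b] that a_comm[of "(a \<ominus> b) \<squnion> \<zero>" b] truncated_minus[of a b]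
    by simp
  show "((u \<ominus> ((u \<ominus> x \<oplus> y) \<sqinter> u)) \<oplus> y) \<sqinter> u = ((u \<ominus> ((u \<ominus> y \<oplus> x) \<sqinter> u)) \<oplus> x) \<sqinter> u"
    using x y by (simp only: * sup_comm[of x y])
  fix z assume "z \<in> U"
  then have z: "z \<in> carrier G" "\<zero> \<preceq> z" "z \<preceq> u" by auto
  have **: "((a \<oplus> b) \<sqinter> u \<oplus> c) \<sqinter> u = (a \<oplus> b \<oplus> c) \<sqinter> u"
    if "a \<in> carrier G" "b \<in> carrier G" "c \<in> carrier G" "\<zero> \<preceq> c" for a b c
  proof -
    have "(a \<oplus> b) \<sqinter> u \<oplus> c = (a \<oplus> b \<oplus> c) \<sqinter> (u \<oplus> c)"
      using that add_inf_left[of "a \<oplus> b" u c] by (simp add: a_comm)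
    moreover have "(u \<oplus> c) \<sqinter> u = u" using that by (simp add: inf_absorb2 leq_add_nonneg)
    ultimately show ?thesis using that by (simp add: inf_assoc)
  qed
  show "((x \<oplus> y) \<sqinter> u \<oplus> z) \<sqinter> u = (x \<oplus> (y \<oplus> z) \<sqinter> u) \<sqinter> u"
    using **[of x y z] **[of y z x] x y z
    by (simp add: a_comm[of x "(y \<oplus> z) \<sqinter> u"] a_assoc[of x y z] a_comm[of x "y \<oplus> z"])
qed simp_all

lemma mult_Gamma:
  assumes "x \<in> U"
  shows "((\<lambda>y. mv_add (Gamma G u) x y) ^^ n) \<zero> = ([n] \<cdot> x) \<sqinter> u"
proof (induct n)
  case 0
  then show ?case by (simp add: inf_absorb1)
next
  case (Suc n)
  have x: "x \<in> carrier G" "\<zero> \<preceq> x" using assms by auto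
  have "(x \<oplus> ([n] \<cdot> x) \<sqinter> u) \<sqinter> u = ((x \<oplus> [n] \<cdot> x) \<sqinter> (x \<oplus> u)) \<sqinter> u"
    using x by (simp add: add_inf_left)
  also have "\<dots> = (x \<oplus> [n] \<cdot> x) \<sqinter> u"
    using x leq_add_nonneg[of x u] by (simp add: inf_assoc inf_absorb2 a_comm)
  finally show ?case using x Suc by (simp add: a_comm)
qed

text \<open>Disjoint from \<open>u\<close>, the element is disjoint from all multiples of \<open>u\<close>, one of which exceeds it.\<close>

lemma disjoint_unit:
  assumes "z \<in> carrier G" "z \<sqinter> u = \<zero>"
  shows "z = \<zero>"
proof -
  have z: "\<zero> \<preceq> z" using inf_le1[of z u] assms by simp
  have dis: "z \<sqinter> [n] \<cdot> u = \<zero>" for n :: nat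
    by (induct n) (use assms z in \<open>simp_all add: nsmul_Suc disjoint_add inf_absorb2\<close>)
  obtain n :: nat where "z \<preceq> [n] \<cdot> u" using strong_unitE(3)[OF unit assms(1)] by blast
  then show ?thesis using dis[of n] inf_absorb1[of z "[n] \<cdot> u"] assms by simp
qed

text \<open>If \<open>x \<noteq> \<zero>\<close>, some multiple \<open>[n] \<cdot> x\<close> is not below \<open>u\<close>, that is, \<open>z = ([n] \<cdot> x \<ominus> u) \<squnion> \<zero>\<close> is not zero.
  The elements disjoint from \<open>z\<close> form a proper ideal; take a maximal ideal \<open>J\<close> containing it. The
  element \<open>w = (u \<ominus> [n] \<cdot> x) \<squnion> \<zero>\<close> is disjoint from \<open>z\<close>, so \<open>w \<sqinter> u\<close> lies in \<open>J\<close>. If \<open>x\<close> were in \<open>J\<close> as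
  well, then so would be the truncated sum of \<open>([n] \<cdot> x) \<sqinter> u\<close> and \<open>w \<sqinter> u\<close>, which is \<open>u\<close>.\<close>

lemma Gamma_semisimple:
  assumes arch: "archimedean G"
  shows "semisimple (Gamma G u)"
proof -
  interpret \<Gamma>: mv "Gamma G u" using Gamma_mv_algebra by unfold_locales
  have "\<exists>I. mv_maximal_ideal (Gamma G u) I \<and> x \<notin> I" if xU: "x \<in> U" and x0: "x \<noteq> \<zero>" for x
  proof -
    have x: "x \<in> carrier G" "\<zero> \<preceq> x" "x \<preceq> u" using xU by auto
    obtain n :: nat where n: "\<not> [n] \<cdot> x \<preceq> u"
      using arch x x0 unit_closed unfolding archimedean_def by blast
    define z where "z = ([n] \<cdot> x \<ominus> u) \<squnion> \<zero>"
    define w where "w = (u \<ominus> [n] \<cdot> x) \<squnion> \<zero>"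
    have zw: "z \<in> carrier G" "w \<in> carrier G" "\<zero> \<preceq> z" "\<zero> \<preceq> w"
      using x by (simp_all add: z_def w_def sup_ge2)
    have "\<ominus> ([n] \<cdot> x \<ominus> u) = u \<ominus> [n] \<cdot> x" using x by (simp add: minus_eq minus_add a_comm)
    then have disj: "z \<sqinter> w = \<zero>"
      using pos_parts_disjoint[of "[n] \<cdot> x \<ominus> u"] x by (simp add: z_def w_def)
    have z0: "z \<noteq> \<zero>"
    proof
      assume "z = \<zero>"
      then have "[n] \<cdot> x \<ominus> u \<preceq> \<zero>" using sup_ge1[of "[n] \<cdot> x \<ominus> u" \<zero>] x by (simp add: z_def)
      then show False using n x by (simp add: diff_leq_iff)
    qed
    define I where "I = {a \<in> U. z \<sqinter> a = \<zero>}"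
    have below: "z \<sqinter> b = \<zero>" if "z \<sqinter> a = \<zero>" "b \<preceq> a" "\<zero> \<preceq> b" "a \<in> carrier G" "b \<in> carrier G" for a b
    proof (rule leq_antisym)
      have "z \<sqinter> b \<preceq> a" using leq_trans[OF inf_le2 that(2)] that zw by simp
      then show "z \<sqinter> b \<preceq> \<zero>"
        unfolding that(1)[symmetric] using that zw by (intro inf_greatest) (simp_all add: inf_le1)
      show "\<zero> \<preceq> z \<sqinter> b" using that zw by (simp add: leq_inf_iff)
    qed (use that zw in simp_all)
    have "mv_ideal (Gamma G u) I"
      unfolding mv_ideal_def
    proof (intro conjI ballI impI)
      show "mv_zero (Gamma G u) \<in> I" using zw by (simp add: I_def inf_absorb2)
      show "I \<subseteq> carrier (Gamma G u)" by (auto simp: I_def)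
      fix a assume a: "a \<in> I"
      then have a': "a \<in> carrier G" "\<zero> \<preceq> a" "z \<sqinter> a = \<zero>" by (auto simp: I_def)
      {
        fix b assume b: "b \<in> I"
        then have b': "b \<in> carrier G" "\<zero> \<preceq> b" "z \<sqinter> b = \<zero>" by (auto simp: I_def)
        have "z \<sqinter> ((a \<oplus> b) \<sqinter> u) = \<zero>"
        proof (rule below)
          show "z \<sqinter> (a \<oplus> b) = \<zero>" using a' b' zw by (intro disjoint_add) simp_all
          show "\<zero> \<preceq> (a \<oplus> b) \<sqinter> u" using a' b' by (simp add: leq_inf_iff add_nonneg)
        qed (use a' b' in \<open>simp_all add: inf_le1\<close>)
        then show "mv_add (Gamma G u) a b \<in> I"
          using \<Gamma>.closed(3)[of a b] a b by (simp add: I_def)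
      }
      fix b assume "b \<in> carrier (Gamma G u)" "mv_le (Gamma G u) b a"
      then show "b \<in> I" using a below[of a b] by (simp add: I_def Gamma_le)
    qed
    moreover have "mv_one (Gamma G u) \<notin> I"
      using disjoint_unit[OF zw(1)] z0 by (auto simp: I_def)
    ultimately obtain J where J: "mv_maximal_ideal (Gamma G u) J" "I \<subseteq> J"
      using \<Gamma>.maximal_ideal_exists by blast
    have Jid: "mv_ideal (Gamma G u) J" and JU: "u \<notin> J"
      using J \<Gamma>.ideal_proper_iff[of J] by (auto simp: mv_maximal_ideal_def)
    have "x \<notin> J"
    proof
      assume xJ: "x \<in> J"
      have add: "mv_add (Gamma G u) a b \<in> J" if "a \<in> J" "b \<in> J" for a b
        using Jid that unfolding mv_ideal_def by blast
      have zJ: "\<zero> \<in> J" using Jid unfolding mv_ideal_def by simp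
      have "((\<lambda>y. mv_add (Gamma G u) x y) ^^ k) \<zero> \<in> J" for k
        by (induct k) (simp_all only: funpow.simps id_apply comp_apply add xJ zJ)
      then have nx: "([n] \<cdot> x) \<sqinter> u \<in> J" using mult_Gamma[OF xU] by simp
      have "w \<sqinter> u \<in> I"
        using zw disj below[of w "w \<sqinter> u"] by (simp add: I_def leq_inf_iff inf_le1 inf_le2)
      with nx J(2) have mem: "(([n] \<cdot> x) \<sqinter> u \<oplus> w \<sqinter> u) \<sqinter> u \<in> J" using add by fastforce
      let ?s = "([n] \<cdot> x) \<sqinter> u"
      have s: "?s \<in> carrier G" "\<zero> \<preceq> ?s" using x by (simp_all add: leq_inf_iff nsmul_nonneg)
      have "u \<ominus> [n] \<cdot> x \<preceq> w" unfolding w_def using x by (intro sup_ge1) auto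
      then have "u \<preceq> w \<oplus> [n] \<cdot> x" using x zw by (simp add: diff_leq_iff)
      moreover have "u \<preceq> w \<oplus> u" using zw leq_add_nonneg[of w u] by (simp add: a_comm)
      ultimately have "u \<preceq> w \<oplus> ?s" using x zw by (simp add: add_inf_left leq_inf_iff)
      moreover have "u \<preceq> u \<oplus> ?s" using leq_add_nonneg[of ?s u] s by simp
      ultimately have "u \<preceq> ?s \<oplus> w \<sqinter> u"
        using s zw add_inf_left[of w u ?s] a_comm[of ?s w] a_comm[of ?s u]
          inf_greatest[of u "?s \<oplus> w" "?s \<oplus> u"] by simp
      then show False using mem JU s zw by (simp add: inf_absorb2)
    qed
    then show ?thesis using J by blast
  qed
  moreover have "\<zero> \<in> I" if "mv_maximal_ideal (Gamma G u) I" for I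
    using that by (auto simp: mv_maximal_ideal_def mv_ideal_def)
  ultimately show ?thesis unfolding semisimple_def by auto
qed

end

section \<open>Extending maps from the unit interval\<close>

context lgroup
begin

abbreviation lsum :: "'a list \<Rightarrow> 'a" where "lsum xs \<equiv> foldr (\<oplus>) xs \<zero>"

lemma lsum_closed [simp]: "set xs \<subseteq> carrier G \<Longrightarrow> lsum xs \<in> carrier G"
  by (induct xs) auto

lemma lsum_append: "set xs \<subseteq> carrier G \<Longrightarrow> set ys \<subseteq> carrier G \<Longrightarrow> lsum (xs @ ys) = lsum xs \<oplus> lsum ys"
  by (induct xs) (auto simp: a_assoc)

lemma lsum_nonneg: "set xs \<subseteq> carrier G \<Longrightarrow> (\<And>x. x \<in> set xs \<Longrightarrow> \<zero> \<preceq> x) \<Longrightarrow> \<zero> \<preceq> lsum xs"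
  by (induct xs) (auto intro!: add_nonneg)

text \<open>The first summand of \<open>a\<close> is \<open>a \<sqinter> b\<close>, and \<open>minus_inf_leq\<close> leaves a rest to which the induction
  hypothesis applies.\<close>

lemma riesz_decomposition:
  assumes "set bs \<subseteq> carrier G" "\<And>b. b \<in> set bs \<Longrightarrow> \<zero> \<preceq> b" "a \<in> carrier G" "\<zero> \<preceq> a" "a \<preceq> lsum bs"
  shows "\<exists>cs. list_all2 (\<lambda>c b. c \<in> carrier G \<and> \<zero> \<preceq> c \<and> c \<preceq> b) cs bs \<and> lsum cs = a"
  using assms
proof (induct bs arbitrary: a)
  case Nil
  then have "a = \<zero>" by (simp add: leq_antisym)
  then show ?case by (intro exI[of _ "[]"]) simp
next
  case (Cons b bs)
  then have b: "b \<in> carrier G" "\<zero> \<preceq> b" and bs: "set bs \<subseteq> carrier G" by auto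
  let ?c = "a \<sqinter> b"
  have c: "?c \<in> carrier G" "\<zero> \<preceq> ?c" "?c \<preceq> b" "?c \<preceq> a"
    using Cons b by (simp_all add: leq_inf_iff inf_le1 inf_le2)
  have "\<zero> \<preceq> lsum bs" using Cons bs by (intro lsum_nonneg) auto
  then have "a \<ominus> ?c \<preceq> lsum bs"
    using Cons b bs by (intro minus_inf_leq) simp_all
  moreover have "\<zero> \<preceq> a \<ominus> ?c" using leq_iff[of ?c a] c Cons by simp
  ultimately obtain cs where cs: "list_all2 (\<lambda>c b. c \<in> carrier G \<and> \<zero> \<preceq> c \<and> c \<preceq> b) cs bs"
    "lsum cs = a \<ominus> ?c"
    using Cons(1)[of "a \<ominus> ?c"] Cons(2-) b bs c by auto
  moreover have "?c \<oplus> (a \<ominus> ?c) = a" using Cons c by (simp add: minus_eq a_lcomm r_neg)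
  ultimately show ?case using c by (intro exI[of _ "?c # cs"]) simp
qed

lemma disjoint_lsum:
  assumes "x \<in> carrier G" "set ys \<subseteq> carrier G" "\<zero> \<preceq> x" "\<And>y. y \<in> set ys \<Longrightarrow> x \<sqinter> y = \<zero>"
  shows "x \<sqinter> lsum ys = \<zero>"
  using assms(2,4)
proof (induct ys)
  case Nil
  then show ?case using assms(1,3) by (simp add: inf_absorb2)
next
  case (Cons y ys)
  then show ?case using assms(1) disjoint_add[of x y "lsum ys"] by simp
qed

lemma disjoint_lsums:
  assumes "set xs \<subseteq> carrier G" "set ys \<subseteq> carrier G" "\<And>y. y \<in> set ys \<Longrightarrow> \<zero> \<preceq> y"
    "\<And>x. x \<in> set xs \<Longrightarrow> \<zero> \<preceq> x" "\<And>x y. x \<in> set xs \<Longrightarrow> y \<in> set ys \<Longrightarrow> x \<sqinter> y = \<zero>"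
  shows "lsum xs \<sqinter> lsum ys = \<zero>"
proof -
  have "lsum ys \<sqinter> x = \<zero>" if "x \<in> set xs" for x
    using disjoint_lsum[of x ys] assms that inf_comm[of "lsum ys" x] by auto
  then show ?thesis
    using disjoint_lsum[of "lsum ys" xs] assms lsum_nonneg[of ys] inf_comm[of "lsum xs" "lsum ys"] by simp
qed

lemma lsum_member_leq:
  assumes "x \<in> set xs" "set xs \<subseteq> carrier G" "\<And>x. x \<in> set xs \<Longrightarrow> \<zero> \<preceq> x"
  shows "x \<preceq> lsum xs"
  using assms
proof (induct xs)
  case (Cons y ys)
  have y: "y \<in> carrier G" "\<zero> \<preceq> y" and ys: "set ys \<subseteq> carrier G" "\<zero> \<preceq> lsum ys"
    using Cons by (auto intro: lsum_nonneg)
  show ?case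
  proof (cases "x = y")
    case True
    then show ?thesis using y ys by (simp add: leq_add_nonneg)
  next
    case False
    then have "x \<in> set ys" using Cons by simp
    then have "x \<preceq> lsum ys" "x \<in> carrier G" using Cons ys by auto
    then show ?thesis using y ys leq_add_nonneg[of y "lsum ys"] leq_trans[of x "lsum ys" "lsum ys \<oplus> y"]
      by (simp add: a_comm)
  qed
qed simp

lemma nonneg_difference:
  assumes "x \<in> carrier G"
  obtains p q where "p \<in> carrier G" "q \<in> carrier G" "\<zero> \<preceq> p" "\<zero> \<preceq> q" "x \<oplus> q = p"
proof
  show "x \<oplus> (\<ominus> x \<squnion> \<zero>) = x \<squnion> \<zero>"
    using assms by (simp add: add_sup_left r_neg sup_comm)
qed (use assms in \<open>simp_all add: sup_ge2\<close>)

end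

context lu_grp
begin

text \<open>Decompose \<open>x\<close> below a multiple of \<open>u\<close>, that is, below a sum of copies of \<open>u\<close>.\<close>

lemma unit_decomposition:
  assumes "x \<in> carrier G" "\<zero> \<preceq> x"
  shows "\<exists>cs. set cs \<subseteq> U \<and> lsum cs = x"
proof -
  obtain n :: nat where n: "x \<preceq> [n] \<cdot> u" using strong_unitE(3)[OF unit assms(1)] by blast
  have "lsum (replicate k u) = [k] \<cdot> u" for k
    by (induct k) (simp_all add: nsmul_Suc a_comm)
  then have "x \<preceq> lsum (replicate n u)" using n by simp
  moreover have "set (replicate n u) \<subseteq> carrier G" "\<And>b. b \<in> set (replicate n u) \<Longrightarrow> \<zero> \<preceq> b"
    by auto
  ultimately obtain cs where
    cs: "list_all2 (\<lambda>c b. c \<in> carrier G \<and> \<zero> \<preceq> c \<and> c \<preceq> b) cs (replicate n u)" "lsum cs = x"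
    using riesz_decomposition[of "replicate n u" x] assms by blast
  have "set cs \<subseteq> U"
    using cs(1) by (auto simp: list_all2_conv_all_nth in_set_conv_nth)
  then show ?thesis using cs by blast
qed

text \<open>The group is generated by the unit interval.\<close>

lemma additive_eqI:
  assumes "abelian_group H" "f \<in> carrier G \<rightarrow> carrier H" "g \<in> carrier G \<rightarrow> carrier H"
    and fadd: "\<And>x y. \<lbrakk>x \<in> carrier G; y \<in> carrier G\<rbrakk> \<Longrightarrow> f (x \<oplus> y) = f x \<oplus>\<^bsub>H\<^esub> f y"
    and gadd: "\<And>x y. \<lbrakk>x \<in> carrier G; y \<in> carrier G\<rbrakk> \<Longrightarrow> g (x \<oplus> y) = g x \<oplus>\<^bsub>H\<^esub> g y"
    and eq: "\<And>x. x \<in> U \<Longrightarrow> f x = g x" and x: "x \<in> carrier G"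
  shows "f x = g x"
proof -
  interpret H: abelian_group H by fact
  have f0: "f \<zero> = \<zero>\<^bsub>H\<^esub>" by (rule additive_zero[OF abelian_group_axioms assms(1,2)]) (rule fadd)
  have g0: "g \<zero> = \<zero>\<^bsub>H\<^esub>" by (rule additive_zero[OF abelian_group_axioms assms(1,3)]) (rule gadd)
  have sums: "f (lsum cs) = g (lsum cs)" if "set cs \<subseteq> U" for cs
    using that
  proof (induct cs)
    case (Cons c cs)
    then have c: "c \<in> U" and cs: "set cs \<subseteq> U" by auto
    then have cl: "c \<in> carrier G" "lsum cs \<in> carrier G" by (auto intro!: lsum_closed)
    show ?case using Cons(1)[OF cs] fadd[OF cl] gadd[OF cl] eq[OF c] by simp
  qed (simp add: f0 g0)
  obtain p q where pq: "p \<in> carrier G" "q \<in> carrier G" "\<zero> \<preceq> p" "\<zero> \<preceq> q" "x \<oplus> q = p"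
    using nonneg_difference[OF x] .
  obtain ps where "set ps \<subseteq> U" "lsum ps = p" using unit_decomposition[OF pq(1,3)] by blast
  then have fp: "f p = g p" using sums by blast
  obtain qs where "set qs \<subseteq> U" "lsum qs = q" using unit_decomposition[OF pq(2,4)] by blast
  then have fq: "f q = g q" using sums by blast
  have "f x \<oplus>\<^bsub>H\<^esub> f q = g x \<oplus>\<^bsub>H\<^esub> f q"
    using fadd[OF x pq(2)] gadd[OF x pq(2)] pq(5) fp fq by simp
  then show ?thesis
    using funcset_mem[OF assms(2) x] funcset_mem[OF assms(3) x] funcset_mem[OF assms(2) pq(2)] by simp
qed

end

text \<open>A map on the unit interval that is additive wherever the sum stays in the unit interval. It
  extends first to sums of elements of the unit interval, then to differences of such sums.\<close>

locale partially_additive = lu_grp G u + H: lgroup H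
  for G :: "('a, 'b) ogroup_scheme" (structure) and u and H :: "('c, 'd) ogroup_scheme" +
  fixes h :: "'a \<Rightarrow> 'c"
  assumes h_closed [simp]: "x \<in> U \<Longrightarrow> h x \<in> carrier H"
    and h_add: "\<lbrakk>x \<in> U; y \<in> U; x \<oplus> y \<preceq> u\<rbrakk> \<Longrightarrow> h (x \<oplus> y) = h x \<oplus>\<^bsub>H\<^esub> h y"
begin

abbreviation hsum where "hsum xs \<equiv> H.lsum (map h xs)"

lemma h_zero: "h \<zero> = \<zero>\<^bsub>H\<^esub>"
proof -
  have "h \<zero> \<oplus>\<^bsub>H\<^esub> h \<zero> = h \<zero>" using h_add[of \<zero> \<zero>] by simp
  then show ?thesis using H.add.r_cancel_one[of "h \<zero>" "h \<zero>"] by simp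
qed

lemma hsum_closed [simp]: "set xs \<subseteq> U \<Longrightarrow> hsum xs \<in> carrier H"
  by (intro H.lsum_closed) auto

lemma U_closed: "set xs \<subseteq> U \<Longrightarrow> set xs \<subseteq> carrier G" "set xs \<subseteq> U \<Longrightarrow> \<zero> \<preceq> lsum xs"
  by (auto intro!: lsum_nonneg)

lemma h_lsum: "set xs \<subseteq> U \<Longrightarrow> lsum xs \<preceq> u \<Longrightarrow> h (lsum xs) = hsum xs"
proof (induct xs)
  case Nil
  then show ?case by (simp add: h_zero)
next
  case (Cons x xs)
  then have x: "x \<in> carrier G" "\<zero> \<preceq> x" "x \<preceq> u" and xs: "set xs \<subseteq> U" by auto
  note xs' = U_closed[OF xs]
  have "lsum xs \<preceq> lsum xs \<oplus> x" using x xs' by (simp add: leq_add_nonneg)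
  then have "lsum xs \<preceq> u"
    using leq_trans[of "lsum xs" "lsum xs \<oplus> x" u] Cons(3) x xs' by (simp add: a_comm)
  then show ?case using Cons(1)[OF xs] h_add[of x "lsum xs"] Cons(3) x xs' by simp
qed

lemma hsum_split:
  assumes "list_all2 (\<lambda>c b. c \<in> carrier G \<and> \<zero> \<preceq> c \<and> c \<preceq> b) cs bs" "set bs \<subseteq> U"
  shows "\<exists>ds. set ds \<subseteq> U \<and> set cs \<subseteq> U \<and> lsum bs = lsum cs \<oplus> lsum ds \<and> hsum bs = hsum cs \<oplus>\<^bsub>H\<^esub> hsum ds"
  using assms
proof (induct rule: list_all2_induct)
  case Nil
  then show ?case by (intro exI[of _ "[]"]) simp
next
  case (Cons c cs b bs)
  then obtain ds where ds: "set ds \<subseteq> U" "set cs \<subseteq> U" "lsum bs = lsum cs \<oplus> lsum ds"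
    "hsum bs = hsum cs \<oplus>\<^bsub>H\<^esub> hsum ds" by auto
  have b: "b \<in> carrier G" "\<zero> \<preceq> b" "b \<preceq> u" and c: "c \<in> carrier G" "\<zero> \<preceq> c" "c \<preceq> b"
    using Cons by auto
  have cu: "c \<preceq> u" using leq_trans[of c b u] b c by simp
  have d: "b \<ominus> c \<in> U"
  proof -
    have "\<zero> \<preceq> b \<ominus> c" using leq_iff[of c b] b c by simp
    moreover have "b \<ominus> c \<preceq> b" using b c by (simp add: diff_leq_iff leq_add_nonneg)
    ultimately show ?thesis using leq_trans[of "b \<ominus> c" b u] b c by simp
  qed
  have bcd: "c \<oplus> (b \<ominus> c) = b" using b c by (simp add: minus_eq a_lcomm r_neg)
  then have "h b = h c \<oplus>\<^bsub>H\<^esub> h (b \<ominus> c)" using h_add[of c "b \<ominus> c"] b c d cu by simp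
  moreover have "h c \<in> carrier H" "h (b \<ominus> c) \<in> carrier H" using c cu d by auto
  ultimately have "h b \<oplus>\<^bsub>H\<^esub> hsum bs = (h c \<oplus>\<^bsub>H\<^esub> hsum cs) \<oplus>\<^bsub>H\<^esub> (h (b \<ominus> c) \<oplus>\<^bsub>H\<^esub> hsum ds)"
    using ds by (simp add: H.a_ac)
  moreover have "b \<oplus> lsum bs = (c \<oplus> lsum cs) \<oplus> ((b \<ominus> c) \<oplus> lsum ds)"
  proof -
    have "(c \<oplus> lsum cs) \<oplus> ((b \<ominus> c) \<oplus> lsum ds) = (c \<oplus> (b \<ominus> c)) \<oplus> (lsum cs \<oplus> lsum ds)"
      using b c U_closed[OF ds(1)] U_closed[OF ds(2)] minus_closed[of b c] by (simp add: a_ac del: minus_closed)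
    then show ?thesis using bcd ds by simp
  qed
  ultimately show ?case using ds d c cu by (intro exI[of _ "(b \<ominus> c) # ds"]) simp
qed

text \<open>By Riesz decomposition, the first summand \<open>x\<close> of \<open>xs\<close> is cut out of \<open>ys\<close>; then \<open>x\<close> is removed from
  both sides.\<close>

lemma hsum_unique: "set xs \<subseteq> U \<Longrightarrow> set ys \<subseteq> U \<Longrightarrow> lsum xs = lsum ys \<Longrightarrow> hsum xs = hsum ys"
proof (induct xs arbitrary: ys)
  case Nil
  then show ?case using h_lsum[of ys] by (simp add: h_zero[symmetric])
next
  case (Cons x xs)
  then have x: "x \<in> carrier G" "\<zero> \<preceq> x" "x \<preceq> u" and xs: "set xs \<subseteq> U" by auto
  note cl = U_closed[OF xs] U_closed[OF Cons(3)]
  have "x \<preceq> lsum ys" using Cons(4) x cl leq_add_nonneg[of "lsum xs" x] by simp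
  then obtain cs where cs: "list_all2 (\<lambda>c b. c \<in> carrier G \<and> \<zero> \<preceq> c \<and> c \<preceq> b) cs ys" "lsum cs = x"
    using riesz_decomposition[of ys x] Cons(3) x cl by auto
  from hsum_split[OF cs(1) Cons(3)] obtain ds where ds: "set ds \<subseteq> U" "set cs \<subseteq> U"
    "lsum ys = lsum cs \<oplus> lsum ds" "hsum ys = hsum cs \<oplus>\<^bsub>H\<^esub> hsum ds" by blast
  have "x \<oplus> lsum xs = x \<oplus> lsum ds" using Cons(4) ds(3) cs(2) by simp
  then have "lsum xs = lsum ds" using x cl U_closed[OF ds(1)] by simp
  then have "hsum xs = hsum ds" using Cons(1)[OF xs ds(1)] by simp
  moreover have "h x = hsum cs" using h_lsum[OF ds(2)] cs(2) x by simp
  ultimately show ?case using ds(4) by simp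
qed

definition pos_ext where "pos_ext x = hsum (SOME xs. set xs \<subseteq> U \<and> lsum xs = x)"

lemma pos_ext_lsum:
  assumes "set xs \<subseteq> U"
  shows "pos_ext (lsum xs) = hsum xs"
proof -
  let ?ys = "SOME ys. set ys \<subseteq> U \<and> lsum ys = lsum xs"
  have "\<exists>ys. set ys \<subseteq> U \<and> lsum ys = lsum xs" using assms by blast
  then have "set ?ys \<subseteq> U \<and> lsum ?ys = lsum xs" by (rule someI_ex)
  then have "hsum ?ys = hsum xs" using assms by (intro hsum_unique) auto
  then show ?thesis unfolding pos_ext_def .
qed

lemma pos_ext_closed: "x \<in> carrier G \<Longrightarrow> \<zero> \<preceq> x \<Longrightarrow> pos_ext x \<in> carrier H"
proof -
  assume "x \<in> carrier G" "\<zero> \<preceq> x"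
  then obtain xs where xs: "set xs \<subseteq> U" "lsum xs = x" using unit_decomposition by blast
  show ?thesis using pos_ext_lsum[OF xs(1)] hsum_closed[OF xs(1)] xs(2) by simp
qed

lemma pos_ext_add:
  assumes "x \<in> carrier G" "\<zero> \<preceq> x" "y \<in> carrier G" "\<zero> \<preceq> y"
  shows "pos_ext (x \<oplus> y) = pos_ext x \<oplus>\<^bsub>H\<^esub> pos_ext y"
proof -
  obtain xs ys where xy: "set xs \<subseteq> U" "lsum xs = x" "set ys \<subseteq> U" "lsum ys = y"
    using unit_decomposition[of x] unit_decomposition[of y] assms by blast
  have "set (map h xs) \<subseteq> carrier H" "set (map h ys) \<subseteq> carrier H" using xy by auto
  then have "hsum (xs @ ys) = hsum xs \<oplus>\<^bsub>H\<^esub> hsum ys" using H.lsum_append by simp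
  moreover have "lsum (xs @ ys) = x \<oplus> y"
    using lsum_append[OF U_closed(1)[OF xy(1)] U_closed(1)[OF xy(3)]] xy by simp
  ultimately show ?thesis
    using pos_ext_lsum[of "xs @ ys"] pos_ext_lsum[of xs] pos_ext_lsum[of ys] xy by simp
qed

definition ext where
  "ext = (\<lambda>x\<in>carrier G. pos_ext (x \<squnion> \<zero>) \<ominus>\<^bsub>H\<^esub> pos_ext (\<ominus> x \<squnion> \<zero>))"

text \<open>The value does not depend on how the argument is written as a difference of positive elements.\<close>

lemma ext_diff:
  assumes "x \<in> carrier G" "p \<in> carrier G" "q \<in> carrier G" "\<zero> \<preceq> p" "\<zero> \<preceq> q" "x \<oplus> q = p"
  shows "ext x \<oplus>\<^bsub>H\<^esub> pos_ext q = pos_ext p"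
proof -
  let ?p = "x \<squnion> \<zero>" and ?q = "\<ominus> x \<squnion> \<zero>"
  have n: "\<zero> \<preceq> ?p" "\<zero> \<preceq> ?q" using assms by (simp_all add: sup_ge2)
  have "x \<oplus> ?q = ?p" using assms by (simp add: add_sup_left r_neg sup_comm)
  then have "?p \<oplus> q = p \<oplus> ?q" using assms a_ac(1)[of x ?q q] a_ac(1)[of x q ?q] a_comm[of ?q q]
    by simp
  then have eq: "pos_ext ?p \<oplus>\<^bsub>H\<^esub> pos_ext q = pos_ext p \<oplus>\<^bsub>H\<^esub> pos_ext ?q"
    using pos_ext_add[of ?p q] pos_ext_add[of p ?q] assms n by simp
  have cl: "pos_ext ?p \<in> carrier H" "pos_ext ?q \<in> carrier H" "pos_ext p \<in> carrier H" "pos_ext q \<in> carrier H"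
    using assms n by (simp_all add: pos_ext_closed)
  have "ext x \<oplus>\<^bsub>H\<^esub> pos_ext q = (pos_ext ?p \<oplus>\<^bsub>H\<^esub> pos_ext q) \<oplus>\<^bsub>H\<^esub> \<ominus>\<^bsub>H\<^esub> pos_ext ?q"
    using cl assms by (simp add: ext_def H.minus_eq H.a_ac)
  also have "\<dots> = pos_ext p" using cl unfolding eq by (simp add: H.a_assoc H.r_neg)
  finally show ?thesis .
qed

lemma ext_closed: "ext \<in> carrier G \<rightarrow>\<^sub>E carrier H"
  unfolding ext_def by (auto simp: sup_ge2 intro!: H.minus_closed pos_ext_closed)

lemma ext_nonneg: "x \<in> carrier G \<Longrightarrow> \<zero> \<preceq> x \<Longrightarrow> ext x = pos_ext x"
  using ext_diff[of x x \<zero>] pos_ext_lsum[of "[]"] PiE_mem[OF ext_closed, of x] by simp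

lemma ext_unit: "x \<in> U \<Longrightarrow> ext x = h x"
  using ext_nonneg[of x] pos_ext_lsum[of "[x]"] by simp

lemma ext_add:
  assumes "x \<in> carrier G" "y \<in> carrier G"
  shows "ext (x \<oplus> y) = ext x \<oplus>\<^bsub>H\<^esub> ext y"
proof -
  obtain p q where p: "p \<in> carrier G" "q \<in> carrier G" "\<zero> \<preceq> p" "\<zero> \<preceq> q" "x \<oplus> q = p"
    using nonneg_difference[OF assms(1)] .
  obtain p' q' where p': "p' \<in> carrier G" "q' \<in> carrier G" "\<zero> \<preceq> p'" "\<zero> \<preceq> q'" "y \<oplus> q' = p'"
    using nonneg_difference[OF assms(2)] .
  have cl: "ext x \<in> carrier H" "ext y \<in> carrier H" "ext (x \<oplus> y) \<in> carrier H"
    "pos_ext q \<in> carrier H" "pos_ext q' \<in> carrier H"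
    using assms p p' PiE_mem[OF ext_closed] by (simp_all add: pos_ext_closed)
  have "(x \<oplus> y) \<oplus> (q \<oplus> q') = p \<oplus> p'"
    unfolding p(5)[symmetric] p'(5)[symmetric] using assms p(2) p'(2) by (simp add: a_ac)
  then have "ext (x \<oplus> y) \<oplus>\<^bsub>H\<^esub> pos_ext (q \<oplus> q') = pos_ext (p \<oplus> p')"
    using assms p p' by (intro ext_diff) (simp_all add: add_nonneg)
  also have "\<dots> = (ext x \<oplus>\<^bsub>H\<^esub> pos_ext q) \<oplus>\<^bsub>H\<^esub> (ext y \<oplus>\<^bsub>H\<^esub> pos_ext q')"
    using ext_diff[OF assms(1) p] ext_diff[OF assms(2) p'] pos_ext_add[of p p'] p p' by simp
  also have "\<dots> = (ext x \<oplus>\<^bsub>H\<^esub> ext y) \<oplus>\<^bsub>H\<^esub> (pos_ext q \<oplus>\<^bsub>H\<^esub> pos_ext q')"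
    using cl by (simp add: H.a_ac)
  finally show ?thesis using pos_ext_add[of q q'] p p' cl by simp
qed

end

locale Gamma_hom = G: lu_grp G u + H: lu_grp H w
  for G :: "('a, 'b) ogroup_scheme" and u and H :: "('c, 'd) ogroup_scheme" and w +
  fixes h assumes mv_map: "mv_map (Gamma G u) (Gamma H w) h"
begin

lemma h_U: "x \<in> G.U \<Longrightarrow> h x \<in> H.U"
  using mv_map by (auto simp: mv_map_def)

lemma h_oplus: "x \<in> G.U \<Longrightarrow> y \<in> G.U \<Longrightarrow> h ((x \<oplus>\<^bsub>G\<^esub> y) \<sqinter>\<^bsub>G\<^esub> u) = (h x \<oplus>\<^bsub>H\<^esub> h y) \<sqinter>\<^bsub>H\<^esub> w"
  and h_neg: "x \<in> G.U \<Longrightarrow> h (u \<ominus>\<^bsub>G\<^esub> x) = w \<ominus>\<^bsub>H\<^esub> h x"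
  and h_zero: "h \<zero>\<^bsub>G\<^esub> = \<zero>\<^bsub>H\<^esub>"
  using mv_map by (simp_all add: mv_map_def)

lemma compl_U: "x \<in> G.U \<Longrightarrow> u \<ominus>\<^bsub>G\<^esub> x \<in> G.U"
  using G.Gamma_mv_algebra unfolding mv_algebra_def by simp

lemma h_unit: "h u = w"
  using h_neg[of "\<zero>\<^bsub>G\<^esub>"] h_zero by (simp add: G.minus_eq H.minus_eq)

lemma h_add:
  assumes "x \<in> G.U" "y \<in> G.U" "x \<oplus>\<^bsub>G\<^esub> y \<preceq>\<^bsub>G\<^esub> u"
  shows "h (x \<oplus>\<^bsub>G\<^esub> y) = h x \<oplus>\<^bsub>H\<^esub> h y"
proof -
  have x: "x \<in> carrier G" "y \<in> carrier G" and hx: "h x \<in> carrier H" "h y \<in> carrier H"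
    using assms h_U by auto
  have "mv_summable (Gamma G u) x y" using assms G.Gamma_summable x by blast
  then have "(u \<ominus>\<^bsub>G\<^esub> x \<oplus>\<^bsub>G\<^esub> (u \<ominus>\<^bsub>G\<^esub> y)) \<sqinter>\<^bsub>G\<^esub> u = u"
    by (simp add: mv_summable_def mv_le_def)
  then have "(w \<ominus>\<^bsub>H\<^esub> h x \<oplus>\<^bsub>H\<^esub> (w \<ominus>\<^bsub>H\<^esub> h y)) \<sqinter>\<^bsub>H\<^esub> w = w"
    using h_oplus[OF compl_U[OF assms(1)] compl_U[OF assms(2)]] h_neg assms h_unit by simp
  then have "mv_summable (Gamma H w) (h x) (h y)"
    by (simp add: mv_summable_def mv_le_def)
  then have "h x \<oplus>\<^bsub>H\<^esub> h y \<preceq>\<^bsub>H\<^esub> w" using H.Gamma_summable hx by blast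
  then show ?thesis
    using h_oplus[OF assms(1,2)] assms(3) x hx by (simp add: G.inf_absorb1 H.inf_absorb1)
qed

sublocale partially_additive G u H h
proof unfold_locales
  show "h x \<in> carrier H" if "x \<in> G.U" for x using h_U[OF that] by simp
qed (rule h_add)

text \<open>Elements of the unit interval are disjoint iff the truncated difference \<open>(x\<^sup>* \<oplus> y)\<^sup>*\<close> is \<open>x\<close>, and
  this is preserved by homomorphisms of MV-algebras.\<close>

lemma h_disjoint:
  assumes "x \<in> G.U" "y \<in> G.U" "x \<sqinter>\<^bsub>G\<^esub> y = \<zero>\<^bsub>G\<^esub>"
  shows "h x \<sqinter>\<^bsub>H\<^esub> h y = \<zero>\<^bsub>H\<^esub>"
proof -
  have x: "x \<in> carrier G" "y \<in> carrier G" and hx: "h x \<in> carrier H" "h y \<in> carrier H"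
    using assms h_U by auto
  let ?a = "(u \<ominus>\<^bsub>G\<^esub> x \<oplus>\<^bsub>G\<^esub> y) \<sqinter>\<^bsub>G\<^esub> u"
  have a: "?a \<in> G.U" using G.Gamma_mv_algebra compl_U[OF assms(1)] assms(2) unfolding mv_algebra_def by simp
  have "u \<ominus>\<^bsub>G\<^esub> ?a = x"
    using G.truncated_minus[OF x] G.pos_part_diff_disjoint[OF x assms(3)] by simp
  then have "h x = w \<ominus>\<^bsub>H\<^esub> h ?a" using h_neg[OF a] by simp
  also have "h ?a = (w \<ominus>\<^bsub>H\<^esub> h x \<oplus>\<^bsub>H\<^esub> h y) \<sqinter>\<^bsub>H\<^esub> w"
    using h_oplus[OF compl_U[OF assms(1)] assms(2)] h_neg[OF assms(1)] by simp
  also have "w \<ominus>\<^bsub>H\<^esub> \<dots> = (h x \<ominus>\<^bsub>H\<^esub> h y) \<squnion>\<^bsub>H\<^esub> \<zero>\<^bsub>H\<^esub>"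
    using H.truncated_minus[OF hx] .
  also have "\<dots> = h x \<ominus>\<^bsub>H\<^esub> (h x \<sqinter>\<^bsub>H\<^esub> h y)"
    using H.minus_inf_self[OF hx] by (simp add: H.sup_comm)
  finally have "h x \<oplus>\<^bsub>H\<^esub> \<ominus>\<^bsub>H\<^esub> (h x \<sqinter>\<^bsub>H\<^esub> h y) = h x" by (simp add: H.minus_eq)
  then have "\<ominus>\<^bsub>H\<^esub> (h x \<sqinter>\<^bsub>H\<^esub> h y) = \<zero>\<^bsub>H\<^esub>" using hx by (simp add: H.add.r_cancel_one)
  then show ?thesis using hx H.minus_minus[of "h x \<sqinter>\<^bsub>H\<^esub> h y"] by simp
qed

text \<open>Summands of disjoint positive elements are disjoint, so disjointness of sums reduces to that of
  elements of the unit interval, which \<open>h\<close> preserves.\<close>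

lemma ext_l_hom: "ext \<in> l_hom G H"
proof (rule l_hom_disjointI[OF G.l_group H.l_group ext_closed ext_add])
  fix x y assume x: "x \<in> carrier G" "y \<in> carrier G" "x \<sqinter>\<^bsub>G\<^esub> y = \<zero>\<^bsub>G\<^esub>"
  then have nn: "\<zero>\<^bsub>G\<^esub> \<preceq>\<^bsub>G\<^esub> x" "\<zero>\<^bsub>G\<^esub> \<preceq>\<^bsub>G\<^esub> y"
    using G.inf_le1[of x y] G.inf_le2[of x y] by simp_all
  then obtain xs ys where xy: "set xs \<subseteq> G.U" "G.lsum xs = x" "set ys \<subseteq> G.U" "G.lsum ys = y"
    using G.unit_decomposition[of x] G.unit_decomposition[of y] x by blast
  have "h a \<sqinter>\<^bsub>H\<^esub> h b = \<zero>\<^bsub>H\<^esub>" if ab: "a \<in> set xs" "b \<in> set ys" for a b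
  proof -
    have U: "a \<in> G.U" "b \<in> G.U" using ab xy by auto
    have "a \<preceq>\<^bsub>G\<^esub> x" "b \<preceq>\<^bsub>G\<^esub> y"
      using G.lsum_member_leq[OF ab(1)] G.lsum_member_leq[OF ab(2)] xy by auto
    then have "a \<sqinter>\<^bsub>G\<^esub> b \<preceq>\<^bsub>G\<^esub> x" "a \<sqinter>\<^bsub>G\<^esub> b \<preceq>\<^bsub>G\<^esub> y"
      using G.leq_trans[of "a \<sqinter>\<^bsub>G\<^esub> b" a x] G.leq_trans[of "a \<sqinter>\<^bsub>G\<^esub> b" b y] U x
      by (simp_all add: G.inf_le1 G.inf_le2)
    then have "a \<sqinter>\<^bsub>G\<^esub> b \<preceq>\<^bsub>G\<^esub> \<zero>\<^bsub>G\<^esub>" using G.inf_greatest[of "a \<sqinter>\<^bsub>G\<^esub> b" x y] U x by simp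
    moreover have "\<zero>\<^bsub>G\<^esub> \<preceq>\<^bsub>G\<^esub> a \<sqinter>\<^bsub>G\<^esub> b" using U by (simp add: G.leq_inf_iff)
    ultimately have "a \<sqinter>\<^bsub>G\<^esub> b = \<zero>\<^bsub>G\<^esub>" using G.leq_antisym U by simp
    then show ?thesis using h_disjoint U by blast
  qed
  moreover have "set (map h xs) \<subseteq> carrier H" "set (map h ys) \<subseteq> carrier H" using xy h_U by auto
  moreover have "\<zero>\<^bsub>H\<^esub> \<preceq>\<^bsub>H\<^esub> b" if "b \<in> set (map h xs) \<or> b \<in> set (map h ys)" for b
    using that xy h_U by auto
  ultimately have "hsum xs \<sqinter>\<^bsub>H\<^esub> hsum ys = \<zero>\<^bsub>H\<^esub>"
    by (intro H.disjoint_lsums) auto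
  then show "ext x \<sqinter>\<^bsub>H\<^esub> ext y = \<zero>\<^bsub>H\<^esub>"
    using ext_nonneg x nn pos_ext_lsum[OF xy(1)] pos_ext_lsum[OF xy(3)] xy by simp
qed

end

section \<open>The Archimedean tensor product\<close>

lemma l_hom_compose:
  assumes "l_group G" "l_group H" "f \<in> l_hom G H" "g \<in> l_hom H K"
  shows "compose (carrier G) g f \<in> l_hom G K"
proof -
  interpret G: lgroup G by (rule lgroup.intro) fact
  interpret f: lgroup_hom G H f
    by (intro lgroup_hom.intro lgroup.intro lgroup_hom_axioms.intro assms)
  show ?thesis
    using assms(4) unfolding l_hom_def compose_def
    by (auto simp: f.add f.sup f.inf intro: f.closed)
qed

lemma l_hom_id: "l_group G \<Longrightarrow> (\<lambda>x\<in>carrier G. x) \<in> l_hom G G"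
  using lgroup.sup_closed[OF lgroup.intro, of G] lgroup.inf_closed[OF lgroup.intro, of G]
    abelian_groupE(1)[of G]
  by (auto simp: l_hom_def l_group_def)

primrec leval :: "('l, 'd) ogroup_scheme \<Rightarrow> ('g \<Rightarrow> 'h \<Rightarrow> 'l) \<Rightarrow> ('g, 'h) lterm \<Rightarrow> 'l" where
  "leval L \<beta> (Pure g h) = \<beta> g h"
| "leval L \<beta> LZero = \<zero>\<^bsub>L\<^esub>"
| "leval L \<beta> (LAdd s t) = leval L \<beta> s \<oplus>\<^bsub>L\<^esub> leval L \<beta> t"
| "leval L \<beta> (LNeg t) = \<ominus>\<^bsub>L\<^esub> leval L \<beta> t"
| "leval L \<beta> (LSup s t) = leval L \<beta> s \<squnion>\<^bsub>L\<^esub> leval L \<beta> t"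

primrec terms_over :: "'g set \<Rightarrow> 'h set \<Rightarrow> ('g, 'h) lterm \<Rightarrow> bool" where
  "terms_over A B (Pure g h) \<longleftrightarrow> g \<in> A \<and> h \<in> B"
| "terms_over A B LZero \<longleftrightarrow> True"
| "terms_over A B (LAdd s t) \<longleftrightarrow> terms_over A B s \<and> terms_over A B t"
| "terms_over A B (LNeg t) \<longleftrightarrow> terms_over A B t"
| "terms_over A B (LSup s t) \<longleftrightarrow> terms_over A B s \<and> terms_over A B t"

definition generated :: "'g set \<Rightarrow> 'h set \<Rightarrow> ('l, 'd) ogroup_scheme \<Rightarrow> ('g \<Rightarrow> 'h \<Rightarrow> 'l) \<Rightarrow> 'l set" where
  "generated A B L \<beta> = leval L \<beta> ` {t. terms_over A B t}"

lemma leval_closed: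
  assumes "l_group L" "\<And>g h. g \<in> A \<Longrightarrow> h \<in> B \<Longrightarrow> \<beta> g h \<in> carrier L" "terms_over A B t"
  shows "leval L \<beta> t \<in> carrier L"
proof -
  interpret lgroup L by (rule lgroup.intro) fact
  show ?thesis using assms(3) by (induct t) (simp_all add: assms(2))
qed

lemma generated_sub_lgroup:
  assumes "l_group L" "\<And>g h. g \<in> A \<Longrightarrow> h \<in> B \<Longrightarrow> \<beta> g h \<in> carrier L"
  shows "sub_lgroup (generated A B L \<beta>) L"
proof -
  have "leval L \<beta> s \<oplus>\<^bsub>L\<^esub> leval L \<beta> t \<in> generated A B L \<beta>" "leval L \<beta> s \<squnion>\<^bsub>L\<^esub> leval L \<beta> t \<in> generated A B L \<beta>"
    "\<ominus>\<^bsub>L\<^esub> leval L \<beta> s \<in> generated A B L \<beta>"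
    if "terms_over A B s" "terms_over A B t" for s t
    using that imageI[of "LAdd s t" "{t. terms_over A B t}" "leval L \<beta>"]
      imageI[of "LSup s t" "{t. terms_over A B t}" "leval L \<beta>"]
      imageI[of "LNeg s" "{t. terms_over A B t}" "leval L \<beta>"]
    by (simp_all add: generated_def)
  moreover have "\<zero>\<^bsub>L\<^esub> \<in> generated A B L \<beta>"
    using imageI[of LZero "{t. terms_over A B t}" "leval L \<beta>"] by (simp add: generated_def)
  moreover have "generated A B L \<beta> \<subseteq> carrier L"
    using leval_closed[OF assms] by (auto simp: generated_def)
  ultimately show ?thesis unfolding sub_lgroup_def by (auto simp: generated_def)
qed

lemma l_hom_leval:
  assumes "l_group L" "l_group L'" "f \<in> l_hom L L'"
    and "\<And>g h. g \<in> A \<Longrightarrow> h \<in> B \<Longrightarrow> \<beta> g h \<in> carrier L \<and> f (\<beta> g h) = \<beta>' g h"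
    and "terms_over A B t"
  shows "f (leval L \<beta> t) = leval L' \<beta>' t"
proof -
  interpret f: lgroup_hom L L' f
    by (intro lgroup_hom.intro lgroup.intro lgroup_hom_axioms.intro assms)
  have "leval L \<beta> t \<in> carrier L \<and> f (leval L \<beta> t) = leval L' \<beta>' t"
    using assms(5) by (induct t) (simp_all add: assms(4) f.add f.sup f.minus f.zero)
  then show ?thesis ..
qed

lemma l_hom_eq_on_generated:
  assumes "l_group L" "l_group L'" "f \<in> l_hom L L'" "f' \<in> l_hom L L'"
    and closed: "\<And>g h. g \<in> A \<Longrightarrow> h \<in> B \<Longrightarrow> \<beta> g h \<in> carrier L"
    and eq: "\<And>g h. g \<in> A \<Longrightarrow> h \<in> B \<Longrightarrow> f (\<beta> g h) = f' (\<beta> g h)"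
    and gen: "carrier L = generated A B L \<beta>"
  shows "f = f'"
proof (rule extensionalityI[of _ "carrier L"])
  show "f \<in> extensional (carrier L)" "f' \<in> extensional (carrier L)"
    using assms(3,4) by (auto simp: l_hom_def PiE_def)
  fix x assume "x \<in> carrier L"
  then obtain t where t: "terms_over A B t" "x = leval L \<beta> t" unfolding gen generated_def by blast
  have "f x = leval L' (\<lambda>g h. f' (\<beta> g h)) t"
    unfolding t(2) by (rule l_hom_leval[OF assms(1-3) _ t(1)]) (simp add: closed eq)
  also have "\<dots> = f' x"
    unfolding t(2) by (rule sym, rule l_hom_leval[OF assms(1,2,4) _ t(1)]) (simp add: closed)
  finally show "f x = f' x" .
qed

lemma bimorphism_closed:
  "bimorphism G H L \<beta> \<Longrightarrow> g \<in> carrier G \<Longrightarrow> h \<in> carrier H \<Longrightarrow> \<beta> g h \<in> carrier L"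
  by (simp add: bimorphism_def)

text \<open>An element of the \<open>\<ell>\<close>-group generated by the image of a bimorphism is represented by the set of
  all terms that evaluate to it. This copy makes it possible to replace test objects of any type by
  test objects in the type of sets of terms.\<close>

locale bimorphism_image = G: lgroup G + H: lgroup H + L: lgroup L
  for G :: "('g, 'b) ogroup_scheme" and H :: "('h, 'c) ogroup_scheme" and L :: "('l, 'd) ogroup_scheme" +
  fixes \<beta> assumes bi: "bimorphism G H L \<beta>"
begin

definition "label x = {t. terms_over (carrier G) (carrier H) t \<and> leval L \<beta> t = x}"

abbreviation "gen \<equiv> generated (carrier G) (carrier H) L \<beta>"

lemma label_inj: "inj_on label gen"
proof (rule inj_onI)
  fix x y assume "x \<in> gen" "label x = label y"
  then obtain t where "t \<in> label x" "leval L \<beta> t = x" by (auto simp: generated_def label_def)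
  with \<open>label x = label y\<close> show "x = y" by (simp add: label_def)
qed

sublocale transported L gen label
  by unfold_locales
     (use bimorphism_closed[OF bi] in \<open>auto intro!: generated_sub_lgroup L.l_group label_inj\<close>)

lemma pure_in_gen: "g \<in> carrier G \<Longrightarrow> h \<in> carrier H \<Longrightarrow> \<beta> g h \<in> gen"
  using imageI[of "Pure g h" "{t. terms_over (carrier G) (carrier H) t}" "leval L \<beta>"]
  by (simp add: generated_def)

lemma label_bimorphism: "bimorphism G H T (\<lambda>g h. label (\<beta> g h))"
  using bi unfolding bimorphism_def
  by (simp add: transport_add transport_sup transport_inf pure_in_gen)

definition "unlabel = (\<lambda>y\<in>carrier T. inv_into gen label y)"

lemma unlabel_hom: "unlabel \<in> l_hom T L"
  unfolding unlabel_def by (rule transport_inv_hom)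

lemma unlabel_label: "g \<in> carrier G \<Longrightarrow> h \<in> carrier H \<Longrightarrow> unlabel (label (\<beta> g h)) = \<beta> g h"
  using pure_in_gen[of g h] label_inj by (simp add: unlabel_def)

lemma label_generated: "carrier T = generated (carrier G) (carrier H) T (\<lambda>g h. label (\<beta> g h))"
proof -
  have *: "leval L \<beta> t \<in> gen \<and> leval T (\<lambda>g h. label (\<beta> g h)) t = label (leval L \<beta> t)"
    if "terms_over (carrier G) (carrier H) t" for t
    using that
    by (induct t) (simp_all add: pure_in_gen transport_add transport_sup transport_minus transport_zero)
  have "carrier T = (\<lambda>t. label (leval L \<beta> t)) ` {t. terms_over (carrier G) (carrier H) t}"
    unfolding transport_carrier by (subst generated_def) (rule image_image)
  also have "\<dots> = generated (carrier G) (carrier H) T (\<lambda>g h. label (\<beta> g h))"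
    unfolding generated_def[of _ _ T] using * by (intro image_cong) simp_all
  finally show ?thesis .
qed

end

lemma bimorphism_imageI:
  "l_group G \<Longrightarrow> l_group H \<Longrightarrow> l_group L \<Longrightarrow> bimorphism G H L \<beta> \<Longrightarrow> bimorphism_image G H L \<beta>"
  by (intro bimorphism_image.intro lgroup.intro bimorphism_image_axioms.intro)

text \<open>The test objects in the type of sets of terms form a set, so there is a diagonal bimorphism \<open>\<delta>\<close>
  into their product. What it generates there is again Archimedean, is mapped to every test object by
  a projection, and admits no other homomorphism with the given values because it is generated by
  the image of \<open>\<delta>\<close>.\<close>

lemma universal_bimorphism_exists:
  fixes G :: "('g, 'b) ogroup_scheme" and H :: "('h, 'c) ogroup_scheme"
  assumes G: "l_group G" and H: "l_group H"
  shows "\<exists>(T :: ('g, 'h) lterm set ogroup) \<tau>.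
    universal_bimorphism TYPE(('g, 'h) lterm set) G H T \<tau>"
proof -
  interpret G: lgroup G by (rule lgroup.intro) fact
  interpret H: lgroup H by (rule lgroup.intro) fact
  define I :: "(('g, 'h) lterm set ogroup \<times> ('g \<Rightarrow> 'h \<Rightarrow> ('g, 'h) lterm set)) set"
    where "I = {(L, \<beta>). l_group L \<and> archimedean L \<and> bimorphism G H L \<beta>}"
  let ?\<Pi> = "prod_group I fst"
  define \<delta> where "\<delta> g h = (\<lambda>i\<in>I. snd i g h)" for g h
  have I: "l_group (fst i)" "archimedean (fst i)" "bimorphism G H (fst i) (snd i)" if "i \<in> I" for i
    using that by (auto simp: I_def)
  have lg: "l_group ?\<Pi>" and arch: "archimedean ?\<Pi>"
    using prod_group_l_group[of I fst] prod_group_archimedean[of I fst] I by blast+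
  interpret \<Pi>: lgroup ?\<Pi> by (rule lgroup.intro) fact
  have \<delta>: "\<delta> g h \<in> carrier ?\<Pi>" if "g \<in> carrier G" "h \<in> carrier H" for g h
    using that bimorphism_closed[OF I(3)] by (auto simp: \<delta>_def prod_group_simps)
  have sup: "(\<delta> g h \<squnion>\<^bsub>?\<Pi>\<^esub> \<delta> g' h') = (\<lambda>i\<in>I. snd i g h \<squnion>\<^bsub>fst i\<^esub> snd i g' h')"
    if "g \<in> carrier G" "h \<in> carrier H" "g' \<in> carrier G" "h' \<in> carrier H" for g h g' h'
    using prod_group_sup[of I fst, OF I(1) \<delta>[OF that(1,2)] \<delta>[OF that(3,4)]]
    by (auto simp: \<delta>_def intro!: restrict_ext)
  have inf: "(\<delta> g h \<sqinter>\<^bsub>?\<Pi>\<^esub> \<delta> g' h') = (\<lambda>i\<in>I. snd i g h \<sqinter>\<^bsub>fst i\<^esub> snd i g' h')"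
    if c: "g \<in> carrier G" "h \<in> carrier H" "g' \<in> carrier G" "h' \<in> carrier H" for g h g' h'
  proof (rule PiE_ext)
    show "(\<delta> g h \<sqinter>\<^bsub>?\<Pi>\<^esub> \<delta> g' h') \<in> (\<Pi>\<^sub>E i\<in>I. carrier (fst i))"
      using \<Pi>.inf_closed[OF \<delta>[OF c(1,2)] \<delta>[OF c(3,4)]] by (simp add: prod_group_simps)
    show "(\<lambda>i\<in>I. snd i g h \<sqinter>\<^bsub>fst i\<^esub> snd i g' h') \<in> (\<Pi>\<^sub>E i\<in>I. carrier (fst i))"
      using c bimorphism_closed[OF I(3)] lgroup.inf_closed[OF lgroup.intro[OF I(1)]] by auto
    fix i assume i: "i \<in> I"
    have p: "(\<lambda>x\<in>carrier ?\<Pi>. x i) \<in> l_hom ?\<Pi> (fst i)"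
      using prod_group_projection[of I fst] I(1) i by blast
    interpret p: lgroup_hom ?\<Pi> "fst i" "\<lambda>x\<in>carrier ?\<Pi>. x i"
      by (intro lgroup_hom.intro lgroup.intro lgroup_hom_axioms.intro lg I(1)[OF i] p)
    show "(\<delta> g h \<sqinter>\<^bsub>?\<Pi>\<^esub> \<delta> g' h') i = (\<lambda>i\<in>I. snd i g h \<sqinter>\<^bsub>fst i\<^esub> snd i g' h') i"
      using p.inf[OF \<delta>[OF c(1,2)] \<delta>[OF c(3,4)]] i \<delta>[OF c(1,2)] \<delta>[OF c(3,4)] \<Pi>.inf_closed[OF \<delta>[OF c(1,2)] \<delta>[OF c(3,4)]]
      by (simp add: \<delta>_def)
  qed
  have bi: "bimorphism G H ?\<Pi> \<delta>"
    unfolding bimorphism_def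
  proof (intro conjI ballI impI)
    fix g h assume gh: "g \<in> carrier G" "h \<in> carrier H"
    then show "\<delta> g h \<in> carrier ?\<Pi>" by (rule \<delta>)
    {
      fix g' assume g': "g' \<in> carrier G"
      show "\<delta> (g \<oplus>\<^bsub>G\<^esub> g') h = \<delta> g h \<oplus>\<^bsub>?\<Pi>\<^esub> \<delta> g' h"
        using gh g' I(3) unfolding bimorphism_def
        by (auto simp: \<delta>_def prod_group_simps intro!: restrict_ext)
      assume "\<zero>\<^bsub>H\<^esub> \<preceq>\<^bsub>H\<^esub> h"
      then show "\<delta> (g \<squnion>\<^bsub>G\<^esub> g') h = \<delta> g h \<squnion>\<^bsub>?\<Pi>\<^esub> \<delta> g' h" "\<delta> (g \<sqinter>\<^bsub>G\<^esub> g') h = \<delta> g h \<sqinter>\<^bsub>?\<Pi>\<^esub> \<delta> g' h"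
        using gh g' I(3) unfolding bimorphism_def sup[OF gh g' gh(2)] inf[OF gh g' gh(2)]
        by (auto simp: \<delta>_def intro!: restrict_ext)
    }
    {
      fix h' assume h': "h' \<in> carrier H"
      show "\<delta> g (h \<oplus>\<^bsub>H\<^esub> h') = \<delta> g h \<oplus>\<^bsub>?\<Pi>\<^esub> \<delta> g h'"
        using gh h' I(3) unfolding bimorphism_def
        by (auto simp: \<delta>_def prod_group_simps intro!: restrict_ext)
      assume "\<zero>\<^bsub>G\<^esub> \<preceq>\<^bsub>G\<^esub> g"
      then show "\<delta> g (h \<squnion>\<^bsub>H\<^esub> h') = \<delta> g h \<squnion>\<^bsub>?\<Pi>\<^esub> \<delta> g h'" "\<delta> g (h \<sqinter>\<^bsub>H\<^esub> h') = \<delta> g h \<sqinter>\<^bsub>?\<Pi>\<^esub> \<delta> g h'"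
        using gh h' I(3) unfolding bimorphism_def sup[OF gh gh(1) h'] inf[OF gh gh(1) h']
        by (auto simp: \<delta>_def intro!: restrict_ext)
    }
  qed
  interpret im: bimorphism_image G H ?\<Pi> \<delta>
    by (rule bimorphism_imageI[OF G H lg bi])
  let ?\<tau> = "\<lambda>g h. im.label (\<delta> g h)"
  have "universal_bimorphism TYPE(('g, 'h) lterm set) G H im.T ?\<tau>"
    unfolding universal_bimorphism_def
  proof (intro conjI allI impI)
    show "l_group im.T" by (rule im.transport_l_group)
    show "archimedean im.T" by (rule im.transport_archimedean[OF arch])
    show "bimorphism G H im.T ?\<tau>" by (rule im.label_bimorphism)
    fix L :: "('g, 'h) lterm set ogroup" and \<beta> assume L: "l_group L \<and> archimedean L \<and> bimorphism G H L \<beta>"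
    then have i: "(L, \<beta>) \<in> I" by (simp add: I_def)
    have "(\<lambda>x\<in>carrier ?\<Pi>. x (L, \<beta>)) \<in> l_hom ?\<Pi> L"
      using prod_group_projection[of I fst, OF I(1) i] by simp
    then have hom: "compose (carrier im.T) (\<lambda>x\<in>carrier ?\<Pi>. x (L, \<beta>)) im.unlabel \<in> l_hom im.T L"
      by (rule l_hom_compose[OF im.transport_l_group lg im.unlabel_hom])
    have tc: "?\<tau> g h \<in> carrier im.T" if "g \<in> carrier G" "h \<in> carrier H" for g h
      using bimorphism_closed[OF im.label_bimorphism that] .
    have val: "compose (carrier im.T) (\<lambda>x\<in>carrier ?\<Pi>. x (L, \<beta>)) im.unlabel (?\<tau> g h) = \<beta> g h"
      if "g \<in> carrier G" "h \<in> carrier H" for g h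
      using tc[OF that] \<delta>[OF that] im.unlabel_label[OF that] i by (simp add: compose_eq \<delta>_def)
    show "\<exists>!f. f \<in> l_hom im.T L \<and> (\<forall>g\<in>carrier G. \<forall>h\<in>carrier H. f (?\<tau> g h) = \<beta> g h)"
    proof (rule ex1I, intro conjI ballI)
      fix f assume f: "f \<in> l_hom im.T L \<and> (\<forall>g\<in>carrier G. \<forall>h\<in>carrier H. f (?\<tau> g h) = \<beta> g h)"
      show "f = compose (carrier im.T) (\<lambda>x\<in>carrier ?\<Pi>. x (L, \<beta>)) im.unlabel"
        by (rule l_hom_eq_on_generated[OF im.transport_l_group _ _ hom tc _ im.label_generated])
           (use f L val in auto)
    qed (rule hom, rule val)
  qed
  then show ?thesis by blast
qed

locale tensor = G: lgroup G + H: lgroup H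
  for G :: "('g, 'b) ogroup_scheme" and H :: "('h, 'c) ogroup_scheme"
begin

abbreviation "T \<equiv> tensor_group G H"
abbreviation "\<tau> \<equiv> pure_tensor G H"

lemma universal: "universal_bimorphism TYPE(('g, 'h) lterm set) G H T \<tau>"
proof -
  have "\<exists>X :: ('g, 'h) lterm set ogroup \<times> ('g \<Rightarrow> 'h \<Rightarrow> ('g, 'h) lterm set). case X of (S, \<sigma>) \<Rightarrow> universal_bimorphism TYPE(('g, 'h) lterm set) G H S \<sigma>"
    using universal_bimorphism_exists[OF G.l_group H.l_group] by auto
  from someI_ex[OF this] show ?thesis
    unfolding arch_tensor_def by (simp add: case_prod_unfold)
qed

lemma T_l_group: "l_group T" and T_archimedean: "archimedean T" and bimorphism: "bimorphism G H T \<tau>"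
  using universal by (simp_all add: universal_bimorphism_def)

sublocale T: lgroup T
  by (rule lgroup.intro) (rule T_l_group)

lemma pure_closed [simp]: "g \<in> carrier G \<Longrightarrow> h \<in> carrier H \<Longrightarrow> \<tau> g h \<in> carrier T"
  by (rule bimorphism_closed[OF bimorphism])

text \<open>The sub-\<open>\<ell>\<close>-group generated by the pure tensors is a test object. The homomorphism into it,
  followed by the inclusion, fixes the pure tensors, so it is the identity and the inclusion is onto.\<close>

lemma generated: "carrier T = generated (carrier G) (carrier H) T \<tau>"
proof -
  interpret im: bimorphism_image G H T \<tau>
    by (rule bimorphism_imageI[OF G.l_group H.l_group T_l_group bimorphism])
  have "\<exists>!f. f \<in> l_hom T im.T \<and> (\<forall>g\<in>carrier G. \<forall>h\<in>carrier H. f (\<tau> g h) = im.label (\<tau> g h))"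
    using universal im.transport_l_group im.transport_archimedean[OF T_archimedean] im.label_bimorphism
    unfolding universal_bimorphism_def by blast
  then obtain f where f: "f \<in> l_hom T im.T"
    "\<And>g h. g \<in> carrier G \<Longrightarrow> h \<in> carrier H \<Longrightarrow> f (\<tau> g h) = im.label (\<tau> g h)" by blast
  have hom: "compose (carrier T) im.unlabel f \<in> l_hom T T"
    by (rule l_hom_compose[OF T_l_group im.transport_l_group f(1) im.unlabel_hom])
  have val: "compose (carrier T) im.unlabel f (\<tau> g h) = \<tau> g h"
    if "g \<in> carrier G" "h \<in> carrier H" for g h
    using that f(2) im.unlabel_label by (simp add: compose_eq)
  have "\<exists>!f. f \<in> l_hom T T \<and> (\<forall>g\<in>carrier G. \<forall>h\<in>carrier H. f (\<tau> g h) = \<tau> g h)"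
    using universal T_l_group T_archimedean bimorphism unfolding universal_bimorphism_def by blast
  then have unique: "f1 = f2" if "f1 \<in> l_hom T T \<and> (\<forall>g\<in>carrier G. \<forall>h\<in>carrier H. f1 (\<tau> g h) = \<tau> g h)"
    "f2 \<in> l_hom T T \<and> (\<forall>g\<in>carrier G. \<forall>h\<in>carrier H. f2 (\<tau> g h) = \<tau> g h)" for f1 f2
    using that by blast
  \<comment> \<open>both sides are endomorphisms of \<open>T\<close> that fix the pure tensors\<close>
  have eq: "compose (carrier T) im.unlabel f = (\<lambda>x\<in>carrier T. x)"
    by (rule unique) (use hom val l_hom_id[OF T_l_group] in simp_all)
  have "carrier T \<subseteq> im.gen"
  proof
    fix x assume x: "x \<in> carrier T"
    have "f x \<in> carrier im.T" using f(1) x by (auto simp: l_hom_def)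
    then have "im.unlabel (f x) \<in> im.gen" using inv_into_into[of "f x" im.label im.gen] by (simp add: im.unlabel_def)
    moreover have "im.unlabel (f x) = x" using fun_cong[OF eq, of x] x by (simp add: compose_eq)
    ultimately show "x \<in> im.gen" by simp
  qed
  moreover have "im.gen \<subseteq> carrier T" using im.sub by (simp add: sub_lgroup_def)
  ultimately show ?thesis by blast
qed

lemma l_hom_eqI:
  assumes "l_group L" "f \<in> l_hom T L" "f' \<in> l_hom T L"
    and "\<And>g h. g \<in> carrier G \<Longrightarrow> h \<in> carrier H \<Longrightarrow> f (\<tau> g h) = f' (\<tau> g h)"
  shows "f = f'"
  by (rule l_hom_eq_on_generated[OF T_l_group assms(1-3) pure_closed assms(4) generated])

text \<open>A test object of any type may be replaced by the copy of what the bimorphism generates in it.\<close>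

lemma lift_exists:
  assumes L: "l_group L" "archimedean L" and bi: "bimorphism G H L \<beta>"
  shows "\<exists>f\<in>l_hom T L. \<forall>g\<in>carrier G. \<forall>h\<in>carrier H. f (\<tau> g h) = \<beta> g h"
proof -
  interpret im: bimorphism_image G H L \<beta>
    by (rule bimorphism_imageI[OF G.l_group H.l_group L(1) bi])
  have "\<exists>!f. f \<in> l_hom T im.T \<and> (\<forall>g\<in>carrier G. \<forall>h\<in>carrier H. f (\<tau> g h) = im.label (\<beta> g h))"
    using universal im.transport_l_group im.transport_archimedean[OF L(2)] im.label_bimorphism
    unfolding universal_bimorphism_def by blast
  then obtain f where f: "f \<in> l_hom T im.T"
    "\<And>g h. g \<in> carrier G \<Longrightarrow> h \<in> carrier H \<Longrightarrow> f (\<tau> g h) = im.label (\<beta> g h)" by blast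
  have "compose (carrier T) im.unlabel f \<in> l_hom T L"
    by (rule l_hom_compose[OF T_l_group im.transport_l_group f(1) im.unlabel_hom])
  moreover have "compose (carrier T) im.unlabel f (\<tau> g h) = \<beta> g h"
    if "g \<in> carrier G" "h \<in> carrier H" for g h
    using that f(2) im.unlabel_label by (simp add: compose_eq)
  ultimately show ?thesis by blast
qed

lemma T_induct [consumes 1, case_names pure zero add minus sup]:
  assumes "x \<in> carrier T"
    and "\<And>g h. g \<in> carrier G \<Longrightarrow> h \<in> carrier H \<Longrightarrow> Q (\<tau> g h)" and "Q \<zero>\<^bsub>T\<^esub>"
    and "\<And>x y. \<lbrakk>x \<in> carrier T; y \<in> carrier T; Q x; Q y\<rbrakk> \<Longrightarrow> Q (x \<oplus>\<^bsub>T\<^esub> y)"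
    and "\<And>x. \<lbrakk>x \<in> carrier T; Q x\<rbrakk> \<Longrightarrow> Q (\<ominus>\<^bsub>T\<^esub> x)"
    and "\<And>x y. \<lbrakk>x \<in> carrier T; y \<in> carrier T; Q x; Q y\<rbrakk> \<Longrightarrow> Q (x \<squnion>\<^bsub>T\<^esub> y)"
  shows "Q x"
proof -
  have "Q (leval T \<tau> t)" if "terms_over (carrier G) (carrier H) t" for t
    using that
    by (induct t) (simp_all add: assms(2-) leval_closed[OF T_l_group pure_closed])
  then show ?thesis using assms(1) unfolding generated by (auto simp: generated_def)
qed

end

section \<open>Ordered fields and lattice-ordered linear spaces\<close>

context lgroup
begin

lemma nsmul_disjoint: "a \<sqinter> b = \<zero> \<Longrightarrow> a \<in> carrier G \<Longrightarrow> b \<in> carrier G \<Longrightarrow> a \<sqinter> [(n::nat)] \<cdot> b = \<zero>"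
proof (induct n)
  case 0
  then have "\<zero> \<preceq> a" using inf_le1[of a b] by simp
  then show ?case using 0 by (simp add: inf_absorb2)
next
  case (Suc n)
  then show ?case by (simp add: nsmul_Suc disjoint_add)
qed

text \<open>Multiples of disjoint elements are disjoint.\<close>

lemma nsmul_l_hom: "(\<lambda>x\<in>carrier G. [(n::nat)] \<cdot> x) \<in> l_hom G G"
proof (rule l_hom_disjointI[OF l_group l_group])
  fix x y assume xy: "x \<in> carrier G" "y \<in> carrier G" "x \<sqinter> y = \<zero>"
  have "x \<sqinter> [n] \<cdot> y = \<zero>" using nsmul_disjoint xy by simp
  then have "[n] \<cdot> y \<sqinter> [n] \<cdot> x = \<zero>" using nsmul_disjoint[of "[n] \<cdot> y" x] xy inf_comm by simp
  then show "(\<lambda>x\<in>carrier G. [n] \<cdot> x) x \<sqinter> (\<lambda>x\<in>carrier G. [n] \<cdot> x) y = \<zero>"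
    using xy inf_comm[of "[n] \<cdot> x" "[n] \<cdot> y"] by simp
qed (auto simp: nsmul_add)

lemma nsmul_sup: "x \<in> carrier G \<Longrightarrow> y \<in> carrier G \<Longrightarrow> [(n::nat)] \<cdot> (x \<squnion> y) = [n] \<cdot> x \<squnion> [n] \<cdot> y"
  using nsmul_l_hom[of n] by (simp add: l_hom_def)

end

text \<open>That \<open>\<one>\<close> is a strong unit expresses that the field is Archimedean.\<close>

locale ordered_field = field K for K :: "('k, 'c) ogroup_scheme" (structure) +
  assumes K_l_group: "l_group K"
    and total: "\<lbrakk>x \<in> carrier K; y \<in> carrier K\<rbrakk> \<Longrightarrow> x \<preceq> y \<or> y \<preceq> x"
    and mult_nonneg: "\<lbrakk>x \<in> carrier K; y \<in> carrier K; \<zero> \<preceq> x; \<zero> \<preceq> y\<rbrakk> \<Longrightarrow> \<zero> \<preceq> x \<otimes> y"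
    and strong_unit_one: "strong_unit K \<one>"
begin

sublocale K: lgroup K
  by (rule lgroup.intro) (rule K_l_group)

lemma one_nonneg [simp]: "\<zero> \<preceq> \<one>"
  using strong_unit_one by (simp add: strong_unit_def)

lemma mult_mono:
  assumes "\<zero> \<preceq> k" "x \<preceq> y" "k \<in> carrier K" "x \<in> carrier K" "y \<in> carrier K"
  shows "k \<otimes> x \<preceq> k \<otimes> y"
proof -
  have "\<zero> \<preceq> k \<otimes> (y \<ominus> x)"
    using assms K.leq_iff[of x y] by (intro mult_nonneg) simp_all
  also have "k \<otimes> (y \<ominus> x) = k \<otimes> y \<ominus> k \<otimes> x" using assms by (simp add: minus_eq r_distr r_minus)
  finally show ?thesis using assms K.leq_iff[of "k \<otimes> x" "k \<otimes> y"] by simp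
qed

lemma mult_sup:
  assumes "\<zero> \<preceq> k" "k \<in> carrier K" "x \<in> carrier K" "y \<in> carrier K"
  shows "k \<otimes> (x \<squnion> y) = k \<otimes> x \<squnion> k \<otimes> y"
  using total[of x y]
proof
  assume "x \<preceq> y"
  then show ?thesis using mult_mono[of k x y] assms by (simp add: K.sup_absorb2)
next
  assume "y \<preceq> x"
  then show ?thesis using mult_mono[of k y x] assms by (simp add: K.sup_absorb1)
qed (use assms in simp_all)

lemma mult_inf:
  assumes "\<zero> \<preceq> k" "k \<in> carrier K" "x \<in> carrier K" "y \<in> carrier K"
  shows "k \<otimes> (x \<sqinter> y) = (k \<otimes> x) \<sqinter> (k \<otimes> y)"
  using total[of x y]
proof
  assume "x \<preceq> y"
  then show ?thesis using mult_mono[of k x y] assms by (simp add: K.inf_absorb1)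
next
  assume "y \<preceq> x"
  then show ?thesis using mult_mono[of k y x] assms by (simp add: K.inf_absorb2)
qed (use assms in simp_all)

lemma square_nonneg: "x \<in> carrier K \<Longrightarrow> \<zero> \<preceq> x \<otimes> x"
  using total[of \<zero> x] mult_nonneg[of x x] mult_nonneg[of "\<ominus> x" "\<ominus> x"] K.leq_minus_iff[of x \<zero>]
  by (auto simp: l_minus r_minus)

lemma inv_nonneg:
  assumes "\<zero> \<preceq> k" "k \<in> carrier K" "k \<noteq> \<zero>"
  shows "inv k \<in> carrier K" "inv k \<otimes> k = \<one>" "k \<otimes> inv k = \<one>" "\<zero> \<preceq> inv k"
proof -
  have "k \<in> Units K" using assms by (simp add: field_Units)
  then show c: "inv k \<in> carrier K" "inv k \<otimes> k = \<one>" "k \<otimes> inv k = \<one>" by simp_all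
  have "k \<otimes> (inv k \<otimes> inv k) = inv k" using c assms by (simp add: m_assoc[symmetric])
  then show "\<zero> \<preceq> inv k"
    using mult_nonneg[of k "inv k \<otimes> inv k"] square_nonneg[of "inv k"] c assms by simp
qed

lemma nat_mult: "x \<in> carrier K \<Longrightarrow> [(n::nat)] \<cdot> \<one> \<otimes> x = [n] \<cdot> x"
  by (induct n) (simp_all add: K.nsmul_Suc l_distr)

lemma nat_leqD: "[(m::nat)] \<cdot> \<one> \<preceq> [n] \<cdot> \<one> \<Longrightarrow> m \<le> n"
proof (rule ccontr)
  assume le: "[m] \<cdot> \<one> \<preceq> [n] \<cdot> \<one>" and "\<not> m \<le> n"
  then obtain d where "m = n + Suc d" using less_imp_add_positive[of n m] gr0_conv_Suc by auto
  then have "[n] \<cdot> \<one> \<oplus> [Suc d] \<cdot> \<one> \<preceq> [n] \<cdot> \<one> \<oplus> \<zero>"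
    using le K.nsmul_add_left[of \<one> n "Suc d"] by simp
  then have "[Suc d] \<cdot> \<one> \<preceq> \<zero>" using K.add_leq_cancel_left[of "[Suc d] \<cdot> \<one>" \<zero> "[n] \<cdot> \<one>"] by simp
  moreover have "\<one> \<preceq> [Suc d] \<cdot> \<one>" using K.nsmul_mono_left[of 1 "Suc d" \<one>] by simp
  ultimately have "\<one> \<preceq> \<zero>" using K.leq_trans[of \<one> "[Suc d] \<cdot> \<one>" \<zero>] by simp
  then show False using K.leq_antisym[of \<one> \<zero>] by simp
qed

text \<open>If \<open>k\<close> is an integer, then two values of \<open>m\<close> qualify. This does no harm, since integer parts only
  occur in estimates up to a constant.\<close>

definition "floor_of m k \<longleftrightarrow> [(m::nat)] \<cdot> \<one> \<preceq> k \<and> k \<preceq> [Suc m] \<cdot> \<one>"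

lemma floor_exists:
  assumes "k \<in> carrier K" "\<zero> \<preceq> k"
  shows "\<exists>m. floor_of m k"
proof -
  obtain n :: nat where "k \<preceq> [n] \<cdot> \<one>" using strong_unit_one assms unfolding strong_unit_def by blast
  then have "k \<preceq> [Suc n] \<cdot> \<one>"
    using K.leq_trans[OF _ K.nsmul_mono_left[of n "Suc n" \<one>]] assms by simp
  then show ?thesis
  proof (induct n)
    case 0
    then show ?case using assms by (auto simp: floor_of_def intro: exI[of _ 0])
  next
    case (Suc n)
    have "k \<preceq> [Suc n] \<cdot> \<one> \<or> [Suc n] \<cdot> \<one> \<preceq> k" using total assms by simp
    then show ?case
    proof
      assume "[Suc n] \<cdot> \<one> \<preceq> k"
      then have "floor_of (Suc n) k" using Suc(2) by (simp add: floor_of_def)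
      then show ?thesis ..
    qed (use Suc in auto)
  qed
qed

definition "norm_le k n \<longleftrightarrow> k \<preceq> [(n::nat)] \<cdot> \<one> \<and> \<ominus> k \<preceq> [n] \<cdot> \<one>"

lemma norm_le_exists:
  assumes "k \<in> carrier K"
  shows "\<exists>n. norm_le k n"
proof -
  obtain m n :: nat where mn: "k \<preceq> [m] \<cdot> \<one>" "\<ominus> k \<preceq> [n] \<cdot> \<one>"
    using strong_unit_one assms a_inv_closed[OF assms] unfolding strong_unit_def by blast
  have "[m] \<cdot> \<one> \<preceq> [(m + n)] \<cdot> \<one>" "[n] \<cdot> \<one> \<preceq> [(m + n)] \<cdot> \<one>"
    using K.nsmul_mono_left[of m "m + n" \<one>] K.nsmul_mono_left[of n "m + n" \<one>] by simp_all
  then have "norm_le k (m + n)"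
    using mn K.leq_trans[of k "[m] \<cdot> \<one>"] K.leq_trans[of "\<ominus> k" "[n] \<cdot> \<one>"] assms
    by (simp add: norm_le_def)
  then show ?thesis ..
qed

lemma norm_le_mult:
  assumes "norm_le k n" "\<zero> \<preceq> r" "r \<preceq> \<one>" "k \<in> carrier K" "r \<in> carrier K"
  shows "norm_le (r \<otimes> k) n"
proof -
  have "r \<otimes> k \<preceq> [n] \<cdot> \<one>" if k: "k \<in> carrier K" "k \<preceq> [n] \<cdot> \<one>" for k
  proof -
    have "r \<otimes> k \<preceq> r \<otimes> ([n] \<cdot> \<one>)" using k assms by (intro mult_mono) simp_all
    also have "r \<otimes> ([n] \<cdot> \<one>) = [n] \<cdot> r" using nat_mult[of r n] m_comm[of r "[n] \<cdot> \<one>"] assms by simp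
    finally have "r \<otimes> k \<preceq> [n] \<cdot> r" .
    moreover have "[n] \<cdot> r \<preceq> [n] \<cdot> \<one>" using assms by (intro K.nsmul_mono) simp_all
    ultimately show ?thesis using K.leq_trans[of "r \<otimes> k" "[n] \<cdot> r" "[n] \<cdot> \<one>"] assms k by simp
  qed
  from this[of k] this[of "\<ominus> k"] show ?thesis using assms by (simp add: norm_le_def r_minus)
qed

end

locale linear_space = ordered_field K + V: lgroup V
  for K :: "('k, 'c) ogroup_scheme" (structure) and V :: "('k, 'v, 'b) olspace_scheme" +
  assumes lo_linear_space: "lo_linear_space K V"
begin

abbreviation scalar (infixr "\<odot>" 72) where "k \<odot> x \<equiv> scale V k x"

lemma module: "module K (module_of V)"
  using lo_linear_space by (simp add: lo_linear_space_def)

lemma scale_closed [simp]: "k \<in> carrier K \<Longrightarrow> x \<in> carrier V \<Longrightarrow> k \<odot> x \<in> carrier V"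
  and scale_add_left: "k \<in> carrier K \<Longrightarrow> l \<in> carrier K \<Longrightarrow> x \<in> carrier V \<Longrightarrow>
    (k \<oplus> l) \<odot> x = k \<odot> x \<oplus>\<^bsub>V\<^esub> l \<odot> x"
  and scale_add: "k \<in> carrier K \<Longrightarrow> x \<in> carrier V \<Longrightarrow> y \<in> carrier V \<Longrightarrow>
    k \<odot> (x \<oplus>\<^bsub>V\<^esub> y) = k \<odot> x \<oplus>\<^bsub>V\<^esub> k \<odot> y"
  and scale_mult: "k \<in> carrier K \<Longrightarrow> l \<in> carrier K \<Longrightarrow> x \<in> carrier V \<Longrightarrow>
    (k \<otimes> l) \<odot> x = k \<odot> l \<odot> x"
  and scale_one [simp]: "x \<in> carrier V \<Longrightarrow> \<one> \<odot> x = x"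
  using module.smult_closed[OF module, of k x] module.smult_l_distr[OF module, of k l x]
    module.smult_r_distr[OF module, of k x y] module.smult_assoc1[OF module, of k l x]
    module.smult_one[OF module, of x]
  by (simp_all add: module_of_def)

lemma scale_nonneg: "\<zero> \<preceq> k \<Longrightarrow> \<zero>\<^bsub>V\<^esub> \<preceq>\<^bsub>V\<^esub> x \<Longrightarrow> k \<in> carrier K \<Longrightarrow> x \<in> carrier V \<Longrightarrow> \<zero>\<^bsub>V\<^esub> \<preceq>\<^bsub>V\<^esub> k \<odot> x"
  using lo_linear_space by (simp add: lo_linear_space_def)

lemma scale_minus:
  assumes "k \<in> carrier K" "x \<in> carrier V"
  shows "k \<odot> (\<ominus>\<^bsub>V\<^esub> x) = \<ominus>\<^bsub>V\<^esub> (k \<odot> x)"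
  using assms by (intro additive_minus[OF V.abelian_group_axioms V.abelian_group_axioms]) (auto simp: scale_add)

lemma scale_minus_left:
  assumes "k \<in> carrier K" "x \<in> carrier V"
  shows "(\<ominus> k) \<odot> x = \<ominus>\<^bsub>V\<^esub> (k \<odot> x)"
  using additive_minus[OF abelian_group_axioms V.abelian_group_axioms, of "\<lambda>k. k \<odot> x" k] assms
  by (simp add: scale_add_left)

lemma scale_zero_left: "x \<in> carrier V \<Longrightarrow> \<zero> \<odot> x = \<zero>\<^bsub>V\<^esub>"
  using additive_zero[OF abelian_group_axioms V.abelian_group_axioms, of "\<lambda>k. k \<odot> x"]
  by (simp add: scale_add_left)

lemma scale_mono:
  assumes "\<zero> \<preceq> k" "x \<preceq>\<^bsub>V\<^esub> y" "k \<in> carrier K" "x \<in> carrier V" "y \<in> carrier V"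
  shows "k \<odot> x \<preceq>\<^bsub>V\<^esub> k \<odot> y"
proof -
  have "\<zero>\<^bsub>V\<^esub> \<preceq>\<^bsub>V\<^esub> k \<odot> (y \<ominus>\<^bsub>V\<^esub> x)"
    using assms V.leq_iff[of x y] by (intro scale_nonneg) simp_all
  also have "k \<odot> (y \<ominus>\<^bsub>V\<^esub> x) = k \<odot> y \<ominus>\<^bsub>V\<^esub> k \<odot> x" using assms by (simp add: V.minus_eq scale_add scale_minus)
  finally show ?thesis using assms V.leq_iff[of "k \<odot> x" "k \<odot> y"] by simp
qed

lemma scale_mono_left:
  assumes "k \<preceq> l" "\<zero>\<^bsub>V\<^esub> \<preceq>\<^bsub>V\<^esub> x" "k \<in> carrier K" "l \<in> carrier K" "x \<in> carrier V"
  shows "k \<odot> x \<preceq>\<^bsub>V\<^esub> l \<odot> x"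
proof -
  have "\<zero>\<^bsub>V\<^esub> \<preceq>\<^bsub>V\<^esub> (l \<ominus> k) \<odot> x"
    using assms K.leq_iff[of k l] by (intro scale_nonneg) simp_all
  also have "(l \<ominus> k) \<odot> x = l \<odot> x \<ominus>\<^bsub>V\<^esub> k \<odot> x"
    using assms by (simp add: minus_eq V.minus_eq scale_add_left scale_minus_left)
  finally show ?thesis using assms V.leq_iff[of "k \<odot> x" "l \<odot> x"] by simp
qed

text \<open>A positive scalar is invertible, and so it acts as an order automorphism.\<close>

lemma scale_sup:
  assumes "\<zero> \<preceq> k" "k \<in> carrier K" "x \<in> carrier V" "y \<in> carrier V"
  shows "k \<odot> (x \<squnion>\<^bsub>V\<^esub> y) = k \<odot> x \<squnion>\<^bsub>V\<^esub> k \<odot> y"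
proof (cases "k = \<zero>")
  case True
  then show ?thesis using assms by (simp add: scale_zero_left V.sup_absorb1)
next
  case False
  note inv = inv_nonneg[OF assms(1,2) False]
  show ?thesis
  proof (rule sym, rule V.sup_eqI)
    fix z assume z: "z \<in> carrier V"
    have "k \<odot> v \<preceq>\<^bsub>V\<^esub> z \<longleftrightarrow> v \<preceq>\<^bsub>V\<^esub> inv k \<odot> z" if v: "v \<in> carrier V" for v
    proof
      assume "k \<odot> v \<preceq>\<^bsub>V\<^esub> z"
      then have "inv k \<odot> k \<odot> v \<preceq>\<^bsub>V\<^esub> inv k \<odot> z" using v z assms inv by (intro scale_mono) simp_all
      then show "v \<preceq>\<^bsub>V\<^esub> inv k \<odot> z" using v assms inv by (simp add: scale_mult[symmetric])
    next
      assume "v \<preceq>\<^bsub>V\<^esub> inv k \<odot> z"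
      then have "k \<odot> v \<preceq>\<^bsub>V\<^esub> k \<odot> inv k \<odot> z" using v z assms inv by (intro scale_mono) simp_all
      then show "k \<odot> v \<preceq>\<^bsub>V\<^esub> z" using z assms inv by (simp add: scale_mult[symmetric])
    qed
    then show "k \<odot> (x \<squnion>\<^bsub>V\<^esub> y) \<preceq>\<^bsub>V\<^esub> z \<longleftrightarrow> k \<odot> x \<preceq>\<^bsub>V\<^esub> z \<and> k \<odot> y \<preceq>\<^bsub>V\<^esub> z"
      using assms z inv by (simp add: V.sup_leq_iff)
  qed (use assms in simp_all)
qed

lemma scale_l_hom: "\<zero> \<preceq> k \<Longrightarrow> k \<in> carrier K \<Longrightarrow> (\<lambda>x\<in>carrier V. k \<odot> x) \<in> l_hom V V"
  by (rule l_hom_supI[OF V.l_group V.l_group]) (auto simp: scale_add scale_sup)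

lemma scale_inf:
  "\<zero> \<preceq> k \<Longrightarrow> k \<in> carrier K \<Longrightarrow> x \<in> carrier V \<Longrightarrow> y \<in> carrier V \<Longrightarrow>
    k \<odot> (x \<sqinter>\<^bsub>V\<^esub> y) = k \<odot> x \<sqinter>\<^bsub>V\<^esub> k \<odot> y"
  using scale_l_hom[of k] by (simp add: l_hom_def)

text \<open>In the scalar variable lattice operations are preserved because \<open>K\<close> is a chain, where a supremum
  or infimum is one of the two arguments.\<close>

lemma scale_bimorphism:
  assumes G: "l_group G" and f: "f \<in> l_hom G V"
  shows "bimorphism K G V (\<lambda>k g. k \<odot> f g)"
proof -
  interpret f: lgroup_hom G V f
    by (intro lgroup_hom.intro lgroup.intro lgroup_hom_axioms.intro G V.l_group f)
  have nn: "\<zero>\<^bsub>V\<^esub> \<preceq>\<^bsub>V\<^esub> f g" if "\<zero>\<^bsub>G\<^esub> \<preceq>\<^bsub>G\<^esub> g" "g \<in> carrier G" for g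
    using f.mono[OF that(1)] that by (simp add: f.zero)
  have sup: "(k \<squnion> l) \<odot> y = k \<odot> y \<squnion>\<^bsub>V\<^esub> l \<odot> y" and inf: "(k \<sqinter> l) \<odot> y = k \<odot> y \<sqinter>\<^bsub>V\<^esub> l \<odot> y"
    if y: "k \<in> carrier K" "l \<in> carrier K" "y \<in> carrier V" "\<zero>\<^bsub>V\<^esub> \<preceq>\<^bsub>V\<^esub> y" for k l y
  proof -
    consider "k \<preceq> l" | "l \<preceq> k" using total y by blast
    then have "(k \<squnion> l) \<odot> y = k \<odot> y \<squnion>\<^bsub>V\<^esub> l \<odot> y \<and> (k \<sqinter> l) \<odot> y = k \<odot> y \<sqinter>\<^bsub>V\<^esub> l \<odot> y"
    proof cases
      case 1
      then show ?thesis using scale_mono_left[of k l y] y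
        by (simp add: K.sup_absorb2 V.sup_absorb2 K.inf_absorb1 V.inf_absorb1)
    next
      case 2
      then show ?thesis using scale_mono_left[of l k y] y
        by (simp add: K.sup_absorb1 V.sup_absorb1 K.inf_absorb2 V.inf_absorb2)
    qed
    then show "(k \<squnion> l) \<odot> y = k \<odot> y \<squnion>\<^bsub>V\<^esub> l \<odot> y" "(k \<sqinter> l) \<odot> y = k \<odot> y \<sqinter>\<^bsub>V\<^esub> l \<odot> y" by blast+
  qed
  show ?thesis
    unfolding bimorphism_def
    by (intro conjI ballI impI) (simp_all add: scale_add_left f.add scale_add sup inf nn f.sup f.inf scale_sup scale_inf)
qed

end

section \<open>Scalar multiplication on the tensor product\<close>

locale field_tensor = ordered_field K + G: lu_grp G v
  for K :: "('k, 'c) ogroup_scheme" (structure) and G :: "('g, 'b) ogroup_scheme" and v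
begin

sublocale tensor K G
  by unfold_locales

abbreviation "w \<equiv> \<tau> \<one> v"

lemma w_closed [simp]: "w \<in> carrier T" by simp

lemma tau_add_left: "k \<in> carrier K \<Longrightarrow> l \<in> carrier K \<Longrightarrow> g \<in> carrier G \<Longrightarrow> \<tau> (k \<oplus> l) g = \<tau> k g \<oplus>\<^bsub>T\<^esub> \<tau> l g"
  and tau_add: "k \<in> carrier K \<Longrightarrow> g \<in> carrier G \<Longrightarrow> h \<in> carrier G \<Longrightarrow> \<tau> k (g \<oplus>\<^bsub>G\<^esub> h) = \<tau> k g \<oplus>\<^bsub>T\<^esub> \<tau> k h"
  and tau_sup_left: "k \<in> carrier K \<Longrightarrow> l \<in> carrier K \<Longrightarrow> g \<in> carrier G \<Longrightarrow> \<zero>\<^bsub>G\<^esub> \<preceq>\<^bsub>G\<^esub> g \<Longrightarrow>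
    \<tau> (k \<squnion> l) g = \<tau> k g \<squnion>\<^bsub>T\<^esub> \<tau> l g"
  and tau_inf_left: "k \<in> carrier K \<Longrightarrow> l \<in> carrier K \<Longrightarrow> g \<in> carrier G \<Longrightarrow> \<zero>\<^bsub>G\<^esub> \<preceq>\<^bsub>G\<^esub> g \<Longrightarrow>
    \<tau> (k \<sqinter> l) g = \<tau> k g \<sqinter>\<^bsub>T\<^esub> \<tau> l g"
  and tau_sup: "k \<in> carrier K \<Longrightarrow> g \<in> carrier G \<Longrightarrow> h \<in> carrier G \<Longrightarrow> \<zero> \<preceq> k \<Longrightarrow>
    \<tau> k (g \<squnion>\<^bsub>G\<^esub> h) = \<tau> k g \<squnion>\<^bsub>T\<^esub> \<tau> k h"
  and tau_inf: "k \<in> carrier K \<Longrightarrow> g \<in> carrier G \<Longrightarrow> h \<in> carrier G \<Longrightarrow> \<zero> \<preceq> k \<Longrightarrow>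
    \<tau> k (g \<sqinter>\<^bsub>G\<^esub> h) = \<tau> k g \<sqinter>\<^bsub>T\<^esub> \<tau> k h"
  using bimorphism by (simp_all add: bimorphism_def)

lemma tau_minus_left: "k \<in> carrier K \<Longrightarrow> g \<in> carrier G \<Longrightarrow> \<tau> (\<ominus> k) g = \<ominus>\<^bsub>T\<^esub> \<tau> k g"
  using additive_minus[OF abelian_group_axioms T.abelian_group_axioms, of "\<lambda>k. \<tau> k g" k]
  by (simp add: tau_add_left)

lemma tau_minus: "k \<in> carrier K \<Longrightarrow> g \<in> carrier G \<Longrightarrow> \<tau> k (\<ominus>\<^bsub>G\<^esub> g) = \<ominus>\<^bsub>T\<^esub> \<tau> k g"
  using additive_minus[OF G.abelian_group_axioms T.abelian_group_axioms, of "\<tau> k" g]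
  by (simp add: tau_add)

lemma tau_nsmul_left: "k \<in> carrier K \<Longrightarrow> g \<in> carrier G \<Longrightarrow> \<tau> ([(n::nat)] \<cdot> k) g = [n] \<cdot>\<^bsub>T\<^esub> \<tau> k g"
  using additive_nsmul[OF abelian_group_axioms T.abelian_group_axioms, of "\<lambda>k. \<tau> k g" k n]
  by (simp add: tau_add_left)

lemma tau_nsmul: "k \<in> carrier K \<Longrightarrow> g \<in> carrier G \<Longrightarrow> \<tau> k ([(n::nat)] \<cdot>\<^bsub>G\<^esub> g) = [n] \<cdot>\<^bsub>T\<^esub> \<tau> k g"
  using additive_nsmul[OF G.abelian_group_axioms T.abelian_group_axioms, of "\<tau> k" g n]
  by (simp add: tau_add)

lemma tau_zero: "k \<in> carrier K \<Longrightarrow> \<tau> k \<zero>\<^bsub>G\<^esub> = \<zero>\<^bsub>T\<^esub>"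
  using tau_nsmul[of k "\<zero>\<^bsub>G\<^esub>" 0] by simp

lemma tau_mono: "k \<in> carrier K \<Longrightarrow> g \<in> carrier G \<Longrightarrow> h \<in> carrier G \<Longrightarrow> \<zero> \<preceq> k \<Longrightarrow> g \<preceq>\<^bsub>G\<^esub> h \<Longrightarrow>
    \<tau> k g \<preceq>\<^bsub>T\<^esub> \<tau> k h"
  using tau_sup[of k g h] T.sup_ge1[of "\<tau> k g" "\<tau> k h"] by (simp add: G.sup_absorb2)

lemma tau_mono_left: "k \<in> carrier K \<Longrightarrow> l \<in> carrier K \<Longrightarrow> g \<in> carrier G \<Longrightarrow> \<zero>\<^bsub>G\<^esub> \<preceq>\<^bsub>G\<^esub> g \<Longrightarrow> k \<preceq> l \<Longrightarrow>
    \<tau> k g \<preceq>\<^bsub>T\<^esub> \<tau> l g"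
  using tau_sup_left[of k l g] T.sup_ge1[of "\<tau> k g" "\<tau> l g"] by (simp add: K.sup_absorb2)

lemma w_nonneg: "\<zero>\<^bsub>T\<^esub> \<preceq>\<^bsub>T\<^esub> w"
  using tau_mono[of \<one> "\<zero>\<^bsub>G\<^esub>" v] by (simp add: tau_zero)

lemma pure_bound:
  assumes "norm_le k a" "g \<preceq>\<^bsub>G\<^esub> [(b::nat)] \<cdot>\<^bsub>G\<^esub> v" "\<ominus>\<^bsub>G\<^esub> g \<preceq>\<^bsub>G\<^esub> [b] \<cdot>\<^bsub>G\<^esub> v" "k \<in> carrier K" "g \<in> carrier G"
  shows "\<tau> k g \<preceq>\<^bsub>T\<^esub> [(a * b)] \<cdot>\<^bsub>T\<^esub> w"
proof -
  have pos: "\<tau> k g \<preceq>\<^bsub>T\<^esub> [(a * b)] \<cdot>\<^bsub>T\<^esub> w"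
    if "\<zero> \<preceq> k" "k \<preceq> [a] \<cdot> \<one>" "g \<preceq>\<^bsub>G\<^esub> [b] \<cdot>\<^bsub>G\<^esub> v" "k \<in> carrier K" "g \<in> carrier G" for k g
  proof -
    have "\<tau> k g \<preceq>\<^bsub>T\<^esub> \<tau> k ([b] \<cdot>\<^bsub>G\<^esub> v)" using that by (intro tau_mono) simp_all
    moreover have "\<tau> k ([b] \<cdot>\<^bsub>G\<^esub> v) \<preceq>\<^bsub>T\<^esub> \<tau> ([a] \<cdot> \<one>) ([b] \<cdot>\<^bsub>G\<^esub> v)"
      using that by (intro tau_mono_left) (simp_all add: G.nsmul_nonneg)
    moreover have "\<tau> ([a] \<cdot> \<one>) ([b] \<cdot>\<^bsub>G\<^esub> v) = [(a * b)] \<cdot>\<^bsub>T\<^esub> w"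
      using T.nsmul_mult[of w b a] by (simp add: tau_nsmul_left tau_nsmul mult.commute)
    ultimately show ?thesis
      using T.leq_trans[of "\<tau> k g" "\<tau> k ([b] \<cdot>\<^bsub>G\<^esub> v)" "[(a * b)] \<cdot>\<^bsub>T\<^esub> w"] that by simp
  qed
  have "\<zero> \<preceq> k \<or> \<zero> \<preceq> \<ominus> k"
    using total[of \<zero> k] K.leq_minus_iff[of k \<zero>] assms by auto
  then show ?thesis
  proof
    assume "\<zero> \<preceq> k"
    then show ?thesis using pos[of k g] assms by (simp add: norm_le_def)
  next
    assume "\<zero> \<preceq> \<ominus> k"
    then show ?thesis
      using pos[of "\<ominus> k" "\<ominus>\<^bsub>G\<^esub> g"] assms by (simp add: norm_le_def tau_minus tau_minus_left)
  qed
qed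

lemma unit_bound:
  assumes "g \<in> carrier G"
  obtains b :: nat where "g \<preceq>\<^bsub>G\<^esub> [b] \<cdot>\<^bsub>G\<^esub> v" "\<ominus>\<^bsub>G\<^esub> g \<preceq>\<^bsub>G\<^esub> [b] \<cdot>\<^bsub>G\<^esub> v"
proof -
  obtain m n :: nat where mn: "g \<preceq>\<^bsub>G\<^esub> [m] \<cdot>\<^bsub>G\<^esub> v" "\<ominus>\<^bsub>G\<^esub> g \<preceq>\<^bsub>G\<^esub> [n] \<cdot>\<^bsub>G\<^esub> v"
    using G.strong_unitE(3)[OF G.unit] assms G.a_inv_closed[OF assms] by blast
  have "[m] \<cdot>\<^bsub>G\<^esub> v \<preceq>\<^bsub>G\<^esub> [(m + n)] \<cdot>\<^bsub>G\<^esub> v" "[n] \<cdot>\<^bsub>G\<^esub> v \<preceq>\<^bsub>G\<^esub> [(m + n)] \<cdot>\<^bsub>G\<^esub> v"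
    using G.nsmul_mono_left[of m "m + n" v] G.nsmul_mono_left[of n "m + n" v] by simp_all
  then show ?thesis
    using that[of "m + n"] mn G.leq_trans[of g "[m] \<cdot>\<^bsub>G\<^esub> v"] G.leq_trans[of "\<ominus>\<^bsub>G\<^esub> g" "[n] \<cdot>\<^bsub>G\<^esub> v"] assms
    by simp
qed

text \<open>By induction on the construction of \<open>x\<close> from pure tensors; this makes \<open>w\<close> a strong unit.\<close>

lemma T_bounded:
  assumes "x \<in> carrier T"
  shows "\<exists>n::nat. x \<preceq>\<^bsub>T\<^esub> [n] \<cdot>\<^bsub>T\<^esub> w \<and> \<ominus>\<^bsub>T\<^esub> x \<preceq>\<^bsub>T\<^esub> [n] \<cdot>\<^bsub>T\<^esub> w"
  using assms
proof (induct rule: T_induct)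
  case (pure k g)
  obtain a where a: "norm_le k a" using norm_le_exists[OF pure(1)] by blast
  obtain b :: nat where b: "g \<preceq>\<^bsub>G\<^esub> [b] \<cdot>\<^bsub>G\<^esub> v" "\<ominus>\<^bsub>G\<^esub> g \<preceq>\<^bsub>G\<^esub> [b] \<cdot>\<^bsub>G\<^esub> v"
    using unit_bound[OF pure(2)] .
  have "\<tau> k g \<preceq>\<^bsub>T\<^esub> [(a * b)] \<cdot>\<^bsub>T\<^esub> w" "\<tau> k (\<ominus>\<^bsub>G\<^esub> g) \<preceq>\<^bsub>T\<^esub> [(a * b)] \<cdot>\<^bsub>T\<^esub> w"
    using pure_bound[OF a] b pure by simp_all
  then show ?case using pure by (auto simp: tau_minus)
next
  case zero
  then show ?case by (intro exI[of _ 0]) simp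
next
  case (add x y)
  then obtain m n :: nat where
    "x \<preceq>\<^bsub>T\<^esub> [m] \<cdot>\<^bsub>T\<^esub> w" "\<ominus>\<^bsub>T\<^esub> x \<preceq>\<^bsub>T\<^esub> [m] \<cdot>\<^bsub>T\<^esub> w" "y \<preceq>\<^bsub>T\<^esub> [n] \<cdot>\<^bsub>T\<^esub> w" "\<ominus>\<^bsub>T\<^esub> y \<preceq>\<^bsub>T\<^esub> [n] \<cdot>\<^bsub>T\<^esub> w"
    by blast
  then show ?case
    using add by (intro exI[of _ "m + n"]) (simp add: T.nsmul_add_left T.minus_add T.add_mono)
next
  case (minus x)
  then show ?case by auto
next
  case (sup x y)
  then obtain m n :: nat where mn:
    "x \<preceq>\<^bsub>T\<^esub> [m] \<cdot>\<^bsub>T\<^esub> w" "\<ominus>\<^bsub>T\<^esub> x \<preceq>\<^bsub>T\<^esub> [m] \<cdot>\<^bsub>T\<^esub> w" "y \<preceq>\<^bsub>T\<^esub> [n] \<cdot>\<^bsub>T\<^esub> w" "\<ominus>\<^bsub>T\<^esub> y \<preceq>\<^bsub>T\<^esub> [n] \<cdot>\<^bsub>T\<^esub> w"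
    by blast
  have le: "[m] \<cdot>\<^bsub>T\<^esub> w \<preceq>\<^bsub>T\<^esub> [(m + n)] \<cdot>\<^bsub>T\<^esub> w" "[n] \<cdot>\<^bsub>T\<^esub> w \<preceq>\<^bsub>T\<^esub> [(m + n)] \<cdot>\<^bsub>T\<^esub> w"
    using T.nsmul_mono_left[of m "m + n" w] T.nsmul_mono_left[of n "m + n" w] w_nonneg by simp_all
  have "x \<preceq>\<^bsub>T\<^esub> [(m + n)] \<cdot>\<^bsub>T\<^esub> w" "y \<preceq>\<^bsub>T\<^esub> [(m + n)] \<cdot>\<^bsub>T\<^esub> w" "\<ominus>\<^bsub>T\<^esub> x \<preceq>\<^bsub>T\<^esub> [(m + n)] \<cdot>\<^bsub>T\<^esub> w"
    using T.leq_trans[OF mn(1) le(1)] T.leq_trans[OF mn(2) le(1)] T.leq_trans[OF mn(3) le(2)] sup by simp_all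
  moreover have "\<ominus>\<^bsub>T\<^esub> (x \<squnion>\<^bsub>T\<^esub> y) \<preceq>\<^bsub>T\<^esub> \<ominus>\<^bsub>T\<^esub> x"
    using sup T.sup_ge1[of x y] by (simp add: T.leq_minus_iff)
  ultimately show ?case
    using sup T.leq_trans[of "\<ominus>\<^bsub>T\<^esub> (x \<squnion>\<^bsub>T\<^esub> y)" "\<ominus>\<^bsub>T\<^esub> x" "[(m + n)] \<cdot>\<^bsub>T\<^esub> w"]
    by (intro exI[of _ "m + n"]) (simp add: T.sup_leq_iff)
qed

lemma T_strong_unit: "strong_unit T w"
  using T_bounded w_nonneg unfolding strong_unit_def by auto

lemma scaled_bimorphism:
  assumes "\<zero> \<preceq> k" "k \<in> carrier K"
  shows "bimorphism K G T (\<lambda>\<mu> g. \<tau> (k \<otimes> \<mu>) g)"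
  unfolding bimorphism_def
  using assms
  by (intro conjI ballI impI)
     (simp_all add: r_distr tau_add_left tau_add mult_sup mult_inf tau_sup_left tau_inf_left tau_sup
       tau_inf mult_nonneg)

text \<open>The action of a nonnegative scalar. A negative scalar reverses the order, so it does not act by
  an \<open>\<ell>\<close>-homomorphism and cannot be obtained from the universal property.\<close>

definition smul where
  "smul k = (SOME f. f \<in> l_hom T T \<and> (\<forall>\<mu>\<in>carrier K. \<forall>g\<in>carrier G. f (\<tau> \<mu> g) = \<tau> (k \<otimes> \<mu>) g))"

lemma smul_spec:
  assumes "\<zero> \<preceq> k" "k \<in> carrier K"
  shows "smul k \<in> l_hom T T \<and> (\<forall>\<mu>\<in>carrier K. \<forall>g\<in>carrier G. smul k (\<tau> \<mu> g) = \<tau> (k \<otimes> \<mu>) g)"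
proof -
  have "\<exists>f. f \<in> l_hom T T \<and> (\<forall>\<mu>\<in>carrier K. \<forall>g\<in>carrier G. f (\<tau> \<mu> g) = \<tau> (k \<otimes> \<mu>) g)"
    using lift_exists[OF T_l_group T_archimedean scaled_bimorphism[OF assms]] by blast
  from someI_ex[OF this] show ?thesis unfolding smul_def .
qed

lemma smul_hom: "\<zero> \<preceq> k \<Longrightarrow> k \<in> carrier K \<Longrightarrow> lgroup_hom T T (smul k)"
  using smul_spec[of k] by (intro lgroup_hom.intro lgroup.intro lgroup_hom_axioms.intro T_l_group) auto

lemma smul_pure: "\<zero> \<preceq> k \<Longrightarrow> k \<in> carrier K \<Longrightarrow> \<mu> \<in> carrier K \<Longrightarrow> g \<in> carrier G \<Longrightarrow>
    smul k (\<tau> \<mu> g) = \<tau> (k \<otimes> \<mu>) g"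
  using smul_spec by blast

lemma smul_closed: "\<zero> \<preceq> k \<Longrightarrow> k \<in> carrier K \<Longrightarrow> x \<in> carrier T \<Longrightarrow> smul k x \<in> carrier T"
  using lgroup_hom.closed[OF smul_hom] .

text \<open>A bound on the distance of \<open>a\<close> and \<open>b\<close>, measured by the strong unit. Two inequalities take the
  place of an absolute value.\<close>

definition near :: "nat \<Rightarrow> ('k, 'g) lterm set \<Rightarrow> ('k, 'g) lterm set \<Rightarrow> bool" where
  "near C a b \<longleftrightarrow> a \<preceq>\<^bsub>T\<^esub> b \<oplus>\<^bsub>T\<^esub> [C] \<cdot>\<^bsub>T\<^esub> w \<and> b \<preceq>\<^bsub>T\<^esub> a \<oplus>\<^bsub>T\<^esub> [C] \<cdot>\<^bsub>T\<^esub> w"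

lemma near_sym: "near C a b \<Longrightarrow> near C b a"
  by (simp add: near_def)

lemma near_diffI:
  assumes "a \<ominus>\<^bsub>T\<^esub> b \<preceq>\<^bsub>T\<^esub> [C] \<cdot>\<^bsub>T\<^esub> w" "b \<ominus>\<^bsub>T\<^esub> a \<preceq>\<^bsub>T\<^esub> [C] \<cdot>\<^bsub>T\<^esub> w" "a \<in> carrier T" "b \<in> carrier T"
  shows "near C a b"
  using assms by (simp add: near_def T.diff_leq_iff T.a_comm)

lemma leq_widen:
  assumes "a \<preceq>\<^bsub>T\<^esub> b \<oplus>\<^bsub>T\<^esub> [C] \<cdot>\<^bsub>T\<^esub> w" "b \<preceq>\<^bsub>T\<^esub> b'" "C \<le> (C'::nat)"
    "a \<in> carrier T" "b \<in> carrier T" "b' \<in> carrier T"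
  shows "a \<preceq>\<^bsub>T\<^esub> b' \<oplus>\<^bsub>T\<^esub> [C'] \<cdot>\<^bsub>T\<^esub> w"
proof -
  have "[C] \<cdot>\<^bsub>T\<^esub> w \<preceq>\<^bsub>T\<^esub> [C'] \<cdot>\<^bsub>T\<^esub> w" using assms w_nonneg by (intro T.nsmul_mono_left) simp_all
  then have "b \<oplus>\<^bsub>T\<^esub> [C] \<cdot>\<^bsub>T\<^esub> w \<preceq>\<^bsub>T\<^esub> b' \<oplus>\<^bsub>T\<^esub> [C'] \<cdot>\<^bsub>T\<^esub> w" using assms by (intro T.add_mono) simp_all
  then show ?thesis using T.leq_trans[OF assms(1)] assms by simp
qed

lemma near_trans:
  assumes "near C a b" "near D b c" "a \<in> carrier T" "b \<in> carrier T" "c \<in> carrier T"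
  shows "near (C + D) a c"
proof -
  have chain: "x \<preceq>\<^bsub>T\<^esub> z \<oplus>\<^bsub>T\<^esub> [(C + D)] \<cdot>\<^bsub>T\<^esub> w"
    if "x \<preceq>\<^bsub>T\<^esub> y \<oplus>\<^bsub>T\<^esub> [C'] \<cdot>\<^bsub>T\<^esub> w" "y \<preceq>\<^bsub>T\<^esub> z \<oplus>\<^bsub>T\<^esub> [D'] \<cdot>\<^bsub>T\<^esub> w" "C + D = C' + D'"
      "x \<in> carrier T" "y \<in> carrier T" "z \<in> carrier T" for x y z and C' D' :: nat
  proof -
    have "x \<preceq>\<^bsub>T\<^esub> (z \<oplus>\<^bsub>T\<^esub> [D'] \<cdot>\<^bsub>T\<^esub> w) \<oplus>\<^bsub>T\<^esub> [C'] \<cdot>\<^bsub>T\<^esub> w"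
      using that by (intro leq_widen[OF that(1,2)]) simp_all
    also have "(z \<oplus>\<^bsub>T\<^esub> [D'] \<cdot>\<^bsub>T\<^esub> w) \<oplus>\<^bsub>T\<^esub> [C'] \<cdot>\<^bsub>T\<^esub> w = z \<oplus>\<^bsub>T\<^esub> [(C + D)] \<cdot>\<^bsub>T\<^esub> w"
      unfolding that(3) using that by (simp add: T.nsmul_add_left T.a_ac)
    finally show ?thesis .
  qed
  show ?thesis
    using assms chain[of a b C c D] chain[of c b D a C] by (simp add: near_def add.commute)
qed

lemma near_add:
  assumes "near C a b" "near D a' b'" "a \<in> carrier T" "b \<in> carrier T" "a' \<in> carrier T" "b' \<in> carrier T"
  shows "near (C + D) (a \<oplus>\<^bsub>T\<^esub> a') (b \<oplus>\<^bsub>T\<^esub> b')"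
proof -
  have "(x \<oplus>\<^bsub>T\<^esub> y) \<oplus>\<^bsub>T\<^esub> [(C + D)] \<cdot>\<^bsub>T\<^esub> w = (x \<oplus>\<^bsub>T\<^esub> [C] \<cdot>\<^bsub>T\<^esub> w) \<oplus>\<^bsub>T\<^esub> (y \<oplus>\<^bsub>T\<^esub> [D] \<cdot>\<^bsub>T\<^esub> w)"
    if "x \<in> carrier T" "y \<in> carrier T" for x y
    using that by (simp add: T.nsmul_add_left T.a_ac)
  then show ?thesis using assms by (simp add: near_def T.add_mono)
qed

lemma near_minus:
  assumes "near C a b" "a \<in> carrier T" "b \<in> carrier T"
  shows "near C (\<ominus>\<^bsub>T\<^esub> a) (\<ominus>\<^bsub>T\<^esub> b)"
proof (rule near_diffI)
  show "\<ominus>\<^bsub>T\<^esub> a \<ominus>\<^bsub>T\<^esub> \<ominus>\<^bsub>T\<^esub> b \<preceq>\<^bsub>T\<^esub> [C] \<cdot>\<^bsub>T\<^esub> w" "\<ominus>\<^bsub>T\<^esub> b \<ominus>\<^bsub>T\<^esub> \<ominus>\<^bsub>T\<^esub> a \<preceq>\<^bsub>T\<^esub> [C] \<cdot>\<^bsub>T\<^esub> w"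
    using assms T.diff_leq_iff[of b "[C] \<cdot>\<^bsub>T\<^esub> w" a] T.diff_leq_iff[of a "[C] \<cdot>\<^bsub>T\<^esub> w" b]
    by (simp_all add: near_def T.minus_eq T.a_comm)
qed (use assms in simp_all)

lemma near_sup:
  assumes "near C a b" "near D a' b'" "a \<in> carrier T" "b \<in> carrier T" "a' \<in> carrier T" "b' \<in> carrier T"
  shows "near (C + D) (a \<squnion>\<^bsub>T\<^esub> a') (b \<squnion>\<^bsub>T\<^esub> b')"
proof -
  have "x \<squnion>\<^bsub>T\<^esub> x' \<preceq>\<^bsub>T\<^esub> (y \<squnion>\<^bsub>T\<^esub> y') \<oplus>\<^bsub>T\<^esub> [(C + D)] \<cdot>\<^bsub>T\<^esub> w"
    if "x \<preceq>\<^bsub>T\<^esub> y \<oplus>\<^bsub>T\<^esub> [C] \<cdot>\<^bsub>T\<^esub> w" "x' \<preceq>\<^bsub>T\<^esub> y' \<oplus>\<^bsub>T\<^esub> [D] \<cdot>\<^bsub>T\<^esub> w"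
      "x \<in> carrier T" "x' \<in> carrier T" "y \<in> carrier T" "y' \<in> carrier T" for x x' y y'
    using leq_widen[OF that(1), of "y \<squnion>\<^bsub>T\<^esub> y'" "C + D"] leq_widen[OF that(2), of "y \<squnion>\<^bsub>T\<^esub> y'" "C + D"] that
    by (simp add: T.sup_leq_iff T.sup_ge1 T.sup_ge2)
  then show ?thesis using assms by (simp add: near_def)
qed

text \<open>A description of \<open>k x\<close> by integral multiples of \<open>x\<close>: up to an error bounded independently of \<open>n\<close>,
  the multiple \<open>n z\<close> is \<open>m x\<close>, where \<open>m\<close> is the integer part of \<open>n k\<close>.\<close>

definition approximates where
  "approximates k x z \<longleftrightarrow>
     (\<exists>C. \<forall>n m. floor_of m ([(n::nat)] \<cdot> k) \<longrightarrow> near C ([n] \<cdot>\<^bsub>T\<^esub> z) ([m] \<cdot>\<^bsub>T\<^esub> x))"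

lemma approximatesE:
  assumes "approximates k x z"
  obtains C where "\<And>n m. floor_of m ([(n::nat)] \<cdot> k) \<Longrightarrow> near C ([n] \<cdot>\<^bsub>T\<^esub> z) ([m] \<cdot>\<^bsub>T\<^esub> x)"
  using assms unfolding approximates_def by blast

lemma approximatesI:
  "(\<And>n m. floor_of m ([(n::nat)] \<cdot> k) \<Longrightarrow> near C ([n] \<cdot>\<^bsub>T\<^esub> z) ([m] \<cdot>\<^bsub>T\<^esub> x)) \<Longrightarrow> approximates k x z"
  unfolding approximates_def by blast

text \<open>The multiples \<open>n z\<close> and \<open>n z'\<close> are both near \<open>m x\<close>, hence within a bounded distance of each other
  for all \<open>n\<close>.\<close>

lemma approximates_unique:
  assumes "approximates k x z" "approximates k x z'" "\<zero> \<preceq> k" "k \<in> carrier K"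
    "x \<in> carrier T" "z \<in> carrier T" "z' \<in> carrier T"
  shows "z = z'"
proof -
  obtain C where C: "\<And>n m. floor_of m ([(n::nat)] \<cdot> k) \<Longrightarrow> near C ([n] \<cdot>\<^bsub>T\<^esub> z) ([m] \<cdot>\<^bsub>T\<^esub> x)"
    using approximatesE[OF assms(1)] by blast
  obtain D where D: "\<And>n m. floor_of m ([(n::nat)] \<cdot> k) \<Longrightarrow> near D ([n] \<cdot>\<^bsub>T\<^esub> z') ([m] \<cdot>\<^bsub>T\<^esub> x)"
    using approximatesE[OF assms(2)] by blast
  have "near (C + D) ([n] \<cdot>\<^bsub>T\<^esub> z) ([n] \<cdot>\<^bsub>T\<^esub> z')" for n :: nat
  proof -
    obtain m where m: "floor_of m ([n] \<cdot> k)" using floor_exists[of "[n] \<cdot> k"] assms K.nsmul_nonneg by auto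
    show ?thesis using near_trans[OF C[OF m] near_sym[OF D[OF m]]] assms by simp
  qed
  then show ?thesis
    using assms unfolding near_def
    by (intro T.archimedean_eqI[OF T_archimedean, of z z' "[(C + D)] \<cdot>\<^bsub>T\<^esub> w"]) simp_all
qed

text \<open>On a pure tensor \<open>\<tau> \<mu> g\<close> the error is \<open>\<tau> (r \<otimes> \<mu>) g\<close> with the fractional part \<open>r\<close> of \<open>n k\<close>, which
  is bounded because \<open>r\<close> lies between \<open>\<zero>\<close> and \<open>\<one>\<close>. The property is inherited by sums, negatives and
  suprema, as the action of \<open>k\<close> is an \<open>\<ell>\<close>-homomorphism.\<close>

lemma smul_approximates:
  assumes k: "\<zero> \<preceq> k" "k \<in> carrier K" and "x \<in> carrier T"
  shows "approximates k x (smul k x)"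
  using assms(3)
proof (induct rule: T_induct)
  interpret s: lgroup_hom T T "smul k" by (rule smul_hom[OF k])
  {
    case (pure \<mu> g)
    obtain a where a: "norm_le \<mu> a" using norm_le_exists[OF pure(1)] by blast
    obtain b :: nat where b: "g \<preceq>\<^bsub>G\<^esub> [b] \<cdot>\<^bsub>G\<^esub> v" "\<ominus>\<^bsub>G\<^esub> g \<preceq>\<^bsub>G\<^esub> [b] \<cdot>\<^bsub>G\<^esub> v"
      using unit_bound[OF pure(2)] .
    show ?case
    proof (rule approximatesI[of k "a * b"])
      fix n m :: nat assume m: "floor_of m ([n] \<cdot> k)"
      let ?r = "[n] \<cdot> k \<ominus> [m] \<cdot> \<one>"
      have "?r \<preceq> \<one>"
        using m k K.diff_leq_iff[of "[n] \<cdot> k" \<one> "[m] \<cdot> \<one>"] by (simp add: floor_of_def K.nsmul_Suc a_comm)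
      moreover have r0: "\<zero> \<preceq> ?r" "?r \<in> carrier K"
        using m k K.leq_iff[of "[m] \<cdot> \<one>" "[n] \<cdot> k"] by (simp_all add: floor_of_def)
      ultimately have r: "norm_le (?r \<otimes> \<mu>) a"
        using norm_le_mult[OF a] pure by simp
      have "?r \<otimes> \<mu> = ([n] \<cdot> (k \<otimes> \<mu>)) \<oplus> \<ominus> ([m] \<cdot> \<mu>)"
        using k pure nat_mult[of \<mu> m] nat_mult[of "k \<otimes> \<mu>" n] nat_mult[of k n]
        by (simp add: minus_eq l_distr l_minus m_assoc[symmetric])
      then have tr: "\<tau> (?r \<otimes> \<mu>) g = [n] \<cdot>\<^bsub>T\<^esub> smul k (\<tau> \<mu> g) \<ominus>\<^bsub>T\<^esub> [m] \<cdot>\<^bsub>T\<^esub> \<tau> \<mu> g"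
        using k pure by (simp add: tau_add_left tau_minus_left tau_nsmul_left smul_pure T.minus_eq)
      show "near (a * b) ([n] \<cdot>\<^bsub>T\<^esub> smul k (\<tau> \<mu> g)) ([m] \<cdot>\<^bsub>T\<^esub> \<tau> \<mu> g)"
      proof (rule near_diffI)
        show "[n] \<cdot>\<^bsub>T\<^esub> smul k (\<tau> \<mu> g) \<ominus>\<^bsub>T\<^esub> [m] \<cdot>\<^bsub>T\<^esub> \<tau> \<mu> g \<preceq>\<^bsub>T\<^esub> [(a * b)] \<cdot>\<^bsub>T\<^esub> w"
          unfolding tr[symmetric] using pure_bound[OF r] b pure r0 by simp
        have "\<tau> (?r \<otimes> \<mu>) (\<ominus>\<^bsub>G\<^esub> g) \<preceq>\<^bsub>T\<^esub> [(a * b)] \<cdot>\<^bsub>T\<^esub> w"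
          using pure_bound[OF r] b pure r0 by simp
        moreover have "\<tau> (?r \<otimes> \<mu>) (\<ominus>\<^bsub>G\<^esub> g) = [m] \<cdot>\<^bsub>T\<^esub> \<tau> \<mu> g \<ominus>\<^bsub>T\<^esub> [n] \<cdot>\<^bsub>T\<^esub> smul k (\<tau> \<mu> g)"
          using pure k r0 by (simp add: tau_minus tr T.minus_eq T.minus_add T.a_comm)
        ultimately show "[m] \<cdot>\<^bsub>T\<^esub> \<tau> \<mu> g \<ominus>\<^bsub>T\<^esub> [n] \<cdot>\<^bsub>T\<^esub> smul k (\<tau> \<mu> g) \<preceq>\<^bsub>T\<^esub> [(a * b)] \<cdot>\<^bsub>T\<^esub> w" by simp
      qed (use pure k in simp_all)
    qed
  next
    case zero
    show ?case
      by (rule approximatesI[of _ 0]) (simp add: near_def s.zero T.add.nat_pow_one)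
  next
    case (add x y)
    obtain C where C: "\<And>n m. floor_of m ([(n::nat)] \<cdot> k) \<Longrightarrow> near C ([n] \<cdot>\<^bsub>T\<^esub> smul k x) ([m] \<cdot>\<^bsub>T\<^esub> x)"
      using approximatesE[OF add(3)] by blast
    obtain D where D: "\<And>n m. floor_of m ([(n::nat)] \<cdot> k) \<Longrightarrow> near D ([n] \<cdot>\<^bsub>T\<^esub> smul k y) ([m] \<cdot>\<^bsub>T\<^esub> y)"
      using approximatesE[OF add(4)] by blast
    show ?case
    proof (rule approximatesI[of _ "C + D"])
      fix n m :: nat assume m: "floor_of m ([n] \<cdot> k)"
      show "near (C + D) ([n] \<cdot>\<^bsub>T\<^esub> smul k (x \<oplus>\<^bsub>T\<^esub> y)) ([m] \<cdot>\<^bsub>T\<^esub> (x \<oplus>\<^bsub>T\<^esub> y))"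
        using near_add[OF C[OF m] D[OF m]] add by (simp add: s.add T.nsmul_add)
    qed
  next
    case (minus x)
    obtain C where C: "\<And>n m. floor_of m ([(n::nat)] \<cdot> k) \<Longrightarrow> near C ([n] \<cdot>\<^bsub>T\<^esub> smul k x) ([m] \<cdot>\<^bsub>T\<^esub> x)"
      using approximatesE[OF minus(2)] by blast
    show ?case
    proof (rule approximatesI[of _ C])
      fix n m :: nat assume m: "floor_of m ([n] \<cdot> k)"
      show "near C ([n] \<cdot>\<^bsub>T\<^esub> smul k (\<ominus>\<^bsub>T\<^esub> x)) ([m] \<cdot>\<^bsub>T\<^esub> (\<ominus>\<^bsub>T\<^esub> x))"
        using near_minus[OF C[OF m]] minus by (simp add: s.minus T.nsmul_minus)
    qed
  next
    case (sup x y)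
    obtain C where C: "\<And>n m. floor_of m ([(n::nat)] \<cdot> k) \<Longrightarrow> near C ([n] \<cdot>\<^bsub>T\<^esub> smul k x) ([m] \<cdot>\<^bsub>T\<^esub> x)"
      using approximatesE[OF sup(3)] by blast
    obtain D where D: "\<And>n m. floor_of m ([(n::nat)] \<cdot> k) \<Longrightarrow> near D ([n] \<cdot>\<^bsub>T\<^esub> smul k y) ([m] \<cdot>\<^bsub>T\<^esub> y)"
      using approximatesE[OF sup(4)] by blast
    show ?case
    proof (rule approximatesI[of _ "C + D"])
      fix n m :: nat assume m: "floor_of m ([n] \<cdot> k)"
      show "near (C + D) ([n] \<cdot>\<^bsub>T\<^esub> smul k (x \<squnion>\<^bsub>T\<^esub> y)) ([m] \<cdot>\<^bsub>T\<^esub> (x \<squnion>\<^bsub>T\<^esub> y))"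
        using near_sup[OF C[OF m] D[OF m]] sup by (simp add: s.sup T.nsmul_sup)
    qed
  }
qed

lemma near_nsmul:
  assumes "x \<in> carrier T" "x \<preceq>\<^bsub>T\<^esub> [D] \<cdot>\<^bsub>T\<^esub> w" "\<ominus>\<^bsub>T\<^esub> x \<preceq>\<^bsub>T\<^esub> [D] \<cdot>\<^bsub>T\<^esub> w" "b \<le> a" "a \<le> b + (2::nat)"
  shows "near (2 * D) ([a] \<cdot>\<^bsub>T\<^esub> x) ([b] \<cdot>\<^bsub>T\<^esub> x)"
proof -
  have small: "[(a - b)] \<cdot>\<^bsub>T\<^esub> y \<preceq>\<^bsub>T\<^esub> [(2 * D)] \<cdot>\<^bsub>T\<^esub> w"
    if "y \<in> carrier T" "y \<preceq>\<^bsub>T\<^esub> [D] \<cdot>\<^bsub>T\<^esub> w" for y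
  proof -
    have "[(a - b)] \<cdot>\<^bsub>T\<^esub> y \<preceq>\<^bsub>T\<^esub> [(a - b)] \<cdot>\<^bsub>T\<^esub> ([D] \<cdot>\<^bsub>T\<^esub> w)" using that by (intro T.nsmul_mono) simp_all
    moreover have "[((a - b) * D)] \<cdot>\<^bsub>T\<^esub> w \<preceq>\<^bsub>T\<^esub> [(2 * D)] \<cdot>\<^bsub>T\<^esub> w"
      using w_nonneg assms(5) by (intro T.nsmul_mono_left mult_le_mono1) (arith, simp_all)
    ultimately show ?thesis
      using T.leq_trans[of "[(a - b)] \<cdot>\<^bsub>T\<^esub> y" "[((a - b) * D)] \<cdot>\<^bsub>T\<^esub> w" "[(2 * D)] \<cdot>\<^bsub>T\<^esub> w"] that
      by (simp add: T.nsmul_mult)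
  qed
  have a: "[a] \<cdot>\<^bsub>T\<^esub> x = [b] \<cdot>\<^bsub>T\<^esub> x \<oplus>\<^bsub>T\<^esub> [(a - b)] \<cdot>\<^bsub>T\<^esub> x"
    using T.nsmul_add_left[OF assms(1), of b "a - b"] assms(4) by simp
  have b: "[b] \<cdot>\<^bsub>T\<^esub> x = [a] \<cdot>\<^bsub>T\<^esub> x \<oplus>\<^bsub>T\<^esub> [(a - b)] \<cdot>\<^bsub>T\<^esub> (\<ominus>\<^bsub>T\<^esub> x)"
    unfolding a using assms(1) by (simp add: T.nsmul_minus T.a_assoc T.r_neg)
  have "[a] \<cdot>\<^bsub>T\<^esub> x \<preceq>\<^bsub>T\<^esub> [b] \<cdot>\<^bsub>T\<^esub> x \<oplus>\<^bsub>T\<^esub> [(2 * D)] \<cdot>\<^bsub>T\<^esub> w"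
    unfolding a using small[of x] assms(1,2) by (simp add: T.add_leq_cancel_left)
  moreover have "[b] \<cdot>\<^bsub>T\<^esub> x \<preceq>\<^bsub>T\<^esub> [a] \<cdot>\<^bsub>T\<^esub> x \<oplus>\<^bsub>T\<^esub> [(2 * D)] \<cdot>\<^bsub>T\<^esub> w"
    unfolding b using small[of "\<ominus>\<^bsub>T\<^esub> x"] assms(1,3) by (simp add: T.add_leq_cancel_left)
  ultimately show ?thesis by (simp add: near_def)
qed

text \<open>Rounding loses at most \<open>1\<close> in each of the three integer parts. The bound \<open>2\<close>, rather than \<open>1\<close>, is
  needed because \<open>floor_of\<close> admits both neighbours of an integer.\<close>

lemma floor_add:
  assumes "floor_of m1 k" "floor_of m2 l" "floor_of m (k \<oplus> l)" "k \<in> carrier K" "l \<in> carrier K"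
  shows "m \<le> m1 + m2 + 2" "m1 + m2 \<le> m + 2"
proof -
  have "[(m1 + m2)] \<cdot> \<one> \<preceq> k \<oplus> l"
    using assms by (simp add: floor_of_def K.nsmul_add_left K.add_mono)
  then have "[(m1 + m2)] \<cdot> \<one> \<preceq> [Suc m] \<cdot> \<one>"
    using assms K.leq_trans[of "[(m1 + m2)] \<cdot> \<one>" "k \<oplus> l" "[Suc m] \<cdot> \<one>"] by (simp add: floor_of_def)
  from nat_leqD[OF this] show "m1 + m2 \<le> m + 2" by simp
  have "k \<oplus> l \<preceq> [Suc m1] \<cdot> \<one> \<oplus> [Suc m2] \<cdot> \<one>"
    using assms unfolding floor_of_def by (intro K.add_mono) simp_all
  then have "k \<oplus> l \<preceq> [(Suc m1 + Suc m2)] \<cdot> \<one>" using K.nsmul_add_left[of \<one> "Suc m1" "Suc m2"] by simp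
  then have "[m] \<cdot> \<one> \<preceq> [(Suc m1 + Suc m2)] \<cdot> \<one>"
    using assms K.leq_trans[of "[m] \<cdot> \<one>" "k \<oplus> l" "[(Suc m1 + Suc m2)] \<cdot> \<one>"] by (simp add: floor_of_def)
  from nat_leqD[OF this] show "m \<le> m1 + m2 + 2" by simp
qed

text \<open>The right-hand side need not be an \<open>\<ell>\<close>-homomorphism in \<open>x\<close>, so comparing the two sides on pure
  tensors proves nothing. Instead, the right-hand side has the property that characterises the left
  one by \<open>approximates_unique\<close>.\<close>

lemma smul_add_left:
  assumes k: "\<zero> \<preceq> k" "k \<in> carrier K" and l: "\<zero> \<preceq> l" "l \<in> carrier K" and x: "x \<in> carrier T"
  shows "smul (k \<oplus> l) x = smul k x \<oplus>\<^bsub>T\<^esub> smul l x"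
proof -
  have kl: "\<zero> \<preceq> k \<oplus> l" "k \<oplus> l \<in> carrier K" using k l by (simp_all add: K.add_nonneg)
  obtain C where C: "\<And>n m. floor_of m ([(n::nat)] \<cdot> k) \<Longrightarrow> near C ([n] \<cdot>\<^bsub>T\<^esub> smul k x) ([m] \<cdot>\<^bsub>T\<^esub> x)"
    using approximatesE[OF smul_approximates[OF k x]] by blast
  obtain C' where C': "\<And>n m. floor_of m ([(n::nat)] \<cdot> l) \<Longrightarrow> near C' ([n] \<cdot>\<^bsub>T\<^esub> smul l x) ([m] \<cdot>\<^bsub>T\<^esub> x)"
    using approximatesE[OF smul_approximates[OF l x]] by blast
  obtain D :: nat where D: "x \<preceq>\<^bsub>T\<^esub> [D] \<cdot>\<^bsub>T\<^esub> w" "\<ominus>\<^bsub>T\<^esub> x \<preceq>\<^bsub>T\<^esub> [D] \<cdot>\<^bsub>T\<^esub> w" using T_bounded[OF x] by blast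
  have c: "smul k x \<in> carrier T" "smul l x \<in> carrier T" using smul_closed k l x by simp_all
  let ?z = "smul k x \<oplus>\<^bsub>T\<^esub> smul l x"
  have "approximates (k \<oplus> l) x ?z"
  proof (rule approximatesI[of _ "C + C' + 2 * D"])
    fix n m :: nat assume m: "floor_of m ([n] \<cdot> (k \<oplus> l))"
    obtain m1 where m1: "floor_of m1 ([n] \<cdot> k)" using floor_exists[of "[n] \<cdot> k"] k K.nsmul_nonneg by auto
    obtain m2 where m2: "floor_of m2 ([n] \<cdot> l)" using floor_exists[of "[n] \<cdot> l"] l K.nsmul_nonneg by auto
    have "near (C + C') ([n] \<cdot>\<^bsub>T\<^esub> ?z) ([(m1 + m2)] \<cdot>\<^bsub>T\<^esub> x)"
      using near_add[OF C[OF m1] C'[OF m2]] c x by (simp add: T.nsmul_add T.nsmul_add_left)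
    moreover have "near (2 * D) ([(m1 + m2)] \<cdot>\<^bsub>T\<^esub> x) ([m] \<cdot>\<^bsub>T\<^esub> x)"
    proof -
      have "m \<le> m1 + m2 + 2" "m1 + m2 \<le> m + 2"
        using floor_add[OF m1 m2, of m] m k l K.nsmul_add[of k l n] by simp_all
      then show ?thesis
        using near_nsmul[OF x D, of m "m1 + m2"] near_nsmul[OF x D, of "m1 + m2" m] near_sym
        by (cases "m \<le> m1 + m2") simp_all
    qed
    ultimately show "near (C + C' + 2 * D) ([n] \<cdot>\<^bsub>T\<^esub> ?z) ([m] \<cdot>\<^bsub>T\<^esub> x)"
      using near_trans c x by simp
  qed
  then show ?thesis
    using approximates_unique[OF smul_approximates[OF kl x] _ kl x] smul_closed[OF kl x] c by simp
qed

text \<open>Here both sides are \<open>\<ell>\<close>-homomorphisms in \<open>x\<close>, so it suffices to compare them on pure tensors.\<close>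

lemma smul_mult:
  assumes k: "\<zero> \<preceq> k" "k \<in> carrier K" and l: "\<zero> \<preceq> l" "l \<in> carrier K" and x: "x \<in> carrier T"
  shows "smul (k \<otimes> l) x = smul k (smul l x)"
proof -
  have kl: "\<zero> \<preceq> k \<otimes> l" "k \<otimes> l \<in> carrier K" using k l by (simp_all add: mult_nonneg)
  have "smul (k \<otimes> l) = compose (carrier T) (smul k) (smul l)"
  proof (rule l_hom_eqI[OF T_l_group])
    show "smul (k \<otimes> l) \<in> l_hom T T" using smul_spec[OF kl] by blast
    show "compose (carrier T) (smul k) (smul l) \<in> l_hom T T"
      using smul_spec[OF k] smul_spec[OF l] by (intro l_hom_compose[OF T_l_group T_l_group]) auto
  qed (use k l kl in \<open>simp_all add: smul_pure compose_eq m_assoc\<close>)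
  then show ?thesis using x by (simp add: compose_eq)
qed

lemma smul_one:
  assumes "x \<in> carrier T"
  shows "smul \<one> x = x"
proof -
  have "smul \<one> = (\<lambda>x\<in>carrier T. x)"
    by (rule l_hom_eqI[OF T_l_group _ l_hom_id[OF T_l_group]]) (use smul_spec[of \<one>] in auto)
  then show ?thesis using assms by simp
qed

lemma smul_zero:
  assumes "x \<in> carrier T"
  shows "smul \<zero> x = \<zero>\<^bsub>T\<^esub>"
  using smul_add_left[of \<zero> \<zero> x] smul_closed[of \<zero> x] assms T.add.r_cancel_one[of "smul \<zero> x" "smul \<zero> x"] by simp

definition scalar_mult where
  "scalar_mult k x = smul (k \<squnion> \<zero>) x \<ominus>\<^bsub>T\<^esub> smul (\<ominus> k \<squnion> \<zero>) x"

text \<open>By \<open>smul_add_left\<close>, the action of \<open>k\<close> does not depend on how \<open>k\<close> is written as a difference of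
  nonnegative scalars.\<close>

lemma scalar_mult_diff:
  assumes "k \<in> carrier K" "p \<in> carrier K" "q \<in> carrier K" "\<zero> \<preceq> p" "\<zero> \<preceq> q" "k \<oplus> q = p" "x \<in> carrier T"
  shows "scalar_mult k x \<oplus>\<^bsub>T\<^esub> smul q x = smul p x"
proof -
  let ?p = "k \<squnion> \<zero>" and ?q = "\<ominus> k \<squnion> \<zero>"
  have n: "\<zero> \<preceq> ?p" "\<zero> \<preceq> ?q" using assms by (simp_all add: K.sup_ge2)
  have "k \<oplus> ?q = ?p" using assms by (simp add: K.add_sup_left r_neg K.sup_comm)
  then have "?p \<oplus> q = p \<oplus> ?q" using assms a_ac(1)[of k ?q q] a_ac(1)[of k q ?q] a_comm[of ?q q]
    by simp
  then have eq: "smul ?p x \<oplus>\<^bsub>T\<^esub> smul q x = smul p x \<oplus>\<^bsub>T\<^esub> smul ?q x"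
    using smul_add_left[of ?p q x] smul_add_left[of p ?q x] assms n by simp
  have cl: "smul ?p x \<in> carrier T" "smul ?q x \<in> carrier T" "smul p x \<in> carrier T" "smul q x \<in> carrier T"
    using assms n by (simp_all add: smul_closed)
  have "scalar_mult k x \<oplus>\<^bsub>T\<^esub> smul q x = (smul ?p x \<oplus>\<^bsub>T\<^esub> smul q x) \<oplus>\<^bsub>T\<^esub> \<ominus>\<^bsub>T\<^esub> smul ?q x"
    using cl assms by (simp add: scalar_mult_def T.minus_eq T.a_ac)
  also have "\<dots> = smul p x" using cl unfolding eq by (simp add: T.a_assoc T.r_neg)
  finally show ?thesis .
qed

lemma scalar_mult_nonneg: "\<zero> \<preceq> k \<Longrightarrow> k \<in> carrier K \<Longrightarrow> x \<in> carrier T \<Longrightarrow> scalar_mult k x = smul k x"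
  using scalar_mult_diff[of k k \<zero> x] smul_closed[of "k \<squnion> \<zero>" x] smul_closed[of "\<ominus> k \<squnion> \<zero>" x]
  by (simp add: smul_zero K.sup_ge2 scalar_mult_def T.minus_eq)

lemma scalar_mult_closed [simp]: "k \<in> carrier K \<Longrightarrow> x \<in> carrier T \<Longrightarrow> scalar_mult k x \<in> carrier T"
  using smul_closed[of "k \<squnion> \<zero>" x] smul_closed[of "\<ominus> k \<squnion> \<zero>" x] by (simp add: scalar_mult_def K.sup_ge2)

lemma scalar_mult_add_left:
  assumes "k \<in> carrier K" "l \<in> carrier K" "x \<in> carrier T"
  shows "scalar_mult (k \<oplus> l) x = scalar_mult k x \<oplus>\<^bsub>T\<^esub> scalar_mult l x"
proof -
  obtain p q where p: "p \<in> carrier K" "q \<in> carrier K" "\<zero> \<preceq> p" "\<zero> \<preceq> q" "k \<oplus> q = p"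
    using K.nonneg_difference[OF assms(1)] .
  obtain p' q' where p': "p' \<in> carrier K" "q' \<in> carrier K" "\<zero> \<preceq> p'" "\<zero> \<preceq> q'" "l \<oplus> q' = p'"
    using K.nonneg_difference[OF assms(2)] .
  have cl: "smul q x \<in> carrier T" "smul q' x \<in> carrier T" using assms p p' by (simp_all add: smul_closed)
  have "(k \<oplus> l) \<oplus> (q \<oplus> q') = p \<oplus> p'"
    unfolding p(5)[symmetric] p'(5)[symmetric] using assms p(2) p'(2) by (simp add: a_ac)
  then have "scalar_mult (k \<oplus> l) x \<oplus>\<^bsub>T\<^esub> smul (q \<oplus> q') x = smul (p \<oplus> p') x"
    using assms p p' by (intro scalar_mult_diff) (simp_all add: K.add_nonneg)
  also have "\<dots> = (scalar_mult k x \<oplus>\<^bsub>T\<^esub> smul q x) \<oplus>\<^bsub>T\<^esub> (scalar_mult l x \<oplus>\<^bsub>T\<^esub> smul q' x)"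
    using scalar_mult_diff[OF assms(1) p assms(3)] scalar_mult_diff[OF assms(2) p' assms(3)]
      smul_add_left[of p p' x] p p' assms by simp
  also have "\<dots> = (scalar_mult k x \<oplus>\<^bsub>T\<^esub> scalar_mult l x) \<oplus>\<^bsub>T\<^esub> (smul q x \<oplus>\<^bsub>T\<^esub> smul q' x)"
    using cl assms by (simp add: T.a_ac)
  finally show ?thesis using smul_add_left[of q q' x] p p' cl assms by simp
qed

lemma scalar_mult_add:
  assumes "k \<in> carrier K" "x \<in> carrier T" "y \<in> carrier T"
  shows "scalar_mult k (x \<oplus>\<^bsub>T\<^esub> y) = scalar_mult k x \<oplus>\<^bsub>T\<^esub> scalar_mult k y"
proof -
  have n: "\<zero> \<preceq> k \<squnion> \<zero>" "\<zero> \<preceq> \<ominus> k \<squnion> \<zero>" "k \<squnion> \<zero> \<in> carrier K" "\<ominus> k \<squnion> \<zero> \<in> carrier K"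
    using assms by (simp_all add: K.sup_ge2)
  show ?thesis
    using lgroup_hom.add[OF smul_hom[OF n(1,3)] assms(2,3)] lgroup_hom.add[OF smul_hom[OF n(2,4)] assms(2,3)]
      smul_closed[OF n(1,3)] smul_closed[OF n(2,4)] assms
    by (simp add: scalar_mult_def T.minus_eq T.minus_add T.a_ac)
qed

lemma scalar_mult_pure:
  assumes "k \<in> carrier K" "\<mu> \<in> carrier K" "g \<in> carrier G"
  shows "scalar_mult k (\<tau> \<mu> g) = \<tau> (k \<otimes> \<mu>) g"
proof -
  have n: "\<zero> \<preceq> k \<squnion> \<zero>" "\<zero> \<preceq> \<ominus> k \<squnion> \<zero>" using assms by (simp_all add: K.sup_ge2)
  have "k \<oplus> (\<ominus> k \<squnion> \<zero>) = k \<squnion> \<zero>" using assms by (simp add: K.add_sup_left r_neg K.sup_comm)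
  then have "k \<otimes> \<mu> \<oplus> (\<ominus> k \<squnion> \<zero>) \<otimes> \<mu> = (k \<squnion> \<zero>) \<otimes> \<mu>"
    using l_distr[of k "\<ominus> k \<squnion> \<zero>" \<mu>] assms by simp
  then have "\<tau> ((k \<squnion> \<zero>) \<otimes> \<mu>) g = \<tau> (k \<otimes> \<mu>) g \<oplus>\<^bsub>T\<^esub> \<tau> ((\<ominus> k \<squnion> \<zero>) \<otimes> \<mu>) g"
    using tau_add_left[of "k \<otimes> \<mu>" "(\<ominus> k \<squnion> \<zero>) \<otimes> \<mu>" g] assms by simp
  then show ?thesis
    using assms n by (simp add: scalar_mult_def smul_pure T.minus_eq T.a_assoc T.r_neg)
qed

lemma scalar_mult_mult_nonneg:
  assumes "\<zero> \<preceq> k" "k \<in> carrier K" "l \<in> carrier K" "x \<in> carrier T"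
  shows "scalar_mult (k \<otimes> l) x = scalar_mult k (scalar_mult l x)"
proof -
  have n: "\<zero> \<preceq> l \<squnion> \<zero>" "\<zero> \<preceq> \<ominus> l \<squnion> \<zero>" using assms by (simp_all add: K.sup_ge2)
  interpret s: lgroup_hom T T "smul k" using smul_hom assms by blast
  have "l \<oplus> (\<ominus> l \<squnion> \<zero>) = l \<squnion> \<zero>" using assms by (simp add: K.add_sup_left r_neg K.sup_comm)
  then have "k \<otimes> l \<oplus> k \<otimes> (\<ominus> l \<squnion> \<zero>) = k \<otimes> (l \<squnion> \<zero>)"
    using r_distr[of l "\<ominus> l \<squnion> \<zero>" k] assms by simp
  then have "scalar_mult (k \<otimes> l) x \<oplus>\<^bsub>T\<^esub> smul (k \<otimes> (\<ominus> l \<squnion> \<zero>)) x = smul (k \<otimes> (l \<squnion> \<zero>)) x"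
    using assms n by (intro scalar_mult_diff) (simp_all add: mult_nonneg)
  then have "scalar_mult (k \<otimes> l) x \<oplus>\<^bsub>T\<^esub> smul k (smul (\<ominus> l \<squnion> \<zero>) x) = smul k (smul (l \<squnion> \<zero>) x)"
    using assms n by (simp add: smul_mult)
  moreover have "scalar_mult k (scalar_mult l x) \<oplus>\<^bsub>T\<^esub> smul k (smul (\<ominus> l \<squnion> \<zero>) x) = smul k (smul (l \<squnion> \<zero>) x)"
  proof -
    have c: "smul (l \<squnion> \<zero>) x \<in> carrier T" "smul (\<ominus> l \<squnion> \<zero>) x \<in> carrier T"
      using assms n by (simp_all add: smul_closed)
    have "scalar_mult l x \<oplus>\<^bsub>T\<^esub> smul (\<ominus> l \<squnion> \<zero>) x = smul (l \<squnion> \<zero>) x"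
      using c by (simp add: scalar_mult_def T.minus_eq T.a_assoc T.l_neg)
    then show ?thesis
      using s.add[of "scalar_mult l x" "smul (\<ominus> l \<squnion> \<zero>) x"] c assms by (simp add: scalar_mult_nonneg)
  qed
  moreover have "smul k (smul (\<ominus> l \<squnion> \<zero>) x) \<in> carrier T" using assms n by (simp add: smul_closed)
  ultimately show ?thesis
    using assms T.add.right_cancel[of "smul k (smul (\<ominus> l \<squnion> \<zero>) x)" "scalar_mult (k \<otimes> l) x"
        "scalar_mult k (scalar_mult l x)"] by simp
qed

end

section \<open>The tensor product as a linear space\<close>

lemma abelian_group_cong:
  assumes "abelian_group G" "carrier H = carrier G" "\<zero>\<^bsub>H\<^esub> = \<zero>\<^bsub>G\<^esub>" "add H = add G"
  shows "abelian_group H"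
  using abelian_groupE[OF assms(1)] assms(2-4) by (intro abelian_groupI) auto

lemma truncate_extend: "ogroup.truncate (ogroup.extend G s) = G"
  by (cases G) (simp add: ogroup.truncate_def ogroup.extend_def)

lemma extend_simps [simp]:
  "carrier (ogroup.extend G (olspace.fields s)) = carrier G"
  "\<zero>\<^bsub>ogroup.extend G (olspace.fields s)\<^esub> = \<zero>\<^bsub>G\<^esub>"
  "add (ogroup.extend G (olspace.fields s)) = add G"
  "leq (ogroup.extend G (olspace.fields s)) = leq G"
  "scale (ogroup.extend G (olspace.fields s)) = s"
  by (simp_all add: ogroup.extend_def olspace.fields_def)

text \<open>The notions concerning \<open>\<ell>\<close>-groups only depend on the listed fields, so they hold for a linear
  space iff they hold for its underlying \<open>\<ell>\<close>-group.\<close>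

locale truncation =
  fixes V :: "('k, 'v, 'b) olspace_scheme" and T :: "'v ogroup"
  assumes fields: "carrier V = carrier T" "\<zero>\<^bsub>V\<^esub> = \<zero>\<^bsub>T\<^esub>" "add V = add T" "leq V = leq T"
begin

lemma order_of_eq: "order_of V = order_of T"
  by (simp add: order_of_def fields)

lemma nsmul_eq: "[(n::nat)] \<cdot>\<^bsub>V\<^esub> x = [n] \<cdot>\<^bsub>T\<^esub> x"
  by (simp add: add_pow_def nat_pow_def fields)

lemma l_group_eq: "l_group T \<Longrightarrow> l_group V"
  using abelian_group_cong[of T V] by (simp add: l_group_def fields order_of_eq)

lemma archimedean_eq: "archimedean V \<longleftrightarrow> archimedean T"
  by (simp add: archimedean_def fields nsmul_eq)

lemma strong_unit_eq: "strong_unit V u \<longleftrightarrow> strong_unit T u"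
  by (simp add: strong_unit_def fields nsmul_eq)

lemma l_hom_eq: "l_hom V L = l_hom T L"
  by (simp add: l_hom_def fields order_of_eq)

end

lemma truncationI: "ogroup.truncate V = T \<Longrightarrow> truncation V T"
  by unfold_locales (auto simp: ogroup.truncate_def)

context field_tensor
begin

lemma scalar_mult_minus_left: "k \<in> carrier K \<Longrightarrow> x \<in> carrier T \<Longrightarrow> scalar_mult (\<ominus> k) x = \<ominus>\<^bsub>T\<^esub> scalar_mult k x"
  using additive_minus[OF abelian_group_axioms T.abelian_group_axioms, of "\<lambda>k. scalar_mult k x" k]
  by (simp add: scalar_mult_add_left)

lemma scalar_mult_mult:
  assumes "k \<in> carrier K" "l \<in> carrier K" "x \<in> carrier T"
  shows "scalar_mult (k \<otimes> l) x = scalar_mult k (scalar_mult l x)"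
proof (cases "\<zero> \<preceq> k")
  case True
  then show ?thesis using scalar_mult_mult_nonneg assms by simp
next
  case False
  then have "\<zero> \<preceq> \<ominus> k" using total[of \<zero> k] K.leq_minus_iff[of k \<zero>] assms by auto
  then have "scalar_mult (\<ominus> k \<otimes> l) x = scalar_mult (\<ominus> k) (scalar_mult l x)"
    using scalar_mult_mult_nonneg[of "\<ominus> k" l x] assms by simp
  then have "\<ominus>\<^bsub>T\<^esub> scalar_mult (k \<otimes> l) x = \<ominus>\<^bsub>T\<^esub> scalar_mult k (scalar_mult l x)"
    using assms by (simp add: l_minus scalar_mult_minus_left)
  from arg_cong[OF this, of "a_inv T"] show ?thesis using assms by simp
qed

lemma linear_space_exists:
  "\<exists>V :: ('k, ('k, 'g) lterm set) olspace. ogroup.truncate V = T \<and> lo_linear_space K V \<and>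
    (\<forall>k\<in>carrier K. \<forall>\<mu>\<in>carrier K. \<forall>g\<in>carrier G. scale V k (\<tau> \<mu> g) = \<tau> (k \<otimes> \<mu>) g)"
proof -
  let ?V = "ogroup.extend T (olspace.fields scalar_mult)"
  interpret V: truncation ?V T by unfold_locales simp_all
  have lg: "l_group ?V" by (rule V.l_group_eq) (rule T_l_group)
  have "module K (module_of ?V)"
  proof (rule moduleI)
    show "cring K" ..
    show "abelian_group (module_of ?V)"
      by (rule abelian_group_cong[OF T.abelian_group_axioms]) (simp_all add: module_of_def)
    show "\<one> \<odot>\<^bsub>module_of ?V\<^esub> x = x" if "x \<in> carrier (module_of ?V)" for x
      using that smul_one[of x] scalar_mult_nonneg[of \<one> x] by (simp add: module_of_def)
  qed (simp_all add: module_of_def scalar_mult_add_left scalar_mult_add scalar_mult_mult)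
  moreover have "\<zero>\<^bsub>T\<^esub> \<preceq>\<^bsub>T\<^esub> scalar_mult k x"
    if "k \<in> carrier K" "x \<in> carrier T" "\<zero> \<preceq> k" "\<zero>\<^bsub>T\<^esub> \<preceq>\<^bsub>T\<^esub> x" for k x
  proof -
    interpret s: lgroup_hom T T "smul k" using smul_hom that by blast
    show ?thesis using s.mono[of "\<zero>\<^bsub>T\<^esub>" x] that by (simp add: s.zero scalar_mult_nonneg)
  qed
  ultimately have "lo_linear_space K ?V"
    using lg field_axioms by (simp add: lo_linear_space_def)
  then show ?thesis
    by (intro exI[of _ ?V] conjI truncate_extend) (simp_all add: scalar_mult_pure)
qed

abbreviation "V \<equiv> tensor_space K G"

lemma V_spec: "ogroup.truncate V = T \<and> lo_linear_space K V \<and>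
    (\<forall>k\<in>carrier K. \<forall>\<mu>\<in>carrier K. \<forall>g\<in>carrier G. scale V k (\<tau> \<mu> g) = \<tau> (k \<otimes> \<mu>) g)"
  unfolding tensor_space_def by (rule someI_ex) (rule linear_space_exists)

sublocale V: truncation V T
  by (rule truncationI) (use V_spec in blast)

sublocale V: linear_space K V
proof unfold_locales
  show "lo_linear_space K V" using V_spec by blast
  then show "l_group V" by (simp add: lo_linear_space_def)
qed

lemma scale_pure: "k \<in> carrier K \<Longrightarrow> \<mu> \<in> carrier K \<Longrightarrow> g \<in> carrier G \<Longrightarrow> scale V k (\<tau> \<mu> g) = \<tau> (k \<otimes> \<mu>) g"
  using V_spec by blast

lemma V_LinSpAr: "(V, w) \<in> LinSpAr K"
  using V_spec T_archimedean T_strong_unit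
  by (simp add: LinSpAr_def V.archimedean_eq V.strong_unit_eq)

lemma linear_hom_eqI:
  assumes "l_group W" "f \<in> l_hom V W" "f' \<in> l_hom V W"
    and "\<And>k g. k \<in> carrier K \<Longrightarrow> g \<in> carrier G \<Longrightarrow> f (\<tau> k g) = f' (\<tau> k g)"
  shows "f = f'"
  using l_hom_eqI[OF assms(1), of f f'] assms(2-4) by (simp add: V.l_hom_eq)

text \<open>The map \<open>f\<close> is the lift of the bimorphism \<open>(k, g) \<mapsto> k f0(g)\<close>. For nonnegative \<open>k\<close>, the maps \<open>f(k x)\<close>
  and \<open>k f(x)\<close> are \<open>\<ell>\<close>-homomorphisms in \<open>x\<close> that agree on pure tensors.\<close>

lemma linear_lift:
  assumes W: "(W, u) \<in> LinSpAr K" and f0: "f0 \<in> l_hom G W" "f0 v = u"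
  shows "\<exists>f. f \<in> lin_hom K (V, w) (W, u) \<and>
    (\<forall>k\<in>carrier K. \<forall>g\<in>carrier G. f (\<tau> k g) = scale W k (f0 g))"
proof -
  have Wl: "lo_linear_space K W" and arch: "archimedean W" and "l_group W"
    using W by (auto simp: LinSpAr_def lo_linear_space_def)
  interpret W: linear_space K W by unfold_locales fact+
  have f0_closed: "f0 g \<in> carrier W" if "g \<in> carrier G" for g
    using f0(1) that by (auto simp: l_hom_def)
  obtain f where f: "f \<in> l_hom T W" "\<And>k g. k \<in> carrier K \<Longrightarrow> g \<in> carrier G \<Longrightarrow> f (\<tau> k g) = scale W k (f0 g)"
    using lift_exists[OF W.V.l_group arch W.scale_bimorphism[OF G.l_group f0(1)]] by blast
  interpret f: lgroup_hom V W f
    by unfold_locales (use f(1) in \<open>simp add: V.l_hom_eq\<close>)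
  have nonneg: "f (scale V k x) = scale W k (f x)" if k: "\<zero> \<preceq> k" "k \<in> carrier K" and x: "x \<in> carrier V" for k x
  proof -
    have "compose (carrier V) f (\<lambda>x\<in>carrier V. scale V k x) = compose (carrier V) (\<lambda>x\<in>carrier W. scale W k x) f"
    proof (rule linear_hom_eqI[OF W.V.l_group])
      show "compose (carrier V) f (\<lambda>x\<in>carrier V. scale V k x) \<in> l_hom V W"
        by (rule l_hom_compose[OF V.V.l_group V.V.l_group V.scale_l_hom[OF k] f.hom])
      show "compose (carrier V) (\<lambda>x\<in>carrier W. scale W k x) f \<in> l_hom V W"
        by (rule l_hom_compose[OF V.V.l_group W.V.l_group f.hom W.scale_l_hom[OF k]])
    qed (use k f(2) f0_closed in \<open>simp_all add: V.fields(1) compose_eq scale_pure W.scale_mult\<close>)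
    from fun_cong[OF this, of x] show ?thesis using x by (simp add: compose_eq)
  qed
  have "f (scale V k x) = scale W k (f x)" if k: "k \<in> carrier K" and x: "x \<in> carrier V" for k x
  proof (cases "\<zero> \<preceq> k")
    case True
    then show ?thesis using nonneg k x by blast
  next
    case False
    then have "\<zero> \<preceq> \<ominus> k" using total[of \<zero> k] K.leq_minus_iff[of k \<zero>] k by auto
    then have "f (scale V (\<ominus> k) x) = scale W (\<ominus> k) (f x)" using nonneg k x by simp
    then have "\<ominus>\<^bsub>W\<^esub> f (scale V k x) = \<ominus>\<^bsub>W\<^esub> scale W k (f x)"
      using k x by (simp add: V.scale_minus_left W.scale_minus_left f.minus)
    from arg_cong[OF this, of "a_inv W"] show ?thesis using k x by simp
  qed
  moreover have "f w = u" using f(2)[of \<one> v] f0_closed[of v] f0(2) by simp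
  ultimately have "f \<in> lin_hom K (V, w) (W, u)" using f.hom by (simp add: lin_hom_def)
  then show ?thesis using f(2) by blast
qed

end

section \<open>The functor to MV-modules\<close>

text \<open>What is needed of \<open>P\<close> and of its embedding \<open>\<epsilon>\<close> into the unit interval of \<open>K\<close>.\<close>

locale scalars = ordered_field K + P: mv P
  for K :: "('k, 'c) ogroup_scheme" (structure) and P :: "('p, 'd) pmv_scheme" +
  fixes \<epsilon> :: "'p \<Rightarrow> 'k"
  assumes P_total: "mv_total P"
    and \<epsilon>_closed [simp]: "\<alpha> \<in> carrier P \<Longrightarrow> \<epsilon> \<alpha> \<in> carrier K"
    and \<epsilon>_nonneg [simp]: "\<alpha> \<in> carrier P \<Longrightarrow> \<zero> \<preceq> \<epsilon> \<alpha>"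
    and \<epsilon>_le_one [simp]: "\<alpha> \<in> carrier P \<Longrightarrow> \<epsilon> \<alpha> \<preceq> \<one>"
    and \<epsilon>_add: "\<lbrakk>\<alpha> \<in> carrier P; \<beta> \<in> carrier P; mv_summable P \<alpha> \<beta>\<rbrakk> \<Longrightarrow> \<epsilon> (mv_add P \<alpha> \<beta>) = \<epsilon> \<alpha> \<oplus> \<epsilon> \<beta>"
    and \<epsilon>_mult: "\<lbrakk>\<alpha> \<in> carrier P; \<beta> \<in> carrier P\<rbrakk> \<Longrightarrow> \<epsilon> (pmv_mult P \<alpha> \<beta>) = \<epsilon> \<alpha> \<otimes> \<epsilon> \<beta>"
    and \<epsilon>_one: "\<epsilon> (mv_one P) = \<one>"

lemma GammaK_simps [simp]:
  "carrier (GammaK \<epsilon> (V, u)) = {x \<in> carrier V. \<zero>\<^bsub>V\<^esub> \<preceq>\<^bsub>V\<^esub> x \<and> x \<preceq>\<^bsub>V\<^esub> u}"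
  "mv_add (GammaK \<epsilon> (V, u)) = (\<lambda>x y. (x \<oplus>\<^bsub>V\<^esub> y) \<sqinter>\<^bsub>V\<^esub> u)"
  "mv_neg (GammaK \<epsilon> (V, u)) = (\<lambda>x. u \<ominus>\<^bsub>V\<^esub> x)" "mv_zero (GammaK \<epsilon> (V, u)) = \<zero>\<^bsub>V\<^esub>"
  "act (GammaK \<epsilon> (V, u)) = (\<lambda>\<alpha>. scale V (\<epsilon> \<alpha>))"
  "carrier (Gamma_space (V, u)) = {x \<in> carrier V. \<zero>\<^bsub>V\<^esub> \<preceq>\<^bsub>V\<^esub> x \<and> x \<preceq>\<^bsub>V\<^esub> u}"
  by (simp_all add: GammaK_def restrict_scalars_def Gamma_space_def mv.extend_def pmodule.fields_def Gamma_def)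

text \<open>The record of a module adds a field to that of its MV-algebra, which these notions do not see.\<close>

lemma mv_algebra_cong:
  assumes "carrier B = carrier A" "mv_add B = mv_add A" "mv_neg B = mv_neg A" "mv_zero B = mv_zero A"
  shows "mv_algebra B \<longleftrightarrow> mv_algebra A" "semisimple B \<longleftrightarrow> semisimple A"
    "mv_summable B = mv_summable A" "mv_one B = mv_one A"
proof -
  show one: "mv_one B = mv_one A" by (simp add: mv_one_def assms)
  have le: "mv_le B = mv_le A" by (simp add: fun_eq_iff mv_le_def one assms)
  then show "mv_summable B = mv_summable A" by (simp add: fun_eq_iff mv_summable_def assms)
  have "mv_ideal B = mv_ideal A" by (simp add: fun_eq_iff mv_ideal_def assms le)
  then show "semisimple B \<longleftrightarrow> semisimple A"
    by (simp add: semisimple_def mv_maximal_ideal_def assms)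
  show "mv_algebra B \<longleftrightarrow> mv_algebra A" by (simp add: mv_algebra_def assms one)
qed

lemma GammaK_cong:
  "mv_algebra (GammaK \<epsilon> (V, u)) \<longleftrightarrow> mv_algebra (Gamma V u)"
  "semisimple (GammaK \<epsilon> (V, u)) \<longleftrightarrow> semisimple (Gamma V u)"
  "mv_summable (GammaK \<epsilon> (V, u)) = mv_summable (Gamma V u)"
  "mv_one (GammaK \<epsilon> (V, u)) = mv_one (Gamma V u)"
  by (rule mv_algebra_cong; simp add: Gamma_def)+

lemma mv_map_summable:
  assumes "mv_map A B f" "mv_algebra A" "x \<in> carrier A" "y \<in> carrier A" "mv_summable A x y"
  shows "mv_summable B (f x) (f y)"
proof -
  have c: "mv_zero A \<in> carrier A" "mv_neg A x \<in> carrier A" "mv_neg A y \<in> carrier A"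
    using assms(2-4) by (simp_all add: mv_algebra_def)
  have one: "f (mv_one A) = mv_one B" using assms(1) c by (simp add: mv_map_def mv_one_def)
  have "f (mv_add A (mv_neg A x) (mv_neg A y)) = mv_add B (mv_neg B (f x)) (mv_neg B (f y))"
    using assms(1,3,4) c by (simp add: mv_map_def)
  then show ?thesis using assms(5) one by (simp add: mv_summable_def mv_le_def)
qed

context scalars
begin

lemma LinSpArD:
  assumes "(V, u) \<in> LinSpAr K"
  shows "linear_space K V" "lu_grp V u" "archimedean V"
proof -
  have "lo_linear_space K V" "l_group V" "strong_unit V u"
    using assms by (auto simp: LinSpAr_def lo_linear_space_def)
  then show "linear_space K V" "lu_grp V u" by unfold_locales
  show "archimedean V" using assms by (simp add: LinSpAr_def)
qed

text \<open>The scalars from \<open>P\<close> are at most \<open>\<one>\<close>, so they map the unit interval to itself.\<close>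

lemma GammaK_object:
  assumes A: "(V, u) \<in> LinSpAr K"
  shows "GammaK \<epsilon> (V, u) \<in> MVArDom P"
proof -
  interpret V: linear_space K V by (rule LinSpArD[OF A])
  interpret U: lu_grp V u by (rule LinSpArD[OF A])
  have act: "scale V (\<epsilon> \<alpha>) x \<in> U.U" if "\<alpha> \<in> carrier P" "x \<in> U.U" for \<alpha> x
  proof -
    have "scale V (\<epsilon> \<alpha>) x \<preceq>\<^bsub>V\<^esub> scale V \<one> x"
      using that by (intro V.scale_mono_left) simp_all
    then have "scale V (\<epsilon> \<alpha>) x \<preceq>\<^bsub>V\<^esub> u"
      using that V.V.leq_trans[of "scale V (\<epsilon> \<alpha>) x" x u] by simp
    then show ?thesis using that by (simp add: V.scale_nonneg)
  qed
  have add: "mv_summable (Gamma V u) x y \<longleftrightarrow> x \<oplus>\<^bsub>V\<^esub> y \<preceq>\<^bsub>V\<^esub> u"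
    if "x \<in> U.U" "y \<in> U.U" for x y
    using that by (simp add: U.Gamma_summable)
  have "mv_module P (GammaK \<epsilon> (V, u))"
    unfolding mv_module_def GammaK_cong U.Gamma_one
  proof (intro conjI ballI impI)
    show "mv_algebra (Gamma V u)" by (rule U.Gamma_mv_algebra)
    fix x assume "x \<in> carrier (GammaK \<epsilon> (V, u))"
    then have x: "x \<in> U.U" by simp
    then have xc: "x \<in> carrier V" by simp
    show "act (GammaK \<epsilon> (V, u)) (mv_one P) x = x" using x by (simp add: \<epsilon>_one)
    fix \<alpha> assume \<alpha>: "\<alpha> \<in> carrier P"
    show "act (GammaK \<epsilon> (V, u)) \<alpha> x \<in> carrier (GammaK \<epsilon> (V, u))" using act[OF \<alpha> x] by simp
    {
      fix y assume "y \<in> carrier (GammaK \<epsilon> (V, u))" and s: "mv_summable (Gamma V u) x y"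
      then have y: "y \<in> U.U" by simp
      then have yc: "y \<in> carrier V" by simp
      have le: "x \<oplus>\<^bsub>V\<^esub> y \<preceq>\<^bsub>V\<^esub> u" using s add[OF x y] by simp
      then have xy: "x \<oplus>\<^bsub>V\<^esub> y \<in> U.U" using x y by (simp add: V.V.add_nonneg)
      have eq: "scale V (\<epsilon> \<alpha>) x \<oplus>\<^bsub>V\<^esub> scale V (\<epsilon> \<alpha>) y = scale V (\<epsilon> \<alpha>) (x \<oplus>\<^bsub>V\<^esub> y)"
        using \<alpha> xc yc by (simp add: V.scale_add)
      have bound: "scale V (\<epsilon> \<alpha>) x \<oplus>\<^bsub>V\<^esub> scale V (\<epsilon> \<alpha>) y \<preceq>\<^bsub>V\<^esub> u"
        unfolding eq using act[OF \<alpha> xy] by simp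
      then show "mv_summable (Gamma V u) (act (GammaK \<epsilon> (V, u)) \<alpha> x) (act (GammaK \<epsilon> (V, u)) \<alpha> y)"
        using act[OF \<alpha> x] act[OF \<alpha> y] by (simp add: U.Gamma_summable)
      show "mv_add (GammaK \<epsilon> (V, u)) (act (GammaK \<epsilon> (V, u)) \<alpha> x) (act (GammaK \<epsilon> (V, u)) \<alpha> y) =
          act (GammaK \<epsilon> (V, u)) \<alpha> (mv_add (GammaK \<epsilon> (V, u)) x y)"
        using bound le eq \<alpha> xc yc by (simp add: V.V.inf_absorb1)
    }
    fix \<beta> assume \<beta>: "\<beta> \<in> carrier P"
    show "act (GammaK \<epsilon> (V, u)) (pmv_mult P \<alpha> \<beta>) x = act (GammaK \<epsilon> (V, u)) \<alpha> (act (GammaK \<epsilon> (V, u)) \<beta> x)"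
      using \<alpha> \<beta> xc by (simp add: \<epsilon>_mult V.scale_mult)
    assume s: "mv_summable P \<alpha> \<beta>"
    have eq: "scale V (\<epsilon> \<alpha>) x \<oplus>\<^bsub>V\<^esub> scale V (\<epsilon> \<beta>) x = scale V (\<epsilon> (mv_add P \<alpha> \<beta>)) x"
      using \<alpha> \<beta> s xc by (simp add: \<epsilon>_add V.scale_add_left)
    have bound: "scale V (\<epsilon> \<alpha>) x \<oplus>\<^bsub>V\<^esub> scale V (\<epsilon> \<beta>) x \<preceq>\<^bsub>V\<^esub> u"
      unfolding eq using act[OF _ x, of "mv_add P \<alpha> \<beta>"] \<alpha> \<beta> by simp
    then show "mv_summable (Gamma V u) (act (GammaK \<epsilon> (V, u)) \<alpha> x) (act (GammaK \<epsilon> (V, u)) \<beta> x)"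
      using act[OF \<alpha> x] act[OF \<beta> x] by (simp add: U.Gamma_summable)
    show "mv_add (GammaK \<epsilon> (V, u)) (act (GammaK \<epsilon> (V, u)) \<alpha> x) (act (GammaK \<epsilon> (V, u)) \<beta> x) =
        act (GammaK \<epsilon> (V, u)) (mv_add P \<alpha> \<beta>) x"
      using bound eq \<alpha> \<beta> xc by (simp add: V.V.inf_absorb1)
  qed
  moreover have "semisimple (GammaK \<epsilon> (V, u))"
    unfolding GammaK_cong by (rule U.Gamma_semisimple[OF LinSpArD(3)[OF A]])
  ultimately show ?thesis by (simp add: MVArDom_def)
qed

lemma lin_homD:
  assumes "(V, u) \<in> LinSpAr K" "(W, w) \<in> LinSpAr K" "f \<in> lin_hom K (V, u) (W, w)"
  shows "lgroup_hom V W f" "f u = w" "\<And>k x. k \<in> carrier K \<Longrightarrow> x \<in> carrier V \<Longrightarrow> f (scale V k x) = scale W k (f x)"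
proof -
  show "lgroup_hom V W f"
    using LinSpArD(2)[OF assms(1)] LinSpArD(2)[OF assms(2)] assms(3)
    by (intro lgroup_hom.intro lgroup_hom_axioms.intro) (auto simp: lu_grp_def lin_hom_def)
qed (use assms(3) in \<open>auto simp: lin_hom_def\<close>)

lemma lin_hom_unit_interval:
  assumes A: "(V, u) \<in> LinSpAr K" and B: "(W, w) \<in> LinSpAr K" and f: "f \<in> lin_hom K (V, u) (W, w)"
    and x: "x \<in> carrier V" "\<zero>\<^bsub>V\<^esub> \<preceq>\<^bsub>V\<^esub> x" "x \<preceq>\<^bsub>V\<^esub> u"
  shows "f x \<in> carrier W \<and> \<zero>\<^bsub>W\<^esub> \<preceq>\<^bsub>W\<^esub> f x \<and> f x \<preceq>\<^bsub>W\<^esub> w"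
proof -
  interpret f: lgroup_hom V W f by (rule lin_homD[OF A B f])
  interpret U: lu_grp V u by (rule LinSpArD[OF A])
  show ?thesis
    using f.mono[of "\<zero>\<^bsub>V\<^esub>" x] f.mono[of x u] x lin_homD(2)[OF A B f] by (simp add: f.zero)
qed

lemma GammaK_morphism:
  assumes A: "(V, u) \<in> LinSpAr K" and B: "(W, w) \<in> LinSpAr K" and f: "f \<in> lin_hom K (V, u) (W, w)"
  shows "GammaK_map (V, u) f \<in> mv_module_hom P (GammaK \<epsilon> (V, u)) (GammaK \<epsilon> (W, w))"
proof -
  interpret f: lgroup_hom V W f by (rule lin_homD[OF A B f])
  interpret U: lu_grp V u by (rule LinSpArD[OF A])
  interpret W: lu_grp W w by (rule LinSpArD[OF B])
  interpret M: mv "Gamma V u" using U.Gamma_mv_algebra by unfold_locales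
  note fU = lin_hom_unit_interval[OF A B f]
  have module: "mv_module P (GammaK \<epsilon> (V, u))" using GammaK_object[OF A] by (simp add: MVArDom_def)
  have cl: "(x \<oplus>\<^bsub>V\<^esub> y) \<sqinter>\<^bsub>V\<^esub> u \<in> U.U" "u \<ominus>\<^bsub>V\<^esub> x \<in> U.U" if "x \<in> U.U" "y \<in> U.U" for x y
    using M.closed(3)[of x y] M.closed(2)[of x] that by simp_all
  have act: "scale V (\<epsilon> \<alpha>) x \<in> U.U" if "\<alpha> \<in> carrier P" "x \<in> U.U" for \<alpha> x
    using module that unfolding mv_module_def by simp
  have "mv_map (GammaK \<epsilon> (V, u)) (GammaK \<epsilon> (W, w)) (GammaK_map (V, u) f)"
    unfolding mv_map_def
  proof (intro conjI ballI)
    fix x assume "x \<in> carrier (GammaK \<epsilon> (V, u))"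
    then have x: "x \<in> U.U" by simp
    then show "GammaK_map (V, u) f x \<in> carrier (GammaK \<epsilon> (W, w))" using fU by (simp add: GammaK_map_def)
    show "GammaK_map (V, u) f (mv_neg (GammaK \<epsilon> (V, u)) x) = mv_neg (GammaK \<epsilon> (W, w)) (GammaK_map (V, u) f x)"
      using cl(2)[OF x x] x lin_homD(2)[OF A B f]
      by (simp add: GammaK_map_def f.G.minus_eq f.H.minus_eq f.add f.minus)
    fix y assume "y \<in> carrier (GammaK \<epsilon> (V, u))"
    then have y: "y \<in> U.U" by simp
    show "GammaK_map (V, u) f (mv_add (GammaK \<epsilon> (V, u)) x y) =
        mv_add (GammaK \<epsilon> (W, w)) (GammaK_map (V, u) f x) (GammaK_map (V, u) f y)"
      using cl(1)[OF x y] x y lin_homD(2)[OF A B f] by (simp add: GammaK_map_def f.add f.inf)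
  qed (simp add: GammaK_map_def f.zero)
  moreover have "GammaK_map (V, u) f (act (GammaK \<epsilon> (V, u)) \<alpha> x) = act (GammaK \<epsilon> (W, w)) \<alpha> (GammaK_map (V, u) f x)"
    if \<alpha>: "\<alpha> \<in> carrier P" and "x \<in> carrier (GammaK \<epsilon> (V, u))" for \<alpha> x
  proof -
    have x: "x \<in> U.U" using that by simp
    show ?thesis using act[OF \<alpha> x] x \<alpha> lin_homD(3)[OF A B f, of "\<epsilon> \<alpha>" x] by (simp add: GammaK_map_def)
  qed
  moreover have "GammaK_map (V, u) f \<in> carrier (GammaK \<epsilon> (V, u)) \<rightarrow>\<^sub>E carrier (GammaK \<epsilon> (W, w))"
    using fU by (auto simp: GammaK_map_def)
  ultimately show ?thesis unfolding mv_module_hom_def by blast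
qed

lemma GammaK_compose:
  assumes A: "(V, u) \<in> LinSpAr K" and B: "(W, w) \<in> LinSpAr K" and f: "f \<in> lin_hom K (V, u) (W, w)"
  shows "GammaK_map (V, u) (compose (carrier V) g f) =
    compose (carrier (GammaK \<epsilon> (V, u))) (GammaK_map (W, w) g) (GammaK_map (V, u) f)"
  using lin_hom_unit_interval[OF A B f]
  by (auto simp: fun_eq_iff GammaK_map_def compose_def)

lemma mv_module_hom_compose:
  assumes "f \<in> mv_module_hom P L M" "g \<in> mv_module_hom P M N" "mv_module P L"
  shows "compose (carrier L) g f \<in> mv_module_hom P L N"
proof -
  interpret L: mv L using assms(3) by unfold_locales (simp add: mv_module_def)
  have "f x \<in> carrier M" if "x \<in> carrier L" for x
    using assms(1) that by (auto simp: mv_module_hom_def)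
  moreover have "act L \<alpha> x \<in> carrier L" if "x \<in> carrier L" "\<alpha> \<in> carrier P" for x \<alpha>
    using assms(3) that by (simp add: mv_module_def)
  ultimately show ?thesis
    using assms(1,2) by (simp add: mv_module_hom_def mv_map_def compose_eq) (auto simp: compose_def)
qed

lemma mv_module_hom_id: "mv_module P M \<Longrightarrow> (\<lambda>x\<in>carrier M. x) \<in> mv_module_hom P M M"
proof -
  assume M: "mv_module P M"
  interpret M: mv M using M by unfold_locales (simp add: mv_module_def)
  show ?thesis using M by (simp add: mv_module_hom_def mv_map_def mv_module_def)
qed

end

section \<open>The universal arrow\<close>

locale presented_module = scalars K P \<epsilon>
  for K :: "('k, 'c) ogroup_scheme" (structure) and P :: "('p, 'd) pmv_scheme" and \<epsilon> :: "'p \<Rightarrow> 'k" +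
  fixes M :: "('p, 'm) pmodule" and G :: "'g ogroup" and v :: 'g and \<phi> :: "'m \<Rightarrow> 'g"
  assumes module: "mv_module P M" and presents: "presents M (G, v, \<phi>)"
begin

sublocale M: mv M
  using module by unfold_locales (simp add: mv_module_def)

sublocale field_tensor K G v
  using presents
  by (intro field_tensor.intro lu_grp.intro lgroup.intro lu_grp_axioms.intro ordered_field_axioms)
     (auto simp: presents_def lu_group_def)

lemma \<phi>_map: "mv_map M (Gamma G v) \<phi>" and \<phi>_bij: "bij_betw \<phi> (carrier M) G.U"
  using presents by (auto simp: presents_def mv_iso_def)

lemma \<phi>_U: "x \<in> carrier M \<Longrightarrow> \<phi> x \<in> carrier G \<and> \<zero>\<^bsub>G\<^esub> \<preceq>\<^bsub>G\<^esub> \<phi> x \<and> \<phi> x \<preceq>\<^bsub>G\<^esub> v"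
  using \<phi>_map by (simp add: mv_map_def)

lemma \<phi>_closed [simp]: "x \<in> carrier M \<Longrightarrow> \<phi> x \<in> carrier G"
  using \<phi>_U by blast

lemma \<phi>_add:
  assumes "x \<in> carrier M" "y \<in> carrier M" "mv_summable M x y"
  shows "\<phi> (mv_add M x y) = \<phi> x \<oplus>\<^bsub>G\<^esub> \<phi> y"
proof -
  have "mv_summable (Gamma G v) (\<phi> x) (\<phi> y)"
    by (rule mv_map_summable[OF \<phi>_map M.mv_algebra assms])
  then have "\<phi> x \<oplus>\<^bsub>G\<^esub> \<phi> y \<preceq>\<^bsub>G\<^esub> v" using assms by (simp add: G.Gamma_summable)
  then show ?thesis using \<phi>_map assms by (simp add: mv_map_def G.inf_absorb1)
qed

lemma act_closed [simp]: "\<alpha> \<in> carrier P \<Longrightarrow> x \<in> carrier M \<Longrightarrow> act M \<alpha> x \<in> carrier M"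
  using module by (simp add: mv_module_def)

lemma \<phi>_act_add:
  assumes "\<alpha> \<in> carrier P" "\<beta> \<in> carrier P" "x \<in> carrier M" "mv_summable P \<alpha> \<beta>"
  shows "\<phi> (act M (mv_add P \<alpha> \<beta>) x) = \<phi> (act M \<alpha> x) \<oplus>\<^bsub>G\<^esub> \<phi> (act M \<beta> x)"
proof -
  have "mv_summable M (act M \<alpha> x) (act M \<beta> x)"
    "mv_add M (act M \<alpha> x) (act M \<beta> x) = act M (mv_add P \<alpha> \<beta>) x"
    using module assms by (simp_all add: mv_module_def)
  then show ?thesis using \<phi>_add[of "act M \<alpha> x" "act M \<beta> x"] assms by simp
qed

lemma act_one: "x \<in> carrier M \<Longrightarrow> act M (mv_one P) x = x"
  using module by (simp add: mv_module_def)

text \<open>Division with remainder: \<open>m\<close> and \<open>r\<close> are the integer and the fractional part of \<open>n \<alpha>\<close>. In the step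
  from \<open>n\<close> to \<open>n + 1\<close> either \<open>r + \<alpha>\<close> is defined, or, \<open>P\<close> being a chain, \<open>\<alpha>\<close> exceeds \<open>r\<^sup>*\<close>; in the
  latter case \<open>r + r\<^sup>* = 1\<close> is carried over to \<open>m\<close>. As \<open>r\<close> remains in \<open>P\<close>, the same calculation can be
  carried out in \<open>K\<close> and, by additivity of the action, on \<open>x\<close>.\<close>

lemma multiple_decomposition:
  assumes \<alpha>: "\<alpha> \<in> carrier P" and x: "x \<in> carrier M"
  shows "\<exists>m. \<exists>r\<in>carrier P. [(n::nat)] \<cdot> \<epsilon> \<alpha> = [(m::nat)] \<cdot> \<one> \<oplus> \<epsilon> r \<and>
    [n] \<cdot>\<^bsub>G\<^esub> \<phi> (act M \<alpha> x) = [m] \<cdot>\<^bsub>G\<^esub> \<phi> x \<oplus>\<^bsub>G\<^esub> \<phi> (act M r x)"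
proof (induct n)
  case 0
  have s: "mv_summable P (mv_zero P) (mv_zero P)" by (simp add: P.summable_iff)
  have "\<epsilon> (mv_zero P) = \<zero>"
    using \<epsilon>_add[OF _ _ s] add.r_cancel_one[of "\<epsilon> (mv_zero P)" "\<epsilon> (mv_zero P)"] by simp
  moreover have "\<phi> (act M (mv_zero P) x) = \<zero>\<^bsub>G\<^esub>"
    using \<phi>_act_add[OF _ _ x s] x G.add.r_cancel_one[of "\<phi> (act M (mv_zero P) x)" "\<phi> (act M (mv_zero P) x)"]
    by simp
  ultimately show ?case by (intro exI[of _ 0] bexI[of _ "mv_zero P"]) simp_all
next
  case (Suc n)
  then obtain m r where r: "r \<in> carrier P" "[n] \<cdot> \<epsilon> \<alpha> = [(m::nat)] \<cdot> \<one> \<oplus> \<epsilon> r"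
    "[n] \<cdot>\<^bsub>G\<^esub> \<phi> (act M \<alpha> x) = [m] \<cdot>\<^bsub>G\<^esub> \<phi> x \<oplus>\<^bsub>G\<^esub> \<phi> (act M r x)" by blast
  have step: "[Suc n] \<cdot> \<epsilon> \<alpha> = [m] \<cdot> \<one> \<oplus> (\<epsilon> r \<oplus> \<epsilon> \<alpha>)"
    "[Suc n] \<cdot>\<^bsub>G\<^esub> \<phi> (act M \<alpha> x) = [m] \<cdot>\<^bsub>G\<^esub> \<phi> x \<oplus>\<^bsub>G\<^esub> (\<phi> (act M r x) \<oplus>\<^bsub>G\<^esub> \<phi> (act M \<alpha> x))"
    using \<alpha> x r by (simp_all add: K.nsmul_Suc G.nsmul_Suc a_assoc G.a_assoc)
  show ?case
  proof (cases "mv_summable P r \<alpha>")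
    case True
    then show ?thesis
      using step \<alpha> x r(1) by (intro exI[of _ m] bexI[of _ "mv_add P r \<alpha>"]) (simp_all add: \<epsilon>_add \<phi>_act_add)
  next
    case False
    let ?c = "mv_neg P r"
    let ?s = "P.minus \<alpha> ?c"
    \<comment> \<open>\<open>\<alpha> = r\<^sup>* + s\<close>, so that \<open>r + \<alpha> = 1 + s\<close>\<close>
    have "mv_le P ?c \<alpha>"
      using False P_total \<alpha> r(1) P.compl_le[of ?c \<alpha>] unfolding mv_total_def mv_summable_def by auto
    then have \<alpha>_eq: "mv_add P ?c ?s = \<alpha>" "mv_summable P ?c ?s"
      using P.add_minus[of ?c \<alpha>] P.summable_minus[of ?c \<alpha>] \<alpha> r(1) by simp_all
    have c: "mv_summable P r ?c" "mv_add P r ?c = mv_one P" using r(1) by (simp_all add: P.summable_iff)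
    have cl: "?c \<in> carrier P" "?s \<in> carrier P" using \<alpha> r(1) by simp_all
    have "\<epsilon> r \<oplus> \<epsilon> \<alpha> = (\<epsilon> r \<oplus> \<epsilon> ?c) \<oplus> \<epsilon> ?s"
      using \<epsilon>_add[OF cl \<alpha>_eq(2)] \<alpha>_eq(1) cl r(1) by (simp add: a_assoc)
    also have "\<epsilon> r \<oplus> \<epsilon> ?c = \<one>" using \<epsilon>_add[OF r(1) cl(1) c(1)] c(2) by (simp add: \<epsilon>_one)
    finally have e: "\<epsilon> r \<oplus> \<epsilon> \<alpha> = \<one> \<oplus> \<epsilon> ?s" .
    have "\<phi> (act M r x) \<oplus>\<^bsub>G\<^esub> \<phi> (act M \<alpha> x) = (\<phi> (act M r x) \<oplus>\<^bsub>G\<^esub> \<phi> (act M ?c x)) \<oplus>\<^bsub>G\<^esub> \<phi> (act M ?s x)"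
      using \<phi>_act_add[OF cl x \<alpha>_eq(2)] \<alpha>_eq(1) cl r(1) x by (simp add: G.a_assoc)
    also have "\<phi> (act M r x) \<oplus>\<^bsub>G\<^esub> \<phi> (act M ?c x) = \<phi> x"
      using \<phi>_act_add[OF r(1) cl(1) x c(1)] c(2) act_one[OF x] by simp
    finally have p: "\<phi> (act M r x) \<oplus>\<^bsub>G\<^esub> \<phi> (act M \<alpha> x) = \<phi> x \<oplus>\<^bsub>G\<^esub> \<phi> (act M ?s x)" .
    show ?thesis
      using step cl x unfolding e p
      by (intro exI[of _ "Suc m"] bexI[of _ ?s]) (simp_all add: K.nsmul_Suc G.nsmul_Suc a_assoc G.a_assoc)
  qed
qed

text \<open>The \<open>n\<close>-fold multiples of both sides are \<open>m (1 \<otimes> x)\<close> plus a remainder between \<open>0\<close> and the unit, by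
  \<open>multiple_decomposition\<close>. So they are within the distance \<open>w\<close> of each other, for all \<open>n\<close>.\<close>

lemma pure_act:
  assumes \<alpha>: "\<alpha> \<in> carrier P" and x: "x \<in> carrier M"
  shows "\<tau> \<one> (\<phi> (act M \<alpha> x)) = \<tau> (\<epsilon> \<alpha>) (\<phi> x)"
proof (rule T.archimedean_eqI[OF T_archimedean, of _ _ w])
  fix n :: nat
  obtain m r where r: "r \<in> carrier P" "[n] \<cdot> \<epsilon> \<alpha> = [(m::nat)] \<cdot> \<one> \<oplus> \<epsilon> r"
    "[n] \<cdot>\<^bsub>G\<^esub> \<phi> (act M \<alpha> x) = [m] \<cdot>\<^bsub>G\<^esub> \<phi> x \<oplus>\<^bsub>G\<^esub> \<phi> (act M r x)"
    using multiple_decomposition[OF \<alpha> x] by blast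
  let ?a = "[m] \<cdot>\<^bsub>T\<^esub> \<tau> \<one> (\<phi> x)" and ?b = "\<tau> \<one> (\<phi> (act M r x))" and ?c = "\<tau> (\<epsilon> r) (\<phi> x)"
  have cl: "?a \<in> carrier T" "?b \<in> carrier T" "?c \<in> carrier T" using r(1) x by simp_all
  have "[n] \<cdot>\<^bsub>T\<^esub> \<tau> \<one> (\<phi> (act M \<alpha> x)) = \<tau> \<one> ([n] \<cdot>\<^bsub>G\<^esub> \<phi> (act M \<alpha> x))"
    using \<alpha> x by (simp add: tau_nsmul)
  also have "\<dots> = ?a \<oplus>\<^bsub>T\<^esub> ?b" unfolding r(3) using r(1) x by (simp add: tau_add tau_nsmul)
  finally have 1: "[n] \<cdot>\<^bsub>T\<^esub> \<tau> \<one> (\<phi> (act M \<alpha> x)) = ?a \<oplus>\<^bsub>T\<^esub> ?b" .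
  have "[n] \<cdot>\<^bsub>T\<^esub> \<tau> (\<epsilon> \<alpha>) (\<phi> x) = \<tau> ([n] \<cdot> \<epsilon> \<alpha>) (\<phi> x)"
    using \<alpha> x by (simp add: tau_nsmul_left)
  also have "\<dots> = ?a \<oplus>\<^bsub>T\<^esub> ?c" unfolding r(2) using r(1) x by (simp add: tau_add_left tau_nsmul_left)
  finally have 2: "[n] \<cdot>\<^bsub>T\<^esub> \<tau> (\<epsilon> \<alpha>) (\<phi> x) = ?a \<oplus>\<^bsub>T\<^esub> ?c" .
  have bounds: "\<zero>\<^bsub>T\<^esub> \<preceq>\<^bsub>T\<^esub> ?b" "?b \<preceq>\<^bsub>T\<^esub> w"
    using tau_mono[of \<one> "\<zero>\<^bsub>G\<^esub>" "\<phi> (act M r x)"] tau_mono[of \<one> "\<phi> (act M r x)" v] \<phi>_U[of "act M r x"] r(1) x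
    by (simp_all add: tau_zero)
  have "\<zero>\<^bsub>T\<^esub> \<preceq>\<^bsub>T\<^esub> ?c" using tau_mono[of "\<epsilon> r" "\<zero>\<^bsub>G\<^esub>" "\<phi> x"] \<phi>_U[OF x] r(1) x by (simp add: tau_zero)
  moreover have "?c \<preceq>\<^bsub>T\<^esub> w"
    using tau_mono_left[of "\<epsilon> r" \<one> "\<phi> x"] tau_mono[of \<one> "\<phi> x" v] \<phi>_U[OF x] r(1) x
      T.leq_trans[of ?c "\<tau> \<one> (\<phi> x)" w] by simp
  ultimately have le: "?b \<preceq>\<^bsub>T\<^esub> ?c \<oplus>\<^bsub>T\<^esub> w" "?c \<preceq>\<^bsub>T\<^esub> ?b \<oplus>\<^bsub>T\<^esub> w"
    using bounds cl T.add_mono[of "\<zero>\<^bsub>T\<^esub>" ?c ?b w] T.add_mono[of "\<zero>\<^bsub>T\<^esub>" ?b ?c w] by simp_all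
  show "[n] \<cdot>\<^bsub>T\<^esub> \<tau> \<one> (\<phi> (act M \<alpha> x)) \<preceq>\<^bsub>T\<^esub> [n] \<cdot>\<^bsub>T\<^esub> \<tau> (\<epsilon> \<alpha>) (\<phi> x) \<oplus>\<^bsub>T\<^esub> w"
    "[n] \<cdot>\<^bsub>T\<^esub> \<tau> (\<epsilon> \<alpha>) (\<phi> x) \<preceq>\<^bsub>T\<^esub> [n] \<cdot>\<^bsub>T\<^esub> \<tau> \<one> (\<phi> (act M \<alpha> x)) \<oplus>\<^bsub>T\<^esub> w"
    unfolding 1 2 using le cl by (simp_all add: T.a_assoc T.add_leq_cancel_left)
qed (use \<alpha> x in simp_all)

lemma tensor_obj_eq: "tensor_obj K (G, v, \<phi>) = (V, w)"
  by (simp add: tensor_obj_def)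

lemma tensor_unit_eq: "tensor_unit K M (G, v, \<phi>) = (\<lambda>x\<in>carrier M. \<tau> \<one> (\<phi> x))"
  by (simp add: tensor_unit_def)

lemma tensor_obj_LinSpAr: "tensor_obj K (G, v, \<phi>) \<in> LinSpAr K"
  unfolding tensor_obj_eq by (rule V_LinSpAr)

lemma tensor_unit_hom:
  "tensor_unit K M (G, v, \<phi>) \<in> mv_module_hom P M (GammaK \<epsilon> (tensor_obj K (G, v, \<phi>)))"
  unfolding tensor_obj_eq tensor_unit_eq
proof -
  have U: "\<tau> \<one> (\<phi> x) \<in> carrier (GammaK \<epsilon> (V, w))" if "x \<in> carrier M" for x
    using tau_mono[of \<one> "\<zero>\<^bsub>G\<^esub>" "\<phi> x"] tau_mono[of \<one> "\<phi> x" v] \<phi>_U[OF that] that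
    by (simp add: V.fields tau_zero)
  have minus: "a \<ominus>\<^bsub>V\<^esub> b = a \<ominus>\<^bsub>T\<^esub> b" for a b
    by (simp add: a_minus_def a_inv_def m_inv_def V.fields)
  have "mv_map M (GammaK \<epsilon> (V, w)) (\<lambda>x\<in>carrier M. \<tau> \<one> (\<phi> x))"
    unfolding mv_map_def
  proof (intro conjI ballI)
    have "\<phi> (mv_zero M) = \<zero>\<^bsub>G\<^esub>" using \<phi>_map by (simp add: mv_map_def)
    then show "(\<lambda>x\<in>carrier M. \<tau> \<one> (\<phi> x)) (mv_zero M) = mv_zero (GammaK \<epsilon> (V, w))"
      by (simp add: tau_zero V.fields)
    fix x assume x: "x \<in> carrier M"
    show "(\<lambda>x\<in>carrier M. \<tau> \<one> (\<phi> x)) x \<in> carrier (GammaK \<epsilon> (V, w))" using U[OF x] x by simp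
    have "\<phi> (mv_neg M x) = v \<ominus>\<^bsub>G\<^esub> \<phi> x" using \<phi>_map x by (simp add: mv_map_def)
    then show "(\<lambda>x\<in>carrier M. \<tau> \<one> (\<phi> x)) (mv_neg M x) = mv_neg (GammaK \<epsilon> (V, w)) ((\<lambda>x\<in>carrier M. \<tau> \<one> (\<phi> x)) x)"
      using x by (simp add: minus G.minus_eq T.minus_eq tau_add tau_minus)
    fix y assume y: "y \<in> carrier M"
    have "\<phi> (mv_add M x y) = (\<phi> x \<oplus>\<^bsub>G\<^esub> \<phi> y) \<sqinter>\<^bsub>G\<^esub> v" using \<phi>_map x y by (simp add: mv_map_def)
    then show "(\<lambda>x\<in>carrier M. \<tau> \<one> (\<phi> x)) (mv_add M x y) =
       mv_add (GammaK \<epsilon> (V, w)) ((\<lambda>x\<in>carrier M. \<tau> \<one> (\<phi> x)) x) ((\<lambda>x\<in>carrier M. \<tau> \<one> (\<phi> x)) y)"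
      using x y by (simp add: tau_inf tau_add V.fields V.order_of_eq)
  qed
  moreover have "(\<lambda>x\<in>carrier M. \<tau> \<one> (\<phi> x)) (act M \<alpha> x) = act (GammaK \<epsilon> (V, w)) \<alpha> ((\<lambda>x\<in>carrier M. \<tau> \<one> (\<phi> x)) x)"
    if "\<alpha> \<in> carrier P" "x \<in> carrier M" for \<alpha> x
    using that pure_act[OF that] by (simp add: scale_pure)
  ultimately show "(\<lambda>x\<in>carrier M. \<tau> \<one> (\<phi> x)) \<in> mv_module_hom P M (GammaK \<epsilon> (V, w))"
    using U unfolding mv_module_hom_def by (simp del: GammaK_simps)
qed

text \<open>Transferred along \<open>\<phi>\<close>, the map \<open>h\<close> becomes a homomorphism between unit intervals, which extends
  to the groups.\<close>

lemma hom_extension: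
  assumes W: "(W, u) \<in> LinSpAr K" and h: "h \<in> mv_module_hom P M (GammaK \<epsilon> (W, u))"
  shows "\<exists>f0\<in>l_hom G W. f0 v = u \<and> (\<forall>x\<in>carrier M. f0 (\<phi> x) = h x)"
proof -
  interpret W: lu_grp W u by (rule LinSpArD[OF W])
  let ?\<psi> = "inv_into (carrier M) \<phi>"
  have \<psi>: "?\<psi> g \<in> carrier M" "\<phi> (?\<psi> g) = g" if "g \<in> G.U" for g
    using that \<phi>_bij inv_into_into[of g \<phi> "carrier M"] f_inv_into_f[of g \<phi> "carrier M"]
    by (auto simp: bij_betw_def)
  have \<psi>\<phi>: "?\<psi> (\<phi> x) = x" if "x \<in> carrier M" for x
    using that \<phi>_bij by (simp add: bij_betw_def)
  have h_map: "mv_map M (GammaK \<epsilon> (W, u)) h" using h by (simp add: mv_module_hom_def)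
  have \<psi>_oplus: "?\<psi> ((a \<oplus>\<^bsub>G\<^esub> b) \<sqinter>\<^bsub>G\<^esub> v) = mv_add M (?\<psi> a) (?\<psi> b)" if "a \<in> G.U" "b \<in> G.U" for a b
    using \<psi>\<phi>[of "mv_add M (?\<psi> a) (?\<psi> b)"] \<psi>[OF that(1)] \<psi>[OF that(2)] \<phi>_map by (simp add: mv_map_def)
  have \<psi>_neg: "?\<psi> (v \<ominus>\<^bsub>G\<^esub> a) = mv_neg M (?\<psi> a)" if "a \<in> G.U" for a
    using \<psi>\<phi>[of "mv_neg M (?\<psi> a)"] \<psi>[OF that] \<phi>_map by (simp add: mv_map_def)
  have \<psi>_zero: "?\<psi> \<zero>\<^bsub>G\<^esub> = mv_zero M"
    using \<psi>\<phi>[of "mv_zero M"] \<phi>_map by (simp add: mv_map_def)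
  have "mv_map (Gamma G v) (Gamma W u) (h \<circ> ?\<psi>)"
    unfolding mv_map_def
  proof (intro conjI ballI)
    show "(h \<circ> ?\<psi>) (mv_zero (Gamma G v)) = mv_zero (Gamma W u)"
      using h_map by (simp add: mv_map_def \<psi>_zero)
    fix a assume "a \<in> carrier (Gamma G v)"
    then have a: "a \<in> G.U" by simp
    show "(h \<circ> ?\<psi>) a \<in> carrier (Gamma W u)" using h_map \<psi>[OF a] by (simp add: mv_map_def)
    show "(h \<circ> ?\<psi>) (mv_neg (Gamma G v) a) = mv_neg (Gamma W u) ((h \<circ> ?\<psi>) a)"
      using h_map \<psi>[OF a] by (simp add: mv_map_def \<psi>_neg[OF a])
    fix b assume "b \<in> carrier (Gamma G v)"
    then have b: "b \<in> G.U" by simp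
    show "(h \<circ> ?\<psi>) (mv_add (Gamma G v) a b) = mv_add (Gamma W u) ((h \<circ> ?\<psi>) a) ((h \<circ> ?\<psi>) b)"
      using h_map \<psi>[OF a] \<psi>[OF b] by (simp add: mv_map_def \<psi>_oplus[OF a b])
  qed
  then interpret E: Gamma_hom G v W u "h \<circ> ?\<psi>" by unfold_locales
  have "E.ext (\<phi> x) = h x" if "x \<in> carrier M" for x
    using E.ext_unit[of "\<phi> x"] \<phi>_U[OF that] \<psi>\<phi>[OF that] by simp
  moreover have "E.ext v = u" using E.ext_unit[of v] E.h_unit by simp
  ultimately show ?thesis using E.ext_l_hom by blast
qed

lemma compose_tensor_unit:
  assumes x: "x \<in> carrier M"
  shows "compose (carrier M) (GammaK_map (V, w) f) (tensor_unit K M (G, v, \<phi>)) x = f (\<tau> \<one> (\<phi> x))"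
proof -
  have "\<tau> \<one> (\<phi> x) \<in> carrier (Gamma_space (V, w))"
    using tau_mono[of \<one> "\<zero>\<^bsub>G\<^esub>" "\<phi> x"] tau_mono[of \<one> "\<phi> x" v] \<phi>_U[OF x] x
    by (simp add: V.fields tau_zero)
  then show ?thesis using x by (simp add: compose_eq GammaK_map_def tensor_unit_eq del: GammaK_simps)
qed

text \<open>Existence is \<open>hom_extension\<close> followed by \<open>linear_lift\<close>. For uniqueness, the triangle determines
  \<open>f (1 \<otimes> g)\<close> for \<open>g\<close> in the unit interval, additivity then determines it for all \<open>g\<close>, and homogeneity
  determines \<open>f\<close> on all pure tensors.\<close>

lemma universal_arrow:
  assumes A: "A \<in> LinSpAr K" and h: "h \<in> mv_module_hom P M (GammaK \<epsilon> A)"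
  shows "\<exists>!f. f \<in> lin_hom K (tensor_obj K (G, v, \<phi>)) A \<and>
    compose (carrier M) (GammaK_map (tensor_obj K (G, v, \<phi>)) f) (tensor_unit K M (G, v, \<phi>)) = h"
proof -
  obtain W u where Wu: "A = (W, u)" by fastforce
  have W: "(W, u) \<in> LinSpAr K" and h: "h \<in> mv_module_hom P M (GammaK \<epsilon> (W, u))"
    using A h Wu by simp_all
  interpret W: linear_space K W by (rule LinSpArD[OF W])
  have h_ext: "h \<in> extensional (carrier M)" using h by (auto simp: mv_module_hom_def PiE_def)
  obtain f0 where f0: "f0 \<in> l_hom G W" "f0 v = u" "\<And>x. x \<in> carrier M \<Longrightarrow> f0 (\<phi> x) = h x"
    using hom_extension[OF W h] by blast
  interpret f0: lgroup_hom G W f0 by unfold_locales (rule f0(1))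
  obtain f where f: "f \<in> lin_hom K (V, w) (W, u)"
    "\<And>k g. k \<in> carrier K \<Longrightarrow> g \<in> carrier G \<Longrightarrow> f (\<tau> k g) = scale W k (f0 g)"
    using linear_lift[OF W f0(1,2)] by blast
  have triangle: "compose (carrier M) (GammaK_map (V, w) f) (tensor_unit K M (G, v, \<phi>)) = h"
  proof (rule extensionalityI[OF compose_extensional h_ext])
    fix x assume x: "x \<in> carrier M"
    then show "compose (carrier M) (GammaK_map (V, w) f) (tensor_unit K M (G, v, \<phi>)) x = h x"
      unfolding compose_tensor_unit[OF x] using f(2)[of \<one> "\<phi> x"] f0(3)[OF x] f0.closed[of "\<phi> x"] by simp
  qed
  \<comment> \<open>\<open>f0\<close> is recovered from the triangle, and \<open>f\<close> from \<open>f0\<close>\<close>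
  have unique: "f' = f"
    if f': "f' \<in> lin_hom K (V, w) (W, u)"
      and tri: "compose (carrier M) (GammaK_map (V, w) f') (tensor_unit K M (G, v, \<phi>)) = h" for f'
  proof -
    interpret f': lgroup_hom V W f' by (rule lin_homD[OF V_LinSpAr W f'])
    have val: "f' (\<tau> \<one> (\<phi> x)) = f0 (\<phi> x)" if "x \<in> carrier M" for x
      using fun_cong[OF tri, of x] f0(3)[OF that] compose_tensor_unit[OF that, of f'] by simp
    have one: "f' (\<tau> \<one> g) = f0 g" if g: "g \<in> carrier G" for g
    proof (rule G.additive_eqI[OF W.V.abelian_group_axioms _ f0.maps _ f0.add _ g])
      show "(\<lambda>g. f' (\<tau> \<one> g)) \<in> carrier G \<rightarrow> carrier W"
        using f'.closed by (simp add: V.fields)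
      show "f' (\<tau> \<one> (x \<oplus>\<^bsub>G\<^esub> y)) = f' (\<tau> \<one> x) \<oplus>\<^bsub>W\<^esub> f' (\<tau> \<one> y)"
        if "x \<in> carrier G" "y \<in> carrier G" for x y
        using f'.add[of "\<tau> \<one> x" "\<tau> \<one> y"] that by (simp add: tau_add V.fields)
      fix x assume "x \<in> G.U"
      then obtain m where "m \<in> carrier M" "x = \<phi> m" using \<phi>_bij by (auto simp: bij_betw_def)
      then show "f' (\<tau> \<one> x) = f0 x" using val by simp
    qed
    show ?thesis
    proof (rule linear_hom_eqI[OF W.V.l_group])
      show "f' \<in> l_hom V W" by (rule f'.hom)
      show "f \<in> l_hom V W" using f(1) by (simp add: lin_hom_def)
      fix k g assume kg: "k \<in> carrier K" "g \<in> carrier G"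
      have "f' (\<tau> k g) = f' (scale V k (\<tau> \<one> g))" using kg by (simp add: scale_pure)
      also have "\<dots> = scale W k (f0 g)"
        using lin_homD(3)[OF V_LinSpAr W f', of k "\<tau> \<one> g"] kg one by (simp add: V.fields)
      finally show "f' (\<tau> k g) = f (\<tau> k g)" using f(2) kg by simp
    qed
  qed
  show ?thesis
    unfolding tensor_obj_eq Wu using f(1) triangle unique by blast
qed

end

context scalars
begin

lemma MVArDomD: "M \<in> MVArDom P \<Longrightarrow> mv_module P M" "M \<in> MVArDom P \<Longrightarrow> mv_algebra M"
  by (simp_all add: MVArDom_def mv_module_def)

lemma presented_moduleI: "M \<in> MVArDom P \<Longrightarrow> presents M (G, v, \<phi>) \<Longrightarrow> presented_module K P \<epsilon> M G v \<phi>"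
  using MVArDomD(1) by unfold_locales

lemma presentation_of_presents: "M \<in> MVArDom P \<Longrightarrow> presents M (presentation_of M)"
  using presents_presentation_of MVArDomD(2) by blast

lemma presented_presentation_of:
  assumes "M \<in> MVArDom P"
  obtains G v \<phi> where "presentation_of M = (G, v, \<phi>)" "presented_module K P \<epsilon> M G v \<phi>"
proof -
  obtain G v \<phi> where eq: "presentation_of M = (G, v, \<phi>)" by (cases "presentation_of M") blast
  then have "presents M (G, v, \<phi>)" using presentation_of_presents[OF assms] by simp
  from that[OF eq presented_moduleI[OF assms this]] show ?thesis .
qed

lemma L_obj_LinSpAr: "M \<in> MVArDom P \<Longrightarrow> L_obj K M \<in> LinSpAr K"
  by (erule presented_presentation_of) (simp add: L_obj_def presented_module.tensor_obj_LinSpAr)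

lemma iota_hom: "M \<in> MVArDom P \<Longrightarrow> iota K M \<in> mv_module_hom P M (GammaK \<epsilon> (L_obj K M))"
  by (erule presented_presentation_of) (simp add: L_obj_def iota_def presented_module.tensor_unit_hom)

lemma L_universal:
  assumes "M \<in> MVArDom P" "A \<in> LinSpAr K" "h \<in> mv_module_hom P M (GammaK \<epsilon> A)"
  shows "\<exists>!f. f \<in> lin_hom K (L_obj K M) A \<and> compose (carrier M) (GammaK_map (L_obj K M) f) (iota K M) = h"
  using assms(1)
  by (rule presented_presentation_of)
     (simp add: L_obj_def iota_def presented_module.universal_arrow[OF _ assms(2,3)])

lemma GammaK_object': "A \<in> LinSpAr K \<Longrightarrow> GammaK \<epsilon> A \<in> MVArDom P"
  by (cases A) (simp add: GammaK_object)

lemma GammaK_morphism':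
  "A \<in> LinSpAr K \<Longrightarrow> B \<in> LinSpAr K \<Longrightarrow> f \<in> lin_hom K A B \<Longrightarrow>
    GammaK_map A f \<in> mv_module_hom P (GammaK \<epsilon> A) (GammaK \<epsilon> B)"
  by (cases A, cases B) (simp add: GammaK_morphism)

lemma GammaK_compose':
  "A \<in> LinSpAr K \<Longrightarrow> B \<in> LinSpAr K \<Longrightarrow> f \<in> lin_hom K A B \<Longrightarrow>
    GammaK_map A (compose (carrier (fst A)) g f) =
    compose (carrier (GammaK \<epsilon> A)) (GammaK_map B g) (GammaK_map A f)"
  using GammaK_compose by (cases A, cases B) (auto simp del: GammaK_simps)

lemma GammaK_identity:
  "GammaK_map A (\<lambda>x\<in>carrier (fst A). x) = (\<lambda>x\<in>carrier (GammaK \<epsilon> A). x)"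
  by (cases A) (auto simp: GammaK_map_def fun_eq_iff)

lemma lin_hom_compose:
  assumes "A \<in> LinSpAr K" "B \<in> LinSpAr K" "f \<in> lin_hom K A B" "g \<in> lin_hom K B C"
  shows "compose (carrier (fst A)) g f \<in> lin_hom K A C"
proof -
  obtain V u W w X x where A: "A = (V, u)" "B = (W, w)" "C = (X, x)" by (metis surj_pair)
  note AB = assms[unfolded A]
  interpret f: lgroup_hom V W f by (rule lin_homD[OF AB(1-3)])
  interpret V: linear_space K V by (rule LinSpArD[OF AB(1)])
  interpret U: lu_grp V u by (rule LinSpArD[OF AB(1)])
  have "compose (carrier V) g f \<in> l_hom V X"
    using AB(4) by (intro l_hom_compose[OF f.G.l_group f.H.l_group f.hom]) (simp add: lin_hom_def)
  then show ?thesis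
    using AB(4) lin_homD(2,3)[OF AB(1-3)] by (simp add: A lin_hom_def compose_eq)
qed

lemma lin_hom_id: "A \<in> LinSpAr K \<Longrightarrow> (\<lambda>x\<in>carrier (fst A). x) \<in> lin_hom K A A"
proof (cases A)
  case (Pair V u)
  assume "A \<in> LinSpAr K"
  then have A: "(V, u) \<in> LinSpAr K" using Pair by simp
  interpret V: linear_space K V by (rule LinSpArD[OF A])
  interpret U: lu_grp V u by (rule LinSpArD[OF A])
  show ?thesis using l_hom_id[OF V.V.l_group] by (simp add: Pair lin_hom_def)
qed

lemma L_map_spec:
  assumes M: "M \<in> MVArDom P" and N: "N \<in> MVArDom P" and h: "h \<in> mv_module_hom P M N"
  shows "L_map K M N h \<in> lin_hom K (L_obj K M) (L_obj K N)"
    and "compose (carrier M) (GammaK_map (L_obj K M) (L_map K M N h)) (iota K M) =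
      compose (carrier M) (iota K N) h"
    and "\<And>f. f \<in> lin_hom K (L_obj K M) (L_obj K N) \<Longrightarrow>
      compose (carrier M) (GammaK_map (L_obj K M) f) (iota K M) = compose (carrier M) (iota K N) h \<Longrightarrow>
      f = L_map K M N h"
proof -
  have "compose (carrier M) (iota K N) h \<in> mv_module_hom P M (GammaK \<epsilon> (L_obj K N))"
    using mv_module_hom_compose[OF h iota_hom[OF N]] MVArDomD(1)[OF M] by blast
  note ex1 = L_universal[OF M L_obj_LinSpAr[OF N] this]
  from theI'[OF ex1] show 1: "L_map K M N h \<in> lin_hom K (L_obj K M) (L_obj K N)"
    and 2: "compose (carrier M) (GammaK_map (L_obj K M) (L_map K M N h)) (iota K M) =
      compose (carrier M) (iota K N) h"
    unfolding L_map_def by blast+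
  show "f = L_map K M N h" if "f \<in> lin_hom K (L_obj K M) (L_obj K N)"
    "compose (carrier M) (GammaK_map (L_obj K M) f) (iota K M) = compose (carrier M) (iota K N) h" for f
    using ex1 1 2 that by blast
qed

lemma iota_maps: "M \<in> MVArDom P \<Longrightarrow> x \<in> carrier M \<Longrightarrow> iota K M x \<in> carrier (GammaK \<epsilon> (L_obj K M))"
  using iota_hom by (fastforce simp: mv_module_hom_def)

lemma L_map_id:
  assumes M: "M \<in> MVArDom P"
  shows "L_map K M M (\<lambda>x\<in>carrier M. x) = (\<lambda>x\<in>carrier (fst (L_obj K M)). x)"
proof (rule sym, rule L_map_spec(3)[OF M M])
  show "(\<lambda>x\<in>carrier M. x) \<in> mv_module_hom P M M" by (rule mv_module_hom_id[OF MVArDomD(1)[OF M]])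
  show "(\<lambda>x\<in>carrier (fst (L_obj K M)). x) \<in> lin_hom K (L_obj K M) (L_obj K M)"
    by (rule lin_hom_id[OF L_obj_LinSpAr[OF M]])
  show "compose (carrier M) (GammaK_map (L_obj K M) (\<lambda>x\<in>carrier (fst (L_obj K M)). x)) (iota K M) =
      compose (carrier M) (iota K M) (\<lambda>x\<in>carrier M. x)"
    unfolding GammaK_identity using iota_maps[OF M] by (auto simp: compose_def fun_eq_iff)
qed

lemma L_map_compose:
  assumes M: "M \<in> MVArDom P" and N: "N \<in> MVArDom P" and Q: "Q \<in> MVArDom P"
    and h: "h \<in> mv_module_hom P M N" and g: "g \<in> mv_module_hom P N Q"
  shows "L_map K M Q (compose (carrier M) g h) =
    compose (carrier (fst (L_obj K M))) (L_map K N Q g) (L_map K M N h)"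
proof (rule sym, rule L_map_spec(3)[OF M Q])
  note LM = L_obj_LinSpAr[OF M] and LN = L_obj_LinSpAr[OF N]
  note Lh = L_map_spec(1,2)[OF M N h] and Lg = L_map_spec(1,2)[OF N Q g]
  show "compose (carrier M) g h \<in> mv_module_hom P M Q"
    by (rule mv_module_hom_compose[OF h g MVArDomD(1)[OF M]])
  show "compose (carrier (fst (L_obj K M))) (L_map K N Q g) (L_map K M N h)
      \<in> lin_hom K (L_obj K M) (L_obj K Q)"
    by (rule lin_hom_compose[OF LM LN Lh(1) Lg(1)])
  have hN: "h x \<in> carrier N" if "x \<in> carrier M" for x
    using h that by (auto simp: mv_module_hom_def)
  show "compose (carrier M) (GammaK_map (L_obj K M)
        (compose (carrier (fst (L_obj K M))) (L_map K N Q g) (L_map K M N h))) (iota K M) =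
      compose (carrier M) (iota K Q) (compose (carrier M) g h)"
  proof (rule extensionalityI[OF compose_extensional compose_extensional])
    fix x assume x: "x \<in> carrier M"
    have "GammaK_map (L_obj K M) (L_map K M N h) (iota K M x) = iota K N (h x)"
      using fun_cong[OF Lh(2), of x] x by (simp add: compose_eq)
    moreover have "GammaK_map (L_obj K N) (L_map K N Q g) (iota K N (h x)) = iota K Q (g (h x))"
      using fun_cong[OF Lg(2), of "h x"] hN[OF x] by (simp add: compose_eq)
    ultimately show "compose (carrier M) (GammaK_map (L_obj K M)
        (compose (carrier (fst (L_obj K M))) (L_map K N Q g) (L_map K M N h))) (iota K M) x =
      compose (carrier M) (iota K Q) (compose (carrier M) g h) x"
      unfolding GammaK_compose'[OF LM LN Lh(1)] using x iota_maps[OF M x] by (simp add: compose_eq)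
  qed
qed

end

section \<open>The quotient field\<close>

lemma mv_iso_le:
  assumes "mv_iso A B f" "mv_algebra A" "x \<in> carrier A" "y \<in> carrier A"
  shows "mv_le A x y \<longleftrightarrow> mv_le B (f x) (f y)"
proof -
  have f: "mv_map A B f" "inj_on f (carrier A)" using assms(1) by (auto simp: mv_iso_def bij_betw_def)
  have c: "mv_zero A \<in> carrier A" "mv_neg A x \<in> carrier A" "mv_neg A (mv_zero A) \<in> carrier A"
    "mv_add A (mv_neg A x) y \<in> carrier A"
    using assms(2-4) by (simp_all add: mv_algebra_def)
  have "f (mv_one A) = mv_one B" using f(1) c by (simp add: mv_map_def mv_one_def)
  moreover have "f (mv_add A (mv_neg A x) y) = mv_add B (mv_neg B (f x)) (f y)"
    using f(1) assms(3,4) c by (simp add: mv_map_def)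
  ultimately show ?thesis
    using inj_on_eq_iff[OF f(2) c(4), of "mv_one A"] c(3) by (simp add: mv_le_def mv_one_def)
qed

locale domain_ring =
  fixes P :: "'p pmv" and R :: "'r ogroup" and e :: 'r and \<theta> :: "'p \<Rightarrow> 'r"
    and K :: "'k ogroup" and j :: "'r \<Rightarrow> 'k"
  assumes P_domain: "mv_domain P" and P_semisimple: "semisimple P" and P_total: "mv_total P"
    and R_ring: "lu_ring R e" and \<theta>_iso: "pmv_iso P (Gamma_ring R e) \<theta>"
    and K_quotient: "quotient_field R K j"
begin

sublocale P: mv P
  using P_domain by unfold_locales (simp add: mv_domain_def pmv_algebra_def)

sublocale R: ring R
  using R_ring by (simp add: lu_ring_def)

sublocale RG: lu_grp R e
  using R_ring by unfold_locales (auto simp: lu_ring_def lu_group_def)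

sublocale K: field K
  using K_quotient by (simp add: quotient_field_def)

lemma Gamma_ring_simps [simp]:
  "carrier (Gamma_ring R e) = RG.U" "mv_add (Gamma_ring R e) = mv_add (Gamma R e)"
  "mv_neg (Gamma_ring R e) = mv_neg (Gamma R e)" "mv_zero (Gamma_ring R e) = \<zero>\<^bsub>R\<^esub>"
  "pmv_mult (Gamma_ring R e) = monoid.mult R"
  by (simp_all add: Gamma_ring_def mv.extend_def pmv.fields_def Gamma_def)

lemma Gamma_ring_cong: "mv_one (Gamma_ring R e) = e" "mv_le (Gamma_ring R e) = mv_le (Gamma R e)"
proof -
  show one: "mv_one (Gamma_ring R e) = e"
    using RG.Gamma_one by (simp add: mv_one_def)
  show "mv_le (Gamma_ring R e) = mv_le (Gamma R e)"
    unfolding mv_le_def one RG.Gamma_one by (simp add: fun_eq_iff)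
qed

lemma \<theta>: "mv_iso P (Gamma_ring R e) \<theta>" "mv_map P (Gamma_ring R e) \<theta>"
  "bij_betw \<theta> (carrier P) RG.U"
  "\<And>x y. x \<in> carrier P \<Longrightarrow> y \<in> carrier P \<Longrightarrow> \<theta> (pmv_mult P x y) = \<theta> x \<otimes>\<^bsub>R\<^esub> \<theta> y"
  using \<theta>_iso by (auto simp: pmv_iso_def mv_iso_def)

lemma \<theta>_U: "x \<in> carrier P \<Longrightarrow> \<theta> x \<in> RG.U"
  using \<theta>(2) by (simp add: mv_map_def)

lemma \<theta>_surj: "a \<in> RG.U \<Longrightarrow> \<exists>x\<in>carrier P. \<theta> x = a"
  using \<theta>(3) by (force simp: bij_betw_def)

lemma \<theta>_le: "x \<in> carrier P \<Longrightarrow> y \<in> carrier P \<Longrightarrow> mv_le P x y \<longleftrightarrow> \<theta> x \<preceq>\<^bsub>R\<^esub> \<theta> y"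
  using mv_iso_le[OF \<theta>(1) P.mv_algebra, of x y] \<theta>_U[of x] \<theta>_U[of y]
  by (simp add: Gamma_ring_cong RG.Gamma_le)

lemma \<theta>_zero: "\<theta> (mv_zero P) = \<zero>\<^bsub>R\<^esub>"
  using \<theta>(2) by (simp add: mv_map_def)

lemma \<theta>_neg: "x \<in> carrier P \<Longrightarrow> \<theta> (mv_neg P x) = e \<ominus>\<^bsub>R\<^esub> \<theta> x"
  using \<theta>(2) by (simp add: mv_map_def)

lemma \<theta>_oplus: "x \<in> carrier P \<Longrightarrow> y \<in> carrier P \<Longrightarrow> \<theta> (mv_add P x y) = (\<theta> x \<oplus>\<^bsub>R\<^esub> \<theta> y) \<sqinter>\<^bsub>R\<^esub> e"
  using \<theta>(2) by (simp add: mv_map_def)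

lemma \<theta>_one: "\<theta> (mv_one P) = e"
  using \<theta>_neg[of "mv_zero P"] by (simp add: \<theta>_zero R.minus_eq)

lemma \<theta>_add:
  assumes "x \<in> carrier P" "y \<in> carrier P" "mv_summable P x y"
  shows "\<theta> (mv_add P x y) = \<theta> x \<oplus>\<^bsub>R\<^esub> \<theta> y"
proof -
  have c: "\<theta> x \<in> carrier R" "\<theta> y \<in> carrier R" using \<theta>_U assms by auto
  have "\<theta> x \<preceq>\<^bsub>R\<^esub> e \<ominus>\<^bsub>R\<^esub> \<theta> y"
    using assms \<theta>_le[of x "mv_neg P y"] \<theta>_neg by (simp add: mv_summable_def)
  then have "\<theta> x \<oplus>\<^bsub>R\<^esub> \<theta> y \<preceq>\<^bsub>R\<^esub> e" using c by (simp add: RG.leq_diff_iff)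
  then show ?thesis using \<theta>_oplus assms(1,2) c by (simp add: RG.inf_absorb1)
qed

lemma R_mult_nonneg: "\<lbrakk>x \<in> carrier R; y \<in> carrier R; \<zero>\<^bsub>R\<^esub> \<preceq>\<^bsub>R\<^esub> x; \<zero>\<^bsub>R\<^esub> \<preceq>\<^bsub>R\<^esub> y\<rbrakk> \<Longrightarrow> \<zero>\<^bsub>R\<^esub> \<preceq>\<^bsub>R\<^esub> x \<otimes>\<^bsub>R\<^esub> y"
  using R_ring by (simp add: lu_ring_def)

text \<open>The identity of \<open>P\<close> is mapped to \<open>e\<close>. So \<open>e\<close> acts as identity on the unit interval, which generates \<open>R\<close>.\<close>

lemma e_one: "e = \<one>\<^bsub>R\<^esub>"
proof -
  have "e \<otimes>\<^bsub>R\<^esub> a = a" if a: "a \<in> RG.U" for a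
  proof -
    obtain x where x: "x \<in> carrier P" "\<theta> x = a" using \<theta>_surj[OF a] by blast
    have "\<forall>x\<in>carrier P. pmv_mult P (mv_one P) x = x"
      using P_domain unfolding mv_domain_def pmv_algebra_def by blast
    then have "pmv_mult P (mv_one P) x = x" using x by blast
    then show ?thesis using \<theta>(4)[of "mv_one P" x] x \<theta>_one by simp
  qed
  then have "e \<otimes>\<^bsub>R\<^esub> \<one>\<^bsub>R\<^esub> = \<one>\<^bsub>R\<^esub>"
    by (intro RG.additive_eqI[OF R.abelian_group_axioms, of "\<lambda>x. e \<otimes>\<^bsub>R\<^esub> x" "\<lambda>x. x" "\<one>\<^bsub>R\<^esub>"])
       (auto simp: R.r_distr)
  then show ?thesis by simp
qed

text \<open>The positive and the negative part of \<open>x \<ominus> y\<close>, truncated at \<open>e\<close>, are disjoint elements of the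
  unit interval, which is a chain. So one of them vanishes, and it vanishes also before truncation by
  \<open>disjoint_unit\<close>.\<close>

lemma R_total:
  assumes "x \<in> carrier R" "y \<in> carrier R"
  shows "x \<preceq>\<^bsub>R\<^esub> y \<or> y \<preceq>\<^bsub>R\<^esub> x"
proof -
  let ?z = "x \<ominus>\<^bsub>R\<^esub> y"
  let ?p = "?z \<squnion>\<^bsub>R\<^esub> \<zero>\<^bsub>R\<^esub>" and ?n = "\<ominus>\<^bsub>R\<^esub> ?z \<squnion>\<^bsub>R\<^esub> \<zero>\<^bsub>R\<^esub>"
  have z: "?z \<in> carrier R" using assms by simp
  have pn: "?p \<in> carrier R" "?n \<in> carrier R" "\<zero>\<^bsub>R\<^esub> \<preceq>\<^bsub>R\<^esub> ?p" "\<zero>\<^bsub>R\<^esub> \<preceq>\<^bsub>R\<^esub> ?n"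
    using z by (simp_all add: RG.sup_ge2)
  let ?a = "?p \<sqinter>\<^bsub>R\<^esub> e" and ?b = "?n \<sqinter>\<^bsub>R\<^esub> e"
  have ab: "?a \<in> RG.U" "?b \<in> RG.U"
    using pn by (simp_all add: RG.leq_inf_iff RG.inf_le2)
  have disj: "?a \<sqinter>\<^bsub>R\<^esub> ?b = \<zero>\<^bsub>R\<^esub>"
  proof (rule RG.leq_antisym)
    have "?a \<sqinter>\<^bsub>R\<^esub> ?b \<preceq>\<^bsub>R\<^esub> ?p"
      by (rule RG.leq_trans[OF RG.inf_le1 RG.inf_le1]) (use pn in simp_all)
    moreover have "?a \<sqinter>\<^bsub>R\<^esub> ?b \<preceq>\<^bsub>R\<^esub> ?n"
      by (rule RG.leq_trans[OF RG.inf_le2 RG.inf_le1]) (use pn in simp_all)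
    ultimately have "?a \<sqinter>\<^bsub>R\<^esub> ?b \<preceq>\<^bsub>R\<^esub> ?p \<sqinter>\<^bsub>R\<^esub> ?n" using pn by (intro RG.inf_greatest) simp_all
    then show "?a \<sqinter>\<^bsub>R\<^esub> ?b \<preceq>\<^bsub>R\<^esub> \<zero>\<^bsub>R\<^esub>" using RG.pos_parts_disjoint[OF z] by simp
    show "\<zero>\<^bsub>R\<^esub> \<preceq>\<^bsub>R\<^esub> ?a \<sqinter>\<^bsub>R\<^esub> ?b" using ab by (simp add: RG.leq_inf_iff)
  qed (use pn in simp_all)
  obtain p q where pq: "p \<in> carrier P" "\<theta> p = ?a" "q \<in> carrier P" "\<theta> q = ?b"
    using \<theta>_surj[OF ab(1)] \<theta>_surj[OF ab(2)] by blast
  have "?a \<preceq>\<^bsub>R\<^esub> ?b \<or> ?b \<preceq>\<^bsub>R\<^esub> ?a"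
    using P_total pq \<theta>_le[of p q] \<theta>_le[of q p] unfolding mv_total_def by auto
  then have "?a = \<zero>\<^bsub>R\<^esub> \<or> ?b = \<zero>\<^bsub>R\<^esub>"
    using disj RG.inf_absorb1[of ?a ?b] RG.inf_absorb2[of ?b ?a] ab by auto
  then have "?p = \<zero>\<^bsub>R\<^esub> \<or> ?n = \<zero>\<^bsub>R\<^esub>" using RG.disjoint_unit pn by blast
  then have "?z \<preceq>\<^bsub>R\<^esub> \<zero>\<^bsub>R\<^esub> \<or> \<ominus>\<^bsub>R\<^esub> ?z \<preceq>\<^bsub>R\<^esub> \<zero>\<^bsub>R\<^esub>"
    using RG.sup_ge1[of ?z "\<zero>\<^bsub>R\<^esub>"] RG.sup_ge1[of "\<ominus>\<^bsub>R\<^esub> ?z" "\<zero>\<^bsub>R\<^esub>"] z by auto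
  then show ?thesis
  proof
    assume "?z \<preceq>\<^bsub>R\<^esub> \<zero>\<^bsub>R\<^esub>"
    then show ?thesis using assms by (simp add: RG.diff_leq_iff)
  next
    assume "\<ominus>\<^bsub>R\<^esub> ?z \<preceq>\<^bsub>R\<^esub> \<zero>\<^bsub>R\<^esub>"
    then have "\<zero>\<^bsub>R\<^esub> \<preceq>\<^bsub>R\<^esub> ?z" using RG.leq_minus_iff[of "\<zero>\<^bsub>R\<^esub>" ?z] z by simp
    then show ?thesis using RG.leq_iff[of y x] assms by simp
  qed
qed

text \<open>Such an element comes from an element of \<open>P\<close> that lies in all maximal ideals.\<close>

lemma R_no_infinitesimals:
  assumes "x \<in> carrier R" "\<zero>\<^bsub>R\<^esub> \<preceq>\<^bsub>R\<^esub> x" "\<And>n::nat. [n] \<cdot>\<^bsub>R\<^esub> x \<preceq>\<^bsub>R\<^esub> e"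
  shows "x = \<zero>\<^bsub>R\<^esub>"
proof -
  have "x \<preceq>\<^bsub>R\<^esub> e" using assms(3)[of 1] assms(1) by simp
  then have xU: "x \<in> RG.U" using assms by simp
  then obtain p where p: "p \<in> carrier P" "\<theta> p = x" using \<theta>_surj by blast
  have mult: "\<theta> (P.mult n p) = [n] \<cdot>\<^bsub>R\<^esub> x" for n
  proof (induct n)
    case (Suc n)
    have "\<theta> (P.mult (Suc n) p) = (x \<oplus>\<^bsub>R\<^esub> [n] \<cdot>\<^bsub>R\<^esub> x) \<sqinter>\<^bsub>R\<^esub> e"
      using p Suc \<theta>_oplus[of p "P.mult n p"] by simp
    also have "x \<oplus>\<^bsub>R\<^esub> [n] \<cdot>\<^bsub>R\<^esub> x = [Suc n] \<cdot>\<^bsub>R\<^esub> x" using assms(1) by (simp add: R.a_comm)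
    also have "([Suc n] \<cdot>\<^bsub>R\<^esub> x) \<sqinter>\<^bsub>R\<^esub> e = [Suc n] \<cdot>\<^bsub>R\<^esub> x"
      using assms(1) assms(3)[of "Suc n"] by (intro RG.inf_absorb1) simp_all
    finally show ?case .
  qed (simp add: \<theta>_zero)
  have "mv_le P (P.mult n p) (mv_neg P (P.mult n p))" for n
  proof -
    have "[n] \<cdot>\<^bsub>R\<^esub> x \<oplus>\<^bsub>R\<^esub> [n] \<cdot>\<^bsub>R\<^esub> x \<preceq>\<^bsub>R\<^esub> e"
      using assms(3)[of "n + n"] RG.nsmul_add_left[OF assms(1), of n n] by simp
    then show ?thesis using p assms(1) by (simp add: \<theta>_le mult \<theta>_neg RG.leq_diff_iff)
  qed
  then have "p \<in> I" if "mv_maximal_ideal P I" for I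
    using P.infinitesimal_in_maximal_ideal[OF p(1) _ that] by blast
  then have "p = mv_zero P" using P_semisimple p(1) unfolding semisimple_def by blast
  then show ?thesis using p \<theta>_zero by simp
qed

lemma j_hom: "j \<in> ring_hom R K" and j_inj: "inj_on j (carrier R)"
  using K_quotient by (simp_all add: quotient_field_def)

lemma j_closed [simp]: "x \<in> carrier R \<Longrightarrow> j x \<in> carrier K"
  and j_one [simp]: "j \<one>\<^bsub>R\<^esub> = \<one>\<^bsub>K\<^esub>"
  and j_add: "x \<in> carrier R \<Longrightarrow> y \<in> carrier R \<Longrightarrow> j (x \<oplus>\<^bsub>R\<^esub> y) = j x \<oplus>\<^bsub>K\<^esub> j y"
  and j_mult: "x \<in> carrier R \<Longrightarrow> y \<in> carrier R \<Longrightarrow> j (x \<otimes>\<^bsub>R\<^esub> y) = j x \<otimes>\<^bsub>K\<^esub> j y"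
  using j_hom by (auto simp: ring_hom_def)

lemma j_zero: "j \<zero>\<^bsub>R\<^esub> = \<zero>\<^bsub>K\<^esub>"
  by (rule additive_zero[OF R.abelian_group_axioms K.abelian_group_axioms]) (auto simp: j_add)

lemma j_minus: "x \<in> carrier R \<Longrightarrow> j (\<ominus>\<^bsub>R\<^esub> x) = \<ominus>\<^bsub>K\<^esub> j x"
  by (rule additive_minus[OF R.abelian_group_axioms K.abelian_group_axioms]) (auto simp: j_add)

lemma j_eq_zero_iff: "x \<in> carrier R \<Longrightarrow> j x = \<zero>\<^bsub>K\<^esub> \<longleftrightarrow> x = \<zero>\<^bsub>R\<^esub>"
  using inj_on_eq_iff[OF j_inj, of x "\<zero>\<^bsub>R\<^esub>"] by (simp add: j_zero)

lemma R_integral: "x \<in> carrier R \<Longrightarrow> y \<in> carrier R \<Longrightarrow> x \<otimes>\<^bsub>R\<^esub> y = \<zero>\<^bsub>R\<^esub> \<Longrightarrow> x = \<zero>\<^bsub>R\<^esub> \<or> y = \<zero>\<^bsub>R\<^esub>"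
  using K.integral[of "j x" "j y"] j_mult[of x y] by (simp add: j_zero j_eq_zero_iff)

lemma R_cancel_nonneg:
  assumes "b \<in> carrier R" "c \<in> carrier R" "\<zero>\<^bsub>R\<^esub> \<preceq>\<^bsub>R\<^esub> b" "b \<noteq> \<zero>\<^bsub>R\<^esub>" "\<zero>\<^bsub>R\<^esub> \<preceq>\<^bsub>R\<^esub> c \<otimes>\<^bsub>R\<^esub> b"
  shows "\<zero>\<^bsub>R\<^esub> \<preceq>\<^bsub>R\<^esub> c"
proof (rule ccontr)
  assume n: "\<not> \<zero>\<^bsub>R\<^esub> \<preceq>\<^bsub>R\<^esub> c"
  then have "\<zero>\<^bsub>R\<^esub> \<preceq>\<^bsub>R\<^esub> \<ominus>\<^bsub>R\<^esub> c"
    using R_total[of "\<zero>\<^bsub>R\<^esub>" c] RG.leq_minus_iff[of c "\<zero>\<^bsub>R\<^esub>"] assms(2) by auto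
  then have "\<zero>\<^bsub>R\<^esub> \<preceq>\<^bsub>R\<^esub> \<ominus>\<^bsub>R\<^esub> c \<otimes>\<^bsub>R\<^esub> b" using assms by (intro R_mult_nonneg) simp_all
  then have "c \<otimes>\<^bsub>R\<^esub> b \<preceq>\<^bsub>R\<^esub> \<zero>\<^bsub>R\<^esub>"
    using RG.leq_minus_iff[of "c \<otimes>\<^bsub>R\<^esub> b" "\<zero>\<^bsub>R\<^esub>"] assms by (simp add: R.l_minus)
  then have "c \<otimes>\<^bsub>R\<^esub> b = \<zero>\<^bsub>R\<^esub>" using RG.leq_antisym assms by simp
  then have "c = \<zero>\<^bsub>R\<^esub>" using R_integral assms by blast
  then show False using n by simp
qed

text \<open>The nonnegative elements of \<open>K\<close>, as fractions \<open>a / b\<close> with \<open>a \<ge> 0\<close> and \<open>b > 0\<close>. Without inverses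
  and with nonnegative \<open>b\<close>, sums and products are easier to handle than in the definition of the order
  by the sign of \<open>a b\<close>.\<close>

definition positive where
  "positive x \<longleftrightarrow> (\<exists>a\<in>carrier R. \<exists>b\<in>carrier R. \<zero>\<^bsub>R\<^esub> \<preceq>\<^bsub>R\<^esub> a \<and> \<zero>\<^bsub>R\<^esub> \<preceq>\<^bsub>R\<^esub> b \<and> b \<noteq> \<zero>\<^bsub>R\<^esub> \<and> x \<otimes>\<^bsub>K\<^esub> j b = j a)"

lemma fraction:
  assumes "x \<in> carrier K"
  obtains a b where "a \<in> carrier R" "b \<in> carrier R" "b \<noteq> \<zero>\<^bsub>R\<^esub>" "\<zero>\<^bsub>R\<^esub> \<preceq>\<^bsub>R\<^esub> b" "x \<otimes>\<^bsub>K\<^esub> j b = j a"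
    "x = j a \<otimes>\<^bsub>K\<^esub> inv\<^bsub>K\<^esub> (j b)"
proof -
  obtain a b where ab: "a \<in> carrier R" "b \<in> carrier R" "b \<noteq> \<zero>\<^bsub>R\<^esub>" "x = j a \<otimes>\<^bsub>K\<^esub> inv\<^bsub>K\<^esub> (j b)"
    using K_quotient assms unfolding quotient_field_def by blast
  have solve: "x = j c \<otimes>\<^bsub>K\<^esub> inv\<^bsub>K\<^esub> (j d)"
    if "c \<in> carrier R" "d \<in> carrier R" "d \<noteq> \<zero>\<^bsub>R\<^esub>" "x \<otimes>\<^bsub>K\<^esub> j d = j c" for c d
  proof -
    have "j d \<in> Units K" using that by (simp add: K.field_Units j_eq_zero_iff)
    then have "x \<otimes>\<^bsub>K\<^esub> j d \<otimes>\<^bsub>K\<^esub> inv\<^bsub>K\<^esub> (j d) = x" using assms that(2) by (simp add: K.m_assoc)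
    then show ?thesis using that by simp
  qed
  have "j b \<in> Units K" using ab by (simp add: K.field_Units j_eq_zero_iff)
  then have xb: "x \<otimes>\<^bsub>K\<^esub> j b = j a" using ab by (simp add: K.m_assoc)
  show ?thesis
  proof (cases "\<zero>\<^bsub>R\<^esub> \<preceq>\<^bsub>R\<^esub> b")
    case True
    then show ?thesis using that ab xb by blast
  next
    case False
    then have "\<zero>\<^bsub>R\<^esub> \<preceq>\<^bsub>R\<^esub> \<ominus>\<^bsub>R\<^esub> b"
      using R_total[of "\<zero>\<^bsub>R\<^esub>" b] RG.leq_minus_iff[of b "\<zero>\<^bsub>R\<^esub>"] ab(2) by auto
    moreover have "x \<otimes>\<^bsub>K\<^esub> j (\<ominus>\<^bsub>R\<^esub> b) = j (\<ominus>\<^bsub>R\<^esub> a)" using xb ab assms by (simp add: j_minus K.r_minus)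
    moreover have "\<ominus>\<^bsub>R\<^esub> b \<noteq> \<zero>\<^bsub>R\<^esub>" using ab R.minus_minus[of b] by auto
    ultimately show ?thesis using that[of "\<ominus>\<^bsub>R\<^esub> a" "\<ominus>\<^bsub>R\<^esub> b"] solve[of "\<ominus>\<^bsub>R\<^esub> a" "\<ominus>\<^bsub>R\<^esub> b"] ab by simp
  qed
qed

lemma K_leq_iff:
  assumes "x \<in> carrier K" "y \<in> carrier K"
  shows "x \<preceq>\<^bsub>K\<^esub> y \<longleftrightarrow> positive (y \<ominus>\<^bsub>K\<^esub> x)"
proof -
  have d: "y \<ominus>\<^bsub>K\<^esub> x \<in> carrier K" using assms by simp
  obtain a b where ab: "a \<in> carrier R" "b \<in> carrier R" "b \<noteq> \<zero>\<^bsub>R\<^esub>" "\<zero>\<^bsub>R\<^esub> \<preceq>\<^bsub>R\<^esub> b"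
    "(y \<ominus>\<^bsub>K\<^esub> x) \<otimes>\<^bsub>K\<^esub> j b = j a" "y \<ominus>\<^bsub>K\<^esub> x = j a \<otimes>\<^bsub>K\<^esub> inv\<^bsub>K\<^esub> (j b)"
    using fraction[OF d] .
  have leq: "x \<preceq>\<^bsub>K\<^esub> y \<longleftrightarrow> \<zero>\<^bsub>R\<^esub> \<preceq>\<^bsub>R\<^esub> a \<otimes>\<^bsub>R\<^esub> b"
    using K_quotient assms ab unfolding quotient_field_def by blast
  show ?thesis
  proof
    assume "x \<preceq>\<^bsub>K\<^esub> y"
    then have "\<zero>\<^bsub>R\<^esub> \<preceq>\<^bsub>R\<^esub> a" using leq R_cancel_nonneg[of b a] ab by simp
    then show "positive (y \<ominus>\<^bsub>K\<^esub> x)" using ab unfolding positive_def by blast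
  next
    assume "positive (y \<ominus>\<^bsub>K\<^esub> x)"
    then obtain c d where cd: "c \<in> carrier R" "d \<in> carrier R" "\<zero>\<^bsub>R\<^esub> \<preceq>\<^bsub>R\<^esub> c" "\<zero>\<^bsub>R\<^esub> \<preceq>\<^bsub>R\<^esub> d" "d \<noteq> \<zero>\<^bsub>R\<^esub>"
      "(y \<ominus>\<^bsub>K\<^esub> x) \<otimes>\<^bsub>K\<^esub> j d = j c" unfolding positive_def by blast
    have "j (a \<otimes>\<^bsub>R\<^esub> d) = (y \<ominus>\<^bsub>K\<^esub> x) \<otimes>\<^bsub>K\<^esub> j b \<otimes>\<^bsub>K\<^esub> j d" using ab cd by (simp add: j_mult)
    also have "\<dots> = (y \<ominus>\<^bsub>K\<^esub> x) \<otimes>\<^bsub>K\<^esub> j d \<otimes>\<^bsub>K\<^esub> j b" using d ab(2) cd(2) by (simp add: K.m_ac)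
    also have "\<dots> = j (c \<otimes>\<^bsub>R\<^esub> b)" using ab(1-4) cd by (simp add: j_mult)
    finally have "a \<otimes>\<^bsub>R\<^esub> d = c \<otimes>\<^bsub>R\<^esub> b" using inj_on_eq_iff[OF j_inj] ab cd by simp
    then have "\<zero>\<^bsub>R\<^esub> \<preceq>\<^bsub>R\<^esub> a" using R_cancel_nonneg[of d a] R_mult_nonneg[of c b] ab cd by simp
    then show "x \<preceq>\<^bsub>K\<^esub> y" using leq R_mult_nonneg[of a b] ab by simp
  qed
qed

lemma positive_add:
  assumes "positive x" "positive y" "x \<in> carrier K" "y \<in> carrier K"
  shows "positive (x \<oplus>\<^bsub>K\<^esub> y)"
proof -
  obtain a b where ab: "a \<in> carrier R" "b \<in> carrier R" "\<zero>\<^bsub>R\<^esub> \<preceq>\<^bsub>R\<^esub> a" "\<zero>\<^bsub>R\<^esub> \<preceq>\<^bsub>R\<^esub> b" "b \<noteq> \<zero>\<^bsub>R\<^esub>" "x \<otimes>\<^bsub>K\<^esub> j b = j a"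
    using assms(1) unfolding positive_def by blast
  obtain c d where cd: "c \<in> carrier R" "d \<in> carrier R" "\<zero>\<^bsub>R\<^esub> \<preceq>\<^bsub>R\<^esub> c" "\<zero>\<^bsub>R\<^esub> \<preceq>\<^bsub>R\<^esub> d" "d \<noteq> \<zero>\<^bsub>R\<^esub>" "y \<otimes>\<^bsub>K\<^esub> j d = j c"
    using assms(2) unfolding positive_def by blast
  have "(x \<oplus>\<^bsub>K\<^esub> y) \<otimes>\<^bsub>K\<^esub> (j b \<otimes>\<^bsub>K\<^esub> j d) = (x \<otimes>\<^bsub>K\<^esub> j b) \<otimes>\<^bsub>K\<^esub> j d \<oplus>\<^bsub>K\<^esub> (y \<otimes>\<^bsub>K\<^esub> j d) \<otimes>\<^bsub>K\<^esub> j b"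
    using assms(3,4) ab(2) cd(2) by (simp add: K.l_distr K.r_distr K.m_ac)
  also have "\<dots> = j (a \<otimes>\<^bsub>R\<^esub> d \<oplus>\<^bsub>R\<^esub> c \<otimes>\<^bsub>R\<^esub> b)" using ab cd by (simp add: j_add j_mult)
  finally have "(x \<oplus>\<^bsub>K\<^esub> y) \<otimes>\<^bsub>K\<^esub> j (b \<otimes>\<^bsub>R\<^esub> d) = j (a \<otimes>\<^bsub>R\<^esub> d \<oplus>\<^bsub>R\<^esub> c \<otimes>\<^bsub>R\<^esub> b)" using ab cd by (simp add: j_mult)
  moreover have "b \<otimes>\<^bsub>R\<^esub> d \<noteq> \<zero>\<^bsub>R\<^esub>" using R_integral ab cd by blast
  moreover have "\<zero>\<^bsub>R\<^esub> \<preceq>\<^bsub>R\<^esub> b \<otimes>\<^bsub>R\<^esub> d" "\<zero>\<^bsub>R\<^esub> \<preceq>\<^bsub>R\<^esub> a \<otimes>\<^bsub>R\<^esub> d \<oplus>\<^bsub>R\<^esub> c \<otimes>\<^bsub>R\<^esub> b"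
    using ab cd by (simp_all add: R_mult_nonneg RG.add_nonneg)
  moreover have "a \<otimes>\<^bsub>R\<^esub> d \<oplus>\<^bsub>R\<^esub> c \<otimes>\<^bsub>R\<^esub> b \<in> carrier R" "b \<otimes>\<^bsub>R\<^esub> d \<in> carrier R" using ab cd by simp_all
  ultimately show ?thesis unfolding positive_def by blast
qed

lemma positive_mult:
  assumes "positive x" "positive y" "x \<in> carrier K" "y \<in> carrier K"
  shows "positive (x \<otimes>\<^bsub>K\<^esub> y)"
proof -
  obtain a b where ab: "a \<in> carrier R" "b \<in> carrier R" "\<zero>\<^bsub>R\<^esub> \<preceq>\<^bsub>R\<^esub> a" "\<zero>\<^bsub>R\<^esub> \<preceq>\<^bsub>R\<^esub> b" "b \<noteq> \<zero>\<^bsub>R\<^esub>" "x \<otimes>\<^bsub>K\<^esub> j b = j a"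
    using assms(1) unfolding positive_def by blast
  obtain c d where cd: "c \<in> carrier R" "d \<in> carrier R" "\<zero>\<^bsub>R\<^esub> \<preceq>\<^bsub>R\<^esub> c" "\<zero>\<^bsub>R\<^esub> \<preceq>\<^bsub>R\<^esub> d" "d \<noteq> \<zero>\<^bsub>R\<^esub>" "y \<otimes>\<^bsub>K\<^esub> j d = j c"
    using assms(2) unfolding positive_def by blast
  have "(x \<otimes>\<^bsub>K\<^esub> y) \<otimes>\<^bsub>K\<^esub> (j b \<otimes>\<^bsub>K\<^esub> j d) = (x \<otimes>\<^bsub>K\<^esub> j b) \<otimes>\<^bsub>K\<^esub> (y \<otimes>\<^bsub>K\<^esub> j d)"
    using assms(3,4) ab(2) cd(2) by (simp add: K.m_ac)
  then have "(x \<otimes>\<^bsub>K\<^esub> y) \<otimes>\<^bsub>K\<^esub> j (b \<otimes>\<^bsub>R\<^esub> d) = j (a \<otimes>\<^bsub>R\<^esub> c)" using ab cd by (simp add: j_mult)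
  moreover have "b \<otimes>\<^bsub>R\<^esub> d \<noteq> \<zero>\<^bsub>R\<^esub>" using R_integral ab cd by blast
  moreover have "\<zero>\<^bsub>R\<^esub> \<preceq>\<^bsub>R\<^esub> b \<otimes>\<^bsub>R\<^esub> d" "\<zero>\<^bsub>R\<^esub> \<preceq>\<^bsub>R\<^esub> a \<otimes>\<^bsub>R\<^esub> c" using ab cd by (simp_all add: R_mult_nonneg)
  moreover have "a \<otimes>\<^bsub>R\<^esub> c \<in> carrier R" "b \<otimes>\<^bsub>R\<^esub> d \<in> carrier R" using ab cd by simp_all
  ultimately show ?thesis unfolding positive_def by blast
qed

lemma R_one_not_zero: "\<one>\<^bsub>R\<^esub> \<noteq> \<zero>\<^bsub>R\<^esub>"
proof
  assume "\<one>\<^bsub>R\<^esub> = \<zero>\<^bsub>R\<^esub>"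
  then have "j \<one>\<^bsub>R\<^esub> = j \<zero>\<^bsub>R\<^esub>" by (rule arg_cong)
  then show False using K.one_not_zero by (simp only: j_one j_zero)
qed

lemma one_nonneg: "\<zero>\<^bsub>R\<^esub> \<preceq>\<^bsub>R\<^esub> \<one>\<^bsub>R\<^esub>"
  using RG.unit_nonneg e_one by simp

lemma positive_j:
  assumes "a \<in> carrier R"
  shows "positive (j a) \<longleftrightarrow> \<zero>\<^bsub>R\<^esub> \<preceq>\<^bsub>R\<^esub> a"
proof
  assume "\<zero>\<^bsub>R\<^esub> \<preceq>\<^bsub>R\<^esub> a"
  moreover have "j a \<otimes>\<^bsub>K\<^esub> j \<one>\<^bsub>R\<^esub> = j a" using assms by simp
  ultimately show "positive (j a)"
    unfolding positive_def using R_one_not_zero one_nonneg assms R.one_closed by blast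
next
  assume "positive (j a)"
  then obtain c d where cd: "c \<in> carrier R" "d \<in> carrier R" "\<zero>\<^bsub>R\<^esub> \<preceq>\<^bsub>R\<^esub> c" "\<zero>\<^bsub>R\<^esub> \<preceq>\<^bsub>R\<^esub> d" "d \<noteq> \<zero>\<^bsub>R\<^esub>"
    "j a \<otimes>\<^bsub>K\<^esub> j d = j c" unfolding positive_def by blast
  then have "a \<otimes>\<^bsub>R\<^esub> d = c" using inj_on_eq_iff[OF j_inj, of "a \<otimes>\<^bsub>R\<^esub> d" c] assms by (simp add: j_mult)
  then show "\<zero>\<^bsub>R\<^esub> \<preceq>\<^bsub>R\<^esub> a" using R_cancel_nonneg[of d a] cd assms by simp
qed

lemma positive_total: "x \<in> carrier K \<Longrightarrow> positive x \<or> positive (\<ominus>\<^bsub>K\<^esub> x)"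
proof -
  assume x: "x \<in> carrier K"
  obtain a b where ab: "a \<in> carrier R" "b \<in> carrier R" "b \<noteq> \<zero>\<^bsub>R\<^esub>" "\<zero>\<^bsub>R\<^esub> \<preceq>\<^bsub>R\<^esub> b" "x \<otimes>\<^bsub>K\<^esub> j b = j a"
    using fraction[OF x] .
  consider "\<zero>\<^bsub>R\<^esub> \<preceq>\<^bsub>R\<^esub> a" | "\<zero>\<^bsub>R\<^esub> \<preceq>\<^bsub>R\<^esub> \<ominus>\<^bsub>R\<^esub> a"
    using R_total[of "\<zero>\<^bsub>R\<^esub>" a] RG.leq_minus_iff[of a "\<zero>\<^bsub>R\<^esub>"] ab(1) by auto
  then show ?thesis
  proof cases
    case 1
    then show ?thesis using ab unfolding positive_def by blast
  next
    case 2
    moreover have "\<ominus>\<^bsub>K\<^esub> x \<otimes>\<^bsub>K\<^esub> j b = j (\<ominus>\<^bsub>R\<^esub> a)" using ab x by (simp add: K.l_minus j_minus)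
    moreover have "\<ominus>\<^bsub>R\<^esub> a \<in> carrier R" using ab by simp
    ultimately have "positive (\<ominus>\<^bsub>K\<^esub> x)" using ab unfolding positive_def by blast
    then show ?thesis ..
  qed
qed

lemma positive_antisym:
  assumes "positive x" "positive (\<ominus>\<^bsub>K\<^esub> x)" "x \<in> carrier K"
  shows "x = \<zero>\<^bsub>K\<^esub>"
proof -
  obtain a b where ab: "a \<in> carrier R" "b \<in> carrier R" "b \<noteq> \<zero>\<^bsub>R\<^esub>" "\<zero>\<^bsub>R\<^esub> \<preceq>\<^bsub>R\<^esub> b" "x \<otimes>\<^bsub>K\<^esub> j b = j a"
    using fraction[OF assms(3)] .
  have pb: "positive (j b)" using positive_j ab by simp
  have "positive (j a)" using positive_mult[OF assms(1) pb] ab assms(3) by simp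
  moreover have "positive (j (\<ominus>\<^bsub>R\<^esub> a))"
    using positive_mult[OF assms(2) pb] ab assms(3) by (simp add: K.l_minus j_minus)
  ultimately have "\<zero>\<^bsub>R\<^esub> \<preceq>\<^bsub>R\<^esub> a" "\<zero>\<^bsub>R\<^esub> \<preceq>\<^bsub>R\<^esub> \<ominus>\<^bsub>R\<^esub> a" using positive_j ab(1) by simp_all
  then have "a = \<zero>\<^bsub>R\<^esub>" using RG.leq_antisym[of a "\<zero>\<^bsub>R\<^esub>"] RG.leq_minus_iff[of a "\<zero>\<^bsub>R\<^esub>"] ab(1) by simp
  then have "x \<otimes>\<^bsub>K\<^esub> j b = \<zero>\<^bsub>K\<^esub>" using ab by (simp add: j_zero)
  then show ?thesis using K.integral[of x "j b"] ab assms(3) by (simp add: j_eq_zero_iff)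
qed

lemma K_l_group: "l_group K"
proof (rule l_groupI[OF K.abelian_group_axioms])
  have zero: "positive \<zero>\<^bsub>K\<^esub>" using positive_j[of "\<zero>\<^bsub>R\<^esub>"] by (simp add: j_zero)
  show refl: "x \<preceq>\<^bsub>K\<^esub> x" if "x \<in> carrier K" for x
    using that zero by (simp add: K_leq_iff K.minus_eq K.r_neg)
  have minus: "\<ominus>\<^bsub>K\<^esub> (y \<ominus>\<^bsub>K\<^esub> x) = x \<ominus>\<^bsub>K\<^esub> y" if "x \<in> carrier K" "y \<in> carrier K" for x y
    using that by (simp add: K.minus_eq K.minus_add K.a_comm)
  fix x y assume xy: "x \<in> carrier K" "y \<in> carrier K"
  {
    assume "x \<preceq>\<^bsub>K\<^esub> y" "y \<preceq>\<^bsub>K\<^esub> x"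
    then have "y \<ominus>\<^bsub>K\<^esub> x = \<zero>\<^bsub>K\<^esub>" using xy minus by (intro positive_antisym) (simp_all add: K_leq_iff)
    moreover have "y = (y \<ominus>\<^bsub>K\<^esub> x) \<oplus>\<^bsub>K\<^esub> x" using xy by algebra
    ultimately show "x = y" using xy by simp
  }
  have "x \<preceq>\<^bsub>K\<^esub> y \<or> y \<preceq>\<^bsub>K\<^esub> x"
    using positive_total[of "y \<ominus>\<^bsub>K\<^esub> x"] xy minus by (simp add: K_leq_iff)
  then show "\<exists>s\<in>carrier K. x \<preceq>\<^bsub>K\<^esub> s \<and> y \<preceq>\<^bsub>K\<^esub> s \<and> (\<forall>z\<in>carrier K. x \<preceq>\<^bsub>K\<^esub> z \<and> y \<preceq>\<^bsub>K\<^esub> z \<longrightarrow> s \<preceq>\<^bsub>K\<^esub> z)"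
    using xy refl by blast
  fix z assume z: "z \<in> carrier K"
  {
    assume "x \<preceq>\<^bsub>K\<^esub> y"
    moreover have "y \<oplus>\<^bsub>K\<^esub> z \<ominus>\<^bsub>K\<^esub> (x \<oplus>\<^bsub>K\<^esub> z) = y \<ominus>\<^bsub>K\<^esub> x" using xy z by algebra
    ultimately show "x \<oplus>\<^bsub>K\<^esub> z \<preceq>\<^bsub>K\<^esub> y \<oplus>\<^bsub>K\<^esub> z" using xy z by (simp add: K_leq_iff)
  }
  assume "x \<preceq>\<^bsub>K\<^esub> y" "y \<preceq>\<^bsub>K\<^esub> z"
  then have "positive ((y \<ominus>\<^bsub>K\<^esub> x) \<oplus>\<^bsub>K\<^esub> (z \<ominus>\<^bsub>K\<^esub> y))"
    using xy z by (intro positive_add) (simp_all add: K_leq_iff)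
  moreover have "(y \<ominus>\<^bsub>K\<^esub> x) \<oplus>\<^bsub>K\<^esub> (z \<ominus>\<^bsub>K\<^esub> y) = z \<ominus>\<^bsub>K\<^esub> x" using xy z by algebra
  ultimately show "x \<preceq>\<^bsub>K\<^esub> z" using xy z by (simp add: K_leq_iff)
qed

lemma K_nonneg: "x \<in> carrier K \<Longrightarrow> \<zero>\<^bsub>K\<^esub> \<preceq>\<^bsub>K\<^esub> x \<longleftrightarrow> positive x"
  by (simp add: K_leq_iff K.minus_eq)

lemma j_leq:
  assumes "a \<in> carrier R" "b \<in> carrier R"
  shows "j a \<preceq>\<^bsub>K\<^esub> j b \<longleftrightarrow> a \<preceq>\<^bsub>R\<^esub> b"
proof -
  have "j b \<ominus>\<^bsub>K\<^esub> j a = j (b \<ominus>\<^bsub>R\<^esub> a)" using assms by (simp add: K.minus_eq R.minus_eq j_add j_minus)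
  then show ?thesis using assms positive_j[of "b \<ominus>\<^bsub>R\<^esub> a"] RG.leq_iff[of a b] by (simp add: K_leq_iff)
qed

text \<open>For a fraction \<open>a / b\<close>, the denominator satisfies \<open>n b \<ge> 1\<close> for some \<open>n\<close>, since it is not
  infinitesimal and \<open>R\<close> is a chain, and the numerator satisfies \<open>a \<le> m\<close>. Then \<open>a / b \<le> m n\<close>.\<close>

lemma K_strong_unit: "strong_unit K \<one>\<^bsub>K\<^esub>"
  unfolding strong_unit_def
proof (intro conjI ballI)
  interpret KG: lgroup K by (rule lgroup.intro) (rule K_l_group)
  show "\<zero>\<^bsub>K\<^esub> \<preceq>\<^bsub>K\<^esub> \<one>\<^bsub>K\<^esub>" using j_leq[of "\<zero>\<^bsub>R\<^esub>" "\<one>\<^bsub>R\<^esub>"] one_nonneg by (simp add: j_zero)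
  fix x assume x: "x \<in> carrier K"
  obtain a b where ab: "a \<in> carrier R" "b \<in> carrier R" "b \<noteq> \<zero>\<^bsub>R\<^esub>" "\<zero>\<^bsub>R\<^esub> \<preceq>\<^bsub>R\<^esub> b" "x \<otimes>\<^bsub>K\<^esub> j b = j a"
    using fraction[OF x] .
  obtain n :: nat where "\<not> [n] \<cdot>\<^bsub>R\<^esub> b \<preceq>\<^bsub>R\<^esub> e" using R_no_infinitesimals[of b] ab by blast
  then have n: "\<one>\<^bsub>R\<^esub> \<preceq>\<^bsub>R\<^esub> [n] \<cdot>\<^bsub>R\<^esub> b" using R_total[of "[n] \<cdot>\<^bsub>R\<^esub> b" e] ab e_one by auto
  obtain m :: nat where m: "a \<preceq>\<^bsub>R\<^esub> [m] \<cdot>\<^bsub>R\<^esub> \<one>\<^bsub>R\<^esub>" using RG.strong_unitE(3)[OF RG.unit ab(1)] e_one by auto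
  have "[m] \<cdot>\<^bsub>R\<^esub> \<one>\<^bsub>R\<^esub> \<preceq>\<^bsub>R\<^esub> [m] \<cdot>\<^bsub>R\<^esub> ([n] \<cdot>\<^bsub>R\<^esub> b)" using n ab by (intro RG.nsmul_mono) simp_all
  then have le: "a \<preceq>\<^bsub>R\<^esub> [(m * n)] \<cdot>\<^bsub>R\<^esub> b"
    using RG.leq_trans[OF m] ab RG.nsmul_mult[OF ab(2), of m n] by simp
  let ?c = "[(m * n)] \<cdot>\<^bsub>R\<^esub> b \<ominus>\<^bsub>R\<^esub> a"
  have c: "?c \<in> carrier R" "\<zero>\<^bsub>R\<^esub> \<preceq>\<^bsub>R\<^esub> ?c" using le ab RG.leq_iff[of a "[(m * n)] \<cdot>\<^bsub>R\<^esub> b"] by simp_all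
  have "[k] \<cdot>\<^bsub>K\<^esub> \<one>\<^bsub>K\<^esub> \<otimes>\<^bsub>K\<^esub> j b = j ([k] \<cdot>\<^bsub>R\<^esub> b)" for k :: nat
    using ab(2) by (induct k) (simp_all add: K.l_distr j_add j_zero)
  then have "([(m * n)] \<cdot>\<^bsub>K\<^esub> \<one>\<^bsub>K\<^esub> \<ominus>\<^bsub>K\<^esub> x) \<otimes>\<^bsub>K\<^esub> j b = j ?c"
    using ab x by (simp add: K.minus_eq K.l_distr K.l_minus R.minus_eq j_add j_minus)
  then have "positive ([(m * n)] \<cdot>\<^bsub>K\<^esub> \<one>\<^bsub>K\<^esub> \<ominus>\<^bsub>K\<^esub> x)"
    using c ab unfolding positive_def by blast
  then have "x \<preceq>\<^bsub>K\<^esub> [(m * n)] \<cdot>\<^bsub>K\<^esub> \<one>\<^bsub>K\<^esub>" using x by (simp add: K_leq_iff)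
  then show "\<exists>n::nat. x \<preceq>\<^bsub>K\<^esub> [n] \<cdot>\<^bsub>K\<^esub> \<one>\<^bsub>K\<^esub>" ..
qed simp

lemma K_ordered_field: "ordered_field K"
proof (intro ordered_field.intro ordered_field_axioms.intro K.field_axioms K_l_group K_strong_unit)
  fix x y assume xy: "x \<in> carrier K" "y \<in> carrier K"
  have "\<ominus>\<^bsub>K\<^esub> (y \<ominus>\<^bsub>K\<^esub> x) = x \<ominus>\<^bsub>K\<^esub> y" using xy by (simp add: K.minus_eq K.minus_add K.a_comm)
  then show "x \<preceq>\<^bsub>K\<^esub> y \<or> y \<preceq>\<^bsub>K\<^esub> x"
    using positive_total[of "y \<ominus>\<^bsub>K\<^esub> x"] xy by (simp add: K_leq_iff)
  assume "\<zero>\<^bsub>K\<^esub> \<preceq>\<^bsub>K\<^esub> x" "\<zero>\<^bsub>K\<^esub> \<preceq>\<^bsub>K\<^esub> y"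
  then show "\<zero>\<^bsub>K\<^esub> \<preceq>\<^bsub>K\<^esub> x \<otimes>\<^bsub>K\<^esub> y" using positive_mult xy by (simp add: K_nonneg)
qed

lemma scalars: "scalars K P (j \<circ> \<theta>)"
proof (intro scalars.intro scalars_axioms.intro K_ordered_field P.mv_axioms P_total)
  fix \<alpha> assume \<alpha>: "\<alpha> \<in> carrier P"
  have t: "\<theta> \<alpha> \<in> carrier R" "\<zero>\<^bsub>R\<^esub> \<preceq>\<^bsub>R\<^esub> \<theta> \<alpha>" "\<theta> \<alpha> \<preceq>\<^bsub>R\<^esub> \<one>\<^bsub>R\<^esub>" using \<theta>_U[OF \<alpha>] e_one by auto
  show "(j \<circ> \<theta>) \<alpha> \<in> carrier K" using t by simp
  show "\<zero>\<^bsub>K\<^esub> \<preceq>\<^bsub>K\<^esub> (j \<circ> \<theta>) \<alpha>" using t j_leq[of "\<zero>\<^bsub>R\<^esub>" "\<theta> \<alpha>"] by (simp add: j_zero)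
  show "(j \<circ> \<theta>) \<alpha> \<preceq>\<^bsub>K\<^esub> \<one>\<^bsub>K\<^esub>" using t j_leq[of "\<theta> \<alpha>" "\<one>\<^bsub>R\<^esub>"] by simp
  fix \<beta> assume \<beta>: "\<beta> \<in> carrier P"
  have t': "\<theta> \<beta> \<in> carrier R" using \<theta>_U[OF \<beta>] by simp
  show "(j \<circ> \<theta>) (pmv_mult P \<alpha> \<beta>) = (j \<circ> \<theta>) \<alpha> \<otimes>\<^bsub>K\<^esub> (j \<circ> \<theta>) \<beta>" using \<theta>(4)[OF \<alpha> \<beta>] t t' by (simp add: j_mult)
  assume "mv_summable P \<alpha> \<beta>"
  then show "(j \<circ> \<theta>) (mv_add P \<alpha> \<beta>) = (j \<circ> \<theta>) \<alpha> \<oplus>\<^bsub>K\<^esub> (j \<circ> \<theta>) \<beta>" using \<theta>_add[OF \<alpha> \<beta>] t t' by (simp add: j_add)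
qed (simp add: \<theta>_one e_one)

end

section \<open>The adjunction\<close>

theorem theorem4p8:
  fixes P :: "'p pmv" and R :: "'r ogroup" and e :: 'r and \<theta> :: "'p \<Rightarrow> 'r"
    and K :: "'k ogroup" and j :: "'r \<Rightarrow> 'k"
  assumes "mv_domain P" and "semisimple P" and "mv_total P" and "mv_nontrivial P"
    and "lu_ring R e" and "pmv_iso P (Gamma_ring R e) \<theta>"
    and "quotient_field R K j"
  shows "
     \<comment> \<open>\<open>\<Gamma>\<close> is a functor from \<open>LinSpAr K\<close> to \<open>MVArDom P\<close>\<close>
     (\<forall>(A :: ('k, 'v) olspace \<times> 'v) \<in> LinSpAr K.
        GammaK (j \<circ> \<theta>) A \<in> MVArDom P \<and>
        GammaK_map A (\<lambda>x\<in>carrier (fst A). x) = (\<lambda>x\<in>carrier (GammaK (j \<circ> \<theta>) A). x)) \<and>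
     (\<forall>(A :: ('k, 'v) olspace \<times> 'v) \<in> LinSpAr K. \<forall>(B :: ('k, 'w) olspace \<times> 'w) \<in> LinSpAr K.
        \<forall>f \<in> lin_hom K A B.
          GammaK_map A f \<in> mv_module_hom P (GammaK (j \<circ> \<theta>) A) (GammaK (j \<circ> \<theta>) B)) \<and>
     (\<forall>(A :: ('k, 'v) olspace \<times> 'v) \<in> LinSpAr K. \<forall>(B :: ('k, 'w) olspace \<times> 'w) \<in> LinSpAr K.
        \<forall>(C :: ('k, 'x) olspace \<times> 'x) \<in> LinSpAr K.
        \<forall>f \<in> lin_hom K A B. \<forall>g \<in> lin_hom K B C.
          GammaK_map A (compose (carrier (fst A)) g f) =
          compose (carrier (GammaK (j \<circ> \<theta>) A)) (GammaK_map B g) (GammaK_map A f)) \<and>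
     \<comment> \<open>\<open>L\<close> is a functor from \<open>MVArDom P\<close> to \<open>LinSpAr K\<close>\<close>
     (\<forall>(M :: ('p, 'm) pmodule) \<in> MVArDom P.
        presents M (presentation_of M) \<and>
        L_obj K M \<in> LinSpAr K \<and>
        L_map K M M (\<lambda>x\<in>carrier M. x) = (\<lambda>x\<in>carrier (fst (L_obj K M)). x)) \<and>
     (\<forall>(M :: ('p, 'm) pmodule) \<in> MVArDom P. \<forall>(N :: ('p, 'n) pmodule) \<in> MVArDom P.
        \<forall>h \<in> mv_module_hom P M N.
          L_map K M N h \<in> lin_hom K (L_obj K M) (L_obj K N)) \<and>
     (\<forall>(M :: ('p, 'm) pmodule) \<in> MVArDom P. \<forall>(N :: ('p, 'n) pmodule) \<in> MVArDom P.
        \<forall>(Q :: ('p, 'q) pmodule) \<in> MVArDom P.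
        \<forall>h \<in> mv_module_hom P M N. \<forall>g \<in> mv_module_hom P N Q.
          L_map K M Q (compose (carrier M) g h) =
          compose (carrier (fst (L_obj K M))) (L_map K N Q g) (L_map K M N h)) \<and>
     \<comment> \<open>the maps \<open>iota K M\<close> form a natural transformation from the identity to \<open>\<Gamma> \<circ> L\<close>\<close>
     (\<forall>(M :: ('p, 'm) pmodule) \<in> MVArDom P.
        iota K M \<in> mv_module_hom P M (GammaK (j \<circ> \<theta>) (L_obj K M))) \<and>
     (\<forall>(M :: ('p, 'm) pmodule) \<in> MVArDom P. \<forall>(N :: ('p, 'n) pmodule) \<in> MVArDom P.
        \<forall>h \<in> mv_module_hom P M N.
          compose (carrier M) (GammaK_map (L_obj K M) (L_map K M N h)) (iota K M) =
          compose (carrier M) (iota K N) h) \<and>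
     \<comment> \<open>\<open>iota K M\<close> is a universal arrow from \<open>M\<close> to \<open>\<Gamma>\<close>\<close>
     (\<forall>(M :: ('p, 'm) pmodule) \<in> MVArDom P. \<forall>(A :: ('k, 'v) olspace \<times> 'v) \<in> LinSpAr K.
        \<forall>h \<in> mv_module_hom P M (GammaK (j \<circ> \<theta>) A).
          \<exists>!f. f \<in> lin_hom K (L_obj K M) A \<and>
               compose (carrier M) (GammaK_map (L_obj K M) f) (iota K M) = h) \<and>
     \<comment> \<open>the same for every presentation \<open>X = (G, v, \<phi>)\<close> of \<open>M\<close> as \<open>\<Gamma>(G, v)\<close>, not only the chosen one\<close>
     (\<forall>(M :: ('p, 'm) pmodule) \<in> MVArDom P.
      \<forall>X :: 'g ogroup \<times> 'g \<times> ('m \<Rightarrow> 'g). presents M X \<longrightarrow>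
        tensor_obj K X \<in> LinSpAr K \<and>
        tensor_unit K M X \<in> mv_module_hom P M (GammaK (j \<circ> \<theta>) (tensor_obj K X)) \<and>
        (\<forall>(A :: ('k, 'v) olspace \<times> 'v) \<in> LinSpAr K.
         \<forall>h \<in> mv_module_hom P M (GammaK (j \<circ> \<theta>) A).
           \<exists>!f. f \<in> lin_hom K (tensor_obj K X) A \<and>
                compose (carrier M) (GammaK_map (tensor_obj K X) f) (tensor_unit K M X) = h))"
proof -
  interpret D: domain_ring P R e \<theta> K j by (intro domain_ring.intro assms)
  interpret S: scalars K P "j \<circ> \<theta>" by (rule D.scalars)
  show ?thesis
  proof (intro conjI ballI allI impI)
    fix A :: "('k, 'v) olspace \<times> 'v" assume A: "A \<in> LinSpAr K"
    show "GammaK (j \<circ> \<theta>) A \<in> MVArDom P" by (rule S.GammaK_object'[OF A])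
    show "GammaK_map A (\<lambda>x\<in>carrier (fst A). x) = (\<lambda>x\<in>carrier (GammaK (j \<circ> \<theta>) A). x)"
      by (rule S.GammaK_identity)
  next
    fix A :: "('k, 'v) olspace \<times> 'v" and B :: "('k, 'w) olspace \<times> 'w" and f
    assume "A \<in> LinSpAr K" "B \<in> LinSpAr K" "f \<in> lin_hom K A B"
    then show "GammaK_map A f \<in> mv_module_hom P (GammaK (j \<circ> \<theta>) A) (GammaK (j \<circ> \<theta>) B)"
      by (rule S.GammaK_morphism')
  next
    fix A :: "('k, 'v) olspace \<times> 'v" and B :: "('k, 'w) olspace \<times> 'w"
      and C :: "('k, 'x) olspace \<times> 'x" and f g
    assume "A \<in> LinSpAr K" "B \<in> LinSpAr K" "f \<in> lin_hom K A B"
    then show "GammaK_map A (compose (carrier (fst A)) g f) =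
        compose (carrier (GammaK (j \<circ> \<theta>) A)) (GammaK_map B g) (GammaK_map A f)"
      by (rule S.GammaK_compose')
  next
    fix M :: "('p, 'm) pmodule" assume M: "M \<in> MVArDom P"
    show "presents M (presentation_of M)" by (rule S.presentation_of_presents[OF M])
    show "L_obj K M \<in> LinSpAr K" by (rule S.L_obj_LinSpAr[OF M])
    show "L_map K M M (\<lambda>x\<in>carrier M. x) = (\<lambda>x\<in>carrier (fst (L_obj K M)). x)"
      by (rule S.L_map_id[OF M])
    show "iota K M \<in> mv_module_hom P M (GammaK (j \<circ> \<theta>) (L_obj K M))"
      by (rule S.iota_hom[OF M])
  next
    fix M :: "('p, 'm) pmodule" and N :: "('p, 'n) pmodule" and h
    assume MN: "M \<in> MVArDom P" "N \<in> MVArDom P" "h \<in> mv_module_hom P M N"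
    show "L_map K M N h \<in> lin_hom K (L_obj K M) (L_obj K N)" by (rule S.L_map_spec(1)[OF MN])
    show "compose (carrier M) (GammaK_map (L_obj K M) (L_map K M N h)) (iota K M) =
        compose (carrier M) (iota K N) h"
      by (rule S.L_map_spec(2)[OF MN])
  next
    fix M :: "('p, 'm) pmodule" and N :: "('p, 'n) pmodule" and Q :: "('p, 'q) pmodule" and h g
    assume "M \<in> MVArDom P" "N \<in> MVArDom P" "Q \<in> MVArDom P"
      "h \<in> mv_module_hom P M N" "g \<in> mv_module_hom P N Q"
    then show "L_map K M Q (compose (carrier M) g h) =
        compose (carrier (fst (L_obj K M))) (L_map K N Q g) (L_map K M N h)"
      by (rule S.L_map_compose)
  next
    fix M :: "('p, 'm) pmodule" and A :: "('k, 'v) olspace \<times> 'v" and h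
    assume "M \<in> MVArDom P" "A \<in> LinSpAr K" "h \<in> mv_module_hom P M (GammaK (j \<circ> \<theta>) A)"
    then show "\<exists>!f. f \<in> lin_hom K (L_obj K M) A \<and>
        compose (carrier M) (GammaK_map (L_obj K M) f) (iota K M) = h"
      by (rule S.L_universal)
  next
    fix M :: "('p, 'm) pmodule" and X :: "'g ogroup \<times> 'g \<times> ('m \<Rightarrow> 'g)"
    assume M: "M \<in> MVArDom P" and X: "presents M X"
    obtain G v \<phi> where GX: "X = (G, v, \<phi>)" by (cases X) blast
    interpret presented_module K P "j \<circ> \<theta>" M G v \<phi>
      by (rule S.presented_moduleI[OF M X[unfolded GX]])
    show "tensor_obj K X \<in> LinSpAr K" unfolding GX by (rule tensor_obj_LinSpAr)
    show "tensor_unit K M X \<in> mv_module_hom P M (GammaK (j \<circ> \<theta>) (tensor_obj K X))"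
      unfolding GX by (rule tensor_unit_hom)
    fix A :: "('k, 'v) olspace \<times> 'v" and h
    assume "A \<in> LinSpAr K" "h \<in> mv_module_hom P M (GammaK (j \<circ> \<theta>) A)"
    then show "\<exists>!f. f \<in> lin_hom K (tensor_obj K X) A \<and>
        compose (carrier M) (GammaK_map (tensor_obj K X) f) (tensor_unit K M X) = h"
      unfolding GX by (rule universal_arrow)
  qed
qed

end
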